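(* Let $(X,d)$ be a uniformly locally finite metric space, and let $\mathcal{G}=\mathcal{G}(X,d)$ be its coarse groupoid. The rational comparison map $$\alpha_0 \otimes \operatorname{id}_{\mathbb{Q}} \colon H_0(\mathcal{G}; \mathbb{Z}) \otimes_{\mathbb{Z}} \mathbb{Q} \to K_0(C^*_r(\mathcal{G})) \otimes_{\mathbb{Z}} \mathbb{Q}$$ is split-injective (that is, it admits a left inverse group homomorphism).
   Context: A metric space $(X,d)$ is uniformly locally finite if for every $R\ge 0$ there is $N$ with $|B_R(x)|\le N$ for all $x\in X$. Coarse groupoid: call $E\subset X\times X$ an entourage if $\sup_{(x,y)\in E}d(x,y)<\infty$. Let $\overline{E}$ be the closure of $E$ in the Stone–Čech compactification $\beta(X\times X)$ of the discrete space $X \times X$. Then $\mathcal{G}(X,d)=\bigcup_E\overline{E}$ (union over all entourages) with the weak topology (a set is open iff its intersection with each $\overline{E}$ is open in $\overline{E}$); the operations of the pair groupoid $X\times X$ extend continuously and make $\mathcal{G}(X,d)$ a Hausdorff, principal, ample (étale with totally disconnected unit space) groupoid with compact unit space $\mathcal{G}^{(0)}=\beta X$. $C^*_r(\mathcal{G})$ is the reduced groupoid $C^*$-algebra; it is canonically isomorphic to the uniform Roe algebra $C^*_u(X)$, the norm closure in $\mathcal{B}(\ell^2(X))$ of the operators $T$ with $\sup\{d(x,y)\mid\langle T\delta_x,\delta_y\rangle\neq0\}<\infty$, in such a way that $C(\beta X)$ corresponds to the diagonal operators $\ell^\infty(X)$. $H_*(\mathcal{G};\mathbb{Z})$ denotes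 Crainic–Moerdijk groupoid homology; $H_0(\mathcal{G};\mathbb{Z})$ is the quotient of $C(\mathcal{G}^{(0)},\mathbb{Z})$ by the image of $s_*-r_*\colon C_c(\mathcal{G},\mathbb{Z})\to C(\mathcal{G}^{(0)},\mathbb{Z})$, where $s_*(f)(u)=\sum_{s(\gamma)=u}f(\gamma)$ and $r_*(f)(u)=\sum_{r(\gamma)=u}f(\gamma)$. Canonically, $H_0(\mathcal{G}(X,d);\mathbb{Z})$ is the uniformly finite homology group $H^{\mathrm{uf}}_0(X;\mathbb{Z})=\ell^\infty(X,\mathbb{Z})/\operatorname{im}\partial_1$, where $\partial_1(f)(x)=\sum_{y}f(y,x)-\sum_y f(x,y)$ for bounded $f\colon X\times X\to\mathbb{Z}$ supported on an entourage. The $0$th comparison map $\alpha_0\colon H_0(\mathcal{G};\mathbb{Z})\to K_0(C^*_r(\mathcal{G}))$ is the homomorphism induced on the quotient by the map $K_0(C(\mathcal{G}^{(0)}))=C(\mathcal{G}^{(0)},\mathbb{Z})\to K_0(C^*_r(\mathcal{G}))$ coming from the inclusion $C(\mathcal{G}^{(0)})\hookrightarrow C^*_r(\mathcal{G})$ (this map vanishes on the image of $s_*-r_*$). *)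

theory Defs
  imports "HOL-Analysis.Analysis" "HOL-Algebra.Free_Abelian_Groups"
begin

section \<open>The Hilbert space of square-summable functions\<close>

typedef 'i ell2 = "{f :: 'i \<Rightarrow> complex. (\<lambda>i. (cmod (f i))\<^sup>2) summable_on UNIV}"
  morphisms coord Abs_ell2
  by (rule exI[of _ "\<lambda>_. 0"]) simp

setup_lifting type_definition_ell2

lemma summable_coord: "(\<lambda>i. (cmod (coord x i))\<^sup>2) summable_on UNIV"
  using coord[of x] by simp

lemma norm_add_square_le: "(norm (a + b))\<^sup>2 \<le> 2 * (norm a)\<^sup>2 + 2 * (norm b)\<^sup>2"
  for a b :: complex
proof -
  have "(norm (a + b))\<^sup>2 \<le> (norm a + norm b)\<^sup>2"
    by (simp add: norm_triangle_ineq power_mono)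
  also have "\<dots> \<le> 2 * (norm a)\<^sup>2 + 2 * (norm b)\<^sup>2"
    using zero_le_power2[of "norm a - norm b"] by (simp add: power2_eq_square algebra_simps)
  finally show ?thesis .
qed

lemma square_summable_add:
  fixes f g :: "'i \<Rightarrow> complex"
  assumes "(\<lambda>i. (cmod (f i))\<^sup>2) summable_on UNIV" "(\<lambda>i. (cmod (g i))\<^sup>2) summable_on UNIV"
  shows "(\<lambda>i. (cmod (f i + g i))\<^sup>2) summable_on UNIV"
proof (rule summable_on_comparison_test)
  show "(\<lambda>i. 2 * (cmod (f i))\<^sup>2 + 2 * (cmod (g i))\<^sup>2) summable_on UNIV"
    using assms by (intro summable_on_add summable_on_cmult_right)
qed (auto simp: norm_add_square_le)

instantiation ell2 :: (type) real_vector
begin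

lift_definition zero_ell2 :: "'a ell2" is "\<lambda>_. 0" by simp
lift_definition plus_ell2 :: "'a ell2 \<Rightarrow> 'a ell2 \<Rightarrow> 'a ell2" is "\<lambda>f g i. f i + g i"
  by (rule square_summable_add)
lift_definition uminus_ell2 :: "'a ell2 \<Rightarrow> 'a ell2" is "\<lambda>f i. - f i" by simp
lift_definition minus_ell2 :: "'a ell2 \<Rightarrow> 'a ell2 \<Rightarrow> 'a ell2" is "\<lambda>f g i. f i - g i"
proof -
  fix f g :: "'a \<Rightarrow> complex"
  assume "(\<lambda>i. (cmod (f i))\<^sup>2) summable_on UNIV" "(\<lambda>i. (cmod (g i))\<^sup>2) summable_on UNIV"
  then show "(\<lambda>i. (cmod (f i - g i))\<^sup>2) summable_on UNIV"
    using square_summable_add[of f "\<lambda>i. - g i"] by simp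
qed
lift_definition scaleR_ell2 :: "real \<Rightarrow> 'a ell2 \<Rightarrow> 'a ell2" is "\<lambda>r f i. r *\<^sub>R f i"
  by (simp add: power_mult_distrib summable_on_cmult_right)

instance
proof
  fix x y z :: "'a ell2" and a b :: real
  show "x + y + z = x + (y + z)" by transfer (simp add: add.assoc)
  show "x + y = y + x" by transfer (simp add: add.commute)
  show "0 + x = x" by transfer simp
  show "- x + x = 0" by transfer simp
  show "x - y = x + - y" by transfer simp
  show "a *\<^sub>R (x + y) = a *\<^sub>R x + a *\<^sub>R y" by transfer (simp add: algebra_simps)
  show "(a + b) *\<^sub>R x = a *\<^sub>R x + b *\<^sub>R x" by transfer (simp add: algebra_simps)
  show "a *\<^sub>R b *\<^sub>R x = (a * b) *\<^sub>R x" by transfer (simp add: algebra_simps)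
  show "1 *\<^sub>R x = x" by transfer simp
qed

end

instantiation ell2 :: (type) real_normed_vector
begin

definition norm_ell2 :: "'a ell2 \<Rightarrow> real" where
  "norm_ell2 x = sqrt (\<Sum>\<^sub>\<infinity>i. (cmod (coord x i))\<^sup>2)"
definition dist_ell2 :: "'a ell2 \<Rightarrow> 'a ell2 \<Rightarrow> real" where
  "dist_ell2 x y = norm (x - y)"
definition sgn_ell2 :: "'a ell2 \<Rightarrow> 'a ell2" where
  "sgn_ell2 x = inverse (norm x) *\<^sub>R x"
definition uniformity_ell2 :: "('a ell2 \<times> 'a ell2) filter" where
  "uniformity_ell2 = (INF e\<in>{0<..}. principal {(x, y). dist x y < e})"
definition open_ell2 :: "'a ell2 set \<Rightarrow> bool" where
  "open_ell2 U \<longleftrightarrow> (\<forall>x\<in>U. eventually (\<lambda>(x', y). x' = x \<longrightarrow> y \<in> U) uniformity)"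

instance
proof
  fix x y :: "'a ell2" and a :: real
  show "dist x y = norm (x - y)" by (rule dist_ell2_def)
  show "sgn x = x /\<^sub>R norm x" by (rule sgn_ell2_def)
  show "uniformity = (INF e\<in>{0<..}. principal {(x, y). dist x y < e :: bool} :: ('a ell2 \<times> 'a ell2) filter)"
    by (rule uniformity_ell2_def)
  show "open U = (\<forall>x\<in>U. eventually (\<lambda>(x', y). x' = x \<longrightarrow> y \<in> U) uniformity)" for U :: "'a ell2 set"
    by (rule open_ell2_def)
  show "norm x = 0 \<longleftrightarrow> x = 0"
  proof
    assume "norm x = 0"
    then have "(\<Sum>\<^sub>\<infinity>i. (cmod (coord x i))\<^sup>2) = 0"
      by (simp add: norm_ell2_def infsum_nonneg)
    then have "(cmod (coord x i))\<^sup>2 = 0" for i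
      using nonneg_infsum_le_0D[of "\<lambda>i. (cmod (coord x i))\<^sup>2" UNIV i] summable_coord[of x]
      by simp
    then have "coord x = coord 0" by (simp add: zero_ell2.rep_eq fun_eq_iff)
    then show "x = 0" by (simp only: coord_inject)
  qed (simp add: norm_ell2_def zero_ell2.rep_eq)
  show "norm (a *\<^sub>R x) = \<bar>a\<bar> * norm x"
    by (simp add: norm_ell2_def scaleR_ell2.rep_eq power_mult_distrib infsum_cmult_right'
        real_sqrt_mult)
  have L2: "L2_set (\<lambda>i. cmod (coord w i)) F \<le> norm w" if "finite F" for F and w :: "'a ell2"
    unfolding L2_set_def norm_ell2_def
    using that summable_coord[of w] by (intro real_sqrt_le_mono finite_sum_le_infsum) auto
  have "(\<Sum>\<^sub>\<infinity>i. (cmod (coord (x + y) i))\<^sup>2) \<le> (norm x + norm y)\<^sup>2"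
  proof (rule infsum_le_finite_sums)
    fix F :: "'a set" assume F: "finite F"
    have "L2_set (\<lambda>i. cmod (coord (x + y) i)) F
        \<le> L2_set (\<lambda>i. cmod (coord x i) + cmod (coord y i)) F"
      by (rule L2_set_mono) (auto simp: plus_ell2.rep_eq norm_triangle_ineq)
    also have "\<dots> \<le> norm x + norm y"
      using L2_set_triangle_ineq[of "\<lambda>i. cmod (coord x i)" "\<lambda>i. cmod (coord y i)" F]
        L2[OF F, of x] L2[OF F, of y] by linarith
    finally have "(L2_set (\<lambda>i. cmod (coord (x + y) i)) F)\<^sup>2 \<le> (norm x + norm y)\<^sup>2"
      by (rule power_mono) simp
    then show "(\<Sum>i\<in>F. (cmod (coord (x + y) i))\<^sup>2) \<le> (norm x + norm y)\<^sup>2"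
      by (simp add: L2_set_def sum_nonneg)
  qed (rule summable_coord)
  then show "norm (x + y) \<le> norm x + norm y"
    unfolding norm_ell2_def[of "x + y"]
    by (intro real_le_lsqrt) (auto simp: norm_ell2_def infsum_nonneg)
qed

end

definition cinner :: "'i ell2 \<Rightarrow> 'i ell2 \<Rightarrow> complex" where
  "cinner x y = (\<Sum>\<^sub>\<infinity>i. cnj (coord x i) * coord y i)"

type_synonym 'i operator = "'i ell2 \<Rightarrow>\<^sub>L 'i ell2"

text \<open>Operators are only required to be bounded and real-linear here; all operators in the algebras
  below are complex-linear, so that they have an adjoint.\<close>

definition adjoint_op :: "'i operator \<Rightarrow> 'i operator" where
  "adjoint_op T = (THE S. \<forall>x y. cinner (blinfun_apply S x) y = cinner x (blinfun_apply T y))"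

section \<open>The group K0 of a concrete unital C*-algebra\<close>

text \<open>Throughout, \<open>A\<close> is a norm-closed *-subalgebra of the bounded operators on some
  \<open>\<ell>\<^sup>2\<close>-space, with a unit which need not be the identity operator. A projection over \<open>A\<close> is a pair
  \<open>(n, p)\<close> of a size and a projection in the \<open>n \<times> n\<close> matrices over \<open>A\<close>; matrices are functions
  of two indices vanishing outside the index range.\<close>

type_synonym 'i op_matrix = "nat \<Rightarrow> nat \<Rightarrow> 'i operator"

definition matrices :: "'i operator set \<Rightarrow> nat \<Rightarrow> nat \<Rightarrow> 'i op_matrix set" where
  "matrices A m n = {a. \<forall>i j. if i < m \<and> j < n then a i j \<in> A else a i j = 0}"

definition matrix_times :: "nat \<Rightarrow> 'i op_matrix \<Rightarrow> 'i op_matrix \<Rightarrow> 'i op_matrix" where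
  "matrix_times n a b = (\<lambda>i j. \<Sum>k<n. a i k o\<^sub>L b k j)"

definition matrix_star :: "'i op_matrix \<Rightarrow> 'i op_matrix" where
  "matrix_star a = (\<lambda>i j. adjoint_op (a j i))"

definition projections :: "'i operator set \<Rightarrow> (nat \<times> 'i op_matrix) set" where
  "projections A = {(n, p). p \<in> matrices A n n \<and> matrix_times n p p = p \<and> matrix_star p = p}"

definition mvn_equiv ::
    "'i operator set \<Rightarrow> nat \<times> 'i op_matrix \<Rightarrow> nat \<times> 'i op_matrix \<Rightarrow> bool" where
  "mvn_equiv A P Q \<longleftrightarrow>
     (\<exists>v \<in> matrices A (fst Q) (fst P).
        matrix_times (fst Q) (matrix_star v) v = snd P \<and>
        matrix_times (fst P) v (matrix_star v) = snd Q)"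

definition direct_sum ::
    "nat \<times> 'i op_matrix \<Rightarrow> nat \<times> 'i op_matrix \<Rightarrow> nat \<times> 'i op_matrix" where
  "direct_sum P Q =
     (fst P + fst Q,
      \<lambda>i j. if i < fst P \<and> j < fst P then snd P i j
            else if fst P \<le> i \<and> fst P \<le> j then snd Q (i - fst P) (j - fst P)
            else 0)"

text \<open>K0 is the Grothendieck group of the monoid of Murray--von Neumann classes of projections:
  the pair \<open>(P, Q)\<close> stands for \<open>[P] - [Q]\<close>.\<close>

type_synonym 'i formal_difference = "(nat \<times> 'i op_matrix) \<times> (nat \<times> 'i op_matrix)"

definition K0_rel :: "'i operator set \<Rightarrow> ('i formal_difference \<times> 'i formal_difference) set" where
  "K0_rel A = {((P, Q), (P', Q')).
      P \<in> projections A \<and> Q \<in> projections A \<and> P' \<in> projections A \<and> Q' \<in> projections A \<and>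
      (\<exists>R \<in> projections A.
         mvn_equiv A (direct_sum (direct_sum P Q') R) (direct_sum (direct_sum P' Q) R))}"

definition K0 :: "'i operator set \<Rightarrow> 'i formal_difference set monoid" where
  "K0 A =
    \<lparr>carrier = (projections A \<times> projections A) // K0_rel A,
     mult = (\<lambda>c c'. \<Union>(P, Q)\<in>c. \<Union>(P', Q')\<in>c'. K0_rel A `` {(direct_sum P P', direct_sum Q Q')}),
     one = K0_rel A `` {((0, \<lambda>_ _. 0), (0, \<lambda>_ _. 0))}\<rparr>"

text \<open>The map \<open>K0 B \<rightarrow> K0 A\<close> induced by an inclusion \<open>B \<subseteq> A\<close>.\<close>

definition K0_inclusion ::
    "'i operator set \<Rightarrow> 'i formal_difference set \<Rightarrow> 'i formal_difference set" where
  "K0_inclusion A c = K0_rel A `` c"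

section \<open>Topological groupoids, homology in degree 0 and the comparison map\<close>

text \<open>Source and range take values in the units, which are regarded as arrows; \<open>g h\<close> is defined
  when \<open>source g = range h\<close>. Only the values of the operations on arrows, respectively on composable
  pairs, are relevant.\<close>

record 'g top_groupoid =
  arrow_top :: "'g topology"
  gsource :: "'g \<Rightarrow> 'g"
  grange :: "'g \<Rightarrow> 'g"
  gmult :: "'g \<Rightarrow> 'g \<Rightarrow> 'g"
  ginv :: "'g \<Rightarrow> 'g"

definition arrows :: "'g top_groupoid \<Rightarrow> 'g set" where
  "arrows G = topspace (arrow_top G)"

definition unit_arrows :: "'g top_groupoid \<Rightarrow> 'g set" where
  "unit_arrows G = gsource G ` arrows G"

text \<open>Continuous compactly supported functions on \<open>G\<close>, and continuous functions on the (compact)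
  unit space; both are normalized to vanish outside their domain. The coefficients \<open>'b\<close> will be
  \<open>complex\<close>, or \<open>int\<close> with its discrete topology. Since the unit space of an etale groupoid is
  clopen when it is compact and \<open>G\<close> is Hausdorff, the second set is contained in the first.\<close>

definition Cc :: "'g top_groupoid \<Rightarrow> ('g \<Rightarrow> 'b::{zero,topological_space}) set" where
  "Cc G = {f. continuous_map (arrow_top G) euclidean f \<and> (\<forall>g. g \<notin> arrows G \<longrightarrow> f g = 0) \<and>
              compactin (arrow_top G) (Abstract_Topology.closure_of (arrow_top G) {g. f g \<noteq> 0})}"

definition C_units :: "'g top_groupoid \<Rightarrow> ('g \<Rightarrow> 'b::{zero,topological_space}) set" where
  "C_units G = {f. continuous_map (subtopology (arrow_top G) (unit_arrows G)) euclidean f \<and>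
                   (\<forall>g. g \<notin> unit_arrows G \<longrightarrow> f g = 0)}"

text \<open>The operator \<open>conv_op G f\<close> on \<open>\<ell>\<^sup>2(G)\<close> is the direct sum, over all units \<open>u\<close>, of the left regular
  representations of \<open>f\<close> on the spaces \<open>\<ell>\<^sup>2(G\<^sub>u)\<close>, where \<open>G\<^sub>u\<close> is the set of arrows with source \<open>u\<close>.
  For compactly supported \<open>f\<close> and etale \<open>G\<close> each of the sums below has finitely many nonzero
  terms, and the operator is bounded.\<close>

definition conv_op :: "'g top_groupoid \<Rightarrow> ('g \<Rightarrow> complex) \<Rightarrow> 'g operator" where
  "conv_op G f = (THE T. \<forall>\<xi> g. coord (blinfun_apply T \<xi>) g =
     (if g \<in> arrows G
      then \<Sum>\<^sub>\<infinity>h | h \<in> arrows G \<and> gsource G h = gsource G g. f (gmult G g (ginv G h)) * coord \<xi> h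
      else 0))"

definition reduced_algebra :: "'g top_groupoid \<Rightarrow> 'g operator set" where
  "reduced_algebra G = closure (conv_op G ` Cc G)"

text \<open>The copy of \<open>C(G\<^sup>0)\<close> in the reduced C*-algebra.\<close>

definition unit_algebra :: "'g top_groupoid \<Rightarrow> 'g operator set" where
  "unit_algebra G = conv_op G ` C_units G"

definition C_units_group :: "'g top_groupoid \<Rightarrow> ('g \<Rightarrow> int) monoid" where
  "C_units_group G = \<lparr>carrier = C_units G, mult = (\<lambda>f f' u. f u + f' u), one = (\<lambda>_. 0)\<rparr>"

definition source_push :: "'g top_groupoid \<Rightarrow> ('g \<Rightarrow> int) \<Rightarrow> 'g \<Rightarrow> int" where
  "source_push G f u = (\<Sum>g | g \<in> arrows G \<and> gsource G g = u \<and> f g \<noteq> 0. f g)"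

definition range_push :: "'g top_groupoid \<Rightarrow> ('g \<Rightarrow> int) \<Rightarrow> 'g \<Rightarrow> int" where
  "range_push G f u = (\<Sum>g | g \<in> arrows G \<and> grange G g = u \<and> f g \<noteq> 0. f g)"

definition groupoid_H0 :: "'g top_groupoid \<Rightarrow> ('g \<Rightarrow> int) set monoid" where
  "groupoid_H0 G =
     C_units_group G Mod ((\<lambda>f u. source_push G f u - range_push G f u) ` Cc G)"

text \<open>The canonical isomorphism \<open>C(G\<^sup>0, \<int>) \<cong> K0 (C(G\<^sup>0))\<close>, inverse to taking pointwise ranks, sends
  the indicator function of a clopen set to the class of that indicator function. If \<open>0 \<le> f \<le> N\<close>
  then \<open>f\<close> is the sum over \<open>i < N\<close> of the indicator functions of \<open>{u. i < f u}\<close>, so \<open>f\<close> corresponds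
  to the class of the diagonal matrix with these entries; in general one splits \<open>f\<close> into its
  positive and its negative part.\<close>

definition level_projection :: "'g top_groupoid \<Rightarrow> ('g \<Rightarrow> int) \<Rightarrow> nat \<times> 'g op_matrix" where
  "level_projection G f =
     (let N = (LEAST N. \<forall>u \<in> unit_arrows G. f u \<le> int N) in
      (N, \<lambda>i j. if i = j \<and> i < N then conv_op G (indicator {u \<in> unit_arrows G. int i < f u}) else 0))"

definition rank_class :: "'g top_groupoid \<Rightarrow> ('g \<Rightarrow> int) \<Rightarrow> 'g formal_difference set" where
  "rank_class G f =
     K0_rel (unit_algebra G) `` {(level_projection G f, level_projection G (\<lambda>u. - f u))}"

definition comparison_map :: "'g top_groupoid \<Rightarrow> ('g \<Rightarrow> int) set \<Rightarrow> 'g formal_difference set" where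
  "comparison_map G c =
     the_elem ((\<lambda>f. K0_inclusion (reduced_algebra G) (rank_class G f)) ` c)"

section \<open>The coarse groupoid\<close>

definition uniformly_locally_finite :: "'a set \<Rightarrow> ('a \<Rightarrow> 'a \<Rightarrow> real) \<Rightarrow> bool" where
  "uniformly_locally_finite X d \<longleftrightarrow>
     (\<forall>R\<ge>0. \<exists>N. \<forall>x\<in>X. finite (Metric_space.mcball X d x R) \<and> card (Metric_space.mcball X d x R) \<le> N)"

text \<open>The Stone--Cech compactification of the discrete space \<open>S\<close>, realized as the space of
  ultrafilters on \<open>S\<close>, into which \<open>S\<close> embeds by principal ultrafilters.\<close>

definition ultrafilters_on :: "'a set \<Rightarrow> 'a filter set" where
  "ultrafilters_on S = {F. F \<noteq> bot \<and> F \<le> principal S \<and>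
     (\<forall>A. eventually (\<lambda>x. x \<in> A) F \<or> eventually (\<lambda>x. x \<notin> A) F)}"

definition stone_cech :: "'a set \<Rightarrow> 'a filter topology" where
  "stone_cech S = topology_generated_by
     ((\<lambda>A. {F \<in> ultrafilters_on S. eventually (\<lambda>x. x \<in> A) F}) ` Pow S)"

definition entourage :: "'a set \<Rightarrow> ('a \<Rightarrow> 'a \<Rightarrow> real) \<Rightarrow> ('a \<times> 'a) set \<Rightarrow> bool" where
  "entourage X d E \<longleftrightarrow> E \<subseteq> X \<times> X \<and> bdd_above ((\<lambda>(x, y). d x y) ` E)"

definition entourage_closure :: "'a set \<Rightarrow> ('a \<times> 'a) set \<Rightarrow> ('a \<times> 'a) filter set" where
  "entourage_closure X E = Abstract_Topology.closure_of (stone_cech (X \<times> X)) ((\<lambda>p. principal {p}) ` E)"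

definition coarse_arrows :: "'a set \<Rightarrow> ('a \<Rightarrow> 'a \<Rightarrow> real) \<Rightarrow> ('a \<times> 'a) filter set" where
  "coarse_arrows X d = (\<Union>E \<in> Collect (entourage X d). entourage_closure X E)"

definition coarse_open :: "'a set \<Rightarrow> ('a \<Rightarrow> 'a \<Rightarrow> real) \<Rightarrow> ('a \<times> 'a) filter set \<Rightarrow> bool" where
  "coarse_open X d U \<longleftrightarrow> U \<subseteq> coarse_arrows X d \<and>
     (\<forall>E. entourage X d E \<longrightarrow>
        openin (subtopology (stone_cech (X \<times> X)) (entourage_closure X E)) (U \<inter> entourage_closure X E))"

lemma istopology_coarse_open: "istopology (coarse_open X d)"
  unfolding istopology_def
proof (intro conjI allI impI)
  fix S T assume "coarse_open X d S" "coarse_open X d T"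
  moreover have "S \<inter> T \<inter> C = (S \<inter> C) \<inter> (T \<inter> C)" for C by blast
  ultimately show "coarse_open X d (S \<inter> T)"
    unfolding coarse_open_def by (simp add: openin_Int le_infI1)
next
  fix \<K> assume K: "\<forall>K\<in>\<K>. coarse_open X d K"
  show "coarse_open X d (\<Union>\<K>)"
    unfolding coarse_open_def
  proof (intro conjI allI impI)
    show "\<Union>\<K> \<subseteq> coarse_arrows X d"
      using K unfolding coarse_open_def by blast
    fix E assume E: "entourage X d E"
    have "openin (subtopology (stone_cech (X \<times> X)) (entourage_closure X E))
        (\<Union>K\<in>\<K>. K \<inter> entourage_closure X E)"
    proof (rule openin_Union, elim imageE)
      fix S K assume "K \<in> \<K>" and S: "S = K \<inter> entourage_closure X E"
      with K have "coarse_open X d K" by blast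
      with E show "openin (subtopology (stone_cech (X \<times> X)) (entourage_closure X E)) S"
        unfolding coarse_open_def S by blast
    qed
    then show "openin (subtopology (stone_cech (X \<times> X)) (entourage_closure X E))
        (\<Union>\<K> \<inter> entourage_closure X E)"
      by (simp only: Int_Union2)
  qed
qed

text \<open>The pair groupoid has \<open>(x, y) (y, z) = (x, z)\<close>, with source \<open>(y, y)\<close> and range \<open>(x, x)\<close> of the
  arrow \<open>(x, y)\<close>. The continuous extension of a map to ultrafilters is the pushforward \<open>filtermap\<close>.
  For the multiplication, the filter on pairs of arrows that converges to \<open>(F, F')\<close> is first
  restricted to the composable pairs of the pair groupoid. The unit space \<open>\<beta>X\<close> is thereby
  identified with the closure of the diagonal.\<close>

definition coarse_groupoid :: "'a set \<Rightarrow> ('a \<Rightarrow> 'a \<Rightarrow> real) \<Rightarrow> ('a \<times> 'a) filter top_groupoid" where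
  "coarse_groupoid X d =
    \<lparr>arrow_top = topology (coarse_open X d),
     gsource = filtermap (\<lambda>(x, y). (y, y)),
     grange = filtermap (\<lambda>(x, y). (x, x)),
     gmult = (\<lambda>F F'. filtermap (\<lambda>((x, y), (y', z)). (x, z))
                (inf (F \<times>\<^sub>F F') (principal {((x, y), (y', z)) | x y y' z. y = y'}))),
     ginv = filtermap (\<lambda>(x, y). (y, x))\<rparr>"

section \<open>Tensor products of abelian groups and split injections\<close>

text \<open>Abelian groups are written multiplicatively, following the library; only the free abelian
  group is written additively.\<close>

definition tensor_relations ::
    "'a monoid \<Rightarrow> 'b monoid \<Rightarrow> ('a \<times> 'b \<Rightarrow>\<^sub>0 int) set" where
  "tensor_relations A B = generate (free_Abelian_group (carrier A \<times> carrier B))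
     ({frag_of (a \<otimes>\<^bsub>A\<^esub> a', b) - frag_of (a, b) - frag_of (a', b) | a a' b.
         a \<in> carrier A \<and> a' \<in> carrier A \<and> b \<in> carrier B} \<union>
      {frag_of (a, b \<otimes>\<^bsub>B\<^esub> b') - frag_of (a, b) - frag_of (a, b') | a b b'.
         a \<in> carrier A \<and> b \<in> carrier B \<and> b' \<in> carrier B})"

definition tensor_product ::
    "'a monoid \<Rightarrow> 'b monoid \<Rightarrow> ('a \<times> 'b \<Rightarrow>\<^sub>0 int) set monoid" where
  "tensor_product A B = free_Abelian_group (carrier A \<times> carrier B) Mod tensor_relations A B"

definition tensor_map ::
    "'c monoid \<Rightarrow> 'd monoid \<Rightarrow> ('a \<Rightarrow> 'c) \<Rightarrow> ('b \<Rightarrow> 'd) \<Rightarrow>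
     ('a \<times> 'b \<Rightarrow>\<^sub>0 int) set \<Rightarrow> ('c \<times> 'd \<Rightarrow>\<^sub>0 int) set" where
  "tensor_map C D f g t =
     the_elem ((\<lambda>z. tensor_relations C D
                  #>\<^bsub>free_Abelian_group (carrier C \<times> carrier D)\<^esub>
                    frag_extend (\<lambda>(a, b). frag_of (f a, g b)) z) ` t)"

definition rational_group :: "rat monoid" where
  "rational_group = \<lparr>carrier = UNIV, mult = (+), one = 0\<rparr>"

definition split_injective :: "'a monoid \<Rightarrow> 'b monoid \<Rightarrow> ('a \<Rightarrow> 'b) \<Rightarrow> bool" where
  "split_injective A B f \<longleftrightarrow>
     f \<in> hom A B \<and> (\<exists>g \<in> hom B A. \<forall>x \<in> carrier A. g (f x) = x)"

end

theory Submission imports Defs begin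

text \<open>The comparison map is already injective integrally. If two integer-valued functions on \<open>X\<close> have the
  same class in \<open>K\<^sub>0\<close>, then, after adding to a stabilizing projection its complement, two diagonal
  projections with the corresponding rank functions are Murray--von Neumann equivalent over the reduced
  algebra. Approximating the matrix implementing the equivalence by one of finite propagation, and counting
  dimensions, gives Hall's condition for the relation of being at bounded distance between the points
  carrying the two projections, in both directions; hence, by Schroeder--Bernstein, a bijection of bounded
  displacement between these points, and the difference of the two rank functions is the boundary of its graph.

  After tensoring with the rationals an injective homomorphism stays injective, and its image is divisible,
  hence a direct summand.\<close>

section \<open>Splitting off divisible subgroups, tensor products and flatness of the
  rationals\<close>

subsection \<open>Divisible torsion-free groups are direct summands\<close>

text \<open>The operators of the reduced algebra act on square-summable functions on all arrows,
  most of which are nonprincipal ultrafilters, while the dimension count needs functions on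
  \<open>X\<close>. The fibre over a principal unit is a copy of \<open>X\<close> on which an
  operator acts by its kernel, and this single block suffices for the count. The other fibres matter
  only for showing that sums, products and adjoints of finite propagation operators are again of
  this kind: there an arrow is written as the germ of a map near the identity, so that each identity
  becomes a limit along an ultrafilter of the same identity for matrices over \<open>X\<close>. A
  stabilizing projection need not be diagonal. Together with its complement it is equivalent to an
  identity matrix, and the problem becomes one about subsets of finitely many copies of
  \<open>X\<close>. The resulting criterion for equality of two classes is an equivalence: one
  direction makes the comparison map well defined on homology, the other makes it injective.
  Integral homology need not be divisible, so the complement of the image is constructed only after
  tensoring.\<close>

lemma divisible_torsion_free_imp_split_injective:
  assumes D: "comm_group D" and E: "comm_group E"
    and h: "h \<in> hom D E" and inj: "inj_on h (carrier D)"
    and divisible: "\<And>x k::int. x \<in> carrier D \<Longrightarrow> k \<noteq> 0 \<Longrightarrow> \<exists>y\<in>carrier D. y [^]\<^bsub>D\<^esub> k = x"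
    and torsion_free: "\<And>x k::int. x \<in> carrier D \<Longrightarrow> k \<noteq> 0 \<Longrightarrow> x [^]\<^bsub>D\<^esub> k = \<one>\<^bsub>D\<^esub> \<Longrightarrow> x = \<one>\<^bsub>D\<^esub>"
  shows "split_injective D E h"
proof -
  interpret D: comm_group D by fact
  interpret E: comm_group E by fact
  interpret h: group_hom D E h
    by (simp add: group_hom_def group_hom_axioms_def D.is_group E.is_group h)
  have h_pow: "h (x [^]\<^bsub>D\<^esub> (k::int)) = h x [^]\<^bsub>E\<^esub> k" if "x \<in> carrier D" for x k
    by (rule hom_int_pow[OF h that]) (rule D.is_group E.is_group)+
  \<comment> \<open>A complement of the image of \<open>h\<close> is a subgroup that is maximal, by
    Zorn, among those meeting the image trivially. The retraction will send \<open>x\<close> to the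
    unique \<open>d\<close> for which \<open>x\<close> and \<open>h d\<close> differ by an element
    of it.\<close>
  define P where "P = {C. subgroup C E \<and> C \<inter> h ` carrier D \<subseteq> {\<one>\<^bsub>E\<^esub>}}"
  have "{\<one>\<^bsub>E\<^esub>} \<in> P" unfolding P_def using E.triv_subgroup by auto
  then have "P \<noteq> {}" by blast
  moreover have "\<Union>\<C> \<in> P" if "\<C> \<noteq> {}" "subset.chain P \<C>" for \<C>
  proof -
    have sub: "subgroup C E" if "C \<in> \<C>" for C
      using that \<open>subset.chain P \<C>\<close> unfolding P_def subset.chain_def by blast
    have "subgroup (\<Union>\<C>) E"
    proof (rule E.subgroupI)
      show "\<Union>\<C> \<subseteq> carrier E" using sub subgroup.subset by blast
      show "\<Union>\<C> \<noteq> {}" using that(1) sub subgroup.one_closed by blast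
      show "inv\<^bsub>E\<^esub> a \<in> \<Union>\<C>" if a: "a \<in> \<Union>\<C>" for a
      proof -
        from a obtain S where "S \<in> \<C>" "a \<in> S" by blast
        then show ?thesis using sub[of S] subgroup.m_inv_closed[of S E a] by blast
      qed
      show "a \<otimes>\<^bsub>E\<^esub> b \<in> \<Union>\<C>" if ab: "a \<in> \<Union>\<C>" "b \<in> \<Union>\<C>" for a b
      proof -
        from ab obtain S T where ST: "S \<in> \<C>" "T \<in> \<C>" "a \<in> S" "b \<in> T" by blast
        then have "S \<subseteq> T \<or> T \<subseteq> S"
          using \<open>subset.chain P \<C>\<close> unfolding subset_chain_def by blast
        then show ?thesis
            using ST sub[of S] sub[of T] subgroup.m_closed[of S E a b] subgroup.m_closed[of T E a b] by blast
      qed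
    qed
    moreover have "\<Union>\<C> \<inter> h ` carrier D \<subseteq> {\<one>\<^bsub>E\<^esub>}"
      using that(2) unfolding P_def subset.chain_def by blast
    ultimately show ?thesis unfolding P_def by blast
  qed
  ultimately obtain C where C: "C \<in> P" and max: "\<And>C'. C' \<in> P \<Longrightarrow> C \<subseteq> C' \<Longrightarrow> C' = C"
    using subset_Zorn_nonempty[of P] by metis
  have subC: "subgroup C E" and CD: "C \<inter> h ` carrier D \<subseteq> {\<one>\<^bsub>E\<^esub>}" using C unfolding P_def by auto
  interpret C: subgroup C E by fact
  have one_meet: "d = \<one>\<^bsub>D\<^esub>" if "d \<in> carrier D" "h d \<in> C" for d
  proof -
    have "h d = h \<one>\<^bsub>D\<^esub>" using CD that by auto
    then show ?thesis by (rule inj_onD[OF inj]) (use that in auto)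
  qed
  \<comment> \<open>By maximality, adjoining \<open>x\<close> to \<open>C\<close> must create a
    nontrivial common element with the image. The exponent of \<open>x\<close> in it is nonzero
    because \<open>C\<close> alone has no such element.\<close>
  have enlarge: "\<exists>c\<in>C. \<exists>k::int. \<exists>d\<in>carrier D. k \<noteq> 0 \<and> d \<noteq> \<one>\<^bsub>D\<^esub> \<and> h d = c \<otimes>\<^bsub>E\<^esub> x [^]\<^bsub>E\<^esub> k"
    if x: "x \<in> carrier E" "x \<notin> C" for x
  proof -
    define C' where "C' = {c \<otimes>\<^bsub>E\<^esub> x [^]\<^bsub>E\<^esub> (k::int) | c k. c \<in> C}"
    have "subgroup C' E"
    proof (rule E.subgroupI)
      show "C' \<subseteq> carrier E" unfolding C'_def using x by auto
      show "C' \<noteq> {}" unfolding C'_def using C.one_closed by blast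
      show "inv\<^bsub>E\<^esub> a \<in> C'" if "a \<in> C'" for a
      proof -
        from that obtain c k where ck: "a = c \<otimes>\<^bsub>E\<^esub> x [^]\<^bsub>E\<^esub> (k::int)" "c \<in> C" unfolding C'_def by blast
        have "inv\<^bsub>E\<^esub> a = inv\<^bsub>E\<^esub> c \<otimes>\<^bsub>E\<^esub> x [^]\<^bsub>E\<^esub> (-k)"
          using ck x by (simp add: E.inv_mult E.int_pow_neg)
        then show ?thesis unfolding C'_def using ck by blast
      qed
      show "a \<otimes>\<^bsub>E\<^esub> b \<in> C'" if ab: "a \<in> C'" "b \<in> C'" for a b
      proof -
        from ab obtain c k c' k' where ck: "a = c \<otimes>\<^bsub>E\<^esub> x [^]\<^bsub>E\<^esub> (k::int)" "c \<in> C"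
          "b = c' \<otimes>\<^bsub>E\<^esub> x [^]\<^bsub>E\<^esub> (k'::int)" "c' \<in> C" unfolding C'_def by blast
        have "a \<otimes>\<^bsub>E\<^esub> b = (c \<otimes>\<^bsub>E\<^esub> c') \<otimes>\<^bsub>E\<^esub> x [^]\<^bsub>E\<^esub> (k + k')"
          using ck x by (simp add: E.int_pow_mult E.m_ac)
        then show ?thesis unfolding C'_def using ck by blast
      qed
    qed
    moreover have "C \<subseteq> C'"
    proof
      fix c assume "c \<in> C"
      then have "c = c \<otimes>\<^bsub>E\<^esub> x [^]\<^bsub>E\<^esub> (0::int)" by simp
      with \<open>c \<in> C\<close> show "c \<in> C'" unfolding C'_def by blast
    qed
    moreover have "x \<in> C'"
    proof -
      have "x = \<one>\<^bsub>E\<^esub> \<otimes>\<^bsub>E\<^esub> x [^]\<^bsub>E\<^esub> (1::int)" using x by (simp add: E.int_pow_1)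
      then show ?thesis unfolding C'_def using C.one_closed by blast
    qed
    ultimately have "C' \<notin> P" using max x by blast
    with \<open>subgroup C' E\<close> obtain d where d: "d \<in> carrier D" "h d \<in> C'" "h d \<noteq> \<one>\<^bsub>E\<^esub>"
      unfolding P_def by blast
    then obtain c k where ck: "h d = c \<otimes>\<^bsub>E\<^esub> x [^]\<^bsub>E\<^esub> (k::int)" "c \<in> C" unfolding C'_def by blast
    have "d \<noteq> \<one>\<^bsub>D\<^esub>" using d by auto
    moreover have "k \<noteq> 0"
    proof
      assume "k = 0"
      then have "h d \<in> C" using ck by simp
      then show False using one_meet d \<open>d \<noteq> \<one>\<^bsub>D\<^esub>\<close> by blast
    qed
    ultimately show ?thesis using ck d by blast
  qed
  have decompose: "\<exists>d\<in>carrier D. x \<otimes>\<^bsub>E\<^esub> inv\<^bsub>E\<^esub> (h d) \<in> C" if x: "x \<in> carrier E" for x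
  proof (cases "x \<in> C")
    case True
    then show ?thesis by (intro bexI[of _ "\<one>\<^bsub>D\<^esub>"]) auto
  next
    case False
    from enlarge[OF x False] obtain c k d where ck: "c \<in> C" "d \<in> carrier D" "k \<noteq> (0::int)"
      "h d = c \<otimes>\<^bsub>E\<^esub> x [^]\<^bsub>E\<^esub> k" by blast
    \<comment> \<open>Divisibility enters here: with a \<open>k\<close>-th root \<open>e\<close> of
      \<open>d\<close>, the corrected element \<open>y\<close> has its \<open>k\<close>-th power in
      \<open>C\<close>.\<close>
    obtain e where e: "e \<in> carrier D" "e [^]\<^bsub>D\<^esub> k = d" using divisible ck by blast
    define y where "y = x \<otimes>\<^bsub>E\<^esub> inv\<^bsub>E\<^esub> (h e)"
    have yE: "y \<in> carrier E" unfolding y_def using x e by simp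
    have hd: "h e [^]\<^bsub>E\<^esub> k = h d" using h_pow e by auto
    have "y [^]\<^bsub>E\<^esub> k = x [^]\<^bsub>E\<^esub> k \<otimes>\<^bsub>E\<^esub> inv\<^bsub>E\<^esub> (h d)"
      unfolding y_def using x e by (simp add: E.int_pow_distrib E.int_pow_inv hd)
    also have "\<dots> = inv\<^bsub>E\<^esub> c"
      using ck x by (simp add: E.inv_mult E.m_ac)
    finally have yC: "y [^]\<^bsub>E\<^esub> k \<in> C" using ck by simp
    \<comment> \<open>Torsion-freeness enters here: otherwise some \<open>d'\<close> different from
      the unit would have \<open>h d'\<close> equal to an element of \<open>C\<close> times a power
      of \<open>y\<close>. Raising this to the power \<open>k\<close> puts its image into
      \<open>C\<close>, so the \<open>k\<close>-th power of \<open>d'\<close> is trivial.\<close>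
    have "y \<in> C"
    proof (rule ccontr)
      assume "y \<notin> C"
      from enlarge[OF yE this] obtain c' m d' where m: "c' \<in> C" "d' \<in> carrier D" "m \<noteq> (0::int)"
        "d' \<noteq> \<one>\<^bsub>D\<^esub>" "h d' = c' \<otimes>\<^bsub>E\<^esub> y [^]\<^bsub>E\<^esub> m" by blast
      have "h (d' [^]\<^bsub>D\<^esub> k) = c' [^]\<^bsub>E\<^esub> k \<otimes>\<^bsub>E\<^esub> (y [^]\<^bsub>E\<^esub> k) [^]\<^bsub>E\<^esub> m"
        using m yE ck by (simp add: h_pow E.int_pow_distrib E.int_pow_pow mult.commute)
      also have "\<dots> \<in> C"
        using C.m_closed[OF E.subgroup_int_pow_closed[OF subC m(1), of k] E.subgroup_int_pow_closed[OF subC yC, of m]] .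
      finally have "d' [^]\<^bsub>D\<^esub> k = \<one>\<^bsub>D\<^esub>" using one_meet m by simp
      then show False using torsion_free m ck by blast
    qed
    then show ?thesis unfolding y_def using e by blast
  qed
  define g where "g x = (SOME d. d \<in> carrier D \<and> x \<otimes>\<^bsub>E\<^esub> inv\<^bsub>E\<^esub> (h d) \<in> C)" for x
  have g: "g x \<in> carrier D \<and> x \<otimes>\<^bsub>E\<^esub> inv\<^bsub>E\<^esub> (h (g x)) \<in> C" if "x \<in> carrier E" for x
    unfolding g_def by (rule someI_ex) (use decompose[OF that] in blast)
  \<comment> \<open>Two candidates for the value of \<open>g\<close> differ by an element whose
    image lies in \<open>C\<close>. With this uniqueness, \<open>g\<close> is multiplicative as soon
    as the product of two values is itself a candidate.\<close>
  have g_eq: "g x = d" if x: "x \<in> carrier E" and d: "d \<in> carrier D" "x \<otimes>\<^bsub>E\<^esub> inv\<^bsub>E\<^esub> (h d) \<in> C" for x d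
  proof -
    have cancel: "x \<otimes>\<^bsub>E\<^esub> (inv\<^bsub>E\<^esub> x \<otimes>\<^bsub>E\<^esub> w) = w" if "w \<in> carrier E" for w
      using x that by (simp flip: E.m_assoc)
    have "(x \<otimes>\<^bsub>E\<^esub> inv\<^bsub>E\<^esub> (h d)) \<otimes>\<^bsub>E\<^esub> inv\<^bsub>E\<^esub> (x \<otimes>\<^bsub>E\<^esub> inv\<^bsub>E\<^esub> (h (g x))) \<in> C"
      using g[OF x] d by blast
    moreover have "(x \<otimes>\<^bsub>E\<^esub> inv\<^bsub>E\<^esub> (h d)) \<otimes>\<^bsub>E\<^esub> inv\<^bsub>E\<^esub> (x \<otimes>\<^bsub>E\<^esub> inv\<^bsub>E\<^esub> (h (g x)))
        = h (g x) \<otimes>\<^bsub>E\<^esub> inv\<^bsub>E\<^esub> (h d)"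
      using x d g[OF x] cancel[of "h (g x) \<otimes>\<^bsub>E\<^esub> inv\<^bsub>E\<^esub> (h d)"] by (simp add: E.inv_mult E.m_ac)
    ultimately have "h (g x \<otimes>\<^bsub>D\<^esub> inv\<^bsub>D\<^esub> d) \<in> C" using x d g[OF x] by simp
    then have "g x \<otimes>\<^bsub>D\<^esub> inv\<^bsub>D\<^esub> d = \<one>\<^bsub>D\<^esub>" using one_meet d g[OF x] by simp
    then show ?thesis using d g[OF x] D.inv_equality[of "g x" "inv\<^bsub>D\<^esub> d"] by simp
  qed
  have "g \<in> hom E D"
  proof (rule homI)
    show "g x \<in> carrier D" if "x \<in> carrier E" for x using g that by blast
    fix x y assume xy: "x \<in> carrier E" "y \<in> carrier E"
    have "(x \<otimes>\<^bsub>E\<^esub> y) \<otimes>\<^bsub>E\<^esub> inv\<^bsub>E\<^esub> (h (g x \<otimes>\<^bsub>D\<^esub> g y))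
        = (x \<otimes>\<^bsub>E\<^esub> inv\<^bsub>E\<^esub> (h (g x))) \<otimes>\<^bsub>E\<^esub> (y \<otimes>\<^bsub>E\<^esub> inv\<^bsub>E\<^esub> (h (g y)))"
      using xy g[OF xy(1)] g[OF xy(2)] by (simp add: E.inv_mult E.m_ac)
    also have "\<dots> \<in> C" using g[OF xy(1)] g[OF xy(2)] by blast
    finally show "g (x \<otimes>\<^bsub>E\<^esub> y) = g x \<otimes>\<^bsub>D\<^esub> g y"
      using g_eq xy g[OF xy(1)] g[OF xy(2)] by simp
  qed
  moreover have "g (h x) = x" if "x \<in> carrier D" for x
    using that by (intro g_eq) auto
  ultimately show ?thesis unfolding split_injective_def using h by blast
qed

subsection \<open>Tensor products\<close>

definition pure_tensor ::
    "'a monoid \<Rightarrow> 'b monoid \<Rightarrow> 'a \<Rightarrow> 'b \<Rightarrow> ('a \<times> 'b \<Rightarrow>\<^sub>0 int) set" where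
  "pure_tensor A B a b =
     tensor_relations A B #>\<^bsub>free_Abelian_group (carrier A \<times> carrier B)\<^esub> frag_of (a, b)"

lemma (in comm_group) rcos_eq_iff:
  assumes "subgroup H G" "x \<in> carrier G" "y \<in> carrier G"
  shows "H #> x = H #> y \<longleftrightarrow> x \<otimes> inv y \<in> H"
proof -
  have "x \<in> H #> y \<longleftrightarrow> x \<otimes> inv y \<in> H"
    by (rule subgroup.rcos_module[OF assms(1)]) (use assms in auto)
  then show ?thesis
    using repr_independence[of x H y] rcos_self[of x H] assms by metis
qed

context
  fixes A :: "'a monoid" and B :: "'b monoid"
  assumes A: "monoid A" and B: "monoid B"
begin

interpretation F: comm_group "free_Abelian_group (carrier A \<times> carrier B)"
  by (rule abelian_free_Abelian_group)

lemma tensor_relations_subgroup: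
  "subgroup (tensor_relations A B) (free_Abelian_group (carrier A \<times> carrier B))"
proof -
  interpret A: monoid A by (rule A)
  interpret B: monoid B by (rule B)
  have *: "Poly_Mapping.keys (frag_of p - frag_of q - frag_of r) \<subseteq> S" if "p \<in> S" "q \<in> S" "r \<in> S"
    for p q r :: "'a \<times> 'b" and S
    using that keys_diff[of "frag_of p - frag_of q" "frag_of r"] keys_diff[of "frag_of p" "frag_of q"]
    by (auto simp: keys_frag_of)
  show ?thesis
    unfolding tensor_relations_def
    by (rule F.generate_is_subgroup, intro subsetI, elim UnE CollectE exE conjE)
      (simp_all only: carrier_free_Abelian_group_iff, (intro * SigmaI; simp)+)
qed

lemma tensor_product_comm_group: "comm_group (tensor_product A B)"
  unfolding tensor_product_def by (rule F.abelian_FactGroup[OF tensor_relations_subgroup])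

lemma tensor_relations_normal:
  "tensor_relations A B \<lhd> free_Abelian_group (carrier A \<times> carrier B)"
  using tensor_relations_subgroup by (simp add: F.normal_iff_subgroup)

lemma carrier_tensor_product:
  "carrier (tensor_product A B) =
     (\<lambda>z. tensor_relations A B #>\<^bsub>free_Abelian_group (carrier A \<times> carrier B)\<^esub> z)
       ` {z. Poly_Mapping.keys z \<subseteq> carrier A \<times> carrier B}"
  unfolding tensor_product_def carrier_FactGroup by (simp add: free_Abelian_group_def)

lemma tensor_coset_eq_iff:
  assumes "Poly_Mapping.keys x \<subseteq> carrier A \<times> carrier B" "Poly_Mapping.keys y \<subseteq> carrier A \<times> carrier B"
  shows "tensor_relations A B #>\<^bsub>free_Abelian_group (carrier A \<times> carrier B)\<^esub> x =
      tensor_relations A B #>\<^bsub>free_Abelian_group (carrier A \<times> carrier B)\<^esub> y \<longleftrightarrow> x - y \<in> tensor_relations A B"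
  using F.rcos_eq_iff[OF tensor_relations_subgroup, of x y] assms by simp

lemma tensor_coset_hom:
  "(\<lambda>z. tensor_relations A B #>\<^bsub>free_Abelian_group (carrier A \<times> carrier B)\<^esub> z)
     \<in> hom (free_Abelian_group (carrier A \<times> carrier B)) (tensor_product A B)"
  unfolding tensor_product_def by (rule normal.r_coset_hom_Mod[OF tensor_relations_normal])

lemma pure_tensor_closed: "a \<in> carrier A \<Longrightarrow> b \<in> carrier B \<Longrightarrow> pure_tensor A B a b \<in> carrier (tensor_product A B)"
  unfolding pure_tensor_def carrier_tensor_product by (auto simp: keys_frag_of)

lemma pure_tensor_hom_left:
  assumes b: "b \<in> carrier B"
  shows "(\<lambda>a. pure_tensor A B a b) \<in> hom A (tensor_product A B)"
proof (rule homI)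
  interpret A: monoid A by (rule A)
  fix a a' assume a: "a \<in> carrier A" "a' \<in> carrier A"
  have "frag_of (a \<otimes>\<^bsub>A\<^esub> a', b) - frag_of (a, b) - frag_of (a', b) \<in> tensor_relations A B"
    unfolding tensor_relations_def by (rule generate.incl) (use a b in blast)
  then have "pure_tensor A B (a \<otimes>\<^bsub>A\<^esub> a') b =
      tensor_relations A B #>\<^bsub>free_Abelian_group (carrier A \<times> carrier B)\<^esub> (frag_of (a, b) + frag_of (a', b))"
    unfolding pure_tensor_def using a b
    by (subst tensor_coset_eq_iff)
      (auto simp: keys_frag_of diff_diff_eq intro!: order_trans[OF keys_add])
  also have "\<dots> = pure_tensor A B a b \<otimes>\<^bsub>tensor_product A B\<^esub> pure_tensor A B a' b"
    unfolding pure_tensor_def using hom_mult[OF tensor_coset_hom, of "frag_of (a, b)" "frag_of (a', b)"] a b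
    by simp
  finally show "pure_tensor A B (a \<otimes>\<^bsub>A\<^esub> a') b = \<dots>" .
qed (use b pure_tensor_closed in auto)

lemma pure_tensor_hom_right:
  assumes a: "a \<in> carrier A"
  shows "pure_tensor A B a \<in> hom B (tensor_product A B)"
proof (rule homI)
  interpret B: monoid B by (rule B)
  fix b b' assume b: "b \<in> carrier B" "b' \<in> carrier B"
  have "frag_of (a, b \<otimes>\<^bsub>B\<^esub> b') - frag_of (a, b) - frag_of (a, b') \<in> tensor_relations A B"
    unfolding tensor_relations_def by (rule generate.incl) (use a b in blast)
  then have "pure_tensor A B a (b \<otimes>\<^bsub>B\<^esub> b') =
      tensor_relations A B #>\<^bsub>free_Abelian_group (carrier A \<times> carrier B)\<^esub> (frag_of (a, b) + frag_of (a, b'))"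
    unfolding pure_tensor_def using a b
    by (subst tensor_coset_eq_iff)
      (auto simp: keys_frag_of diff_diff_eq intro!: order_trans[OF keys_add])
  also have "\<dots> = pure_tensor A B a b \<otimes>\<^bsub>tensor_product A B\<^esub> pure_tensor A B a b'"
    unfolding pure_tensor_def using hom_mult[OF tensor_coset_hom, of "frag_of (a, b)" "frag_of (a, b')"] a b
    by simp
  finally show "pure_tensor A B a (b \<otimes>\<^bsub>B\<^esub> b') = \<dots>" .
qed (use a pure_tensor_closed in auto)

end

context
  fixes A :: "'a monoid" and B :: "'b monoid" and C :: "'c monoid" and D :: "'d monoid"
    and f :: "'a \<Rightarrow> 'c" and g :: "'b \<Rightarrow> 'd"
  assumes A: "monoid A" and B: "monoid B" and C: "monoid C" and D: "monoid D"
    and f: "f \<in> hom A C" and g: "g \<in> hom B D"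
begin

interpretation F: comm_group "free_Abelian_group (carrier A \<times> carrier B)"
  by (rule abelian_free_Abelian_group)
interpretation F': comm_group "free_Abelian_group (carrier C \<times> carrier D)"
  by (rule abelian_free_Abelian_group)

private definition "push = frag_extend (\<lambda>(a, b). frag_of (f a, g b))"

private lemma push_keys:
  "Poly_Mapping.keys z \<subseteq> carrier A \<times> carrier B \<Longrightarrow> Poly_Mapping.keys (push z) \<subseteq> carrier C \<times> carrier D"
  unfolding push_def using f g
  by (intro order_trans[OF keys_frag_extend]) (force simp: keys_frag_of hom_def Pi_def)

text \<open>Bilinearity relations go to bilinearity relations because \<open>f\<close> and
  \<open>g\<close> are homomorphisms; induction over \<open>generate\<close> extends this from the
  generators. It is the reason why the induced map of tensor products exists.\<close>

private lemma push_relations: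
  assumes "z \<in> tensor_relations A B" shows "push z \<in> tensor_relations C D"
proof -
  interpret A: monoid A by (rule A)
  interpret B: monoid B by (rule B)
  have sub: "subgroup (tensor_relations C D) (free_Abelian_group (carrier C \<times> carrier D))"
    by (rule tensor_relations_subgroup[OF C D])
  define S where "S = {frag_of (a \<otimes>\<^bsub>A\<^esub> a', b) - frag_of (a, b) - frag_of (a', b) | a a' b.
         a \<in> carrier A \<and> a' \<in> carrier A \<and> b \<in> carrier B} \<union>
      {frag_of (a, b \<otimes>\<^bsub>B\<^esub> b') - frag_of (a, b) - frag_of (a, b') | a b b'.
         a \<in> carrier A \<and> b \<in> carrier B \<and> b' \<in> carrier B}"
  have S: "push z \<in> tensor_relations C D" if "z \<in> S" for z
    using that unfolding S_def
  proof (elim UnE CollectE exE conjE)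
    fix a a' b assume z: "z = frag_of (a \<otimes>\<^bsub>A\<^esub> a', b) - frag_of (a, b) - frag_of (a', b)"
      and ab: "a \<in> carrier A" "a' \<in> carrier A" "b \<in> carrier B"
    have "push z = frag_of (f a \<otimes>\<^bsub>C\<^esub> f a', g b) - frag_of (f a, g b) - frag_of (f a', g b)"
      unfolding push_def z using hom_mult[OF f] ab by (simp add: frag_extend_diff)
    moreover have "f a \<in> carrier C" "f a' \<in> carrier C" "g b \<in> carrier D"
      using ab f g by (auto simp: hom_def)
    ultimately show ?thesis
      unfolding tensor_relations_def by (intro generate.incl) blast
  next
    fix a b b' assume z: "z = frag_of (a, b \<otimes>\<^bsub>B\<^esub> b') - frag_of (a, b) - frag_of (a, b')"
      and ab: "a \<in> carrier A" "b \<in> carrier B" "b' \<in> carrier B"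
    have "push z = frag_of (f a, g b \<otimes>\<^bsub>D\<^esub> g b') - frag_of (f a, g b) - frag_of (f a, g b')"
      unfolding push_def z using hom_mult[OF g] ab by (simp add: frag_extend_diff)
    moreover have "f a \<in> carrier C" "g b \<in> carrier D" "g b' \<in> carrier D"
      using ab f g by (auto simp: hom_def)
    ultimately show ?thesis
      unfolding tensor_relations_def by (intro generate.incl) blast
  qed
  have S_carrier: "S \<subseteq> carrier (free_Abelian_group (carrier A \<times> carrier B))"
  proof -
    have "S \<subseteq> tensor_relations A B" unfolding tensor_relations_def S_def by (rule subsetI, rule generate.incl)
    then show ?thesis using subgroup.subset[OF tensor_relations_subgroup[OF A B]] by blast
  qed
  have "z \<in> generate (free_Abelian_group (carrier A \<times> carrier B)) S"
    using assms unfolding tensor_relations_def S_def .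
  then show ?thesis
  proof (induction rule: generate.induct)
    case one
    then show ?case using subgroup.one_closed[OF sub] by (simp add: push_def)
  next
    case (incl h)
    then show ?case by (rule S)
  next
    case (inv h)
    then have "Poly_Mapping.keys h \<subseteq> carrier A \<times> carrier B"
      using subsetD[OF S_carrier inv] by (simp only: carrier_free_Abelian_group_iff)
    moreover have "- push h \<in> tensor_relations C D"
      using subgroup.m_inv_closed[OF sub S[OF inv]] push_keys[OF calculation] by simp
    ultimately show ?case by (simp add: push_def frag_extend_minus)
  next
    case (eng h1 h2)
    then show ?case using subgroup.m_closed[OF sub, of "push h1" "push h2"]
      by (simp add: push_def frag_extend_add)
  qed
qed

text \<open>The \<open>the_elem\<close> in \<open>tensor_map\<close> denotes something only because
  all representatives of a coset are pushed into one coset; afterwards \<open>tensor_map\<close> can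
  be computed on any representative.\<close>

lemma tensor_map_coset:
  assumes z: "Poly_Mapping.keys z \<subseteq> carrier A \<times> carrier B"
  shows "tensor_map C D f g (tensor_relations A B #>\<^bsub>free_Abelian_group (carrier A \<times> carrier B)\<^esub> z)
    = tensor_relations C D #>\<^bsub>free_Abelian_group (carrier C \<times> carrier D)\<^esub>
        frag_extend (\<lambda>(a, b). frag_of (f a, g b)) z"
proof -
  let ?t = "tensor_relations A B #>\<^bsub>free_Abelian_group (carrier A \<times> carrier B)\<^esub> z"
  have "tensor_relations C D #>\<^bsub>free_Abelian_group (carrier C \<times> carrier D)\<^esub> push z'
      = tensor_relations C D #>\<^bsub>free_Abelian_group (carrier C \<times> carrier D)\<^esub> push z"
    if z': "z' \<in> ?t" for z'
  proof -
    have k: "Poly_Mapping.keys z' \<subseteq> carrier A \<times> carrier B"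
      using subgroup.elemrcos_carrier[OF tensor_relations_subgroup[OF A B] F.is_group _ z'] z by simp
    have "?t = tensor_relations A B #>\<^bsub>free_Abelian_group (carrier A \<times> carrier B)\<^esub> z'"
      using F.repr_independence[OF z' _ tensor_relations_subgroup[OF A B]] z by simp
    then have "z' - z \<in> tensor_relations A B"
      using tensor_coset_eq_iff[OF A B k z] by simp
    then have "push z' - push z \<in> tensor_relations C D"
      using push_relations[of "z' - z"] by (simp add: push_def frag_extend_diff)
    then show ?thesis
      using tensor_coset_eq_iff[OF C D push_keys[OF k] push_keys[OF z]] by simp
  qed
  moreover have "z \<in> ?t" using F.rcos_self[OF _ tensor_relations_subgroup[OF A B]] z by simp
  ultimately have "(\<lambda>z. tensor_relations C D #>\<^bsub>free_Abelian_group (carrier C \<times> carrier D)\<^esub> push z) ` ?t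
      = {tensor_relations C D #>\<^bsub>free_Abelian_group (carrier C \<times> carrier D)\<^esub> push z}" by blast
  then show ?thesis unfolding tensor_map_def push_def by simp
qed

lemma tensor_map_hom: "tensor_map C D f g \<in> hom (tensor_product A B) (tensor_product C D)"
proof (rule homI)
  let ?F = "free_Abelian_group (carrier A \<times> carrier B)"
  show "tensor_map C D f g x \<in> carrier (tensor_product C D)" if "x \<in> carrier (tensor_product A B)" for x
    using that push_keys unfolding carrier_tensor_product[OF A B] carrier_tensor_product[OF C D]
    by (auto simp: tensor_map_coset push_def)
  fix x y assume "x \<in> carrier (tensor_product A B)" "y \<in> carrier (tensor_product A B)"
  then obtain u v where uv: "x = tensor_relations A B #>\<^bsub>?F\<^esub> u" "y = tensor_relations A B #>\<^bsub>?F\<^esub> v"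
    "Poly_Mapping.keys u \<subseteq> carrier A \<times> carrier B" "Poly_Mapping.keys v \<subseteq> carrier A \<times> carrier B"
    unfolding carrier_tensor_product[OF A B] by auto
  have "Poly_Mapping.keys (u + v) \<subseteq> carrier A \<times> carrier B"
    using uv keys_add[of u v] by blast
  moreover have "x \<otimes>\<^bsub>tensor_product A B\<^esub> y = tensor_relations A B #>\<^bsub>?F\<^esub> (u + v)"
    using hom_mult[OF tensor_coset_hom[OF A B], of u v] uv by simp
  ultimately show "tensor_map C D f g (x \<otimes>\<^bsub>tensor_product A B\<^esub> y)
      = tensor_map C D f g x \<otimes>\<^bsub>tensor_product C D\<^esub> tensor_map C D f g y"
    using hom_mult[OF tensor_coset_hom[OF C D], of "push u" "push v"] uv push_keys
    by (simp add: tensor_map_coset push_def frag_extend_add)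
qed

lemma tensor_map_pure:
  "a \<in> carrier A \<Longrightarrow> b \<in> carrier B \<Longrightarrow>
    tensor_map C D f g (pure_tensor A B a b) = pure_tensor C D (f a) (g b)"
  unfolding pure_tensor_def by (subst tensor_map_coset) (auto simp: keys_frag_of)

end

subsection \<open>Rationalization\<close>

lemma rational_group_comm_group: "comm_group rational_group"
proof (rule comm_groupI)
  fix x :: rat
  show "\<exists>y\<in>carrier rational_group. y \<otimes>\<^bsub>rational_group\<^esub> x = \<one>\<^bsub>rational_group\<^esub>"
    by (rule bexI[of _ "- x"]) (auto simp: rational_group_def)
qed (auto simp: rational_group_def)

lemma rational_group_simps [simp]:
  "carrier rational_group = UNIV" "x \<otimes>\<^bsub>rational_group\<^esub> y = x + y" "\<one>\<^bsub>rational_group\<^esub> = 0"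
  by (auto simp: rational_group_def)

lemma rational_group_int_pow [simp]: "q [^]\<^bsub>rational_group\<^esub> (k::int) = of_int k * q"
proof -
  interpret Q: comm_group rational_group by (rule rational_group_comm_group)
  have inv: "inv\<^bsub>rational_group\<^esub> x = - x" for x by (rule Q.inv_equality) auto
  have nat: "q [^]\<^bsub>rational_group\<^esub> (n::nat) = of_nat n * q" for n
    by (induction n) (auto simp: algebra_simps Q.nat_pow_Suc)
  show ?thesis by (cases k rule: int_cases2) (auto simp: int_pow_int nat Q.int_pow_neg inv)
qed

context
  fixes A :: "'a monoid"
  assumes A: "comm_group A"
begin

interpretation A: comm_group A by (rule A)
interpretation Q: comm_group rational_group by (rule rational_group_comm_group)
interpretation T: comm_group "tensor_product A rational_group"
  by (rule tensor_product_comm_group) (rule A.monoid_axioms Q.monoid_axioms)+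

private lemmas left_hom = pure_tensor_hom_left[OF A.monoid_axioms Q.monoid_axioms]
private lemmas right_hom = pure_tensor_hom_right[OF A.monoid_axioms Q.monoid_axioms]

lemma pure_tensor_int_pow_left:
  assumes "a \<in> carrier A"
  shows "pure_tensor A rational_group (a [^]\<^bsub>A\<^esub> (k::int)) q = pure_tensor A rational_group a (of_int k * q)"
proof -
  have "pure_tensor A rational_group (a [^]\<^bsub>A\<^esub> k) q = pure_tensor A rational_group a q [^]\<^bsub>tensor_product A rational_group\<^esub> k"
    by (rule hom_int_pow[OF left_hom assms A.is_group T.is_group]) simp
  also have "\<dots> = pure_tensor A rational_group a (q [^]\<^bsub>rational_group\<^esub> k)"
    by (rule hom_int_pow[OF right_hom _ Q.is_group T.is_group, symmetric]) (simp_all add: assms)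
  finally show ?thesis by simp
qed

lemma pure_tensor_int_pow_right:
  assumes "a \<in> carrier A"
  shows "pure_tensor A rational_group a q [^]\<^bsub>tensor_product A rational_group\<^esub> (k::int) = pure_tensor A rational_group a (of_int k * q)"
  using hom_int_pow[OF right_hom _ Q.is_group T.is_group, of a q k] assms by simp

text \<open>Finitely many fractions have a common denominator, and the numerators can be moved to
  the left factor as powers. Since the free abelian group is generated by subtraction, the only case
  with content is a difference, handled over the denominator \<open>n * m\<close>.\<close>

lemma rational_tensor_is_pure:
  assumes "t \<in> carrier (tensor_product A rational_group)"
  obtains a n where "a \<in> carrier A" "n > (0::int)" "t = pure_tensor A rational_group a (1 / of_int n)"
proof -
  let ?F = "free_Abelian_group (carrier A \<times> carrier rational_group)"
  let ?c = "\<lambda>z. tensor_relations A rational_group #>\<^bsub>?F\<^esub> z"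
  note c_hom = tensor_coset_hom[OF A.monoid_axioms Q.monoid_axioms]
  interpret F: comm_group ?F by (rule abelian_free_Abelian_group)
  have "\<exists>a\<in>carrier A. \<exists>n>(0::int). ?c z = pure_tensor A rational_group a (1 / of_int n)"
    if "Poly_Mapping.keys z \<subseteq> carrier A \<times> carrier rational_group" for z
  proof (rule free_Abelian_group_induct[OF that], goal_cases)
    case 1
    have "?c 0 = \<one>\<^bsub>tensor_product A rational_group\<^esub>"
      using hom_one[OF c_hom F.is_group T.is_group] by simp
    also have "\<dots> = pure_tensor A rational_group \<one>\<^bsub>A\<^esub> (1 / of_int 1)"
      using hom_one[OF left_hom A.is_group T.is_group, of "1 / of_int 1"] by simp
    finally show ?case by (intro bexI[of _ "\<one>\<^bsub>A\<^esub>"] exI[of _ 1]) auto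
  next
    case (2 x y)
    then obtain a n b m where *: "a \<in> carrier A" "n > (0::int)" "?c x = pure_tensor A rational_group a (1 / of_int n)"
      "b \<in> carrier A" "m > (0::int)" "?c y = pure_tensor A rational_group b (1 / of_int m)" by blast
    let ?q = "1 / of_int (n * m) :: rat"
    have "?c (x - y) = ?c x \<otimes>\<^bsub>tensor_product A rational_group\<^esub> ?c (- y)"
      using hom_mult[OF c_hom, of x "- y"] 2 by simp
    also have "?c (- y) = inv\<^bsub>tensor_product A rational_group\<^esub> ?c y"
      using group_hom.hom_inv[of ?F "tensor_product A rational_group" ?c y] 2 c_hom
      by (simp add: group_hom_def group_hom_axioms_def T.is_group)
    also have "?c x = pure_tensor A rational_group (a [^]\<^bsub>A\<^esub> m) ?q"
      using * by (simp add: pure_tensor_int_pow_left)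
    also have "?c y = pure_tensor A rational_group (b [^]\<^bsub>A\<^esub> n) ?q"
      using * by (simp add: pure_tensor_int_pow_left)
    also have "inv\<^bsub>tensor_product A rational_group\<^esub> \<dots> = pure_tensor A rational_group (inv\<^bsub>A\<^esub> (b [^]\<^bsub>A\<^esub> n)) ?q"
      using group_hom.hom_inv[of A "tensor_product A rational_group" "\<lambda>a. pure_tensor A rational_group a ?q" "b [^]\<^bsub>A\<^esub> n"] left_hom *
      by (simp add: group_hom_def group_hom_axioms_def T.is_group A.is_group)
    also have "pure_tensor A rational_group (a [^]\<^bsub>A\<^esub> m) ?q \<otimes>\<^bsub>tensor_product A rational_group\<^esub> \<dots>
        = pure_tensor A rational_group (a [^]\<^bsub>A\<^esub> m \<otimes>\<^bsub>A\<^esub> inv\<^bsub>A\<^esub> (b [^]\<^bsub>A\<^esub> n)) ?q"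
      using hom_mult[OF left_hom, of ?q] * by simp
    finally show ?case using *
      by (intro bexI[of _ "a [^]\<^bsub>A\<^esub> m \<otimes>\<^bsub>A\<^esub> inv\<^bsub>A\<^esub> (b [^]\<^bsub>A\<^esub> n)"] exI[of _ "n * m"]) auto
  next
    case (3 p)
    obtain a q where p: "p = (a, q)" "a \<in> carrier A" using 3 by (cases p) auto
    obtain k n where kn: "quotient_of q = (k, n)" by (cases "quotient_of q")
    then have "n > 0" "q = of_int k / of_int n" by (auto simp: quotient_of_denom_pos quotient_of_div)
    then have "?c (frag_of p) = pure_tensor A rational_group (a [^]\<^bsub>A\<^esub> k) (1 / of_int n)"
      using p by (simp add: pure_tensor_int_pow_left) (simp add: pure_tensor_def)
    then show ?case using p \<open>n > 0\<close> by blast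
  qed
  then show ?thesis
    using assms that unfolding carrier_tensor_product[OF A.monoid_axioms Q.monoid_axioms] by blast
qed

text \<open>The maps \<open>\<Phi> M : (a, q) \<mapsto> \<lfloor>M q\<rfloor> a\<close> on the free abelian group kill any given tensor relation as soon
  as \<open>M\<close> is divisible enough.\<close>

lemma pure_tensor_eq_one_imp_torsion:
  assumes a: "a \<in> carrier A" and q: "q \<noteq> 0"
    and eq: "pure_tensor A rational_group a q = \<one>\<^bsub>tensor_product A rational_group\<^esub>"
  shows "\<exists>k::int. k \<noteq> 0 \<and> a [^]\<^bsub>A\<^esub> k = \<one>\<^bsub>A\<^esub>"
proof -
  let ?S = "carrier A \<times> carrier rational_group"
  let ?F = "free_Abelian_group ?S"
  interpret F: comm_group ?F by (rule abelian_free_Abelian_group)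
  have "\<exists>h. h \<in> hom ?F A \<and> (\<forall>x\<in>?S. h (frag_of x) = fst x [^]\<^bsub>A\<^esub> \<lfloor>of_int M * snd x\<rfloor>)" for M :: int
    by (rule A.free_Abelian_group_universal[of "\<lambda>x. fst x [^]\<^bsub>A\<^esub> \<lfloor>of_int M * snd x\<rfloor>" ?S]) auto
  then obtain \<Phi> where \<Phi>: "\<And>M. \<Phi> M \<in> hom ?F A"
    and \<Phi>_of: "\<And>M x. x \<in> ?S \<Longrightarrow> \<Phi> M (frag_of x) = fst x [^]\<^bsub>A\<^esub> \<lfloor>of_int M * snd x\<rfloor>" by metis
  interpret \<Phi>: group_hom ?F A "\<Phi> M" for M
    by (rule group_hom.intro[OF F.is_group A.is_group group_hom_axioms.intro[OF \<Phi>]])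
  have \<Phi>_diff: "\<Phi> M (frag_of x - frag_of y - frag_of z)
      = \<Phi> M (frag_of x) \<otimes>\<^bsub>A\<^esub> inv\<^bsub>A\<^esub> \<Phi> M (frag_of y) \<otimes>\<^bsub>A\<^esub> inv\<^bsub>A\<^esub> \<Phi> M (frag_of z)"
    if "x \<in> ?S" "y \<in> ?S" "z \<in> ?S" for M x y z
  proof -
    have "frag_of x - frag_of y - frag_of z
        = frag_of x \<otimes>\<^bsub>?F\<^esub> inv\<^bsub>?F\<^esub> frag_of y \<otimes>\<^bsub>?F\<^esub> inv\<^bsub>?F\<^esub> frag_of z"
      using that by (simp add: keys_frag_of)
    moreover have "frag_of x \<in> carrier ?F" "frag_of y \<in> carrier ?F" "frag_of z \<in> carrier ?F"
      using that by auto
    ultimately show ?thesis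
      by (simp only: \<Phi>.hom_mult \<Phi>.hom_inv F.m_closed F.inv_closed)
  qed
  define S where "S = {frag_of (a \<otimes>\<^bsub>A\<^esub> a', b) - frag_of (a, b) - frag_of (a', b) | a a' b.
         a \<in> carrier A \<and> a' \<in> carrier A \<and> b \<in> carrier rational_group} \<union>
      {frag_of (a, b \<otimes>\<^bsub>rational_group\<^esub> b') - frag_of (a, b) - frag_of (a, b') | a b b'.
         a \<in> carrier A \<and> b \<in> carrier rational_group \<and> b' \<in> carrier rational_group}"
  have gen: "tensor_relations A rational_group = generate ?F S"
    unfolding tensor_relations_def S_def ..
  have S_carrier: "S \<subseteq> carrier ?F"
    using subgroup.subset[OF tensor_relations_subgroup[OF A.monoid_axioms Q.monoid_axioms]] generate.incl[of _ S ?F]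
    unfolding gen by blast
  \<comment> \<open>When \<open>M\<close> is a multiple of the denominator of \<open>r\<close>, the
    floor changes nothing. So the map \<open>\<lfloor>M q\<rfloor>\<close> is additive on any finite
    set of rationals once \<open>M\<close> is divisible enough.\<close>
  have denom: "\<exists>N>0::int. \<forall>M. N dvd M \<longrightarrow> of_int \<lfloor>of_int M * r\<rfloor> = of_int M * r" for r :: rat
  proof -
    obtain k n where kn: "quotient_of r = (k, n)" by (cases "quotient_of r")
    then have n: "n > 0" "r = of_int k / of_int n" by (auto simp: quotient_of_denom_pos quotient_of_div)
    have "of_int \<lfloor>of_int M * r\<rfloor> = of_int M * r" if "n dvd M" for M
    proof -
      obtain j where "M = n * j" using \<open>n dvd M\<close> by (elim dvdE)
      then have "of_int M * r = of_int (j * k)" using n by simp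
      then show ?thesis by (metis floor_of_int)
    qed
    then show ?thesis using n by blast
  qed
  have kill_S: "\<exists>N>0::int. \<forall>M. N dvd M \<longrightarrow> \<Phi> M z = \<one>\<^bsub>A\<^esub>" if "z \<in> S" for z
    using that unfolding S_def
  proof (elim UnE CollectE exE conjE)
    fix a a' b assume z: "z = frag_of (a \<otimes>\<^bsub>A\<^esub> a', b) - frag_of (a, b) - frag_of (a', b)"
      and ab: "a \<in> carrier A" "a' \<in> carrier A"
    \<comment> \<open>Relations in the left variable die for every \<open>M\<close>, since the
      exponent is the same integer in all three terms; only those in the right variable require
      divisibility.\<close>
    have "\<Phi> M z = \<one>\<^bsub>A\<^esub>" for M
    proof -
      let ?x = "a [^]\<^bsub>A\<^esub> \<lfloor>of_int M * b\<rfloor>" and ?y = "a' [^]\<^bsub>A\<^esub> \<lfloor>of_int M * b\<rfloor>"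
      have "\<Phi> M z = ?x \<otimes>\<^bsub>A\<^esub> ?y \<otimes>\<^bsub>A\<^esub> inv\<^bsub>A\<^esub> ?x \<otimes>\<^bsub>A\<^esub> inv\<^bsub>A\<^esub> ?y"
        using ab unfolding z by (subst \<Phi>_diff) (auto simp: \<Phi>_of A.int_pow_distrib)
      also have "\<dots> = (?x \<otimes>\<^bsub>A\<^esub> inv\<^bsub>A\<^esub> ?x) \<otimes>\<^bsub>A\<^esub> (?y \<otimes>\<^bsub>A\<^esub> inv\<^bsub>A\<^esub> ?y)"
        using ab by (simp add: A.m_ac del: A.r_inv)
      finally show ?thesis using ab by simp
    qed
    then show ?thesis by (intro exI[of _ 1]) auto
  next
    fix a b b' assume z: "z = frag_of (a, b \<otimes>\<^bsub>rational_group\<^esub> b') - frag_of (a, b) - frag_of (a, b')"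
      and ab: "a \<in> carrier A"
    obtain N N' where N: "N > 0" "\<And>M. N dvd M \<Longrightarrow> of_int \<lfloor>of_int M * b\<rfloor> = of_int M * b"
      "N' > 0" "\<And>M. N' dvd M \<Longrightarrow> of_int \<lfloor>of_int M * b'\<rfloor> = of_int M * b'"
      using denom[of b] denom[of b'] by blast
    have "\<Phi> M z = \<one>\<^bsub>A\<^esub>" if M: "N * N' dvd M" for M
    proof -
      define k k' where "k = \<lfloor>of_int M * b\<rfloor>" and "k' = \<lfloor>of_int M * b'\<rfloor>"
      have kk: "of_int k = of_int M * b" "of_int k' = of_int M * b'"
        using N M unfolding k_def k'_def by (auto dest: dvd_mult_left dvd_mult_right)
      have "of_int M * (b + b') = of_int (k + k')" by (simp add: kk algebra_simps)
      then have "\<lfloor>of_int M * (b + b')\<rfloor> = k + k'" by (metis floor_of_int)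
      then have "\<Phi> M z = a [^]\<^bsub>A\<^esub> k \<otimes>\<^bsub>A\<^esub> a [^]\<^bsub>A\<^esub> k' \<otimes>\<^bsub>A\<^esub> inv\<^bsub>A\<^esub> (a [^]\<^bsub>A\<^esub> k) \<otimes>\<^bsub>A\<^esub> inv\<^bsub>A\<^esub> (a [^]\<^bsub>A\<^esub> k')"
        using ab unfolding z by (subst \<Phi>_diff) (auto simp: \<Phi>_of A.int_pow_mult k_def k'_def)
      also have "\<dots> = (a [^]\<^bsub>A\<^esub> k \<otimes>\<^bsub>A\<^esub> inv\<^bsub>A\<^esub> (a [^]\<^bsub>A\<^esub> k)) \<otimes>\<^bsub>A\<^esub> (a [^]\<^bsub>A\<^esub> k' \<otimes>\<^bsub>A\<^esub> inv\<^bsub>A\<^esub> (a [^]\<^bsub>A\<^esub> k'))"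
        using ab by (simp add: A.m_ac del: A.r_inv)
      finally show ?thesis using ab by simp
    qed
    then show ?thesis using N by (intro exI[of _ "N * N'"]) auto
  qed
  have kill: "\<exists>N>0::int. \<forall>M. N dvd M \<longrightarrow> \<Phi> M z = \<one>\<^bsub>A\<^esub>" if "z \<in> generate ?F S" for z
    using that
  proof (induction rule: generate.induct)
    case one
    then show ?case using \<Phi>.hom_one by (intro exI[of _ 1]) auto
  next
    case (incl h)
    then show ?case by (rule kill_S)
  next
    case (inv h)
    then have "h \<in> carrier ?F" using S_carrier by blast
    then have "\<Phi> M (inv\<^bsub>?F\<^esub> h) = inv\<^bsub>A\<^esub> \<Phi> M h" for M by (rule \<Phi>.hom_inv)
    then show ?case using kill_S[OF inv] by auto
  next
    case (eng h1 h2)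
    then have c: "h1 \<in> carrier ?F" "h2 \<in> carrier ?F" using F.generate_in_carrier[OF S_carrier] by blast+
    from eng obtain N1 N2 where N: "N1 > 0" "\<And>M. N1 dvd M \<Longrightarrow> \<Phi> M h1 = \<one>\<^bsub>A\<^esub>"
      "N2 > 0" "\<And>M. N2 dvd M \<Longrightarrow> \<Phi> M h2 = \<one>\<^bsub>A\<^esub>" by blast
    have "\<Phi> M (h1 \<otimes>\<^bsub>?F\<^esub> h2) = \<one>\<^bsub>A\<^esub>" if "N1 * N2 dvd M" for M
      using \<Phi>.hom_mult[OF c] N(2)[OF dvd_mult_left[OF that]] N(4)[OF dvd_mult_right[OF that]]
      by (simp del: mult_free_Abelian_group)
    then show ?case using N by (intro exI[of _ "N1 * N2"]) auto
  qed
  have "frag_of (a, q) \<in> tensor_relations A rational_group"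
    using eq F.rcos_self[OF _ tensor_relations_subgroup[OF A.monoid_axioms Q.monoid_axioms], of "frag_of (a, q)"] a
    unfolding pure_tensor_def tensor_product_def by (simp add: keys_frag_of)
  then obtain N where N: "N > 0" "\<And>M. N dvd M \<Longrightarrow> \<Phi> M (frag_of (a, q)) = \<one>\<^bsub>A\<^esub>"
    using kill gen by blast
  obtain N' where N': "N' > 0" "\<And>M. N' dvd M \<Longrightarrow> of_int \<lfloor>of_int M * q\<rfloor> = of_int M * q"
    using denom by blast
  \<comment> \<open>The factor \<open>N\<close> makes the homomorphism kill the relation, and
    \<open>N'\<close> clears the denominator of \<open>q\<close>, so that the exponent is exactly
    \<open>N * N' * q\<close> and hence a nonzero integer.\<close>
  have "\<lfloor>of_int (N * N') * q\<rfloor> \<noteq> 0"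
  proof
    assume "\<lfloor>of_int (N * N') * q\<rfloor> = 0"
    then have "of_int (N * N') * q = 0" using N'(2)[of "N * N'"] by simp
    then show False using N N' q by simp
  qed
  moreover have "a [^]\<^bsub>A\<^esub> \<lfloor>of_int (N * N') * q\<rfloor> = \<one>\<^bsub>A\<^esub>"
    using N(2)[of "N * N'"] \<Phi>_of[of "(a, q)" "N * N'"] a by simp
  ultimately show ?thesis by blast
qed

end

text \<open>This combines flatness of the rationals with divisibility. A pure tensor vanishes only
  if its left entry is torsion; an injective \<open>f\<close> pulls torsion of \<open>f a\<close>
  back to torsion of \<open>a\<close>, and tensoring with the rationals kills torsion. The source is
  divisible and torsion-free, so its image splits off.\<close>

theorem rational_tensor_map_split_injective:
  fixes f :: "'a \<Rightarrow> 'b"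
  assumes A: "comm_group A" and B: "comm_group B" and f: "f \<in> hom A B" and inj: "inj_on f (carrier A)"
  shows "split_injective (tensor_product A rational_group) (tensor_product B rational_group)
    (tensor_map B rational_group f id)"
proof -
  interpret A: comm_group A by (rule A)
  interpret B: comm_group B by (rule B)
  interpret Q: comm_group rational_group by (rule rational_group_comm_group)
  let ?TA = "tensor_product A rational_group" and ?TB = "tensor_product B rational_group"
  let ?h = "tensor_map B rational_group f id"
  have TA: "comm_group ?TA" and TB: "comm_group ?TB"
    by (intro tensor_product_comm_group A.monoid_axioms B.monoid_axioms Q.monoid_axioms)+
  interpret TA: comm_group ?TA by (rule TA)
  interpret TB: comm_group ?TB by (rule TB)
  note mon = A.monoid_axioms Q.monoid_axioms B.monoid_axioms Q.monoid_axioms f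
  have id: "id \<in> hom rational_group rational_group" by (simp add: hom_def)
  have h: "?h \<in> hom ?TA ?TB" by (rule tensor_map_hom[OF mon id])
  have h_pure: "?h (pure_tensor A rational_group a q) = pure_tensor B rational_group (f a) q"
    if "a \<in> carrier A" for a q
    using tensor_map_pure[OF mon id that, of q] by simp
  interpret f: group_hom A B f by (simp add: group_hom_def group_hom_axioms_def A.is_group B.is_group f)
  interpret h: group_hom ?TA ?TB ?h by (simp add: group_hom_def group_hom_axioms_def h TA.is_group TB.is_group)
  \<comment> \<open>An exponent \<open>k\<close> can be traded between the factors: \<open>a\<close>
    tensor \<open>q\<close> is the \<open>k\<close>-th power of \<open>a\<close> tensor
    \<open>q / k\<close>.\<close>
  have torsion: "pure_tensor A rational_group a q = \<one>\<^bsub>?TA\<^esub>"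
    if "a \<in> carrier A" "k \<noteq> (0::int)" "a [^]\<^bsub>A\<^esub> k = \<one>\<^bsub>A\<^esub>" for a k q
  proof -
    have "pure_tensor A rational_group a q = pure_tensor A rational_group (a [^]\<^bsub>A\<^esub> k) (q / of_int k)"
      using that pure_tensor_int_pow_left[OF A that(1), of k "q / of_int k"] by simp
    also have "\<dots> = \<one>\<^bsub>?TA\<^esub>"
      using that hom_one[OF pure_tensor_hom_left[OF A.monoid_axioms Q.monoid_axioms] A.is_group TA.is_group] by simp
    finally show ?thesis .
  qed
  have "x = \<one>\<^bsub>?TA\<^esub>" if x: "x \<in> carrier ?TA" and hx: "?h x = \<one>\<^bsub>?TB\<^esub>" for x
  proof -
    obtain a n where an: "a \<in> carrier A" "n > (0::int)" "x = pure_tensor A rational_group a (1 / of_int n)"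
      using rational_tensor_is_pure[OF A x] by metis
    have "pure_tensor B rational_group (f a) (1 / of_int n) = \<one>\<^bsub>?TB\<^esub>"
      using hx an h_pure by simp
    then obtain k where k: "k \<noteq> (0::int)" "f a [^]\<^bsub>B\<^esub> k = \<one>\<^bsub>B\<^esub>"
      using pure_tensor_eq_one_imp_torsion[OF B, of "f a" "1 / of_int n"] an by auto
    then have "f (a [^]\<^bsub>A\<^esub> k) = f \<one>\<^bsub>A\<^esub>" using an by (simp add: f.hom_int_pow)
    then have "a [^]\<^bsub>A\<^esub> k = \<one>\<^bsub>A\<^esub>" by (rule inj_onD[OF inj]) (use an in auto)
    then show ?thesis using torsion an k by simp
  qed
  then have inj_h: "inj_on ?h (carrier ?TA)"
    using h.inj_iff_trivial_ker by (auto simp: kernel_def)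
  show ?thesis
  proof (rule divisible_torsion_free_imp_split_injective[OF TA TB h inj_h])
    fix x and k :: int assume x: "x \<in> carrier ?TA" and k: "k \<noteq> 0"
    obtain a n where an: "a \<in> carrier A" "n > (0::int)" "x = pure_tensor A rational_group a (1 / of_int n)"
      using rational_tensor_is_pure[OF A x] by metis
    show "\<exists>y\<in>carrier ?TA. y [^]\<^bsub>?TA\<^esub> k = x"
      using an k pure_tensor_closed[OF A.monoid_axioms Q.monoid_axioms, of a "1 / of_int (n * k)"]
      by (intro bexI[of _ "pure_tensor A rational_group a (1 / of_int (n * k))"])
        (simp_all add: pure_tensor_int_pow_right[OF A])
    assume "x [^]\<^bsub>?TA\<^esub> k = \<one>\<^bsub>?TA\<^esub>"
    then have "pure_tensor A rational_group a (of_int k / of_int n) = \<one>\<^bsub>?TA\<^esub>"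
      using an by (simp add: pure_tensor_int_pow_right[OF A])
    then show "x = \<one>\<^bsub>?TA\<^esub>"
      using pure_tensor_eq_one_imp_torsion[OF A an(1), of "of_int k / of_int n"] torsion an k by auto
  qed
qed

section \<open>Combinatorial tools: ultrafilters, matchings, Schroeder--Bernstein and
  elimination\<close>

subsection \<open>Ultrafilters\<close>

text \<open>No base set is mentioned, so that images under \<open>filtermap\<close> are again
  ultrafilters; being concentrated on a set is expressed by a separate \<open>eventually\<close>
  condition.\<close>

definition ultrafilter :: "'a filter \<Rightarrow> bool" where
  "ultrafilter U \<longleftrightarrow> U \<noteq> bot \<and> (\<forall>P. eventually P U \<or> eventually (\<lambda>x. \<not> P x) U)"

lemma inf_principal_eq_bot_iff: "inf F (principal {x. P x}) = bot \<longleftrightarrow> eventually (\<lambda>x. \<not> P x) F"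
  by (simp add: trivial_limit_def eventually_inf_principal)

text \<open>Zorn for the reversed order: the infimum of a chain of proper filters is proper, because
  an event of the infimum is already an event of some member. A minimal proper filter decides every
  predicate, since restricting it to the predicate either gives \<open>bot\<close> or changes
  nothing.\<close>

lemma ultrafilter_exists:
  assumes "F \<noteq> bot"
  obtains U where "U \<le> F" "ultrafilter U"
proof -
  define S where "S = {G. G \<le> F \<and> G \<noteq> bot}"
  have "\<exists>m\<in>S. \<forall>a\<in>S. a \<le> m \<longrightarrow> a = m"
  proof (rule predicate_Zorn)
    show "partial_order_on S (relation_of (\<lambda>x y. y \<le> x) S)"
      by (auto simp: partial_order_on_def preorder_on_def relation_of_def refl_on_def trans_def antisym_def)
    fix C assume C: "C \<in> Chains (relation_of (\<lambda>x y. y \<le> x) S)"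
    then have CS: "C \<subseteq> S" by (rule Chains_relation_of)
    show "\<exists>u\<in>S. \<forall>a\<in>C. u \<le> a"
    proof (cases "C = {}")
      case True
      then show ?thesis using assms unfolding S_def by auto
    next
      case False
      have lin: "G \<le> H \<or> H \<le> G" if "G \<in> C" "H \<in> C" for G H
        using C that unfolding Chains_def relation_of_def by auto
      have "eventually P (Inf C) \<longleftrightarrow> (\<exists>b\<in>C. eventually P b)" for P
        by (rule eventually_Inf_base[OF False]) (use lin in \<open>metis inf.absorb1 inf.absorb2 order_refl\<close>)
      then have "Inf C \<noteq> bot"
        using CS unfolding trivial_limit_def S_def by blast
      moreover have "Inf C \<le> F"
      proof -
        obtain G where "G \<in> C" using False by blast
        moreover have "G \<le> F" using \<open>G \<in> C\<close> CS unfolding S_def by blast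
        ultimately show ?thesis by (rule Inf_lower2)
      qed
      ultimately show ?thesis unfolding S_def by (intro bexI[of _ "Inf C"]) (auto intro: Inf_lower)
    qed
  qed
  then obtain U where U: "U \<in> S" and min: "\<And>G. G \<in> S \<Longrightarrow> G \<le> U \<Longrightarrow> G = U" by blast
  have "eventually P U \<or> eventually (\<lambda>x. \<not> P x) U" for P
  proof (cases "inf U (principal {x. P x}) = bot")
    case True
    then show ?thesis by (simp add: inf_principal_eq_bot_iff)
  next
    case False
    then have "inf U (principal {x. P x}) \<in> S" using U unfolding S_def by (auto intro: le_infI1)
    then have "inf U (principal {x. P x}) = U" by (rule min) simp
    then have "U \<le> principal {x. P x}" by (metis inf.cobounded2)
    then show ?thesis by (simp add: le_principal)
  qed
  then show thesis using that U unfolding S_def ultrafilter_def by blast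
qed

lemma ultrafilter_not_bot: "ultrafilter U \<Longrightarrow> U \<noteq> bot"
  by (simp add: ultrafilter_def)

lemma ultrafilter_eventually_not:
  assumes "ultrafilter U"
  shows "eventually (\<lambda>x. \<not> P x) U \<longleftrightarrow> \<not> eventually P U"
proof
  assume "eventually (\<lambda>x. \<not> P x) U"
  then show "\<not> eventually P U"
    using eventually_conj[of "\<lambda>x. \<not> P x" U P] assms unfolding ultrafilter_def trivial_limit_def by auto
qed (use assms in \<open>auto simp: ultrafilter_def\<close>)

lemma ultrafilter_eventually_disj:
  assumes "ultrafilter U"
  shows "eventually (\<lambda>x. P x \<or> Q x) U \<longleftrightarrow> eventually P U \<or> eventually Q U"
proof -
  have "\<not> eventually (\<lambda>x. P x \<or> Q x) U \<longleftrightarrow> \<not> eventually P U \<and> \<not> eventually Q U"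
    unfolding ultrafilter_eventually_not[OF assms, symmetric] by (simp add: eventually_conj_iff)
  then show ?thesis by blast
qed

text \<open>Turns a bounded number of alternatives, chosen differently at each point, into one
  alternative valid almost everywhere. Matchings, cardinalities of fibres and enumerations are all
  made uniform in this way.\<close>

lemma ultrafilter_eventually_finite_Bex:
  assumes U: "ultrafilter U" and S: "finite S" and ev: "eventually (\<lambda>x. \<exists>s\<in>S. P s x) U"
  shows "\<exists>s\<in>S. eventually (P s) U"
  using S ev
proof (induction S)
  case empty
  then show ?case using U by (simp add: ultrafilter_def)
next
  case (insert a S)
  then have "eventually (\<lambda>x. P a x \<or> (\<exists>s\<in>S. P s x)) U" by simp
  then show ?case using insert by (auto simp: ultrafilter_eventually_disj[OF U])
qed

lemma ultrafilter_filtermap: "ultrafilter U \<Longrightarrow> ultrafilter (filtermap f U)"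
  unfolding ultrafilter_def by (simp add: filtermap_bot_iff eventually_filtermap)

lemma ultrafilter_le_imp_eq:
  assumes U: "ultrafilter U" and "F \<le> U" "F \<noteq> bot"
  shows "F = U"
proof (rule antisym[OF \<open>F \<le> U\<close>])
  show "U \<le> F"
  proof (rule filter_leI)
    fix P assume P: "eventually P F"
    show "eventually P U"
    proof (rule ccontr)
      assume "\<not> eventually P U"
      then have "eventually (\<lambda>x. \<not> P x) F"
        using U \<open>F \<le> U\<close> filter_leD unfolding ultrafilter_def by blast
      then have "eventually (\<lambda>x. False) F" using P by eventually_elim simp
      then show False using \<open>F \<noteq> bot\<close> by (simp add: trivial_limit_def)
    qed
  qed
qed

text \<open>The closure of the range is compact, so the image filter has a cluster point, and an
  ultrafilter converges to each of its cluster points.\<close>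

lemma ultrafilter_bounded_convergent:
  fixes f :: "'a \<Rightarrow> 'b::heine_borel"
  assumes U: "ultrafilter U" and "bounded (range f)"
  obtains l where "(f \<longlongrightarrow> l) U"
proof -
  let ?K = "closure (range f)"
  have "compact ?K" using assms(2) by (simp add: compact_closure)
  moreover have "filtermap f U \<noteq> bot" "eventually (\<lambda>x. x \<in> ?K) (filtermap f U)"
    using U closure_subset[of "range f"]
    by (auto simp: ultrafilter_def filtermap_bot_iff eventually_filtermap subset_iff intro!: always_eventually)
  ultimately obtain x where x: "inf (nhds x) (filtermap f U) \<noteq> bot"
    unfolding compact_filter by blast
  then have "inf (nhds x) (filtermap f U) = filtermap f U"
    by (intro ultrafilter_le_imp_eq ultrafilter_filtermap U) auto
  then have "filtermap f U \<le> nhds x" by (metis inf.cobounded1)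
  then show thesis using that by (simp add: filterlim_def)
qed

subsection \<open>Hall's marriage theorem\<close>

text \<open>Induction with the usual case distinction: either some nonempty proper subfamily has
  exactly as many neighbours as members, and it is matched separately from the rest, or every such
  subfamily has a neighbour to spare, and one element can be matched arbitrarily.\<close>

lemma hall_finite:
  assumes "finite A" and "\<And>a. a \<in> A \<Longrightarrow> finite (N a)"
    and "\<And>F. F \<subseteq> A \<Longrightarrow> card F \<le> card (\<Union>(N ` F))"
  shows "\<exists>f. inj_on f A \<and> (\<forall>a\<in>A. f a \<in> N a)"
  using assms
proof (induction A arbitrary: N rule: finite_psubset_induct)
  case (psubset A)
  note finN = psubset.prems(1) and hall = psubset.prems(2)
  have finU: "finite (\<Union>(N ` F))" if "F \<subseteq> A" for F
    using that finN psubset.hyps by (auto intro: finite_subset)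
  show ?case
  proof (cases "A = {}")
    case True
    then show ?thesis by simp
  next
    case nonempty: False
    show ?thesis
    proof (cases "\<exists>F\<subset>A. F \<noteq> {} \<and> card (\<Union>(N ` F)) = card F")
      case True
      then obtain F where F: "F \<subset> A" "F \<noteq> {}" "card (\<Union>(N ` F)) = card F" by blast
      obtain f where f: "inj_on f F" "\<forall>a\<in>F. f a \<in> N a"
      proof -
        have "\<exists>f. inj_on f F \<and> (\<forall>a\<in>F. f a \<in> N a)"
        proof (rule psubset.IH[OF F(1)])
          show "finite (N a)" if "a \<in> F" for a using that F(1) finN by blast
          show "card G \<le> card (\<Union>(N ` G))" if "G \<subseteq> F" for G using that F(1) by (intro hall) auto
        qed
        then show thesis using that by blast
      qed
      \<comment> \<open>For a set \<open>G\<close> of remaining elements, Hall's condition for the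
        union of \<open>G\<close> and \<open>F\<close> leaves at least \<open>card G\<close>
        neighbours outside those of \<open>F\<close>, as the latter number exactly
        \<open>card F\<close>.\<close>
      let ?N = "\<lambda>a. N a - \<Union>(N ` F)"
      have "\<exists>g. inj_on g (A - F) \<and> (\<forall>a\<in>A - F. g a \<in> ?N a)"
      proof (rule psubset.IH)
        show "A - F \<subset> A" using F by blast
        show "finite (?N a)" if "a \<in> A - F" for a using that finN by simp
        fix G assume G: "G \<subseteq> A - F"
        have "finite F" "finite G" using F G psubset.hyps by (auto intro: finite_subset)
        then have "card G + card F = card (G \<union> F)"
          using G by (subst card_Un_disjoint) auto
        also have "\<dots> \<le> card (\<Union>(N ` (G \<union> F)))" using G F by (intro hall) auto
        also have "\<Union>(N ` (G \<union> F)) = \<Union>(?N ` G) \<union> \<Union>(N ` F)" by auto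
        also have "card \<dots> \<le> card (\<Union>(?N ` G)) + card (\<Union>(N ` F))" by (rule card_Un_le)
        finally show "card G \<le> card (\<Union>(?N ` G))" using F by simp
      qed
      then obtain g where g: "inj_on g (A - F)" "\<forall>a\<in>A - F. g a \<in> ?N a" by blast
      let ?h = "\<lambda>a. if a \<in> F then f a else g a"
      have sep: "f x \<noteq> g y" if "x \<in> F" "y \<in> A" "y \<notin> F" for x y
        using f(2) g(2) that by (metis DiffD2 DiffI UN_I)
      have "inj_on ?h A"
      proof (rule inj_onI)
        fix x y assume xy: "x \<in> A" "y \<in> A" "?h x = ?h y"
        then show "x = y"
          using inj_onD[OF f(1), of x y] inj_onD[OF g(1), of x y] sep[of x y] sep[of y x]
          by (cases "x \<in> F"; cases "y \<in> F") auto
      qed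
      moreover have "\<forall>a\<in>A. ?h a \<in> N a" using f g by auto
      ultimately show ?thesis by blast
    next
      case False
      obtain a where a: "a \<in> A" using nonempty by blast
      have "card {a} \<le> card (\<Union>(N ` {a}))" using a by (intro hall) auto
      then have "N a \<noteq> {}" by auto
      then obtain b where b: "b \<in> N a" by blast
      \<comment> \<open>In this case removing the single neighbour \<open>b\<close> costs every
        nonempty set at most the one neighbour it has in excess.\<close>
      let ?N = "\<lambda>x. N x - {b}"
      have "\<exists>g. inj_on g (A - {a}) \<and> (\<forall>x\<in>A - {a}. g x \<in> ?N x)"
      proof (rule psubset.IH)
        show "A - {a} \<subset> A" using a by blast
        show "finite (?N x)" if "x \<in> A - {a}" for x using that finN by simp
        fix G assume G: "G \<subseteq> A - {a}"
        show "card G \<le> card (\<Union>(?N ` G))"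
        proof (cases "G = {}")
          case True
          then show ?thesis by simp
        next
          case ne: False
          have "G \<subset> A" using G a by blast
          then have "card G < card (\<Union>(N ` G))"
          proof -
            have "card (\<Union>(N ` G)) \<noteq> card G" using False \<open>G \<subset> A\<close> ne by blast
            moreover have "card G \<le> card (\<Union>(N ` G))" using \<open>G \<subset> A\<close> by (intro hall) auto
            ultimately show ?thesis by linarith
          qed
          moreover have "\<Union>(?N ` G) = \<Union>(N ` G) - {b}" by auto
          then have "card (\<Union>(N ` G)) \<le> card (\<Union>(?N ` G)) + 1"
            by (simp add: card_Diff_singleton_if, arith)
          ultimately show ?thesis by linarith
        qed
      qed
      then obtain g where g: "inj_on g (A - {a})" "\<forall>x\<in>A - {a}. g x \<in> ?N x" by blast
      have "inj_on (g(a := b)) A"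
      proof (rule inj_onI)
        fix x y assume xy: "x \<in> A" "y \<in> A" "(g(a := b)) x = (g(a := b)) y"
        then show "x = y"
          using inj_onD[OF g(1), of x y] g(2) by (cases "x = a"; cases "y = a") auto
      qed
      moreover have "\<forall>x\<in>A. (g(a := b)) x \<in> N x" using g b by auto
      ultimately show ?thesis by blast
    qed
  qed
qed

text \<open>The matching is the limit of matchings of the finite subsets of \<open>A\<close> along an ultrafilter refining the
  filter of finite subsets.\<close>

lemma hall_locally_finite:
  assumes fin: "\<And>a. a \<in> A \<Longrightarrow> finite (N a)"
    and hall: "\<And>F. finite F \<Longrightarrow> F \<subseteq> A \<Longrightarrow> card F \<le> card (\<Union>(N ` F))"
  shows "\<exists>f. inj_on f A \<and> (\<forall>a\<in>A. f a \<in> N a)"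
proof -
  have "\<exists>f. inj_on f F \<and> (\<forall>a\<in>F. f a \<in> N a)" if "finite F" "F \<subseteq> A" for F
  proof (rule hall_finite[OF that(1)])
    show "finite (N a)" if "a \<in> F" for a using that \<open>F \<subseteq> A\<close> fin by blast
    show "card G \<le> card (\<Union>(N ` G))" if "G \<subseteq> F" for G
      using that \<open>F \<subseteq> A\<close> \<open>finite F\<close> by (intro hall) (auto intro: finite_subset)
  qed
  then have "\<forall>F\<in>{F. finite F \<and> F \<subseteq> A}. \<exists>f. inj_on f F \<and> (\<forall>a\<in>F. f a \<in> N a)" by blast
  from bchoice[OF this] obtain m
    where m: "\<And>F. finite F \<Longrightarrow> F \<subseteq> A \<Longrightarrow> inj_on (m F) F \<and> (\<forall>a\<in>F. m F a \<in> N a)" by blast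
  obtain U where U: "U \<le> finite_subsets_at_top A" "ultrafilter U"
    by (rule ultrafilter_exists[of "finite_subsets_at_top A"]) (simp add: finite_subsets_at_top_neq_bot)
  have top: "eventually (\<lambda>F. finite F \<and> X \<subseteq> F \<and> F \<subseteq> A) U" if "finite X" "X \<subseteq> A" for X
    using filter_leD[OF U(1), of "\<lambda>F. finite F \<and> X \<subseteq> F \<and> F \<subseteq> A"] that
    unfolding eventually_finite_subsets_at_top by blast
  \<comment> \<open>Finiteness of \<open>N a\<close> is what makes the limit matching defined at
    \<open>a\<close>: the ultrafilter singles out one of finitely many partners.\<close>
  have "\<exists>b\<in>N a. eventually (\<lambda>F. m F a = b) U" if a: "a \<in> A" for a
  proof (rule ultrafilter_eventually_finite_Bex[OF U(2) fin[OF a]])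
    show "eventually (\<lambda>F. \<exists>b\<in>N a. m F a = b) U"
      by (rule eventually_mono[OF top[of "{a}"]]) (use m a in auto)
  qed
  then have "\<forall>a\<in>A. \<exists>b. b \<in> N a \<and> eventually (\<lambda>F. m F a = b) U" by blast
  from bchoice[OF this] obtain f
    where f: "\<And>a. a \<in> A \<Longrightarrow> f a \<in> N a \<and> eventually (\<lambda>F. m F a = f a) U" by blast
  have "inj_on f A"
  proof (rule inj_onI)
    fix a a' assume a: "a \<in> A" "a' \<in> A" "f a = f a'"
    have "eventually (\<lambda>F. finite F \<and> {a, a'} \<subseteq> F \<and> F \<subseteq> A) U" using a by (intro top) auto
    moreover have "eventually (\<lambda>F. m F a = f a) U" "eventually (\<lambda>F. m F a' = f a') U"
      using f[OF a(1)] f[OF a(2)] by blast+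
    ultimately have "eventually (\<lambda>F. a = a') U"
    proof eventually_elim
      case (elim F)
      then show ?case using m[of F] a inj_onD[of "m F" F a a'] by auto
    qed
    then show "a = a'" using U(2) by (auto simp: ultrafilter_def)
  qed
  then show ?thesis using f by blast
qed

subsection \<open>The bijection in the Schroeder--Bernstein theorem\<close>

text \<open>The additional clause is the point: every pair matched by \<open>h\<close> is matched by
  \<open>f\<close> or, backwards, by \<open>g\<close>. A displacement bound for \<open>f\<close> and
  \<open>g\<close> is therefore inherited by \<open>h\<close>.\<close>

lemma Schroeder_Bernstein_graph:
  assumes f: "inj_on f A" "f ` A \<subseteq> B" and g: "inj_on g B" "g ` B \<subseteq> A"
  shows "\<exists>h. bij_betw h A B \<and> (\<forall>a\<in>A. h a = f a \<or> g (h a) = a)"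
proof -
  \<comment> \<open>On this least fixed point \<open>h\<close> follows \<open>f\<close>; its
    complement in \<open>A\<close> consists precisely of the \<open>g\<close>-images of points of
    \<open>B\<close> not reached from it, and there \<open>h\<close> inverts
    \<open>g\<close>.\<close>
  define X where "X = lfp (\<lambda>X. A - (g ` (B - (f ` X))))"
  have X: "X = A - (g ` (B - (f ` X)))"
    unfolding X_def by (rule lfp_unfold) (blast intro: monoI)
  let ?h = "\<lambda>z. if z \<in> X then f z else the_inv_into B g z"
  have XA: "X \<subseteq> A" and compl: "A - X = g ` (B - f ` X)" using X g(2) by blast+
  have inv: "the_inv_into B g a \<in> B - f ` X \<and> g (the_inv_into B g a) = a" if a: "a \<in> A - X" for a
  proof -
    obtain b where b: "b \<in> B - f ` X" "a = g b" using a compl by blast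
    then show ?thesis using the_inv_into_f_f[OF g(1)] by auto
  qed
  have "inj_on ?h A"
  proof (rule inj_onI)
    fix x y assume xy: "x \<in> A" "y \<in> A" "?h x = ?h y"
    show "x = y"
    proof (cases "x \<in> X"; cases "y \<in> X")
      assume "x \<in> X" "y \<in> X" then show ?thesis using xy f(1) by (auto dest: inj_onD)
    next
      assume X: "x \<in> X" "y \<notin> X"
      then have "f x = the_inv_into B g y" using xy by simp
      then show ?thesis using X xy(1,2) inv[of y] by (metis DiffD2 DiffI imageI)
    next
      assume X: "x \<notin> X" "y \<in> X"
      then have "f y = the_inv_into B g x" using xy by simp
      then show ?thesis using X xy(1,2) inv[of x] by (metis DiffD2 DiffI imageI)
    next
      assume "x \<notin> X" "y \<notin> X" then show ?thesis using xy inv[of x] inv[of y] by (metis DiffI)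
    qed
  qed
  moreover have "?h ` A = B"
  proof
    show "?h ` A \<subseteq> B" using f(2) inv by auto
    show "B \<subseteq> ?h ` A"
    proof
      fix b assume b: "b \<in> B"
      show "b \<in> ?h ` A"
      proof (cases "b \<in> f ` X")
        case True
        then obtain x where x: "x \<in> X" "b = f x" by blast
        then show ?thesis using XA by (intro image_eqI[of _ _ x]) auto
      next
        case False
        then have "g b \<in> A - X" using compl b by blast
        moreover have "the_inv_into B g (g b) = b" using the_inv_into_f_f[OF g(1) b] .
        ultimately show ?thesis by (intro image_eqI[of _ _ "g b"]) auto
      qed
    qed
  qed
  ultimately have "bij_betw ?h A B" by (simp add: bij_betw_def)
  moreover have "\<forall>a\<in>A. ?h a = f a \<or> g (?h a) = a" using inv by auto
  ultimately show ?thesis by blast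
qed

subsection \<open>Homogeneous linear systems\<close>

text \<open>Gaussian elimination, one equation at a time. This is the dimension count behind Hall's
  condition: the unknowns will be the points of a finite set and the equations its
  neighbours.\<close>

lemma underdetermined_homogeneous_system:
  fixes M :: "'n \<Rightarrow> 'f \<Rightarrow> 'k::field"
  assumes "finite R" "finite F" "card R < card F"
  shows "\<exists>c. (\<exists>f\<in>F. c f \<noteq> 0) \<and> (\<forall>n\<in>R. (\<Sum>f\<in>F. M n f * c f) = 0)"
  using assms
proof (induction R arbitrary: F M)
  case empty
  then have "F \<noteq> {}" by auto
  then show ?case by (intro exI[of _ "\<lambda>_. 1"]) auto
next
  case (insert n R)
  show ?case
  proof (cases "\<forall>f\<in>F. M n f = 0")
    case True
    obtain c where "\<exists>f\<in>F. c f \<noteq> 0" "\<forall>n\<in>R. (\<Sum>f\<in>F. M n f * c f) = 0"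
      using insert.IH[of F M] insert.prems insert.hyps by auto
    then show ?thesis using True by (intro exI[of _ c]) auto
  next
    case False
    then obtain f0 where f0: "f0 \<in> F" "M n f0 \<noteq> 0" by blast
    let ?F = "F - {f0}"
    have "card R < card ?F" using insert.prems insert.hyps f0 by simp
    then obtain c where c: "\<exists>f\<in>?F. c f \<noteq> 0"
      "\<forall>m\<in>R. (\<Sum>f\<in>?F. (M m f - M m f0 * M n f / M n f0) * c f) = 0"
      using insert.IH[of ?F "\<lambda>m f. M m f - M m f0 * M n f / M n f0"] insert.prems insert.hyps by blast
    \<comment> \<open>Back substitution: the pivot unknown \<open>f0\<close> receives the value
      forced by the equation \<open>n\<close>.\<close>
    define c' where "c' = c(f0 := - (\<Sum>f\<in>?F. M n f * c f) / M n f0)"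
    have c'_sum: "(\<Sum>f\<in>F. M m f * c' f) = M m f0 * c' f0 + (\<Sum>f\<in>?F. M m f * c f)" for m
    proof -
      have "(\<Sum>f\<in>F. M m f * c' f) = M m f0 * c' f0 + (\<Sum>f\<in>?F. M m f * c' f)"
        using f0 insert.prems by (intro sum.remove) auto
      also have "(\<Sum>f\<in>?F. M m f * c' f) = (\<Sum>f\<in>?F. M m f * c f)"
        by (intro sum.cong) (auto simp: c'_def)
      finally show ?thesis .
    qed
    have c'_f0: "c' f0 = - (\<Sum>f\<in>?F. M n f * c f) / M n f0" by (simp add: c'_def)
    have "(\<Sum>f\<in>F. M n f * c' f) = 0" unfolding c'_sum c'_f0 using f0 by simp
    moreover have "(\<Sum>f\<in>F. M m f * c' f) = 0" if "m \<in> R" for m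
    proof -
      have "0 = (\<Sum>f\<in>?F. M m f * c f - M m f0 / M n f0 * (M n f * c f))"
        using c(2) that by (simp add: algebra_simps)
      also have "\<dots> = (\<Sum>f\<in>?F. M m f * c f) - M m f0 / M n f0 * (\<Sum>f\<in>?F. M n f * c f)"
        by (simp add: sum_subtractf sum_distrib_left)
      also have "\<dots> = (\<Sum>f\<in>F. M m f * c' f)" unfolding c'_sum c'_f0 by simp
      finally show ?thesis by simp
    qed
    moreover have "\<exists>f\<in>F. c' f \<noteq> 0"
    proof -
      obtain f where "f \<in> ?F" "c f \<noteq> 0" using c(1) by blast
      then show ?thesis by (intro bexI[of _ f]) (auto simp: c'_def)
    qed
    ultimately show ?thesis by (intro exI[of _ c']) auto
  qed
qed

section \<open>Completeness of the Hilbert space, adjoints and operators with banded kernels\<close>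

subsection \<open>Norm, inner product and completeness\<close>

lemma coord_eqI: "(\<And>i. coord x i = coord y i) \<Longrightarrow> x = y"
  by (metis coord_inject ext)

lemma norm_ell2_square: "(norm x)\<^sup>2 = (\<Sum>\<^sub>\<infinity>i. (cmod (coord x i))\<^sup>2)"
  by (simp add: norm_ell2_def infsum_nonneg)

lemma sum_coord_square_le: "finite F \<Longrightarrow> (\<Sum>i\<in>F. (cmod (coord x i))\<^sup>2) \<le> (norm x)\<^sup>2"
  unfolding norm_ell2_square using summable_coord[of x] by (intro finite_sum_le_infsum) auto

lemma norm_ell2_leI:
  assumes "0 \<le> c" "\<And>F. finite F \<Longrightarrow> (\<Sum>i\<in>F. (cmod (coord x i))\<^sup>2) \<le> c\<^sup>2"
  shows "norm x \<le> c"
proof (rule power2_le_imp_le[OF _ assms(1)])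
  show "(norm x)\<^sup>2 \<le> c\<^sup>2"
    unfolding norm_ell2_square by (rule infsum_le_finite_sums[OF summable_coord]) (use assms in auto)
qed

lemma square_summableI:
  assumes "\<And>F. finite F \<Longrightarrow> (\<Sum>i\<in>F. (cmod (f i))\<^sup>2) \<le> c"
  shows "(\<lambda>i. (cmod (f i))\<^sup>2) summable_on UNIV"
  by (rule nonneg_bdd_above_summable_on) (use assms in \<open>auto intro!: bdd_aboveI[where M = c]\<close>)

lemma cmod_coord_le_norm: "cmod (coord x i) \<le> norm x"
  using sum_coord_square_le[of "{i}" x] by (auto intro: power2_le_imp_le)

lemma sum_cmod_coord_mult_le:
  assumes "finite F"
  shows "(\<Sum>i\<in>F. cmod (coord x i) * cmod (coord y i)) \<le> norm x * norm y"
proof -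
  have L2: "L2_set (\<lambda>i. cmod (coord z i)) F \<le> norm z" for z :: "'a ell2"
    unfolding L2_set_def using sum_coord_square_le[OF assms, of z] by (intro real_le_lsqrt) auto
  have "(\<Sum>i\<in>F. \<bar>cmod (coord x i)\<bar> * \<bar>cmod (coord y i)\<bar>)
      \<le> L2_set (\<lambda>i. cmod (coord x i)) F * L2_set (\<lambda>i. cmod (coord y i)) F"
    by (rule L2_set_mult_ineq)
  also have "\<dots> \<le> norm x * norm y" by (intro mult_mono L2) auto
  finally show ?thesis by simp
qed

lemma cinner_abs_summable: "(\<lambda>i. cmod (cnj (coord x i) * coord y i)) summable_on UNIV"
  unfolding abs_summable_iff_bdd_above
  by (rule bdd_aboveI[where M = "norm x * norm y"]) (auto simp: norm_mult sum_cmod_coord_mult_le)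

lemma cinner_summable: "(\<lambda>i. cnj (coord x i) * coord y i) summable_on UNIV"
  by (rule abs_summable_summable[OF cinner_abs_summable])

lemma cinner_cauchy_schwarz: "cmod (cinner x y) \<le> norm x * norm y"
proof -
  have "cmod (cinner x y) \<le> (\<Sum>\<^sub>\<infinity>i. cmod (cnj (coord x i) * coord y i))"
    unfolding cinner_def by (rule norm_infsum_bound[OF cinner_abs_summable])
  also have "\<dots> \<le> norm x * norm y"
    by (rule infsum_le_finite_sums[OF cinner_abs_summable]) (simp add: norm_mult sum_cmod_coord_mult_le)
  finally show ?thesis .
qed

lemma cinner_commute: "cnj (cinner x y) = cinner y x"
  unfolding cinner_def infsum_cnj[symmetric] by (simp add: mult.commute)

lemma cinner_add_right: "cinner x (y + z) = cinner x y + cinner x z"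
  unfolding cinner_def plus_ell2.rep_eq distrib_left by (intro infsum_add cinner_summable)

lemma cinner_add_left: "cinner (x + y) z = cinner x z + cinner y z"
  by (metis cinner_add_right cinner_commute complex_cnj_add)

lemma cinner_zero [simp]: "cinner x 0 = 0" "cinner 0 x = 0"
  by (simp_all add: cinner_def zero_ell2.rep_eq)

lemma cinner_minus_right: "cinner x (- y) = - cinner x y"
  unfolding cinner_def uminus_ell2.rep_eq by (simp add: infsum_uminus)

lemma cinner_diff_right: "cinner x (y - z) = cinner x y - cinner x z"
  using cinner_add_right[of x y "- z"] by (simp add: cinner_minus_right)

lemma cinner_diff_left: "cinner (x - y) z = cinner x z - cinner y z"
  by (metis cinner_diff_right cinner_commute complex_cnj_diff)

lemma cinner_self: "cinner x x = of_real ((norm x)\<^sup>2)"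
proof -
  have "cinner x x = (\<Sum>\<^sub>\<infinity>i. complex_of_real ((cmod (coord x i))\<^sup>2))"
    unfolding cinner_def by (intro infsum_cong) (metis complex_norm_square mult.commute of_real_power)
  also have "\<dots> = of_real (\<Sum>\<^sub>\<infinity>i. (cmod (coord x i))\<^sup>2)"
    using has_sum_infsum[OF summable_coord[of x]]
    by (intro infsumI) (simp only: has_sum_of_real_iff)
  finally show ?thesis by (simp add: norm_ell2_square)
qed

lemma cinner_eqI_left: "(\<And>x. cinner y x = cinner z x) \<Longrightarrow> y = z"
  using cinner_self[of "y - z"] by (simp add: cinner_diff_left)

text \<open>Completeness carries over to the bounded operators, where it supplies the limits of
  adjoints needed for the norm closure.\<close>

instance ell2 :: (type) banach
proof
  fix X :: "nat \<Rightarrow> 'a ell2" assume X: "Cauchy X"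
  have "Cauchy (\<lambda>n. coord (X n) i)" for i
  proof (rule CauchyI)
    fix e :: real assume "0 < e"
    then obtain M where M: "\<And>m n. m \<ge> M \<Longrightarrow> n \<ge> M \<Longrightarrow> norm (X m - X n) < e"
      using CauchyD[OF X] by blast
    then show "\<exists>M. \<forall>m\<ge>M. \<forall>n\<ge>M. norm (coord (X m) i - coord (X n) i) < e"
      using cmod_coord_le_norm[of "X _ - X _" i] by (metis minus_ell2.rep_eq order_le_less_trans)
  qed
  then have "\<exists>l. (\<lambda>n. coord (X n) i) \<longlonglongrightarrow> l" for i
    by (simp add: Cauchy_convergent_iff convergent_def)
  then obtain f where f: "\<And>i. (\<lambda>n. coord (X n) i) \<longlonglongrightarrow> f i" by metis
  \<comment> \<open>The Cauchy estimate is used on finite sets of coordinates only, where letting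
    \<open>m\<close> tend to infinity is harmless. Uniformity in \<open>F\<close> then gives both
    summability of the limit and convergence in norm.\<close>
  have bound: "\<exists>M. \<forall>n\<ge>M. \<forall>F. finite F \<longrightarrow> (\<Sum>i\<in>F. (cmod (coord (X n) i - f i))\<^sup>2) \<le> e\<^sup>2"
    if e: "0 < e" for e
  proof -
    obtain M where M: "\<And>m n. m \<ge> M \<Longrightarrow> n \<ge> M \<Longrightarrow> norm (X m - X n) < e"
      using CauchyD[OF X e] by blast
    have "(\<Sum>i\<in>F. (cmod (coord (X n) i - f i))\<^sup>2) \<le> e\<^sup>2" if "n \<ge> M" "finite F" for n F
    proof (rule LIMSEQ_le_const2)
      show "(\<lambda>m. \<Sum>i\<in>F. (cmod (coord (X n) i - coord (X m) i))\<^sup>2)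
          \<longlonglongrightarrow> (\<Sum>i\<in>F. (cmod (coord (X n) i - f i))\<^sup>2)"
        by (intro tendsto_intros f)
      show "\<exists>N. \<forall>m\<ge>N. (\<Sum>i\<in>F. (cmod (coord (X n) i - coord (X m) i))\<^sup>2) \<le> e\<^sup>2"
      proof (intro exI[of _ M] allI impI)
        fix m assume "m \<ge> M"
        have "(\<Sum>i\<in>F. (cmod (coord (X n - X m) i))\<^sup>2) \<le> (norm (X n - X m))\<^sup>2"
          by (rule sum_coord_square_le) fact
        also have "\<dots> \<le> e\<^sup>2" using M[OF that(1) \<open>m \<ge> M\<close>] by (intro power_mono) auto
        finally show "(\<Sum>i\<in>F. (cmod (coord (X n) i - coord (X m) i))\<^sup>2) \<le> e\<^sup>2"
          by (simp add: minus_ell2.rep_eq)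
      qed
    qed
    then show ?thesis by blast
  qed
  obtain M where M: "\<And>F. finite F \<Longrightarrow> (\<Sum>i\<in>F. (cmod (coord (X M) i - f i))\<^sup>2) \<le> 1"
    using bound[of 1] by auto
  have D: "(\<lambda>i. (cmod (coord (X M) i - f i))\<^sup>2) summable_on UNIV"
    by (rule square_summableI) (rule M)
  have "(\<lambda>i. (cmod (coord (X M) i + - (coord (X M) i - f i)))\<^sup>2) summable_on UNIV"
    by (rule square_summable_add[OF summable_coord]) (use D in \<open>simp add: norm_minus_commute\<close>)
  then have "(\<lambda>i. (cmod (f i))\<^sup>2) summable_on UNIV" by simp
  then have coord_f: "coord (Abs_ell2 f) = f" by (intro Abs_ell2_inverse) simp
  have "X \<longlonglongrightarrow> Abs_ell2 f"
  proof (rule LIMSEQ_I)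
    fix e :: real assume "0 < e"
    then obtain M where M: "\<And>n F. n \<ge> M \<Longrightarrow> finite F \<Longrightarrow> (\<Sum>i\<in>F. (cmod (coord (X n) i - f i))\<^sup>2) \<le> (e/2)\<^sup>2"
      using bound[of "e/2"] by (auto simp del: power_divide)
    have "norm (X n - Abs_ell2 f) \<le> e/2" if "n \<ge> M" for n
      by (rule norm_ell2_leI) (use M[OF that] \<open>0 < e\<close> in \<open>simp_all add: minus_ell2.rep_eq coord_f del: power_divide\<close>)
    then show "\<exists>M. \<forall>n\<ge>M. norm (X n - Abs_ell2 f) < e" using \<open>0 < e\<close> by (intro exI[of _ M]) fastforce
  qed
  then show "convergent X" by (auto simp: convergent_def)
qed

subsection \<open>Adjoints\<close>

text \<open>A relation is used because \<open>adjoint_op\<close> is a definite description, and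
  operators are merely real-linear: it says nothing until some adjoint has been exhibited.
  Uniqueness is immediate from the inner product.\<close>

definition is_adjoint :: "'i operator \<Rightarrow> 'i operator \<Rightarrow> bool" where
  "is_adjoint S T \<longleftrightarrow> (\<forall>x y. cinner (S x) y = cinner x (T y))"

lemma is_adjoint_unique: "is_adjoint S T \<Longrightarrow> is_adjoint S' T \<Longrightarrow> S = S'"
  unfolding is_adjoint_def by (intro blinfun_eqI cinner_eqI_left) simp

lemma is_adjoint_sym: "is_adjoint S T \<Longrightarrow> is_adjoint T S"
  unfolding is_adjoint_def
proof (intro allI)
  fix x y assume adj: "\<forall>x y. cinner (S x) y = cinner x (T y)"
  have "cinner (T x) y = cnj (cinner y (T x))" by (rule cinner_commute[symmetric])
  also have "cinner y (T x) = cinner (S y) x" using adj by simp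
  also have "cnj (cinner (S y) x) = cinner x (S y)" by (rule cinner_commute)
  finally show "cinner (T x) y = cinner x (S y)" .
qed

lemma adjoint_op_eq: "is_adjoint S T \<Longrightarrow> adjoint_op T = S"
  unfolding adjoint_op_def is_adjoint_def[symmetric] by (rule the_equality) (blast intro: is_adjoint_unique)+

lemma is_adjoint_zero: "is_adjoint 0 0"
  by (simp add: is_adjoint_def)

lemma is_adjoint_add: "is_adjoint S T \<Longrightarrow> is_adjoint S' T' \<Longrightarrow> is_adjoint (S + S') (T + T')"
  by (simp add: is_adjoint_def plus_blinfun.rep_eq cinner_add_left cinner_add_right)

lemma is_adjoint_diff: "is_adjoint S T \<Longrightarrow> is_adjoint S' T' \<Longrightarrow> is_adjoint (S - S') (T - T')"
  by (simp add: is_adjoint_def minus_blinfun.rep_eq cinner_diff_left cinner_diff_right)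

lemma is_adjoint_compose: "is_adjoint S T \<Longrightarrow> is_adjoint S' T' \<Longrightarrow> is_adjoint (S' o\<^sub>L S) (T o\<^sub>L T')"
  by (simp add: is_adjoint_def)

text \<open>The square of the norm of \<open>S x\<close> equals the inner product of
  \<open>x\<close> with \<open>T (S x)\<close>; Cauchy--Schwarz and one cancellation finish. By
  symmetry the adjoint preserves norms.\<close>

lemma is_adjoint_norm_le:
  assumes "is_adjoint S T" shows "norm S \<le> norm T"
proof (rule norm_blinfun_bound)
  fix x
  have "(norm (S x))\<^sup>2 = cmod (cinner (S x) (S x))" unfolding cinner_self norm_of_real by simp
  also have "\<dots> = cmod (cinner x (T (S x)))" using assms unfolding is_adjoint_def by simp
  also have "\<dots> \<le> norm x * norm (T (S x))" by (rule cinner_cauchy_schwarz)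
  also have "\<dots> \<le> norm x * (norm T * norm (S x))" by (intro mult_left_mono norm_blinfun) auto
  finally have "norm (S x) * norm (S x) \<le> (norm T * norm x) * norm (S x)"
    by (simp add: power2_eq_square mult.assoc mult.left_commute)
  then show "norm (S x) \<le> norm T * norm x"
    by (cases "norm (S x) = 0") (auto dest: mult_right_le_imp_le)
qed simp

lemma is_adjoint_norm_eq: "is_adjoint S T \<Longrightarrow> norm S = norm T"
  by (rule antisym[OF is_adjoint_norm_le is_adjoint_norm_le[OF is_adjoint_sym]])

lemma is_adjoint_tendsto:
  assumes "\<And>n. is_adjoint (S n) (T n)" "S \<longlonglongrightarrow> S'" "T \<longlonglongrightarrow> T'"
  shows "is_adjoint S' T'"
  unfolding is_adjoint_def
proof (intro allI)
  fix x y
  have lim: "(\<lambda>n. cinner (R n) z) \<longlonglongrightarrow> cinner r z" if "R \<longlonglongrightarrow> r" for R :: "nat \<Rightarrow> 'a ell2" and r z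
  proof (rule LIM_zero_cancel, rule Lim_null_comparison)
    show "\<forall>\<^sub>F n in sequentially. norm (cinner (R n) z - cinner r z) \<le> norm (R n - r) * norm z"
      unfolding cinner_diff_left[symmetric] by (intro always_eventually allI cinner_cauchy_schwarz)
    show "(\<lambda>n. norm (R n - r) * norm z) \<longlonglongrightarrow> 0"
      using that by (intro tendsto_mult_left_zero tendsto_norm_zero) (rule LIM_zero)
  qed
  have "(\<lambda>n. cinner (S n x) y) \<longlonglongrightarrow> cinner (S' x) y"
    by (intro lim blinfun.tendsto assms tendsto_const)
  moreover have "(\<lambda>n. cnj (cinner (T n y) x)) \<longlonglongrightarrow> cnj (cinner (T' y) x)"
    by (intro tendsto_cnj lim blinfun.tendsto assms tendsto_const)
  then have "(\<lambda>n. cinner (S n x) y) \<longlonglongrightarrow> cinner x (T' y)"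
    using assms(1) unfolding is_adjoint_def by (simp add: cinner_commute)
  ultimately show "cinner (S' x) y = cinner x (T' y)" by (rule LIMSEQ_unique)
qed

text \<open>Taking adjoints preserves norms of differences, so adjoints of an approximating sequence
  form a Cauchy sequence; its limit is adjoint to the limit.\<close>

lemma is_adjoint_closure:
  assumes A: "\<And>T. T \<in> A \<Longrightarrow> \<exists>S\<in>A. is_adjoint S T" and T: "T \<in> closure A"
  shows "\<exists>S\<in>closure A. is_adjoint S T"
proof -
  obtain X where X: "\<And>n. X n \<in> A" "X \<longlonglongrightarrow> T" using T unfolding closure_sequential by blast
  then have "\<forall>n. \<exists>S. S \<in> A \<and> is_adjoint S (X n)" using A by blast
  from choice[OF this] obtain S where S: "\<And>n. S n \<in> A" "\<And>n. is_adjoint (S n) (X n)" by blast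
  have "Cauchy S"
  proof (rule CauchyI)
    fix e :: real assume "0 < e"
    then obtain M where M: "\<forall>m\<ge>M. \<forall>n\<ge>M. norm (X m - X n) < e"
      using CauchyD[OF LIMSEQ_imp_Cauchy[OF X(2)]] by blast
    have "norm (S m - S n) = norm (X m - X n)" for m n
      by (intro is_adjoint_norm_eq is_adjoint_diff S)
    then show "\<exists>M. \<forall>m\<ge>M. \<forall>n\<ge>M. norm (S m - S n) < e" using M by auto
  qed
  then obtain S' where S': "S \<longlonglongrightarrow> S'" by (auto simp: Cauchy_convergent_iff convergent_def)
  then have "S' \<in> closure A" unfolding closure_sequential using S(1) by blast
  then show ?thesis using is_adjoint_tendsto[OF S(2) S' X(2)] by blast
qed

subsection \<open>Operators given by kernels of bounded valency\<close>

text \<open>The abstract form of finite propagation over a uniformly locally finite space, for an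
  arbitrary index set so that it can be applied to the set of arrows.\<close>

definition banded :: "('i \<Rightarrow> 'i \<Rightarrow> complex) \<Rightarrow> bool" where
  "banded k \<longleftrightarrow> (\<exists>N. (\<forall>i. finite {j. k i j \<noteq> 0} \<and> card {j. k i j \<noteq> 0} \<le> N) \<and>
                  (\<forall>j. finite {i. k i j \<noteq> 0} \<and> card {i. k i j \<noteq> 0} \<le> N)) \<and>
              (\<exists>M. \<forall>i j. cmod (k i j) \<le> M)"

lemma sum_pairs_fst_le:
  fixes g :: "'i \<Rightarrow> real"
  assumes "finite P" "\<And>i. card {j. (i, j) \<in> P} \<le> N" "\<And>i. 0 \<le> g i"
  shows "(\<Sum>(i, j)\<in>P. g i) \<le> real N * (\<Sum>i\<in>fst ` P. g i)"
proof -
  have fin: "finite {j. (i, j) \<in> P}" for i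
    by (rule finite_subset[of _ "snd ` P"]) (use assms(1) in force)+
  have P: "P = (SIGMA i:fst ` P. {j. (i, j) \<in> P})" by force
  have "(\<Sum>(i, j)\<in>P. g i) = (\<Sum>i\<in>fst ` P. \<Sum>j\<in>{j. (i, j) \<in> P}. g i)"
    by (subst P, subst sum.Sigma) (use assms fin in auto)
  also have "\<dots> = (\<Sum>i\<in>fst ` P. real (card {j. (i, j) \<in> P}) * g i)" by simp
  also have "\<dots> \<le> (\<Sum>i\<in>fst ` P. real N * g i)"
    using assms by (intro sum_mono mult_right_mono) auto
  finally show ?thesis by (simp add: sum_distrib_left)
qed

lemma sum_pairs_snd_le:
  fixes g :: "'j \<Rightarrow> real"
  assumes "finite P" "\<And>j. card {i. (i, j) \<in> P} \<le> N" "\<And>j. 0 \<le> g j"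
  shows "(\<Sum>(i, j)\<in>P. g j) \<le> real N * (\<Sum>j\<in>snd ` P. g j)"
proof -
  let ?Q = "prod.swap ` P"
  have "(\<Sum>(i, j)\<in>P. g j) = (\<Sum>(j, i)\<in>?Q. g j)"
    by (subst sum.reindex) (auto simp: case_prod_unfold)
  also have "\<dots> \<le> real N * (\<Sum>j\<in>fst ` ?Q. g j)"
    using assms by (intro sum_pairs_fst_le) auto
  finally show ?thesis by (simp add: image_comp)
qed

text \<open>Schur-type estimate: Cauchy--Schwarz in each row costs a factor \<open>N\<close>, and
  each coordinate of the vector is used by at most \<open>N\<close> rows. The norm is thus at most
  \<open>N * M\<close>.\<close>

lemma kernel_op_exists:
  assumes "banded k"
  shows "\<exists>T :: 'i operator. \<forall>\<xi> i. coord (T \<xi>) i = (\<Sum>j | k i j \<noteq> 0. k i j * coord \<xi> j)"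
proof -
  from assms obtain N M where fin: "\<And>i. finite {j. k i j \<noteq> 0}"
    and row: "\<And>i. card {j. k i j \<noteq> 0} \<le> N" and col: "\<And>j. finite {i. k i j \<noteq> 0}" "\<And>j. card {i. k i j \<noteq> 0} \<le> N"
    and M: "\<And>i j. cmod (k i j) \<le> M" unfolding banded_def by metis
  have "M \<ge> 0" using M[of undefined undefined] norm_ge_zero order_trans by blast
  have row_bound: "(cmod (\<Sum>j | k i j \<noteq> 0. k i j * coord \<xi> j))\<^sup>2
      \<le> real N * M\<^sup>2 * (\<Sum>j | k i j \<noteq> 0. (cmod (coord \<xi> j))\<^sup>2)" for i \<xi>
  proof -
    have "(cmod (\<Sum>j | k i j \<noteq> 0. k i j * coord \<xi> j))\<^sup>2 \<le> (\<Sum>j | k i j \<noteq> 0. cmod (k i j * coord \<xi> j))\<^sup>2"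
      by (intro power_mono norm_sum) auto
    also have "\<dots> \<le> real (card {j. k i j \<noteq> 0}) * (\<Sum>j | k i j \<noteq> 0. (cmod (k i j * coord \<xi> j))\<^sup>2)"
      using sum_squared_le_sum_of_squares[of "\<lambda>j. cmod (k i j * coord \<xi> j)" "{j. k i j \<noteq> 0}"]
      by (simp add: mult.commute)
    also have "\<dots> \<le> real N * (\<Sum>j | k i j \<noteq> 0. M\<^sup>2 * (cmod (coord \<xi> j))\<^sup>2)"
      using row[of i] M \<open>M \<ge> 0\<close>
      by (intro mult_mono sum_mono) (auto simp: norm_mult power_mult_distrib intro!: mult_right_mono power_mono sum_nonneg)
    finally show ?thesis by (simp add: sum_distrib_left mult.assoc)
  qed
  have bound: "(\<Sum>i\<in>F. (cmod (\<Sum>j | k i j \<noteq> 0. k i j * coord \<xi> j))\<^sup>2) \<le> (real N * M * norm \<xi>)\<^sup>2"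
    if F: "finite F" for F \<xi>
  proof -
    let ?P = "SIGMA i:F. {j. k i j \<noteq> 0}"
    have P: "finite ?P" using F fin by auto
    have "(\<Sum>i\<in>F. (cmod (\<Sum>j | k i j \<noteq> 0. k i j * coord \<xi> j))\<^sup>2)
        \<le> (\<Sum>i\<in>F. real N * M\<^sup>2 * (\<Sum>j | k i j \<noteq> 0. (cmod (coord \<xi> j))\<^sup>2))"
      by (intro sum_mono row_bound)
    also have "\<dots> = real N * M\<^sup>2 * (\<Sum>(i, j)\<in>?P. (cmod (coord \<xi> j))\<^sup>2)"
      using F fin by (simp add: sum.Sigma sum_distrib_left case_prod_unfold)
    finally have 1: "(\<Sum>i\<in>F. (cmod (\<Sum>j | k i j \<noteq> 0. k i j * coord \<xi> j))\<^sup>2)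
        \<le> real N * M\<^sup>2 * (\<Sum>(i, j)\<in>?P. (cmod (coord \<xi> j))\<^sup>2)" .
    have "(\<Sum>(i, j)\<in>?P. (cmod (coord \<xi> j))\<^sup>2) \<le> real N * (\<Sum>j\<in>snd ` ?P. (cmod (coord \<xi> j))\<^sup>2)"
    proof (rule sum_pairs_snd_le[OF P])
      show "card {i. (i, j) \<in> ?P} \<le> N" for j
        by (rule order_trans[OF card_mono[OF col(1)[of j]] col(2)[of j]]) auto
    qed simp
    also have "\<dots> \<le> real N * (norm \<xi>)\<^sup>2" using P by (intro mult_left_mono sum_coord_square_le) auto
    finally have "real N * M\<^sup>2 * (\<Sum>(i, j)\<in>?P. (cmod (coord \<xi> j))\<^sup>2) \<le> real N * M\<^sup>2 * (real N * (norm \<xi>)\<^sup>2)"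
      by (rule mult_left_mono) simp
    moreover have "real N * M\<^sup>2 * (real N * (norm \<xi>)\<^sup>2) = (real N * M * norm \<xi>)\<^sup>2"
      by (simp add: power2_eq_square)
    ultimately show ?thesis using 1 by linarith
  qed
  define f where "f \<xi> = Abs_ell2 (\<lambda>i. \<Sum>j | k i j \<noteq> 0. k i j * coord \<xi> j)" for \<xi>
  have f: "coord (f \<xi>) i = (\<Sum>j | k i j \<noteq> 0. k i j * coord \<xi> j)" for \<xi> i
  proof -
    have "coord (f \<xi>) = (\<lambda>i. \<Sum>j | k i j \<noteq> 0. k i j * coord \<xi> j)"
      unfolding f_def by (rule Abs_ell2_inverse) (use square_summableI[OF bound] in simp)
    then show ?thesis by simp
  qed
  have "bounded_linear f"
  proof (rule bounded_linear_intro)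
    show "f (x + y) = f x + f y" for x y
      by (rule coord_eqI) (simp add: f plus_ell2.rep_eq distrib_left sum.distrib)
    show "f (r *\<^sub>R x) = r *\<^sub>R f x" for r x
      by (rule coord_eqI) (simp add: f scaleR_ell2.rep_eq scaleR_right.sum)
    show "norm (f x) \<le> norm x * (real N * M)" for x
    proof (rule norm_ell2_leI)
      show "(\<Sum>i\<in>F. (cmod (coord (f x) i))\<^sup>2) \<le> (norm x * (real N * M))\<^sup>2" if "finite F" for F
        using bound[OF that, of x] by (simp add: f mult.commute)
    qed (use \<open>M \<ge> 0\<close> in simp)
  qed
  then show ?thesis
    by (intro exI[of _ "Blinfun f"]) (simp add: bounded_linear_Blinfun_apply f)
qed

definition kernel_op :: "('i \<Rightarrow> 'i \<Rightarrow> complex) \<Rightarrow> 'i operator" where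
  "kernel_op k = (SOME T. \<forall>\<xi> i. coord (blinfun_apply T \<xi>) i = (\<Sum>j | k i j \<noteq> 0. k i j * coord \<xi> j))"

lemma coord_kernel_op:
  "banded k \<Longrightarrow> coord (kernel_op k \<xi>) i = (\<Sum>j | k i j \<noteq> 0. k i j * coord \<xi> j)"
  using someI_ex[OF kernel_op_exists] unfolding kernel_op_def by blast

lemma banded_finite_row: "banded k \<Longrightarrow> finite {j. k i j \<noteq> 0}"
  by (auto simp: banded_def)

lemma kernel_op_superset:
  assumes "banded k" "finite S" "{j. k i j \<noteq> 0} \<subseteq> S"
  shows "coord (kernel_op k \<xi>) i = (\<Sum>j\<in>S. k i j * coord \<xi> j)"
  unfolding coord_kernel_op[OF assms(1)] by (rule sum.mono_neutral_left) (use assms in auto)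

lemma kernel_op_add:
  assumes k: "banded k" and l: "banded l" and kl: "banded (\<lambda>i j. k i j + l i j)"
  shows "kernel_op (\<lambda>i j. k i j + l i j) = kernel_op k + kernel_op l"
proof (intro blinfun_eqI coord_eqI)
  fix \<xi> i
  let ?S = "{j. k i j \<noteq> 0} \<union> {j. l i j \<noteq> 0}"
  have S: "finite ?S" using k l by (simp add: banded_finite_row)
  have "coord (kernel_op (\<lambda>i j. k i j + l i j) \<xi>) i = (\<Sum>j\<in>?S. (k i j + l i j) * coord \<xi> j)"
    by (rule kernel_op_superset[OF kl S]) auto
  also have "\<dots> = coord (kernel_op k \<xi>) i + coord (kernel_op l \<xi>) i"
    unfolding distrib_right sum.distrib
    using kernel_op_superset[OF k S, of i \<xi>] kernel_op_superset[OF l S, of i \<xi>] by simp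
  finally show "coord (kernel_op (\<lambda>i j. k i j + l i j) \<xi>) i = coord ((kernel_op k + kernel_op l) \<xi>) i"
    by (simp add: plus_blinfun.rep_eq plus_ell2.rep_eq)
qed

lemma kernel_op_compose:
  assumes k: "banded k" and l: "banded l" and m: "banded m"
    and eq: "\<And>i j. m i j = (\<Sum>h | k i h \<noteq> 0. k i h * l h j)"
  shows "kernel_op k o\<^sub>L kernel_op l = kernel_op m"
proof (intro blinfun_eqI coord_eqI)
  fix \<xi> i
  let ?R = "{h. k i h \<noteq> 0}"
  let ?S = "(\<Union>h\<in>?R. {j. l h j \<noteq> 0})"
  have R: "finite ?R" by (rule banded_finite_row[OF k])
  have S: "finite ?S" using R banded_finite_row[OF l] by auto
  have "coord ((kernel_op k o\<^sub>L kernel_op l) \<xi>) i = (\<Sum>h\<in>?R. k i h * (\<Sum>j\<in>?S. l h j * coord \<xi> j))"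
    unfolding blinfun_apply_blinfun_compose coord_kernel_op[OF k]
    by (intro sum.cong refl arg_cong2[where f = "(*)"] kernel_op_superset[OF l S]) auto
  also have "\<dots> = (\<Sum>j\<in>?S. \<Sum>h\<in>?R. k i h * l h j * coord \<xi> j)"
    by (simp add: sum_distrib_left mult.assoc) (rule sum.swap)
  also have "\<dots> = (\<Sum>j\<in>?S. m i j * coord \<xi> j)"
    by (simp add: eq sum_distrib_right)
  also have "\<dots> = coord (kernel_op m \<xi>) i"
  proof (rule kernel_op_superset[OF m S, symmetric])
    show "{j. m i j \<noteq> 0} \<subseteq> ?S"
    proof
      fix j assume "j \<in> {j. m i j \<noteq> 0}"
      then have "(\<Sum>h\<in>?R. k i h * l h j) \<noteq> 0" by (simp add: eq)
      then obtain h where "h \<in> ?R" "k i h * l h j \<noteq> 0" by (rule sum.not_neutral_contains_not_neutral)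
      then show "j \<in> ?S" by auto
    qed
  qed
  finally show "coord ((kernel_op k o\<^sub>L kernel_op l) \<xi>) i = coord (kernel_op m \<xi>) i" .
qed

lemma banded_adjoint: "banded k \<Longrightarrow> banded (\<lambda>i j. cnj (k j i))"
  unfolding banded_def by auto

text \<open>The two inner products are the same double series summed in different orders.
  Interchanging them requires absolute summability: a product of coordinates is bounded by the sum
  of their squares, and each index occurs in at most \<open>N\<close> nonzero pairs.\<close>

lemma kernel_op_adjoint:
  assumes k: "banded k"
  shows "is_adjoint (kernel_op (\<lambda>i j. cnj (k j i))) (kernel_op k)"
  unfolding is_adjoint_def
proof (intro allI)
  fix x y
  from k obtain N M where fin: "\<And>i. finite {j. k i j \<noteq> 0}"
    and row: "\<And>i. card {j. k i j \<noteq> 0} \<le> N" and col: "\<And>j. finite {i. k i j \<noteq> 0}" "\<And>j. card {i. k i j \<noteq> 0} \<le> N"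
    and M: "\<And>i j. cmod (k i j) \<le> M" unfolding banded_def by metis
  have "M \<ge> 0" using M[of undefined undefined] norm_ge_zero order_trans by blast
  let ?f = "\<lambda>i j. cnj (coord x i) * k i j * coord y j"
  have bound: "(\<Sum>(i, j)\<in>P. cmod (?f i j)) \<le> M * (real N * (norm x)\<^sup>2 + real N * (norm y)\<^sup>2)" if P: "finite P" for P
  proof -
    let ?P = "{p \<in> P. k (fst p) (snd p) \<noteq> 0}"
    have fP: "finite ?P" using P by simp
    have "(\<Sum>(i, j)\<in>P. cmod (?f i j)) = (\<Sum>(i, j)\<in>?P. cmod (?f i j))"
      by (rule sum.mono_neutral_right) (use P in auto)
    also have "\<dots> \<le> (\<Sum>(i, j)\<in>?P. M * ((cmod (coord x i))\<^sup>2 + (cmod (coord y j))\<^sup>2))"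
    proof (intro sum_mono, clarify)
      fix i j
      have "cmod (?f i j) = cmod (k i j) * (cmod (coord x i) * cmod (coord y j))"
        by (simp add: norm_mult)
      also have "\<dots> \<le> M * (cmod (coord x i) * cmod (coord y j))" using M by (intro mult_right_mono) auto
      also have "\<dots> \<le> M * ((cmod (coord x i))\<^sup>2 + (cmod (coord y j))\<^sup>2)"
      proof (rule mult_left_mono[OF _ \<open>M \<ge> 0\<close>])
        have "0 \<le> cmod (coord x i) * cmod (coord y j)" by simp
        moreover have "2 * (cmod (coord x i) * cmod (coord y j)) \<le> (cmod (coord x i))\<^sup>2 + (cmod (coord y j))\<^sup>2"
          using sum_squares_bound[of "cmod (coord x i)" "cmod (coord y j)"] by (simp only: mult.assoc)
        ultimately show "cmod (coord x i) * cmod (coord y j) \<le> (cmod (coord x i))\<^sup>2 + (cmod (coord y j))\<^sup>2"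
          by linarith
      qed
      finally show "cmod (?f i j) \<le> M * ((cmod (coord x i))\<^sup>2 + (cmod (coord y j))\<^sup>2)" .
    qed
    also have "\<dots> = M * ((\<Sum>(i, j)\<in>?P. (cmod (coord x i))\<^sup>2) + (\<Sum>(i, j)\<in>?P. (cmod (coord y j))\<^sup>2))"
      by (simp add: case_prod_unfold sum.distrib flip: sum_distrib_left)
    also have "\<dots> \<le> M * (real N * (norm x)\<^sup>2 + real N * (norm y)\<^sup>2)"
    proof (intro mult_left_mono add_mono \<open>M \<ge> 0\<close>)
      have "(\<Sum>(i, j)\<in>?P. (cmod (coord x i))\<^sup>2) \<le> real N * (\<Sum>i\<in>fst ` ?P. (cmod (coord x i))\<^sup>2)"
      proof (rule sum_pairs_fst_le[OF fP])
        show "card {j. (i, j) \<in> ?P} \<le> N" for i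
          by (rule order_trans[OF card_mono[OF fin[of i]] row[of i]]) auto
      qed simp
      also have "\<dots> \<le> real N * (norm x)\<^sup>2" using fP by (intro mult_left_mono sum_coord_square_le) auto
      finally show "(\<Sum>(i, j)\<in>?P. (cmod (coord x i))\<^sup>2) \<le> real N * (norm x)\<^sup>2" .
      have "(\<Sum>(i, j)\<in>?P. (cmod (coord y j))\<^sup>2) \<le> real N * (\<Sum>j\<in>snd ` ?P. (cmod (coord y j))\<^sup>2)"
      proof (rule sum_pairs_snd_le[OF fP])
        show "card {i. (i, j) \<in> ?P} \<le> N" for j
          by (rule order_trans[OF card_mono[OF col(1)[of j]] col(2)[of j]]) auto
      qed simp
      also have "\<dots> \<le> real N * (norm y)\<^sup>2" using fP by (intro mult_left_mono sum_coord_square_le) auto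
      finally show "(\<Sum>(i, j)\<in>?P. (cmod (coord y j))\<^sup>2) \<le> real N * (norm y)\<^sup>2" .
    qed
    finally show ?thesis .
  qed
  have "(\<lambda>p. cmod ((\<lambda>(i, j). ?f i j) p)) summable_on UNIV \<times> UNIV"
    unfolding abs_summable_iff_bdd_above
    by (rule bdd_aboveI[where M = "M * (real N * (norm x)\<^sup>2 + real N * (norm y)\<^sup>2)"])
      (use bound in \<open>auto simp: case_prod_unfold\<close>)
  then have summ: "(\<lambda>(i, j). ?f i j) summable_on UNIV \<times> UNIV" by (rule abs_summable_summable)
  have "cinner (kernel_op (\<lambda>i j. cnj (k j i)) x) y = (\<Sum>\<^sub>\<infinity>j. \<Sum>\<^sub>\<infinity>i. ?f i j)"
    unfolding cinner_def
  proof (intro infsum_cong)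
    fix j
    have "(\<Sum>\<^sub>\<infinity>i. ?f i j) = (\<Sum>i | k i j \<noteq> 0. ?f i j)"
    proof -
      have "(\<Sum>\<^sub>\<infinity>i. ?f i j) = infsum (\<lambda>i. ?f i j) {i. k i j \<noteq> 0}"
        by (rule infsum_cong_neutral) auto
      then show ?thesis using col(1) by simp
    qed
    then show "cnj (coord (kernel_op (\<lambda>i j. cnj (k j i)) x) j) * coord y j = (\<Sum>\<^sub>\<infinity>i. ?f i j)"
      by (simp add: coord_kernel_op[OF banded_adjoint[OF k]] sum_distrib_left mult.commute mult.left_commute)
  qed
  also have "\<dots> = (\<Sum>\<^sub>\<infinity>i. \<Sum>\<^sub>\<infinity>j. ?f i j)"
    by (rule infsum_swap_banach[OF summ, symmetric])
  also have "\<dots> = cinner x (kernel_op k y)"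
    unfolding cinner_def
  proof (intro infsum_cong)
    fix i
    have "(\<Sum>\<^sub>\<infinity>j. ?f i j) = (\<Sum>j | k i j \<noteq> 0. ?f i j)"
    proof -
      have "(\<Sum>\<^sub>\<infinity>j. ?f i j) = infsum (\<lambda>j. ?f i j) {j. k i j \<noteq> 0}"
        by (rule infsum_cong_neutral) auto
      then show ?thesis using fin by simp
    qed
    then show "(\<Sum>\<^sub>\<infinity>j. ?f i j) = cnj (coord x i) * coord (kernel_op k y) i"
      by (simp add: coord_kernel_op[OF k] sum_distrib_left mult.assoc)
  qed
  finally show "cinner (kernel_op (\<lambda>i j. cnj (k j i)) x) y = cinner x (kernel_op k y)" .
qed

section \<open>K0 of a star algebra of operators as an abelian group, with cancellation of
  stabilizers\<close>

section \<open>The Grothendieck group of projections\<close>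

lemma blinfun_compose_sum_left: "sum f S o\<^sub>L c = (\<Sum>k\<in>S. f k o\<^sub>L c)"
  by (rule bounded_bilinear.sum_left[OF bounded_bilinear_blinfun_compose])

lemma blinfun_compose_sum_right: "c o\<^sub>L sum f S = (\<Sum>k\<in>S. c o\<^sub>L f k)"
  by (rule bounded_bilinear.sum_right[OF bounded_bilinear_blinfun_compose])

lemma blinfun_compose_diff_left: "(a - b) o\<^sub>L c = (a o\<^sub>L c) - (b o\<^sub>L c)"
  by (rule bounded_bilinear.diff_left[OF bounded_bilinear_blinfun_compose])

lemma blinfun_compose_diff_right: "c o\<^sub>L (a - b) = (c o\<^sub>L a) - (c o\<^sub>L b)"
  by (rule bounded_bilinear.diff_right[OF bounded_bilinear_blinfun_compose])

lemma blinfun_compose_assoc: "(a o\<^sub>L b) o\<^sub>L c = a o\<^sub>L (b o\<^sub>L c)"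
  by (rule blinfun_eqI) simp

lemma sum_lessThan_add: "sum f {..<m + n} = sum f {..<m} + (\<Sum>k<n. f (m + k :: nat))"
  for f :: "nat \<Rightarrow> 'a::comm_monoid_add"
  by (induction n) (auto simp: add.assoc)

lemma adjoint_op_zero [simp]: "adjoint_op 0 = 0"
  by (rule adjoint_op_eq[OF is_adjoint_zero])

subsection \<open>Block matrices\<close>

text \<open>The rectangular version of \<open>direct_sum\<close>, so that the matrices implementing
  two equivalences can be added as well.\<close>

definition block :: "nat \<Rightarrow> nat \<Rightarrow> 'i op_matrix \<Rightarrow> 'i op_matrix \<Rightarrow> 'i op_matrix" where
  "block m n a b = (\<lambda>i j. if i < m \<and> j < n then a i j
     else if m \<le> i \<and> n \<le> j then b (i - m) (j - n) else 0)"

text \<open>Applied to two projections, this is the partial isometry that exchanges the two summands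
  of their direct sum.\<close>

definition swap_block :: "nat \<Rightarrow> nat \<Rightarrow> 'i op_matrix \<Rightarrow> 'i op_matrix \<Rightarrow> 'i op_matrix" where
  "swap_block p q a b = (\<lambda>i j. if i < q \<and> p \<le> j then b i (j - p)
     else if q \<le> i \<and> j < p then a (i - q) j else 0)"

lemma direct_sum_block: "direct_sum P Q = (fst P + fst Q, block (fst P) (fst P) (snd P) (snd Q))"
  by (simp add: direct_sum_def block_def)

lemma matrix_star_block: "matrix_star (block m n a b) = block n m (matrix_star a) (matrix_star b)"
  unfolding matrix_star_def block_def by (intro ext) auto

lemma matrix_star_swap_block:
  "matrix_star (swap_block p q a b) = swap_block q p (matrix_star b) (matrix_star a)"
  unfolding matrix_star_def swap_block_def by (intro ext) auto

lemma matrix_times_block: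
  "matrix_times (n + n') (block m n a b) (block n p a' b') = block m p (matrix_times n a a') (matrix_times n' b b')"
  unfolding matrix_times_def block_def by (intro ext) (auto simp: sum_lessThan_add)

lemma matrix_times_swap_block:
  "matrix_times (q + p) (swap_block q p b a) (swap_block p q a' b') = block p p (matrix_times p a a') (matrix_times q b b')"
  unfolding matrix_times_def block_def swap_block_def by (intro ext) (auto simp: sum_lessThan_add)

lemma matrix_times_assoc: "matrix_times p (matrix_times n a b) c = matrix_times n a (matrix_times p b c)"
proof (intro ext)
  fix i j
  have "matrix_times p (matrix_times n a b) c i j = (\<Sum>k<p. \<Sum>l<n. a i l o\<^sub>L (b l k o\<^sub>L c k j))"
    unfolding matrix_times_def by (simp add: blinfun_compose_sum_left blinfun_compose_assoc)
  also have "\<dots> = (\<Sum>l<n. \<Sum>k<p. a i l o\<^sub>L (b l k o\<^sub>L c k j))" by (rule sum.swap)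
  also have "\<dots> = matrix_times n a (matrix_times p b c) i j"
    unfolding matrix_times_def by (simp add: blinfun_compose_sum_right)
  finally show "matrix_times p (matrix_times n a b) c i j = matrix_times n a (matrix_times p b c) i j" .
qed

lemma block_in_matrices:
  assumes "0 \<in> A" "a \<in> matrices A m n" "b \<in> matrices A m' n'"
  shows "block m n a b \<in> matrices A (m + m') (n + n')"
proof -
  have b: "\<not> i < m' \<Longrightarrow> b i j = 0" "\<not> j < n' \<Longrightarrow> b i j = 0" "i < m' \<Longrightarrow> j < n' \<Longrightarrow> b i j \<in> A" for i j
    using assms(3) unfolding matrices_def by auto
  show ?thesis
    using assms(1,2) unfolding matrices_def block_def by (auto simp: b)
qed

lemma swap_block_in_matrices:
  assumes "0 \<in> A" "a \<in> matrices A p p" "b \<in> matrices A q q"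
  shows "swap_block p q a b \<in> matrices A (q + p) (p + q)"
  using assms unfolding matrices_def swap_block_def by (auto 0 3)

lemma direct_sum_assoc: "direct_sum (direct_sum P Q) R = direct_sum P (direct_sum Q R)"
  unfolding direct_sum_def by (auto intro!: ext)

definition zero_projection :: "nat \<times> 'i op_matrix" where
  "zero_projection = (0, \<lambda>_ _. 0)"

lemma direct_sum_zero_left: "direct_sum zero_projection P = P"
  unfolding direct_sum_def zero_projection_def by (simp add: prod_eq_iff)

lemma direct_sum_zero_right: "P \<in> projections A \<Longrightarrow> direct_sum P zero_projection = P"
  unfolding direct_sum_def zero_projection_def projections_def matrices_def
  by (auto intro!: ext)

lemma zero_projection_in [simp]: "zero_projection \<in> projections A"
  unfolding zero_projection_def projections_def matrices_def matrix_times_def matrix_star_def by auto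

lemma direct_sum_projections:
  assumes "0 \<in> A" "P \<in> projections A" "Q \<in> projections A"
  shows "direct_sum P Q \<in> projections A"
  using assms block_in_matrices[of A "snd P" "fst P" "fst P" "snd Q" "fst Q" "fst Q"]
  unfolding direct_sum_block projections_def
  by (auto simp: matrix_times_block matrix_star_block)

lemma mvn_equiv_refl: "P \<in> projections A \<Longrightarrow> mvn_equiv A P P"
  unfolding mvn_equiv_def projections_def by (auto intro!: bexI[of _ "snd P"])

lemma K0_rel_self:
  assumes "0 \<in> A" "P \<in> projections A" "Q \<in> projections A"
  shows "((P, Q), (P, Q)) \<in> K0_rel A"
  unfolding K0_rel_def using assms
  by (auto intro!: bexI[OF _ zero_projection_in] mvn_equiv_refl direct_sum_projections)

lemma projections_mono: "A \<subseteq> B \<Longrightarrow> projections A \<subseteq> projections B"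
  unfolding projections_def matrices_def by (auto split: if_splits)

lemma K0_rel_mono: "A \<subseteq> B \<Longrightarrow> K0_rel A \<subseteq> K0_rel B"
proof -
  assume AB: "A \<subseteq> B"
  have "matrices A m n \<subseteq> matrices B m n" for m n
    using AB unfolding matrices_def by (auto split: if_splits)
  then have "mvn_equiv A P Q \<Longrightarrow> mvn_equiv B P Q" for P Q
    unfolding mvn_equiv_def by blast
  then show ?thesis
    using projections_mono[OF AB] unfolding K0_rel_def by blast
qed

text \<open>Direct sums are associative on the nose, so identities in K0 become rearrangements of
  lists of summands.\<close>

definition direct_sum_list :: "(nat \<times> 'i op_matrix) list \<Rightarrow> nat \<times> 'i op_matrix" where
  "direct_sum_list Ps = foldr direct_sum Ps zero_projection"

lemma direct_sum_list_simps [simp]: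
  "direct_sum_list [] = zero_projection"
  "direct_sum_list (P # Ps) = direct_sum P (direct_sum_list Ps)"
  by (simp_all add: direct_sum_list_def)

lemma direct_sum_list_append: "direct_sum_list (Ps @ Qs) = direct_sum (direct_sum_list Ps) (direct_sum_list Qs)"
  by (induction Ps) (simp_all add: direct_sum_zero_left direct_sum_assoc)

subsection \<open>Murray--von Neumann equivalence\<close>

text \<open>Existence of adjoints is part of the data: for a real-linear operator
  \<open>adjoint_op\<close> has its meaning only where an adjoint is known to exist.\<close>

locale star_algebra =
  fixes A :: "'i operator set"
  assumes zero: "0 \<in> A"
    and add: "S \<in> A \<Longrightarrow> T \<in> A \<Longrightarrow> S + T \<in> A"
    and diff: "S \<in> A \<Longrightarrow> T \<in> A \<Longrightarrow> S - T \<in> A"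
    and compose: "S \<in> A \<Longrightarrow> T \<in> A \<Longrightarrow> S o\<^sub>L T \<in> A"
    and adjoint: "T \<in> A \<Longrightarrow> adjoint_op T \<in> A"
    and is_adjoint: "T \<in> A \<Longrightarrow> is_adjoint (adjoint_op T) T"
begin

lemma sum: "(\<And>k. k \<in> S \<Longrightarrow> f k \<in> A) \<Longrightarrow> sum f S \<in> A"
  by (induction S rule: infinite_finite_induct) (auto intro: zero add)

lemma adjoint_adjoint: "T \<in> A \<Longrightarrow> adjoint_op (adjoint_op T) = T"
  by (rule adjoint_op_eq[OF is_adjoint_sym[OF is_adjoint]])

lemma adjoint_compose: "S \<in> A \<Longrightarrow> T \<in> A \<Longrightarrow> adjoint_op (S o\<^sub>L T) = adjoint_op T o\<^sub>L adjoint_op S"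
  by (rule adjoint_op_eq[OF is_adjoint_compose[OF is_adjoint is_adjoint]])

lemma adjoint_add: "S \<in> A \<Longrightarrow> T \<in> A \<Longrightarrow> adjoint_op (S + T) = adjoint_op S + adjoint_op T"
  by (rule adjoint_op_eq[OF is_adjoint_add[OF is_adjoint is_adjoint]])

lemma adjoint_diff: "S \<in> A \<Longrightarrow> T \<in> A \<Longrightarrow> adjoint_op (S - T) = adjoint_op S - adjoint_op T"
  by (rule adjoint_op_eq[OF is_adjoint_diff[OF is_adjoint is_adjoint]])

lemma adjoint_sum: "(\<And>k. k \<in> S \<Longrightarrow> f k \<in> A) \<Longrightarrow> adjoint_op (sum f S) = (\<Sum>k\<in>S. adjoint_op (f k))"
  by (induction S rule: infinite_finite_induct) (auto simp: adjoint_add sum)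

lemma matrix_entry: "a \<in> matrices A m n \<Longrightarrow> a i j \<in> A"
  unfolding matrices_def using zero by (cases "i < m \<and> j < n") auto

lemma matrix_times_in:
  "a \<in> matrices A m n \<Longrightarrow> b \<in> matrices A n p \<Longrightarrow> matrix_times n a b \<in> matrices A m p"
  unfolding matrices_def matrix_times_def by (auto intro!: sum compose sum.neutral)

lemma matrix_star_in: "a \<in> matrices A m n \<Longrightarrow> matrix_star a \<in> matrices A n m"
  unfolding matrices_def matrix_star_def by (auto intro!: adjoint)

lemma matrix_star_star: "a \<in> matrices A m n \<Longrightarrow> matrix_star (matrix_star a) = a"
  unfolding matrix_star_def using matrix_entry adjoint_adjoint by blast

lemma matrix_star_times:
  assumes "a \<in> matrices A m n" "b \<in> matrices A n p"
  shows "matrix_star (matrix_times n a b) = matrix_times n (matrix_star b) (matrix_star a)"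
  unfolding matrix_star_def matrix_times_def using assms[THEN matrix_entry]
  by (intro ext) (simp add: adjoint_sum compose adjoint_compose)

lemma mvn_equiv_sym:
  assumes "mvn_equiv A P Q" shows "mvn_equiv A Q P"
proof -
  obtain v where v: "v \<in> matrices A (fst Q) (fst P)"
    "matrix_times (fst Q) (matrix_star v) v = snd P" "matrix_times (fst P) v (matrix_star v) = snd Q"
    using assms unfolding mvn_equiv_def by blast
  then show ?thesis unfolding mvn_equiv_def
    by (intro bexI[of _ "matrix_star v"] conjI) (simp_all add: matrix_star_in matrix_star_star)
qed

text \<open>The composite of the two partial isometries works: the middle projection, written as
  \<open>v\<close> times its star or as the star of \<open>w\<close> times \<open>w\<close>,
  collapses the product to the square of an end projection.\<close>

lemma mvn_equiv_trans:
  assumes "mvn_equiv A P Q" "mvn_equiv A Q R" and P: "P \<in> projections A" and R: "R \<in> projections A"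
  shows "mvn_equiv A P R"
proof -
  obtain v where v: "v \<in> matrices A (fst Q) (fst P)"
    "matrix_times (fst Q) (matrix_star v) v = snd P" "matrix_times (fst P) v (matrix_star v) = snd Q"
    using assms unfolding mvn_equiv_def by blast
  obtain w where w: "w \<in> matrices A (fst R) (fst Q)"
    "matrix_times (fst R) (matrix_star w) w = snd Q" "matrix_times (fst Q) w (matrix_star w) = snd R"
    using assms unfolding mvn_equiv_def by blast
  have PR: "matrix_times (fst P) (snd P) (snd P) = snd P" "matrix_times (fst R) (snd R) (snd R) = snd R"
    using P R unfolding projections_def by auto
  let ?u = "matrix_times (fst Q) w v"
  have star: "matrix_star ?u = matrix_times (fst Q) (matrix_star v) (matrix_star w)"
    by (rule matrix_star_times[OF w(1) v(1)])
  have "matrix_times (fst R) (matrix_star ?u) ?u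
      = matrix_times (fst Q) (matrix_star v) (matrix_times (fst Q) (matrix_times (fst R) (matrix_star w) w) v)"
    unfolding star by (simp add: matrix_times_assoc)
  also have "\<dots> = matrix_times (fst P) (matrix_times (fst Q) (matrix_star v) v) (matrix_times (fst Q) (matrix_star v) v)"
    unfolding w(2) v(3)[symmetric] by (simp add: matrix_times_assoc)
  finally have 1: "matrix_times (fst R) (matrix_star ?u) ?u = snd P" by (simp add: v(2) PR)
  have "matrix_times (fst P) ?u (matrix_star ?u)
      = matrix_times (fst Q) w (matrix_times (fst Q) (matrix_times (fst P) v (matrix_star v)) (matrix_star w))"
    unfolding star by (simp add: matrix_times_assoc)
  also have "\<dots> = matrix_times (fst R) (matrix_times (fst Q) w (matrix_star w)) (matrix_times (fst Q) w (matrix_star w))"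
    unfolding v(3) w(2)[symmetric] by (simp add: matrix_times_assoc)
  finally have 2: "matrix_times (fst P) ?u (matrix_star ?u) = snd R" by (simp add: w(3) PR)
  show ?thesis unfolding mvn_equiv_def
    using 1 2 matrix_times_in[OF w(1) v(1)] by blast
qed

lemma mvn_equiv_direct_sum:
  assumes "mvn_equiv A P Q" "mvn_equiv A P' Q'"
  shows "mvn_equiv A (direct_sum P P') (direct_sum Q Q')"
proof -
  obtain v where v: "v \<in> matrices A (fst Q) (fst P)"
    "matrix_times (fst Q) (matrix_star v) v = snd P" "matrix_times (fst P) v (matrix_star v) = snd Q"
    using assms unfolding mvn_equiv_def by blast
  obtain w where w: "w \<in> matrices A (fst Q') (fst P')"
    "matrix_times (fst Q') (matrix_star w) w = snd P'" "matrix_times (fst P') w (matrix_star w) = snd Q'"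
    using assms unfolding mvn_equiv_def by blast
  show ?thesis
    unfolding mvn_equiv_def direct_sum_block fst_conv snd_conv
    by (rule bexI[of _ "block (fst Q) (fst P) v w"])
      (simp_all add: matrix_star_block matrix_times_block v w block_in_matrices zero)
qed

lemma mvn_equiv_direct_sum_commute:
  assumes "P \<in> projections A" "Q \<in> projections A"
  shows "mvn_equiv A (direct_sum P Q) (direct_sum Q P)"
proof -
  have PQ: "snd P \<in> matrices A (fst P) (fst P)" "matrix_times (fst P) (snd P) (snd P) = snd P" "matrix_star (snd P) = snd P"
    "snd Q \<in> matrices A (fst Q) (fst Q)" "matrix_times (fst Q) (snd Q) (snd Q) = snd Q" "matrix_star (snd Q) = snd Q"
    using assms unfolding projections_def by auto
  show ?thesis
    unfolding mvn_equiv_def direct_sum_block fst_conv snd_conv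
    by (rule bexI[of _ "swap_block (fst P) (fst Q) (snd P) (snd Q)"])
      (simp_all add: matrix_star_swap_block matrix_times_swap_block PQ swap_block_in_matrices zero)
qed

lemma direct_sum_in: "P \<in> projections A \<Longrightarrow> Q \<in> projections A \<Longrightarrow> direct_sum P Q \<in> projections A"
  by (rule direct_sum_projections[OF zero])

lemma direct_sum_list_in: "set Ps \<subseteq> projections A \<Longrightarrow> direct_sum_list Ps \<in> projections A"
  by (induction Ps) (auto intro: direct_sum_in)

lemma mvn_equiv_direct_sum_list_append:
  "mvn_equiv A (direct_sum_list Ps) (direct_sum_list Ps') \<Longrightarrow> mvn_equiv A (direct_sum_list Qs) (direct_sum_list Qs') \<Longrightarrow>
    mvn_equiv A (direct_sum_list (Ps @ Qs)) (direct_sum_list (Ps' @ Qs'))"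
  by (simp add: direct_sum_list_append mvn_equiv_direct_sum)

text \<open>The head is moved past the prefix that precedes it in the other list. All bookkeeping of
  summands below is reduced to comparing multisets.\<close>

lemma mvn_equiv_permute:
  assumes "mset Ps = mset Qs" "set Ps \<subseteq> projections A"
  shows "mvn_equiv A (direct_sum_list Ps) (direct_sum_list Qs)"
  using assms
proof (induction Ps arbitrary: Qs)
  case Nil
  then show ?case by (simp add: mvn_equiv_refl)
next
  case (Cons P Ps)
  have "P \<in> set Qs" using Cons.prems(1) by (metis list.set_intros(1) mset_eq_setD)
  then obtain us vs where Qs: "Qs = us @ P # vs" by (meson split_list)
  have "mset Ps = mset (us @ vs)" using Cons.prems(1) unfolding Qs by simp
  then have IH: "mvn_equiv A (direct_sum_list Ps) (direct_sum_list (us @ vs))" using Cons by auto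
  have "set (us @ vs) = set Ps" using \<open>mset Ps = mset (us @ vs)\<close> by (metis mset_eq_setD)
  then have mem: "P \<in> projections A" "direct_sum_list us \<in> projections A" "direct_sum_list vs \<in> projections A"
    "direct_sum_list Ps \<in> projections A"
    using Cons.prems(2) by (auto intro!: direct_sum_list_in)
  have "mvn_equiv A (direct_sum (direct_sum P (direct_sum_list us)) (direct_sum_list vs))
      (direct_sum (direct_sum (direct_sum_list us) P) (direct_sum_list vs))"
    using mem by (intro mvn_equiv_direct_sum mvn_equiv_direct_sum_commute mvn_equiv_refl)
  moreover have "mvn_equiv A (direct_sum P (direct_sum_list Ps)) (direct_sum P (direct_sum_list (us @ vs)))"
    using mem IH by (intro mvn_equiv_direct_sum mvn_equiv_refl)
  ultimately show ?case
    using mem unfolding Qs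
    by (auto simp: direct_sum_list_append direct_sum_assoc intro: mvn_equiv_trans direct_sum_in)
qed

subsection \<open>The group structure\<close>

lemma K0_rel_iff:
  assumes "P \<in> projections A" "Q \<in> projections A" "P' \<in> projections A" "Q' \<in> projections A"
  shows "((P, Q), (P', Q')) \<in> K0_rel A \<longleftrightarrow>
    (\<exists>R\<in>projections A. mvn_equiv A (direct_sum_list [P, Q', R]) (direct_sum_list [P', Q, R]))"
proof -
  have "direct_sum_list [P, Q', R] = direct_sum (direct_sum P Q') R"
    "direct_sum_list [P', Q, R] = direct_sum (direct_sum P' Q) R" if "R \<in> projections A" for R
    using direct_sum_zero_right[OF that] by (simp_all add: direct_sum_assoc)
  then show ?thesis unfolding K0_rel_def using assms by auto
qed

lemma K0_relI:
  assumes "set [P, Q, P', Q', R] \<subseteq> projections A"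
    and "mvn_equiv A (direct_sum_list [P, Q', R]) (direct_sum_list [P', Q, R])"
  shows "((P, Q), (P', Q')) \<in> K0_rel A"
  using assms by (subst K0_rel_iff) auto

lemma K0_rel_stableI:
  assumes P: "set [P, Q, P', Q'] \<subseteq> projections A" and Rs: "set Rs \<subseteq> projections A"
    and eq: "mvn_equiv A (direct_sum_list ([P, Q'] @ Rs)) (direct_sum_list ([P', Q] @ Rs))"
  shows "((P, Q), (P', Q')) \<in> K0_rel A"
proof (rule K0_relI[where R = "direct_sum_list Rs"])
  show "set [P, Q, P', Q', direct_sum_list Rs] \<subseteq> projections A"
    using P direct_sum_list_in[OF Rs] by auto
  then show "mvn_equiv A (direct_sum_list [P, Q', direct_sum_list Rs]) (direct_sum_list [P', Q, direct_sum_list Rs])"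
    using eq direct_sum_zero_right[of "direct_sum_list Rs" A] by (simp add: direct_sum_list_append)
qed

lemma equiv_K0_rel: "equiv (projections A \<times> projections A) (K0_rel A)"
proof (rule equivI)
  show "K0_rel A \<subseteq> (projections A \<times> projections A) \<times> projections A \<times> projections A"
    unfolding K0_rel_def by auto
  show "refl_on (projections A \<times> projections A) (K0_rel A)"
    by (rule refl_onI) (auto intro: K0_rel_self[OF zero])
  show "sym (K0_rel A)"
    by (rule symI) (auto simp: K0_rel_def intro: mvn_equiv_sym)
  show "trans (K0_rel A)"
  proof (rule transI, clarify)
    fix P Q P' Q' P'' Q''
    assume 1: "((P, Q), (P', Q')) \<in> K0_rel A" and 2: "((P', Q'), (P'', Q'')) \<in> K0_rel A"
    have mem: "P \<in> projections A" "Q \<in> projections A" "P' \<in> projections A" "Q' \<in> projections A"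
      "P'' \<in> projections A" "Q'' \<in> projections A" using 1 2 unfolding K0_rel_def by auto
    obtain R where R: "R \<in> projections A" "mvn_equiv A (direct_sum_list [P, Q', R]) (direct_sum_list [P', Q, R])"
      using 1 K0_rel_iff mem by blast
    obtain R' where R': "R' \<in> projections A" "mvn_equiv A (direct_sum_list [P', Q'', R']) (direct_sum_list [P'', Q', R'])"
      using 2 K0_rel_iff mem by blast
    show "((P, Q), (P'', Q'')) \<in> K0_rel A"
    \<comment> \<open>Adding the two given equivalences leaves \<open>P'\<close> and
      \<open>Q'\<close> on both sides besides the two stabilizers; all four are absorbed into the
      new stabilizer.\<close>
    proof (rule K0_rel_stableI[where Rs = "[Q', P', R, R']"])
      have a: "mvn_equiv A (direct_sum_list ([P, Q''] @ [Q', P', R, R'])) (direct_sum_list ([P, Q', R] @ [P', Q'', R']))"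
        using mem R R' by (intro mvn_equiv_permute) auto
      have b: "mvn_equiv A (direct_sum_list ([P, Q', R] @ [P', Q'', R'])) (direct_sum_list ([P', Q, R] @ [P'', Q', R']))"
        by (intro mvn_equiv_direct_sum_list_append R R')
      have c: "mvn_equiv A (direct_sum_list ([P', Q, R] @ [P'', Q', R'])) (direct_sum_list ([P'', Q] @ [Q', P', R, R']))"
        using mem R R' by (intro mvn_equiv_permute) auto
      have d: "direct_sum_list ([P, Q''] @ [Q', P', R, R']) \<in> projections A"
        "direct_sum_list ([P', Q, R] @ [P'', Q', R']) \<in> projections A"
        "direct_sum_list ([P'', Q] @ [Q', P', R, R']) \<in> projections A"
        using mem R R' by (intro direct_sum_list_in; simp)+
      show "mvn_equiv A (direct_sum_list ([P, Q''] @ [Q', P', R, R'])) (direct_sum_list ([P'', Q] @ [Q', P', R, R']))"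
        by (rule mvn_equiv_trans[OF mvn_equiv_trans[OF a b d(1,2)] c d(1,3)])
    qed (use mem R R' in auto)
  qed
qed

lemma K0_class_eq_iff:
  assumes "P \<in> projections A" "Q \<in> projections A" "P' \<in> projections A" "Q' \<in> projections A"
  shows "K0_rel A `` {(P, Q)} = K0_rel A `` {(P', Q')} \<longleftrightarrow> ((P, Q), (P', Q')) \<in> K0_rel A"
  using eq_equiv_class_iff[OF equiv_K0_rel] assms by auto

lemma K0_carrierE:
  assumes "c \<in> carrier (K0 A)"
  obtains P Q where "P \<in> projections A" "Q \<in> projections A" "c = K0_rel A `` {(P, Q)}"
  using assms unfolding K0_def by (auto elim!: quotientE)

lemma K0_carrierI: "P \<in> projections A \<Longrightarrow> Q \<in> projections A \<Longrightarrow> K0_rel A `` {(P, Q)} \<in> carrier (K0 A)"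
  unfolding K0_def by (auto intro: quotientI)

lemma K0_mult_class:
  assumes "P \<in> projections A" "Q \<in> projections A" "P' \<in> projections A" "Q' \<in> projections A"
  shows "K0_rel A `` {(P, Q)} \<otimes>\<^bsub>K0 A\<^esub> K0_rel A `` {(P', Q')} = K0_rel A `` {(direct_sum P P', direct_sum Q Q')}"
proof -
  let ?f = "\<lambda>(P, Q) (P', Q'). K0_rel A `` {(direct_sum P P', direct_sum Q Q')}"
  have "congruent2 (K0_rel A) (K0_rel A) ?f"
  proof (rule congruent2I', clarify)
    fix P1 Q1 P1' Q1' P2 Q2 P2' Q2'
    assume 1: "((P1, Q1), (P1', Q1')) \<in> K0_rel A" and 2: "((P2, Q2), (P2', Q2')) \<in> K0_rel A"
    have mem: "P1 \<in> projections A" "Q1 \<in> projections A" "P1' \<in> projections A" "Q1' \<in> projections A"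
       "P2 \<in> projections A" "Q2 \<in> projections A" "P2' \<in> projections A" "Q2' \<in> projections A"
      using 1 2 unfolding K0_rel_def by auto
    obtain R where R: "R \<in> projections A" "mvn_equiv A (direct_sum_list [P1, Q1', R]) (direct_sum_list [P1', Q1, R])"
      using 1 K0_rel_iff mem by blast
    obtain R' where R': "R' \<in> projections A" "mvn_equiv A (direct_sum_list [P2, Q2', R']) (direct_sum_list [P2', Q2, R'])"
      using 2 K0_rel_iff mem by blast
    have a: "mvn_equiv A (direct_sum_list [P1, P2, Q1', Q2', R, R']) (direct_sum_list ([P1, Q1', R] @ [P2, Q2', R']))"
      using mem R R' by (intro mvn_equiv_permute) auto
    have b: "mvn_equiv A (direct_sum_list ([P1, Q1', R] @ [P2, Q2', R'])) (direct_sum_list ([P1', Q1, R] @ [P2', Q2, R']))"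
      by (intro mvn_equiv_direct_sum_list_append R R')
    have c: "mvn_equiv A (direct_sum_list ([P1', Q1, R] @ [P2', Q2, R'])) (direct_sum_list [P1', P2', Q1, Q2, R, R'])"
      using mem R R' by (intro mvn_equiv_permute) auto
    have d: "direct_sum_list [P1, P2, Q1', Q2', R, R'] \<in> projections A"
      "direct_sum_list ([P1', Q1, R] @ [P2', Q2, R']) \<in> projections A"
      "direct_sum_list [P1', P2', Q1, Q2, R, R'] \<in> projections A"
      using mem R R' by (intro direct_sum_list_in; simp)+
    have "mvn_equiv A (direct_sum_list [P1, P2, Q1', Q2', R, R']) (direct_sum_list [P1', P2', Q1, Q2, R, R'])"
      by (rule mvn_equiv_trans[OF mvn_equiv_trans[OF a b d(1,2)] c d(1,3)])
    then have "((direct_sum P1 P2, direct_sum Q1 Q2), (direct_sum P1' P2', direct_sum Q1' Q2')) \<in> K0_rel A"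
      using mem R R' by (intro K0_rel_stableI[where Rs = "[R, R']"]) (auto simp: direct_sum_assoc intro!: direct_sum_in)
    then show "K0_rel A `` {(direct_sum P1 P2, direct_sum Q1 Q2)} = K0_rel A `` {(direct_sum P1' P2', direct_sum Q1' Q2')}"
      using mem by (subst K0_class_eq_iff) (auto intro!: direct_sum_in)
  qed
  then have "(\<Union>x\<in>K0_rel A `` {(P, Q)}. \<Union>y\<in>K0_rel A `` {(P', Q')}. ?f x y) = ?f (P, Q) (P', Q')"
    using assms by (intro UN_equiv_class2[OF equiv_K0_rel equiv_K0_rel]) auto
  then show ?thesis unfolding K0_def by (simp add: case_prod_unfold)
qed

lemma K0_one: "\<one>\<^bsub>K0 A\<^esub> = K0_rel A `` {(zero_projection, zero_projection)}"
  unfolding K0_def zero_projection_def by simp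

lemma K0_comm_group: "comm_group (K0 A)"
proof (rule comm_groupI)
  show "\<one>\<^bsub>K0 A\<^esub> \<in> carrier (K0 A)" unfolding K0_one by (intro K0_carrierI) auto
  fix x assume x: "x \<in> carrier (K0 A)"
  obtain P Q where P: "P \<in> projections A" "Q \<in> projections A" "x = K0_rel A `` {(P, Q)}"
    using x by (rule K0_carrierE)
  show "\<one>\<^bsub>K0 A\<^esub> \<otimes>\<^bsub>K0 A\<^esub> x = x"
    unfolding K0_one P(3) using P by (simp add: K0_mult_class direct_sum_zero_left)
  show "\<exists>y\<in>carrier (K0 A). y \<otimes>\<^bsub>K0 A\<^esub> x = \<one>\<^bsub>K0 A\<^esub>"
  proof (rule bexI[of _ "K0_rel A `` {(Q, P)}"])
    have "((direct_sum Q P, direct_sum P Q), (zero_projection, zero_projection)) \<in> K0_rel A"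
    proof (rule K0_rel_stableI[where Rs = "[]"])
      show "mvn_equiv A (direct_sum_list ([direct_sum Q P, zero_projection] @ [])) (direct_sum_list ([zero_projection, direct_sum P Q] @ []))"
        using P mvn_equiv_direct_sum_commute
        by (simp add: direct_sum_zero_left direct_sum_zero_right[where A = A] direct_sum_in)
    qed (use P direct_sum_in in auto)
    then show "K0_rel A `` {(Q, P)} \<otimes>\<^bsub>K0 A\<^esub> x = \<one>\<^bsub>K0 A\<^esub>"
      unfolding K0_one P(3) using P by (simp add: K0_mult_class K0_class_eq_iff direct_sum_in)
  qed (use P K0_carrierI in blast)
  fix y assume y: "y \<in> carrier (K0 A)"
  obtain P' Q' where P': "P' \<in> projections A" "Q' \<in> projections A" "y = K0_rel A `` {(P', Q')}"
    using y by (rule K0_carrierE)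
  show "x \<otimes>\<^bsub>K0 A\<^esub> y \<in> carrier (K0 A)"
    unfolding P(3) P'(3) using P P' by (simp add: K0_mult_class K0_carrierI direct_sum_in)
  have "((direct_sum P P', direct_sum Q Q'), (direct_sum P' P, direct_sum Q' Q)) \<in> K0_rel A"
  proof (rule K0_rel_stableI[where Rs = "[]"])
    have "mvn_equiv A (direct_sum_list [P, P', Q', Q]) (direct_sum_list [P', P, Q, Q'])"
      using P P' by (intro mvn_equiv_permute) auto
    then show "mvn_equiv A (direct_sum_list ([direct_sum P P', direct_sum Q' Q] @ [])) (direct_sum_list ([direct_sum P' P, direct_sum Q Q'] @ []))"
      by (simp add: direct_sum_assoc)
  qed (use P P' direct_sum_in in auto)
  then show "x \<otimes>\<^bsub>K0 A\<^esub> y = y \<otimes>\<^bsub>K0 A\<^esub> x"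
    unfolding P(3) P'(3) using P P' by (simp add: K0_mult_class K0_class_eq_iff direct_sum_in)
  fix z assume z: "z \<in> carrier (K0 A)"
  obtain P'' Q'' where P'': "P'' \<in> projections A" "Q'' \<in> projections A" "z = K0_rel A `` {(P'', Q'')}"
    using z by (rule K0_carrierE)
  show "x \<otimes>\<^bsub>K0 A\<^esub> y \<otimes>\<^bsub>K0 A\<^esub> z = x \<otimes>\<^bsub>K0 A\<^esub> (y \<otimes>\<^bsub>K0 A\<^esub> z)"
    unfolding P(3) P'(3) P''(3) using P P' P'' by (simp add: K0_mult_class direct_sum_in direct_sum_assoc)
qed

lemma K0_inclusion_class:
  assumes "B \<subseteq> A" "0 \<in> B" "P \<in> projections B" "Q \<in> projections B"
  shows "K0_inclusion A (K0_rel B `` {(P, Q)}) = K0_rel A `` {(P, Q)}"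
proof -
  have "((P, Q), (P, Q)) \<in> K0_rel B" by (rule K0_rel_self) (use assms in auto)
  moreover have "K0_rel B \<subseteq> K0_rel A" by (rule K0_rel_mono) fact
  moreover have "trans (K0_rel A)" using equiv_K0_rel by (auto simp: equiv_def)
  ultimately show ?thesis unfolding K0_inclusion_def by (auto dest: transD)
qed

subsection \<open>Orthogonal projections and cancellation\<close>

text \<open>The partial isometry is the row with the two entries \<open>p\<close> and
  \<open>q\<close>: multiplied by its star on one side it gives their sum, on the other a block
  matrix whose off-diagonal blocks vanish by orthogonality.\<close>

lemma mvn_equiv_orthogonal_sum:
  assumes p: "(n, p) \<in> projections A" and q: "(n, q) \<in> projections A"
    and pq: "matrix_times n p q = (\<lambda>_ _. 0)" "matrix_times n q p = (\<lambda>_ _. 0)"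
  shows "mvn_equiv A (direct_sum (n, p) (n, q)) (n, \<lambda>i j. p i j + q i j)"
proof -
  let ?v = "\<lambda>i j. if j < n then p i j else q i (j - n)"
  have pn: "p i j = 0" if "\<not> (i < n \<and> j < n)" for i j
    using p that unfolding projections_def matrices_def by auto
  have qn: "\<not> i < n \<Longrightarrow> q i j = 0" "\<not> j < n \<Longrightarrow> q i j = 0" for i j
    using q unfolding projections_def matrices_def by auto
  have star: "adjoint_op (p i j) = p j i" "adjoint_op (q i j) = q j i" for i j
  proof -
    have "matrix_star p j i = p j i" "matrix_star q j i = q j i"
      using p q unfolding projections_def by auto
    then show "adjoint_op (p i j) = p j i" "adjoint_op (q i j) = q j i"
      unfolding matrix_star_def by auto
  qed
  have mult: "(\<Sum>k<n. p i k o\<^sub>L p k j) = p i j" "(\<Sum>k<n. q i k o\<^sub>L q k j) = q i j"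
    "(\<Sum>k<n. p i k o\<^sub>L q k j) = 0" "(\<Sum>k<n. q i k o\<^sub>L p k j) = 0" for i j
  proof -
    have "matrix_times n p p i j = p i j" "matrix_times n q q i j = q i j"
      using p q unfolding projections_def by auto
    then show "(\<Sum>k<n. p i k o\<^sub>L p k j) = p i j" "(\<Sum>k<n. q i k o\<^sub>L q k j) = q i j"
      unfolding matrix_times_def by auto
    show "(\<Sum>k<n. p i k o\<^sub>L q k j) = 0" "(\<Sum>k<n. q i k o\<^sub>L p k j) = 0"
      using pq[THEN fun_cong, of i, THEN fun_cong, of j] unfolding matrix_times_def by auto
  qed
  have "p i j \<in> A" "q i j \<in> A" for i j
    using p q matrix_entry unfolding projections_def by auto
  then have "?v \<in> matrices A n (n + n)"
    unfolding matrices_def using pn qn by auto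
  moreover have "matrix_times n (matrix_star ?v) ?v = block n n p q"
    unfolding matrix_times_def matrix_star_def block_def
    by (intro ext) (auto simp: star mult pn qn)
  moreover have "matrix_times (n + n) ?v (matrix_star ?v) = (\<lambda>i j. p i j + q i j)"
    unfolding matrix_times_def matrix_star_def
    by (intro ext) (simp add: sum_lessThan_add star mult)
  ultimately show ?thesis
    unfolding mvn_equiv_def direct_sum_block by auto
qed

end

definition diag_matrix :: "nat \<Rightarrow> (nat \<Rightarrow> 'i operator) \<Rightarrow> 'i op_matrix" where
  "diag_matrix n f = (\<lambda>i j. if i = j \<and> i < n then f i else 0)"

text \<open>Adding the complement \<open>e - R\<close> turns the summand \<open>R\<close> into an identity matrix.\<close>

lemma (in star_algebra) mvn_equiv_cancel:
  assumes e: "e \<in> A" "\<And>T. T \<in> A \<Longrightarrow> e o\<^sub>L T = T" "\<And>T. T \<in> A \<Longrightarrow> T o\<^sub>L e = T"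
    and P: "P \<in> projections A" "Q \<in> projections A" and R: "R \<in> projections A"
    and eq: "mvn_equiv A (direct_sum P R) (direct_sum Q R)"
  shows "\<exists>k. mvn_equiv A (direct_sum P (k, diag_matrix k (\<lambda>_. e))) (direct_sum Q (k, diag_matrix k (\<lambda>_. e)))"
proof -
  obtain k r where Rkr: "R = (k, r)" by (cases R)
  let ?I = "diag_matrix k (\<lambda>_. e)"
  let ?s = "\<lambda>i j. ?I i j - r i j"
  have r: "r \<in> matrices A k k" "matrix_times k r r = r" "matrix_star r = r"
    using R unfolding Rkr projections_def by auto
  have I: "?I \<in> matrices A k k" using e(1) zero unfolding matrices_def diag_matrix_def by auto
  \<comment> \<open>The unit is self-adjoint: its adjoint composed with it is self-adjoint, and
    equals the adjoint because \<open>e\<close> is a right unit.\<close>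
  have e_star: "adjoint_op e = e"
  proof -
    have "adjoint_op (adjoint_op e o\<^sub>L e) = adjoint_op e o\<^sub>L e"
      using e(1) adjoint by (simp add: adjoint_compose adjoint_adjoint)
    moreover have "adjoint_op e o\<^sub>L e = adjoint_op e" using e(1,3) adjoint by blast
    ultimately show ?thesis using adjoint_adjoint[OF e(1)] by simp
  qed
  have I_times: "matrix_times k ?I a = a" "matrix_times k a ?I = a" if a: "a \<in> matrices A k k" for a
  proof -
    have *: "(\<Sum>l<k. (if i = l \<and> i < k then e else 0) o\<^sub>L a l j) = a i j"
      "(\<Sum>l<k. a i l o\<^sub>L (if l = j \<and> l < k then e else 0)) = a i j" for i j
    proof -
      have "(\<Sum>l<k. (if i = l \<and> i < k then e else 0) o\<^sub>L a l j) = (\<Sum>l<k. if i = l then a l j else 0)"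
        using matrix_entry[OF a] e(2) by (intro sum.cong) auto
      also have "\<dots> = a i j" using a unfolding matrices_def by (auto simp: sum.delta)
      finally show "(\<Sum>l<k. (if i = l \<and> i < k then e else 0) o\<^sub>L a l j) = a i j" .
      have "(\<Sum>l<k. a i l o\<^sub>L (if l = j \<and> l < k then e else 0)) = (\<Sum>l<k. if l = j then a i l else 0)"
        using matrix_entry[OF a] e(3) by (intro sum.cong) auto
      also have "\<dots> = a i j" using a unfolding matrices_def by (auto simp: sum.delta)
      finally show "(\<Sum>l<k. a i l o\<^sub>L (if l = j \<and> l < k then e else 0)) = a i j" .
    qed
    show "matrix_times k ?I a = a" "matrix_times k a ?I = a"
      unfolding matrix_times_def diag_matrix_def by (intro ext *)+
  qed
  have s: "?s \<in> matrices A k k" using I r(1) diff unfolding matrices_def by auto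
  have times_s: "matrix_times k a ?s = (\<lambda>i j. a i j - matrix_times k a r i j)" if "a \<in> matrices A k k" for a
  proof -
    have "matrix_times k a ?s = (\<lambda>i j. matrix_times k a ?I i j - matrix_times k a r i j)"
      unfolding matrix_times_def by (simp add: blinfun_compose_diff_right sum_subtractf)
    then show ?thesis using I_times(2)[OF that] by simp
  qed
  have s_times: "matrix_times k ?s a = (\<lambda>i j. a i j - matrix_times k r a i j)" if "a \<in> matrices A k k" for a
  proof -
    have "matrix_times k ?s a = (\<lambda>i j. matrix_times k ?I a i j - matrix_times k r a i j)"
      unfolding matrix_times_def by (simp add: blinfun_compose_diff_left sum_subtractf)
    then show ?thesis using I_times(1)[OF that] by simp
  qed
  have rs: "matrix_times k r ?s = (\<lambda>_ _. 0)" "matrix_times k ?s r = (\<lambda>_ _. 0)"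
    unfolding times_s[OF r(1)] s_times[OF r(1)] r(2) by auto
  have "matrix_times k ?s ?s = ?s" unfolding s_times[OF s] rs by simp
  moreover have "matrix_star ?s = ?s"
  proof (intro ext)
    fix i j
    have "matrix_star ?s i j = adjoint_op (?I j i) - matrix_star r i j"
      unfolding matrix_star_def using matrix_entry[OF I] matrix_entry[OF r(1)] by (simp add: adjoint_diff)
    then show "matrix_star ?s i j = ?s i j" using r(3) e_star by (auto simp: diag_matrix_def)
  qed
  ultimately have S: "(k, ?s) \<in> projections A" using s unfolding projections_def by auto
  have RS: "mvn_equiv A (direct_sum R (k, ?s)) (k, ?I)"
    using mvn_equiv_orthogonal_sum[of k r ?s] R S rs unfolding Rkr by simp
  have "matrix_star ?I = ?I" unfolding matrix_star_def diag_matrix_def using e_star by (intro ext) auto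
  then have Ip: "(k, ?I) \<in> projections A" using I I_times(1)[OF I] unfolding projections_def by auto
  have a: "mvn_equiv A (direct_sum P (k, ?I)) (direct_sum P (direct_sum R (k, ?s)))"
    by (intro mvn_equiv_direct_sum mvn_equiv_refl P mvn_equiv_sym[OF RS])
  have b: "mvn_equiv A (direct_sum P (direct_sum R (k, ?s))) (direct_sum Q (direct_sum R (k, ?s)))"
    unfolding direct_sum_assoc[symmetric] by (intro mvn_equiv_direct_sum mvn_equiv_refl S eq)
  have c: "mvn_equiv A (direct_sum Q (direct_sum R (k, ?s))) (direct_sum Q (k, ?I))"
    by (intro mvn_equiv_direct_sum mvn_equiv_refl P RS)
  have "mvn_equiv A (direct_sum P (k, ?I)) (direct_sum Q (k, ?I))"
    by (rule mvn_equiv_trans[OF mvn_equiv_trans[OF a b] c]) (intro direct_sum_in P R S Ip)+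
  then show ?thesis by blast
qed

section \<open>Topology of the coarse groupoid; compactly supported functions as controlled kernels
  on \<open>X\<close>\<close>

section \<open>The coarse groupoid\<close>

text \<open>Makes the results on limits of bounded functions along ultrafilters, which are stated for
  \<open>heine_borel\<close> types, apply to integer-valued functions.\<close>

instantiation int :: metric_space
begin

definition dist_int :: "int \<Rightarrow> int \<Rightarrow> real" where
  "dist_int x y = real_of_int \<bar>x - y\<bar>"
definition uniformity_int :: "(int \<times> int) filter" where
  "uniformity_int = (INF e\<in>{0<..}. principal {(x, y). dist x y < e})"

instance
proof
  show uniformity: "uniformity = (INF e\<in>{0<..}. principal {(x :: int, y). dist x y < e})"
    by (rule uniformity_int_def)
  fix U :: "int set"
  have eq: "x = y" if "dist x y < 1" for x y :: int
    using that unfolding dist_int_def by linarith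
  have "eventually (\<lambda>(x', y). x' = x \<longrightarrow> y \<in> U) uniformity" if "x \<in> U" for x
    unfolding uniformity
  proof (rule eventually_INF1[of 1])
    show "eventually (\<lambda>(x', y). x' = x \<longrightarrow> y \<in> U) (principal {(x :: int, y). dist x y < 1})"
      using that by (auto simp: eventually_principal dest!: eq)
  qed simp
  then show "open U \<longleftrightarrow> (\<forall>x\<in>U. eventually (\<lambda>(x', y). x' = x \<longrightarrow> y \<in> U) uniformity)"
    by (simp add: open_discrete)
qed (auto simp: dist_int_def)

end

text \<open>A bounded sequence of integers takes finitely many values, so some value recurs
  infinitely often and gives a constant subsequence.\<close>

instance int :: heine_borel
proof
  fix f :: "nat \<Rightarrow> int" assume "bounded (range f)"
  then obtain c :: int and e where e: "\<And>n. dist c (f n) \<le> e" unfolding bounded_def by auto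
  have "range f \<subseteq> {c - \<lceil>e\<rceil>..c + \<lceil>e\<rceil>}"
  proof
    fix y assume "y \<in> range f"
    then have "real_of_int \<bar>c - y\<bar> \<le> e" using e by (auto simp: dist_int_def)
    then have "\<bar>c - y\<bar> \<le> \<lceil>e\<rceil>" by linarith
    then show "y \<in> {c - \<lceil>e\<rceil>..c + \<lceil>e\<rceil>}" by auto
  qed
  then have "finite (range f)" using finite_subset by blast
  then obtain n0 where "infinite {n. f n = f n0}"
    using pigeonhole_infinite[of UNIV f] by auto
  then obtain r :: "nat \<Rightarrow> nat" where r: "strict_mono r" "\<And>n. r n \<in> {n. f n = f n0}"
    using infinite_enumerate by blast
  then have "f \<circ> r = (\<lambda>_. f n0)" by auto
  then show "\<exists>l r. strict_mono r \<and> (f \<circ> r) \<longlonglongrightarrow> l" using r(1) by (intro exI[of _ "f n0"] exI[of _ r]) simp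
qed

subsection \<open>Limits along ultrafilters\<close>

lemma ultrafilter_tendsto_Lim:
  fixes f :: "'a \<Rightarrow> 'b::heine_borel"
  assumes "ultrafilter U" "bounded (range f)"
  shows "(f \<longlongrightarrow> Lim U f) U"
  using ultrafilter_bounded_convergent[OF assms] tendsto_Lim[OF ultrafilter_not_bot[OF assms(1)]] by metis

lemma Lim_filtermap: "Lim (filtermap h U) f = Lim U (\<lambda>x. f (h x) :: 'b::t2_space)"
  by (simp add: t2_space_class.Lim_def filterlim_filtermap)

lemma Lim_eventually_const:
  fixes f :: "'a \<Rightarrow> 'b::t2_space"
  shows "ultrafilter U \<Longrightarrow> eventually (\<lambda>x. f x = c) U \<Longrightarrow> Lim U f = c"
  by (intro tendsto_Lim ultrafilter_not_bot tendsto_eventually)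

lemma Lim_cong_eventually:
  "eventually (\<lambda>x. f x = g x) U \<Longrightarrow> Lim U f = (Lim U g :: 'b::t2_space)"
  unfolding t2_space_class.Lim_def by (simp add: tendsto_cong)

lemma Lim_nonzero_eventually:
  fixes f :: "'a \<Rightarrow> 'b::{zero,t2_space}"
  assumes U: "ultrafilter U" and "Lim U f \<noteq> 0"
  shows "eventually (\<lambda>x. f x \<noteq> 0) U"
  using assms Lim_eventually_const[OF U, of f 0] ultrafilter_eventually_not[OF U, of "\<lambda>x. f x = 0"] by blast

lemma ultrafilter_principal: "ultrafilter (principal {p})"
  unfolding ultrafilter_def by (auto simp: eventually_principal principal_eq_bot_iff)

lemma Lim_principal: "Lim (principal {p}) f = (f p :: 'b::t2_space)"
  by (rule Lim_eventually_const[OF ultrafilter_principal]) (simp add: eventually_principal)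

lemma filtermap_cong_eventually:
  "eventually (\<lambda>x. f x = g x) F \<Longrightarrow> filtermap f F = filtermap g F"
  unfolding filter_eq_iff eventually_filtermap by (auto intro!: eventually_subst elim: eventually_mono)

subsection \<open>The topology on the arrows\<close>

lemma ultrafilters_on_iff: "F \<in> ultrafilters_on S \<longleftrightarrow> ultrafilter F \<and> eventually (\<lambda>x. x \<in> S) F"
proof -
  have "(\<forall>A. eventually (\<lambda>x. x \<in> A) F \<or> eventually (\<lambda>x. x \<notin> A) F) \<longleftrightarrow>
      (\<forall>P. eventually P F \<or> eventually (\<lambda>x. \<not> P x) F)"
  proof
    assume *: "\<forall>A. eventually (\<lambda>x. x \<in> A) F \<or> eventually (\<lambda>x. x \<notin> A) F"
    show "\<forall>P. eventually P F \<or> eventually (\<lambda>x. \<not> P x) F"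
      using *[rule_format, of "Collect _"] by simp
  qed blast
  then show ?thesis unfolding ultrafilters_on_def ultrafilter_def by (auto simp: le_principal)
qed

lemma topspace_stone_cech: "topspace (stone_cech S) = ultrafilters_on S"
  unfolding stone_cech_def topology_generated_by_topspace
  by (auto simp: ultrafilters_on_iff intro!: bexI[of _ S])

text \<open>The generating sets are closed under finite intersection, so they form a base. The set
  \<open>A\<close> need not lie in \<open>S\<close>, as intersecting it with \<open>S\<close> does
  not change which ultrafilters on \<open>S\<close> contain it.\<close>

lemma openin_stone_cech_iff:
  "openin (stone_cech S) T \<longleftrightarrow> T \<subseteq> ultrafilters_on S \<and>
     (\<forall>F\<in>T. \<exists>A. eventually (\<lambda>x. x \<in> A) F \<and> {F'\<in>ultrafilters_on S. eventually (\<lambda>x. x \<in> A) F'} \<subseteq> T)"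
proof
  assume T: "openin (stone_cech S) T"
  then have "generate_topology_on ((\<lambda>A. {F \<in> ultrafilters_on S. eventually (\<lambda>x. x \<in> A) F}) ` Pow S) T"
    unfolding stone_cech_def openin_topology_generated_by_iff .
  then have "\<forall>F\<in>T. \<exists>A. eventually (\<lambda>x. x \<in> A) F \<and> {F'\<in>ultrafilters_on S. eventually (\<lambda>x. x \<in> A) F'} \<subseteq> T"
  proof (induction rule: generate_topology_on.induct)
    case Empty
    then show ?case by simp
  next
    case (Int a b)
    show ?case
    proof
      fix F assume "F \<in> a \<inter> b"
      then obtain A B where "eventually (\<lambda>x. x \<in> A) F" "{F'\<in>ultrafilters_on S. eventually (\<lambda>x. x \<in> A) F'} \<subseteq> a"
        "eventually (\<lambda>x. x \<in> B) F" "{F'\<in>ultrafilters_on S. eventually (\<lambda>x. x \<in> B) F'} \<subseteq> b"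
        using Int.IH by blast
      then show "\<exists>A. eventually (\<lambda>x. x \<in> A) F \<and> {F'\<in>ultrafilters_on S. eventually (\<lambda>x. x \<in> A) F'} \<subseteq> a \<inter> b"
        by (intro exI[of _ "A \<inter> B"]) (auto simp: eventually_conj_iff)
    qed
  next
    case (UN K)
    show ?case
    proof
      fix F assume "F \<in> \<Union>K"
      then obtain k where k: "k \<in> K" "F \<in> k" by blast
      then obtain A where "eventually (\<lambda>x. x \<in> A) F" "{F'\<in>ultrafilters_on S. eventually (\<lambda>x. x \<in> A) F'} \<subseteq> k"
        using UN.IH by blast
      then show "\<exists>A. eventually (\<lambda>x. x \<in> A) F \<and> {F'\<in>ultrafilters_on S. eventually (\<lambda>x. x \<in> A) F'} \<subseteq> \<Union>K"
        using k(1) by (intro exI[of _ A]) blast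
    qed
  next
    case (Basis s)
    then show ?case by auto
  qed
  moreover have "T \<subseteq> ultrafilters_on S" using openin_subset[OF T] by (simp add: topspace_stone_cech)
  ultimately show "T \<subseteq> ultrafilters_on S \<and>
     (\<forall>F\<in>T. \<exists>A. eventually (\<lambda>x. x \<in> A) F \<and> {F'\<in>ultrafilters_on S. eventually (\<lambda>x. x \<in> A) F'} \<subseteq> T)" by blast
next
  assume T: "T \<subseteq> ultrafilters_on S \<and>
     (\<forall>F\<in>T. \<exists>A. eventually (\<lambda>x. x \<in> A) F \<and> {F'\<in>ultrafilters_on S. eventually (\<lambda>x. x \<in> A) F'} \<subseteq> T)"
  show "openin (stone_cech S) T"
  proof (subst openin_subopen, intro ballI)
    fix F assume F: "F \<in> T"
    then obtain A where A: "eventually (\<lambda>x. x \<in> A) F" "{F'\<in>ultrafilters_on S. eventually (\<lambda>x. x \<in> A) F'} \<subseteq> T"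
      using T by blast
    let ?W = "{F'\<in>ultrafilters_on S. eventually (\<lambda>x. x \<in> A \<inter> S) F'}"
    have "openin (stone_cech S) ?W"
      unfolding stone_cech_def by (rule topology_generated_by_Basis, rule image_eqI[of _ _ "A \<inter> S"]) auto
    moreover have "F \<in> ?W" using A F T by (auto simp: ultrafilters_on_iff eventually_conj_iff)
    moreover have "?W \<subseteq> T" using A by (auto simp: eventually_conj_iff)
    ultimately show "\<exists>W. openin (stone_cech S) W \<and> F \<in> W \<and> W \<subseteq> T" by blast
  qed
qed

text \<open>An ultrafilter not containing \<open>E\<close> contains its complement, and this is an
  open condition that excludes all points of \<open>E\<close>. Conversely, if it contains
  \<open>E\<close>, every basic neighbourhood \<open>A\<close> meets \<open>E\<close>, since a
  proper filter has no empty event.\<close>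

lemma entourage_closure_eq:
  assumes "E \<subseteq> X \<times> X"
  shows "entourage_closure X E = {F \<in> ultrafilters_on (X \<times> X). eventually (\<lambda>p. p \<in> E) F}"
proof (intro equalityI subsetI)
  fix F assume F: "F \<in> entourage_closure X E"
  then have top: "F \<in> ultrafilters_on (X \<times> X)"
    and meet: "\<And>T. F \<in> T \<Longrightarrow> openin (stone_cech (X \<times> X)) T \<Longrightarrow> \<exists>p\<in>E. principal {p} \<in> T"
    unfolding entourage_closure_def in_closure_of topspace_stone_cech by auto
  have U: "ultrafilter F" using top by (simp add: ultrafilters_on_iff)
  have "eventually (\<lambda>p. p \<in> E) F"
  proof (rule ccontr)
    assume "\<not> eventually (\<lambda>p. p \<in> E) F"
    then have ev: "eventually (\<lambda>p. p \<in> - E) F" using ultrafilter_eventually_not[OF U] by simp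
    let ?T = "{F \<in> ultrafilters_on (X \<times> X). eventually (\<lambda>p. p \<in> - E) F}"
    have "openin (stone_cech (X \<times> X)) ?T" unfolding openin_stone_cech_iff by blast
    then obtain p where "p \<in> E" "principal {p} \<in> ?T" using meet[of ?T] ev top by blast
    then show False by (simp add: eventually_principal)
  qed
  then show "F \<in> {F \<in> ultrafilters_on (X \<times> X). eventually (\<lambda>p. p \<in> E) F}" using top by blast
next
  fix F assume F: "F \<in> {F \<in> ultrafilters_on (X \<times> X). eventually (\<lambda>p. p \<in> E) F}"
  then have U: "ultrafilter F" by (simp add: ultrafilters_on_iff)
  show "F \<in> entourage_closure X E"
    unfolding entourage_closure_def in_closure_of topspace_stone_cech
  proof (intro conjI allI impI)
    show "F \<in> ultrafilters_on (X \<times> X)" using F by blast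
    fix T assume T: "F \<in> T \<and> openin (stone_cech (X \<times> X)) T"
    then obtain A where A: "eventually (\<lambda>x. x \<in> A) F"
      "{F'\<in>ultrafilters_on (X \<times> X). eventually (\<lambda>x. x \<in> A) F'} \<subseteq> T"
      unfolding openin_stone_cech_iff by blast
    have "eventually (\<lambda>x. x \<in> A \<and> x \<in> E) F" using A F by (simp add: eventually_conj_iff)
    then obtain p where p: "p \<in> A" "p \<in> E"
      using eventually_happens'[OF ultrafilter_not_bot[OF U]] by blast
    then have "principal {p} \<in> T"
      using subsetD[OF A(2), of "principal {p}"] assms
      by (auto simp: ultrafilters_on_iff ultrafilter_principal eventually_principal)
    then show "\<exists>y. y \<in> (\<lambda>p. principal {p}) ` E \<and> y \<in> T" using p by blast
  qed
qed

locale coarse_space = Metric_space X d for X :: "'a set" and d +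
  assumes uniformly_locally_finite: "uniformly_locally_finite X d"
begin

abbreviation G :: "('a \<times> 'a) filter top_groupoid" where
  "G \<equiv> coarse_groupoid X d"

text \<open>The entourages of this form are cofinal, and as predicates they express membership of an
  ultrafilter in an entourage closure by \<open>eventually\<close>.\<close>

definition near :: "real \<Rightarrow> 'a \<times> 'a \<Rightarrow> bool" where
  "near R = (\<lambda>(x, y). x \<in> X \<and> y \<in> X \<and> d x y \<le> R)"

lemma near_mono: "near R p \<Longrightarrow> R \<le> S \<Longrightarrow> near S p"
  by (auto simp: near_def)

lemma entourage_near: "entourage X d (Collect (near R))"
  unfolding entourage_def near_def by (auto intro!: bdd_aboveI[of _ R])

lemma entourageE:
  assumes "entourage X d E"
  obtains R where "R \<ge> 0" "E \<subseteq> Collect (near R)"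
proof -
  obtain R where R: "\<And>x y. (x, y) \<in> E \<Longrightarrow> d x y \<le> R"
    using assms unfolding entourage_def bdd_above_def by force
  have "E \<subseteq> Collect (near (max R 0))"
    using R assms unfolding entourage_def near_def by (fastforce simp: le_max_iff_disj)
  then show thesis using that[of "max R 0"] by simp
qed

lemma coarse_arrows_iff: "F \<in> coarse_arrows X d \<longleftrightarrow> ultrafilter F \<and> (\<exists>R\<ge>0. eventually (near R) F)"
proof
  assume "F \<in> coarse_arrows X d"
  then obtain E where E: "entourage X d E" "F \<in> entourage_closure X E" unfolding coarse_arrows_def by blast
  then have F: "ultrafilter F" "eventually (\<lambda>p. p \<in> E) F"
    by (auto simp: entourage_closure_eq entourage_def ultrafilters_on_iff)
  obtain R where "R \<ge> 0" "E \<subseteq> Collect (near R)" using entourageE[OF E(1)] .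
  then show "ultrafilter F \<and> (\<exists>R\<ge>0. eventually (near R) F)"
    using F by (auto elim!: eventually_mono)
next
  assume *: "ultrafilter F \<and> (\<exists>R\<ge>0. eventually (near R) F)"
  then obtain R where R: "eventually (near R) F" by blast
  then have "eventually (\<lambda>p. p \<in> X \<times> X) F" by (rule eventually_mono) (auto simp: near_def)
  then have "F \<in> entourage_closure X (Collect (near R))"
    using * R entourage_near[of R] by (subst entourage_closure_eq) (auto simp: entourage_def ultrafilters_on_iff)
  then show "F \<in> coarse_arrows X d" unfolding coarse_arrows_def using entourage_near by blast
qed

text \<open>The weak topology turns out to have the traces of the Stone--Cech basic sets as a base.
  Each arrow \<open>F\<close> lies in the closure of some \<open>E\<close>; intersecting a basic set
  with \<open>E\<close> keeps all its arrows inside that closure, where openness is known.\<close>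

lemma coarse_open_iff:
  "coarse_open X d W \<longleftrightarrow> W \<subseteq> coarse_arrows X d \<and>
     (\<forall>F\<in>W. \<exists>A. eventually (\<lambda>p. p \<in> A) F \<and> (\<forall>F'\<in>coarse_arrows X d. eventually (\<lambda>p. p \<in> A) F' \<longrightarrow> F' \<in> W))"
    (is "_ \<longleftrightarrow> _ \<and> ?R")
proof
  assume W: "coarse_open X d W"
  have "?R"
  proof
    fix F assume F: "F \<in> W"
    then have "F \<in> coarse_arrows X d" using W unfolding coarse_open_def by blast
    then obtain E where E: "entourage X d E" "F \<in> entourage_closure X E" unfolding coarse_arrows_def by blast
    have EX: "E \<subseteq> X \<times> X" using E(1) unfolding entourage_def by blast
    obtain T where T: "openin (stone_cech (X \<times> X)) T" "W \<inter> entourage_closure X E = T \<inter> entourage_closure X E"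
      using W E(1) unfolding coarse_open_def openin_subtopology by blast
    then have "F \<in> T" using F E by blast
    then obtain A where A: "eventually (\<lambda>x. x \<in> A) F"
      "{F'\<in>ultrafilters_on (X \<times> X). eventually (\<lambda>x. x \<in> A) F'} \<subseteq> T"
      using T(1) unfolding openin_stone_cech_iff by blast
    have "F' \<in> W" if F': "F' \<in> coarse_arrows X d" "eventually (\<lambda>p. p \<in> A \<inter> E) F'" for F'
    proof -
      have ev: "eventually (\<lambda>p. p \<in> A) F'" "eventually (\<lambda>p. p \<in> E) F'"
        using F'(2) by (auto simp: eventually_conj_iff)
      have "F' \<in> ultrafilters_on (X \<times> X)"
        using F'(1) eventually_mono[OF ev(2), of "\<lambda>p. p \<in> X \<times> X"] EX
        by (auto simp: coarse_arrows_iff ultrafilters_on_iff)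
      then have "F' \<in> T \<inter> entourage_closure X E"
        using A(2) ev by (auto simp: entourage_closure_eq[OF EX])
      then show ?thesis using T(2) by blast
    qed
    moreover have "eventually (\<lambda>p. p \<in> A \<inter> E) F"
      using A(1) E(2) by (simp add: entourage_closure_eq[OF EX] eventually_conj_iff)
    ultimately show "\<exists>A. eventually (\<lambda>p. p \<in> A) F \<and> (\<forall>F'\<in>coarse_arrows X d. eventually (\<lambda>p. p \<in> A) F' \<longrightarrow> F' \<in> W)"
      by blast
  qed
  then show "W \<subseteq> coarse_arrows X d \<and> ?R" using W unfolding coarse_open_def by blast
next
  assume *: "W \<subseteq> coarse_arrows X d \<and> ?R"
  show "coarse_open X d W"
    unfolding coarse_open_def
  proof (intro conjI allI impI)
    show "W \<subseteq> coarse_arrows X d" using * by blast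
    fix E assume E: "entourage X d E"
    let ?T = "\<Union>{{F'\<in>ultrafilters_on (X \<times> X). eventually (\<lambda>x. x \<in> A) F'} | A.
       \<forall>F'\<in>coarse_arrows X d. eventually (\<lambda>p. p \<in> A) F' \<longrightarrow> F' \<in> W}"
    have "openin (stone_cech (X \<times> X)) ?T"
      by (rule openin_Union) (auto simp: openin_stone_cech_iff)
    moreover have "W \<inter> entourage_closure X E = ?T \<inter> entourage_closure X E"
    proof -
      have sub: "entourage_closure X E \<subseteq> coarse_arrows X d" using E unfolding coarse_arrows_def by blast
      moreover have "entourage_closure X E \<subseteq> ultrafilters_on (X \<times> X)"
        using E by (auto simp: entourage_closure_eq entourage_def)
      ultimately show ?thesis using * by blast
    qed
    ultimately show "openin (subtopology (stone_cech (X \<times> X)) (entourage_closure X E)) (W \<inter> entourage_closure X E)"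
      unfolding openin_subtopology by blast
  qed
qed

lemma openin_arrow_top_iff:
  "openin (arrow_top G) W \<longleftrightarrow> W \<subseteq> coarse_arrows X d \<and>
     (\<forall>F\<in>W. \<exists>A. eventually (\<lambda>p. p \<in> A) F \<and> (\<forall>F'\<in>coarse_arrows X d. eventually (\<lambda>p. p \<in> A) F' \<longrightarrow> F' \<in> W))"
  unfolding coarse_groupoid_def
  by (simp add: topology_inverse'[OF istopology_coarse_open] coarse_open_iff)

lemma topspace_arrow_top [simp]: "topspace (arrow_top G) = coarse_arrows X d"
proof
  show "topspace (arrow_top G) \<subseteq> coarse_arrows X d"
    using openin_topspace[of "arrow_top G"] unfolding openin_arrow_top_iff by blast
  have "openin (arrow_top G) (coarse_arrows X d)"
    unfolding openin_arrow_top_iff by (auto intro!: exI[of _ UNIV])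
  then show "coarse_arrows X d \<subseteq> topspace (arrow_top G)" by (rule openin_subset)
qed

lemma arrows_eq [simp]: "arrows G = coarse_arrows X d"
  by (simp add: arrows_def)

definition arrows_in :: "('a \<times> 'a \<Rightarrow> bool) \<Rightarrow> ('a \<times> 'a) filter set" where
  "arrows_in P = {F \<in> coarse_arrows X d. eventually P F}"

lemma openin_arrows_in: "openin (arrow_top G) (arrows_in P)"
  unfolding openin_arrow_top_iff arrows_in_def by (auto intro!: exI[of _ "Collect P"])

lemma arrows_in_not: "arrows_in (\<lambda>p. \<not> P p) = coarse_arrows X d - arrows_in P"
  unfolding arrows_in_def by (auto simp: coarse_arrows_iff ultrafilter_eventually_not)

lemma closedin_arrows_in: "closedin (arrow_top G) (arrows_in P)"
  unfolding closedin_def using openin_arrows_in[of "\<lambda>p. \<not> P p"] by (auto simp: arrows_in_not) (auto simp: arrows_in_def)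

text \<open>If no finite number of basic sets subordinate to the cover contained the entourage, the
  complements would generate a proper filter. An ultrafilter below it is an arrow of the entourage
  closure outside every basic set of the cover.\<close>

lemma compactin_arrows_near: "compactin (arrow_top G) (arrows_in (near R))"
  unfolding compactin_def
proof (intro conjI allI impI)
  show "arrows_in (near R) \<subseteq> topspace (arrow_top G)" by (auto simp: arrows_in_def)
  fix \<U> assume \<U>: "(\<forall>U\<in>\<U>. openin (arrow_top G) U) \<and> arrows_in (near R) \<subseteq> \<Union>\<U>"
  define \<A> where "\<A> = {A. \<exists>W\<in>\<U>. \<forall>F\<in>coarse_arrows X d. eventually (\<lambda>p. p \<in> A) F \<longrightarrow> F \<in> W}"
  have "\<exists>\<F>. finite \<F> \<and> \<F> \<subseteq> \<A> \<and> Collect (near R) \<subseteq> \<Union>\<F>"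
  proof (rule ccontr)
    assume no: "\<not> ?thesis"
    let ?I = "\<lambda>A. principal (Collect (near R) - A)"
    \<comment> \<open>The index \<open>{}\<close> contributes the entourage itself, so the
      ultrafilter is concentrated on it even if \<open>\<A>\<close> is empty.\<close>
    have "(INF A\<in>insert {} \<A>. ?I A) \<noteq> bot"
    proof (rule INF_filter_not_bot)
      fix \<F> assume \<F>: "\<F> \<subseteq> insert {} \<A>" "finite \<F>"
      show "(INF A\<in>\<F>. ?I A) \<noteq> bot"
      proof (cases "\<F> = {}")
        case True
        then show ?thesis by (simp add: trivial_limit_def)
      next
        case False
        have "\<not> Collect (near R) \<subseteq> \<Union>(\<F> - {{}})" using no \<F> by blast
        then obtain p where "near R p" "p \<notin> \<Union>\<F>" by auto
        then have "principal {p} \<le> (INF A\<in>\<F>. ?I A)" by (intro INF_greatest) auto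
        then show ?thesis by (metis bot.extremum_uniqueI principal_eq_bot_iff insert_not_empty)
      qed
    qed
    then obtain F where F: "F \<le> (INF A\<in>insert {} \<A>. ?I A)" "ultrafilter F" by (rule ultrafilter_exists)
    have ev: "eventually (\<lambda>p. p \<in> Collect (near R) - A) F" if "A \<in> insert {} \<A>" for A
      using order_trans[OF F(1) INF_lower[OF that]] by (simp add: le_principal)
    have evR: "eventually (near R) F" using ev[of "{}"] by simp
    then have "eventually (near (max R 0)) F" by (rule eventually_mono) (auto intro: near_mono)
    then have arr: "F \<in> coarse_arrows X d" using F(2) by (auto simp: coarse_arrows_iff intro!: exI[of _ "max R 0"])
    then obtain W where W: "W \<in> \<U>" "F \<in> W" using \<U> evR by (auto simp: arrows_in_def)
    then obtain A where A: "eventually (\<lambda>p. p \<in> A) F"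
      "\<forall>F'\<in>coarse_arrows X d. eventually (\<lambda>p. p \<in> A) F' \<longrightarrow> F' \<in> W"
      using \<U> unfolding openin_arrow_top_iff by blast
    then have "A \<in> \<A>" using W unfolding \<A>_def by blast
    then have "eventually (\<lambda>p. p \<notin> A) F" using ev[of A] by (auto elim: eventually_mono)
    then show False using A(1) ultrafilter_eventually_not[OF F(2)] by blast
  qed
  then obtain \<F> where \<F>: "finite \<F>" "\<F> \<subseteq> \<A>" "Collect (near R) \<subseteq> \<Union>\<F>" by blast
  have "\<forall>A\<in>\<F>. \<exists>W. W \<in> \<U> \<and> (\<forall>F\<in>coarse_arrows X d. eventually (\<lambda>p. p \<in> A) F \<longrightarrow> F \<in> W)"
    using \<F> unfolding \<A>_def by blast
  from bchoice[OF this] obtain W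
    where W: "\<And>A. A \<in> \<F> \<Longrightarrow> W A \<in> \<U> \<and> (\<forall>F\<in>coarse_arrows X d. eventually (\<lambda>p. p \<in> A) F \<longrightarrow> F \<in> W A)" by blast
  have "arrows_in (near R) \<subseteq> \<Union>(W ` \<F>)"
  proof
    fix F assume F: "F \<in> arrows_in (near R)"
    then have U: "ultrafilter F" and arr: "F \<in> coarse_arrows X d" by (auto simp: arrows_in_def coarse_arrows_iff)
    have "eventually (\<lambda>p. \<exists>A\<in>\<F>. p \<in> A) F"
      using F \<F>(3) by (auto simp: arrows_in_def elim!: eventually_mono)
    then obtain A where "A \<in> \<F>" "eventually (\<lambda>p. p \<in> A) F"
      using ultrafilter_eventually_finite_Bex[OF U \<F>(1), of "\<lambda>A p. p \<in> A"] by blast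
    then show "F \<in> \<Union>(W ` \<F>)" using W arr by blast
  qed
  then show "\<exists>\<F>. finite \<F> \<and> \<F> \<subseteq> \<U> \<and> arrows_in (near R) \<subseteq> \<Union>\<F>"
    using \<F>(1) W by (intro exI[of _ "W ` \<F>"]) auto
qed

lemma principal_arrow: "x \<in> X \<Longrightarrow> y \<in> X \<Longrightarrow> principal {(x, y)} \<in> coarse_arrows X d"
  unfolding coarse_arrows_iff
  by (auto simp: ultrafilter_principal eventually_principal near_def intro!: exI[of _ "d x y"])

subsection \<open>Continuous compactly supported functions\<close>

definition controlled :: "('a \<times> 'a \<Rightarrow> 'b::{zero,metric_space}) \<Rightarrow> real \<Rightarrow> bool" where
  "controlled \<phi> R \<longleftrightarrow> R \<ge> 0 \<and> bounded (range \<phi>) \<and> (\<forall>p. \<phi> p \<noteq> 0 \<longrightarrow> near R p)"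

text \<open>The restriction to the arrows of the Stone--Cech extension of \<open>\<phi>\<close>; its
  values on principal arrows return \<open>\<phi>\<close>. The default value agrees with the
  normalization in \<open>Cc\<close>.\<close>

definition extend :: "('a \<times> 'a \<Rightarrow> 'b::{zero,t2_space}) \<Rightarrow> ('a \<times> 'a) filter \<Rightarrow> 'b" where
  "extend \<phi> F = (if F \<in> coarse_arrows X d then Lim F \<phi> else 0)"

definition diagonal :: "('a \<Rightarrow> 'b::zero) \<Rightarrow> 'a \<times> 'a \<Rightarrow> 'b" where
  "diagonal a = (\<lambda>(x, y). if x = y \<and> x \<in> X then a x else 0)"

lemma extend_principal: "x \<in> X \<Longrightarrow> y \<in> X \<Longrightarrow> extend \<phi> (principal {(x, y)}) = \<phi> (x, y)"
  unfolding extend_def by (simp add: principal_arrow Lim_principal)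

lemma extend_nonzero_near:
  "controlled \<phi> R \<Longrightarrow> extend \<phi> F \<noteq> 0 \<Longrightarrow> F \<in> arrows_in (near R)"
proof -
  assume \<phi>: "controlled \<phi> R" and nz: "extend \<phi> F \<noteq> 0"
  then have F: "F \<in> coarse_arrows X d" "Lim F \<phi> \<noteq> 0" by (auto simp: extend_def split: if_splits)
  then have "eventually (\<lambda>p. \<phi> p \<noteq> 0) F"
    by (intro Lim_nonzero_eventually) (auto simp: coarse_arrows_iff)
  then have "eventually (near R) F" using \<phi> by (auto simp: controlled_def elim: eventually_mono)
  then show "F \<in> arrows_in (near R)" using F by (simp add: arrows_in_def)
qed

lemma continuous_extend:
  fixes \<phi> :: "'a \<times> 'a \<Rightarrow> 'b::{zero,heine_borel}"
  assumes \<phi>: "bounded (range \<phi>)"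
  shows "continuous_map (arrow_top G) euclidean (extend \<phi>)"
  unfolding continuous_map_def
proof (intro conjI allI impI)
  fix V :: "'b set" assume "openin euclidean V"
  then have V: "open V" by simp
  show "openin (arrow_top G) {F \<in> topspace (arrow_top G). extend \<phi> F \<in> V}"
    unfolding openin_arrow_top_iff
  proof (intro conjI ballI)
    fix F assume "F \<in> {F \<in> topspace (arrow_top G). extend \<phi> F \<in> V}"
    then have F: "F \<in> coarse_arrows X d" "Lim F \<phi> \<in> V" by (auto simp: extend_def)
    then have U: "ultrafilter F" by (simp add: coarse_arrows_iff)
    \<comment> \<open>A closed ball is taken because limits along other ultrafilters stay in closed
      sets.\<close>
    obtain e where e: "e > 0" "cball (Lim F \<phi>) e \<subseteq> V" using V F(2) open_contains_cball by blast
    let ?A = "{p. \<phi> p \<in> cball (Lim F \<phi>) e}"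
    have "eventually (\<lambda>p. dist (\<phi> p) (Lim F \<phi>) < e) F"
      using ultrafilter_tendsto_Lim[OF U \<phi>] e(1) by (simp add: tendsto_iff)
    then have "eventually (\<lambda>p. p \<in> ?A) F" by (rule eventually_mono) (auto simp: dist_commute)
    moreover have "F' \<in> {F \<in> topspace (arrow_top G). extend \<phi> F \<in> V}"
      if F': "F' \<in> coarse_arrows X d" "eventually (\<lambda>p. p \<in> ?A) F'" for F'
    proof -
      have U': "ultrafilter F'" using F' by (simp add: coarse_arrows_iff)
      have "Lim F' \<phi> \<in> cball (Lim F \<phi>) e"
        by (rule Lim_in_closed_set[OF closed_cball _ ultrafilter_not_bot[OF U'] ultrafilter_tendsto_Lim[OF U' \<phi>]])
          (use F'(2) in simp)
      then show ?thesis using e(2) F'(1) by (auto simp: extend_def)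
    qed
    ultimately show "\<exists>A. eventually (\<lambda>p. p \<in> A) F \<and>
        (\<forall>F'\<in>coarse_arrows X d. eventually (\<lambda>p. p \<in> A) F' \<longrightarrow> F' \<in> {F \<in> topspace (arrow_top G). extend \<phi> F \<in> V})"
      by blast
  qed auto
qed auto

lemma extend_in_Cc:
  fixes \<phi> :: "'a \<times> 'a \<Rightarrow> 'b::{zero,heine_borel}"
  assumes \<phi>: "controlled \<phi> R"
  shows "extend \<phi> \<in> Cc G"
proof -
  have "{g. extend \<phi> g \<noteq> 0} \<subseteq> arrows_in (near R)" using extend_nonzero_near[OF \<phi>] by blast
  then have "(arrow_top G) closure_of {g. extend \<phi> g \<noteq> 0} \<subseteq> arrows_in (near R)"
    by (rule closure_of_minimal[OF _ closedin_arrows_in])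
  then have "compactin (arrow_top G) ((arrow_top G) closure_of {g. extend \<phi> g \<noteq> 0})"
    by (rule closed_compactin[OF compactin_arrows_near _ closedin_closure_of])
  then show ?thesis
    unfolding Cc_def using continuous_extend[of \<phi>] \<phi> by (auto simp: controlled_def extend_def)
qed

text \<open>The open sets \<open>arrows_in (near n)\<close> exhaust the groupoid, so compactness of
  the support yields one propagation bound. By continuity the value at an arrow is the limit along
  it of the values at principal arrows. The explicit formula for \<open>\<phi>\<close> is kept to
  identify diagonal kernels later.\<close>

lemma Cc_imp_extend:
  fixes f :: "('a \<times> 'a) filter \<Rightarrow> 'b::{zero,heine_borel}"
  assumes f: "f \<in> Cc G"
  shows "\<exists>\<phi> R. controlled \<phi> R \<and> f = extend \<phi> \<and> (\<forall>p. \<phi> p = (if p \<in> X \<times> X then f (principal {p}) else 0))"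
proof -
  define \<phi> where "\<phi> p = (if p \<in> X \<times> X then f (principal {p}) else 0)" for p
  have cont: "continuous_map (arrow_top G) euclidean f" and off: "\<And>g. g \<notin> coarse_arrows X d \<Longrightarrow> f g = 0"
    and comp: "compactin (arrow_top G) ((arrow_top G) closure_of {g. f g \<noteq> 0})" (is "compactin _ ?K")
    using f unfolding Cc_def by auto
  have supp: "{g. f g \<noteq> 0} \<subseteq> ?K" using off by (intro closure_of_subset) auto
  have "?K \<subseteq> \<Union>(range (\<lambda>n. arrows_in (near (real n))))"
  proof
    fix F assume "F \<in> ?K"
    then have F: "F \<in> coarse_arrows X d" using closure_of_subset_topspace by fastforce
    then obtain R where R: "eventually (near R) F" by (auto simp: coarse_arrows_iff)
    obtain n where "R \<le> real n" using real_arch_simple by blast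
    then have "eventually (near (real n)) F" using R by (auto elim: eventually_mono near_mono)
    then show "F \<in> \<Union>(range (\<lambda>n. arrows_in (near (real n))))" using F by (auto simp: arrows_in_def)
  qed
  then obtain \<F> where \<F>: "finite \<F>" "\<F> \<subseteq> range (\<lambda>n. arrows_in (near (real n)))" "?K \<subseteq> \<Union>\<F>"
    using comp openin_arrows_in unfolding compactin_def by (metis (no_types, lifting) imageE)
  then obtain I where I: "finite I" "\<F> = (\<lambda>n. arrows_in (near (real n))) ` I"
    using finite_subset_image[OF \<F>(1,2)] by blast
  define m where "m = (if I = {} then 0 else Max I)"
  have near_m: "near (real m) p" if "\<phi> p \<noteq> 0" for p
  proof -
    have "principal {p} \<in> ?K" using that supp unfolding \<phi>_def by (auto split: if_splits)
    then obtain n where "n \<in> I" "near (real n) p" using \<F>(3) I(2) by (auto simp: arrows_in_def eventually_principal)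
    moreover have "n \<le> m" using I(1) \<open>n \<in> I\<close> unfolding m_def by auto
    ultimately show ?thesis by (auto intro: near_mono)
  qed
  have "compactin euclidean (f ` ?K)" by (rule image_compactin[OF comp cont])
  then have "bounded (insert 0 (f ` ?K))" by (simp add: compact_imp_bounded)
  moreover have "range \<phi> \<subseteq> insert 0 (f ` ?K)"
    using supp unfolding \<phi>_def by (auto split: if_splits)
  ultimately have bdd: "bounded (range \<phi>)" by (rule bounded_subset)
  have "f F = extend \<phi> F" for F
  proof (cases "F \<in> coarse_arrows X d")
    case True
    then have U: "ultrafilter F" and "\<exists>R. eventually (near R) F" by (auto simp: coarse_arrows_iff)
    then obtain R where R: "eventually (near R) F" by blast
    have "(\<phi> \<longlongrightarrow> f F) F"
    proof (rule topological_tendstoI)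
      fix V assume V: "open V" "f F \<in> V"
      have "openin (arrow_top G) {g \<in> topspace (arrow_top G). f g \<in> V}"
        using cont V(1) unfolding continuous_map_def by auto
      then obtain A where A: "eventually (\<lambda>p. p \<in> A) F" "\<forall>F'\<in>coarse_arrows X d. eventually (\<lambda>p. p \<in> A) F' \<longrightarrow> f F' \<in> V"
        using True V(2) unfolding openin_arrow_top_iff by auto
      show "eventually (\<lambda>p. \<phi> p \<in> V) F"
        using A(1) R
      proof eventually_elim
        case (elim p)
        then have "p \<in> X \<times> X" by (auto simp: near_def)
        then show ?case using A(2) principal_arrow elim by (auto simp: \<phi>_def eventually_principal)
      qed
    qed
    then have "Lim F \<phi> = f F" by (rule tendsto_Lim[OF ultrafilter_not_bot[OF U]])
    then show ?thesis using True by (simp add: extend_def)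
  qed (simp add: extend_def off)
  then show ?thesis
    using near_m bdd by (intro exI[of _ \<phi>] exI[of _ "real m"]) (auto simp: controlled_def \<phi>_def)
qed

subsection \<open>The unit space\<close>

lemma gsource_eq: "gsource G F = filtermap (\<lambda>y. (y, y)) (filtermap snd F)"
  unfolding coarse_groupoid_def by (simp add: filtermap_filtermap case_prod_unfold)

lemma gsource_eq_iff: "gsource G F = gsource G F' \<longleftrightarrow> filtermap snd F = filtermap snd F'"
proof
  assume "gsource G F = gsource G F'"
  then have "filtermap fst (gsource G F) = filtermap fst (gsource G F')" by simp
  then show "filtermap snd F = filtermap snd F'" by (simp add: gsource_eq filtermap_filtermap)
qed (simp add: gsource_eq)

lemma unit_arrows_eq: "unit_arrows G = arrows_in (\<lambda>(x, y). x = y)"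
proof (intro equalityI subsetI)
  fix F assume "F \<in> unit_arrows G"
  then obtain g where g: "g \<in> coarse_arrows X d" "F = gsource G g" unfolding unit_arrows_def by auto
  then obtain R where R: "ultrafilter g" "eventually (near R) g" by (auto simp: coarse_arrows_iff)
  have "ultrafilter F" unfolding g(2) gsource_eq by (intro ultrafilter_filtermap R)
  moreover have "eventually (near 0) F"
    unfolding g(2) gsource_eq eventually_filtermap using R(2) by (auto simp: near_def elim!: eventually_mono)
  ultimately show "F \<in> arrows_in (\<lambda>(x, y). x = y)"
    unfolding arrows_in_def coarse_arrows_iff by (auto simp: g(2) gsource_eq eventually_filtermap)
next
  fix F assume F: "F \<in> arrows_in (\<lambda>(x, y). x = y)"
  then have "eventually (\<lambda>p. (snd p, snd p) = p) F" unfolding arrows_in_def by (auto elim!: eventually_mono)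
  then have "gsource G F = filtermap (\<lambda>p. p) F"
    unfolding gsource_eq filtermap_filtermap by (rule filtermap_cong_eventually)
  then show "F \<in> unit_arrows G" using F unfolding unit_arrows_def arrows_in_def by (auto intro!: image_eqI[of _ _ F])
qed

lemma controlled_diagonal:
  assumes "bounded (range a)" shows "controlled (diagonal a) 0"
proof -
  have "range (diagonal a) \<subseteq> insert 0 (range a)" by (auto simp: diagonal_def)
  moreover have "bounded (insert 0 (range a))" using assms by simp
  ultimately have "bounded (range (diagonal a))" by (rule bounded_subset[rotated])
  then show ?thesis unfolding controlled_def by (auto simp: diagonal_def near_def split: if_splits)
qed

lemma extend_diagonal_in_C_units:
  fixes a :: "'a \<Rightarrow> 'b::{zero,heine_borel}"
  assumes a: "bounded (range a)"
  shows "extend (diagonal a) \<in> C_units G"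
proof -
  have "bounded (range (diagonal a))" using controlled_diagonal[OF a] by (simp add: controlled_def)
  then have "continuous_map (subtopology (arrow_top G) (unit_arrows G)) euclidean (extend (diagonal a))"
    by (intro continuous_map_from_subtopology continuous_extend)
  moreover have "extend (diagonal a) g = 0" if "g \<notin> unit_arrows G" for g
  proof (rule ccontr)
    assume nz: "extend (diagonal a) g \<noteq> 0"
    then have g: "g \<in> coarse_arrows X d" by (auto simp: extend_def split: if_splits)
    then have "eventually (\<lambda>p. diagonal a p \<noteq> 0) g"
      using nz by (intro Lim_nonzero_eventually) (auto simp: extend_def coarse_arrows_iff)
    then have "eventually (\<lambda>(x, y). x = y) g" by (rule eventually_mono) (auto simp: diagonal_def split: if_splits)
    then show False using that g by (simp add: unit_arrows_eq arrows_in_def)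
  qed
  ultimately show ?thesis unfolding C_units_def by blast
qed

text \<open>The unit space is clopen and contained in a compact set, so extension by zero lands in
  \<open>Cc\<close>. The kernel then vanishes off the diagonal, where principal arrows are not
  units.\<close>

lemma C_units_imp_extend:
  fixes f :: "('a \<times> 'a) filter \<Rightarrow> 'b::{zero,heine_borel}"
  assumes f: "f \<in> C_units G"
  shows "\<exists>a. bounded (range a) \<and> f = extend (diagonal a)"
proof -
  have cont: "continuous_map (subtopology (arrow_top G) (unit_arrows G)) euclidean f"
    and off: "\<And>g. g \<notin> unit_arrows G \<Longrightarrow> f g = 0" using f unfolding C_units_def by auto
  have clopen: "openin (arrow_top G) (unit_arrows G)" "closedin (arrow_top G) (unit_arrows G)"
    "openin (arrow_top G) (coarse_arrows X d - unit_arrows G)"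
    unfolding unit_arrows_eq by (simp_all add: openin_arrows_in closedin_arrows_in flip: arrows_in_not)
  have "continuous_map (arrow_top G) euclidean f"
    unfolding continuous_map_def
  proof (intro conjI allI impI)
    fix V :: "'b set" assume V: "openin euclidean V"
    have 1: "openin (arrow_top G) {g \<in> unit_arrows G. f g \<in> V}"
    proof -
      have "openin (subtopology (arrow_top G) (unit_arrows G))
          {g \<in> topspace (subtopology (arrow_top G) (unit_arrows G)). f g \<in> V}"
        using cont V unfolding continuous_map_def by blast
      moreover have "topspace (subtopology (arrow_top G) (unit_arrows G)) = unit_arrows G"
        using clopen(1) openin_subset by fastforce
      ultimately show ?thesis using clopen(1) openin_trans_full by fastforce
    qed
    have "{g \<in> topspace (arrow_top G). f g \<in> V} =
        {g \<in> unit_arrows G. f g \<in> V} \<union> (if 0 \<in> V then coarse_arrows X d - unit_arrows G else {})"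
      using off openin_subset[OF clopen(1)] by auto metis
    then show "openin (arrow_top G) {g \<in> topspace (arrow_top G). f g \<in> V}"
      using 1 clopen(3) by (auto intro: openin_Un)
  qed auto
  moreover have "compactin (arrow_top G) ((arrow_top G) closure_of {g. f g \<noteq> 0})"
  proof (rule closed_compactin[OF compactin_arrows_near[of 0] _ closedin_closure_of])
    have "unit_arrows G \<subseteq> arrows_in (near 0)"
    proof
      fix F assume F: "F \<in> unit_arrows G"
      then obtain R where "eventually (near R) F" "eventually (\<lambda>(x, y). x = y) F"
        by (auto simp: unit_arrows_eq arrows_in_def coarse_arrows_iff)
      then have "eventually (near 0) F" by eventually_elim (auto simp: near_def)
      then show "F \<in> arrows_in (near 0)" using F by (auto simp: unit_arrows_eq arrows_in_def)
    qed
    then show "(arrow_top G) closure_of {g. f g \<noteq> 0} \<subseteq> arrows_in (near 0)"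
      using off by (intro closure_of_minimal[OF _ closedin_arrows_in]) blast
  qed
  ultimately have "f \<in> Cc G"
    unfolding Cc_def using off openin_subset[OF clopen(1)] by auto
  then obtain \<phi> R where \<phi>: "controlled \<phi> R" "f = extend \<phi>" "\<And>p. \<phi> p = (if p \<in> X \<times> X then f (principal {p}) else 0)"
    using Cc_imp_extend by blast
  have off_diag: "\<phi> (x, y) = 0" if "x \<noteq> y" for x y
    using \<phi>(3)[of "(x, y)"] off[of "principal {(x, y)}"] that
    by (auto simp: unit_arrows_eq arrows_in_def eventually_principal)
  have "\<phi> = diagonal (\<lambda>x. \<phi> (x, x))"
  proof
    fix p :: "'a \<times> 'a"
    obtain x y where p: "p = (x, y)" by (cases p)
    have "x \<notin> X \<Longrightarrow> \<phi> (x, x) = 0" using \<phi>(3)[of "(x, x)"] by simp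
    then show "\<phi> p = diagonal (\<lambda>x. \<phi> (x, x)) p"
      using off_diag[of x y] unfolding p diagonal_def by (cases "x = y") simp_all
  qed
  moreover have "bounded (range (\<lambda>x. \<phi> (x, x)))"
    using \<phi>(1) unfolding controlled_def by (auto intro: bounded_subset)
  ultimately show ?thesis using \<phi>(2) by metis
qed

end

section \<open>Fibres of the source map and convolution computed by limits along
  ultrafilters\<close>

subsection \<open>Arrows as germs of maps at ultrafilters\<close>

text \<open>An arrow with source \<open>u\<close> is the germ at \<open>u\<close> of a self-map of \<open>X\<close> at bounded distance from the
  identity. As \<open>u\<close> is an ultrafilter, two such germs are equal or eventually different.\<close>

definition germ :: "('a \<Rightarrow> 'a) \<Rightarrow> 'a filter \<Rightarrow> ('a \<times> 'a) filter" where
  "germ \<sigma> u = filtermap (\<lambda>y. (\<sigma> y, y)) u"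

lemma eventually_germ: "eventually P (germ \<sigma> u) \<longleftrightarrow> eventually (\<lambda>y. P (\<sigma> y, y)) u"
  by (simp add: germ_def eventually_filtermap)

lemma filtermap_snd_germ [simp]: "filtermap snd (germ \<sigma> u) = u"
  by (simp add: germ_def filtermap_filtermap)

lemma Lim_germ: "Lim (germ \<sigma> u) \<psi> = Lim u (\<lambda>y. \<psi> (\<sigma> y, y) :: 'b::t2_space)"
  by (simp add: germ_def Lim_filtermap)

lemma germ_eq_iff:
  "germ \<sigma> u = germ \<tau> u \<longleftrightarrow> eventually (\<lambda>y. \<sigma> y = \<tau> y) u"
proof
  assume eq: "germ \<sigma> u = germ \<tau> u"
  have "eventually (\<lambda>p. fst p = \<tau> (snd p)) (germ \<tau> u)" by (simp add: eventually_germ)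
  then show "eventually (\<lambda>y. \<sigma> y = \<tau> y) u" unfolding eq[symmetric] by (simp add: eventually_germ)
qed (auto simp: germ_def intro!: filtermap_cong_eventually elim: eventually_mono)

lemma eq_germI:
  assumes "eventually (\<lambda>p. fst p = \<sigma> (snd p)) g"
  shows "g = germ \<sigma> (filtermap snd g)"
proof -
  have "germ \<sigma> (filtermap snd g) = filtermap (\<lambda>p. (\<sigma> (snd p), snd p)) g"
    by (simp add: germ_def filtermap_filtermap)
  also have "\<dots> = filtermap (\<lambda>p. p) g"
    using assms by (intro filtermap_cong_eventually) (auto elim!: eventually_mono)
  finally show ?thesis by simp
qed

context coarse_space
begin

definition displacement :: "('a \<Rightarrow> 'a) \<Rightarrow> real \<Rightarrow> bool" where
  "displacement \<sigma> R \<longleftrightarrow> (\<forall>y\<in>X. \<sigma> y \<in> X \<and> d (\<sigma> y) y \<le> R)"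

text \<open>A selection of finitely many arrows \<open>(w, y)\<close> of the pair groupoid for each
  source \<open>y\<close>, with uniform bounds; in the limit it selects finitely many arrows over
  each unit.\<close>

definition thin :: "('a \<Rightarrow> 'a set) \<Rightarrow> real \<Rightarrow> nat \<Rightarrow> bool" where
  "thin B R N \<longleftrightarrow> (\<forall>y\<in>X. B y \<subseteq> X \<and> finite (B y) \<and> card (B y) \<le> N \<and> (\<forall>w\<in>B y. d w y \<le> R))"

text \<open>A point of the Stone--Cech compactification of \<open>X\<close> itself. Sources are
  compared through \<open>filtermap snd\<close>, which avoids carrying the diagonal around.\<close>

definition unit_ultrafilter :: "'a filter \<Rightarrow> bool" where
  "unit_ultrafilter u \<longleftrightarrow> ultrafilter u \<and> eventually (\<lambda>y. y \<in> X) u"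

lemma ball_card_bound:
  obtains N where "\<And>x. x \<in> X \<Longrightarrow> finite {w\<in>X. d x w \<le> R}" "\<And>x. x \<in> X \<Longrightarrow> card {w\<in>X. d x w \<le> R} \<le> N"
proof -
  have "max R 0 \<ge> 0" by simp
  then obtain N where N: "\<forall>x\<in>X. finite (mcball x (max R 0)) \<and> card (mcball x (max R 0)) \<le> N"
    using uniformly_locally_finite unfolding uniformly_locally_finite_def by blast
  have "{w\<in>X. d x w \<le> R} \<subseteq> mcball x (max R 0)" if "x \<in> X" for x using that by auto
  then show thesis using N by (intro that[of N]) (meson finite_subset card_mono order_trans)+
qed

lemma thin_displaced_ball:
  assumes N: "\<And>x. x \<in> X \<Longrightarrow> finite {w\<in>X. d x w \<le> R}" "\<And>x. x \<in> X \<Longrightarrow> card {w\<in>X. d x w \<le> R} \<le> N"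
    and \<sigma>: "displacement \<sigma> S"
  shows "thin (\<lambda>y. {w\<in>X. d (\<sigma> y) w \<le> R}) (R + S) N"
  unfolding thin_def
proof (intro ballI conjI)
  fix y w assume y: "y \<in> X" and w: "w \<in> {w\<in>X. d (\<sigma> y) w \<le> R}"
  then have "d w y \<le> d w (\<sigma> y) + d (\<sigma> y) y" using \<sigma> by (intro triangle) (auto simp: displacement_def)
  then show "d w y \<le> R + S" using w y \<sigma> by (auto simp: displacement_def commute[of w])
qed (use N \<sigma> in \<open>auto simp: displacement_def\<close>)

lemma thin_enumeration:
  assumes "thin B R N"
  shows "\<exists>e. (\<forall>k. displacement (e k) (max R 0)) \<and> (\<forall>y\<in>X. bij_betw (\<lambda>k. e k y) {..<card (B y)} (B y))"
proof -
  have "\<forall>y\<in>X. \<exists>h. bij_betw h {..<card (B y)} (B y)"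
    using assms ex_bij_betw_nat_finite unfolding thin_def atLeast0LessThan by blast
  from bchoice[OF this] obtain h where h: "\<forall>y\<in>X. bij_betw (h y) {..<card (B y)} (B y)" by blast
  \<comment> \<open>Beyond the size of \<open>B y\<close> the enumeration returns \<open>y\<close>,
    which keeps each \<open>e k\<close> a self-map of \<open>X\<close> of displacement at most
    \<open>max R 0\<close>.\<close>
  define e where "e k y = (if k < card (B y) then h y k else y)" for k y
  have "bij_betw (\<lambda>k. e k y) {..<card (B y)} (B y)" if "y \<in> X" for y
    using h that by (subst bij_betw_cong[where g = "h y"]) (auto simp: e_def)
  moreover have "displacement (e k) (max R 0)" for k
    unfolding displacement_def
  proof (intro ballI)
    fix y assume y: "y \<in> X"
    show "e k y \<in> X \<and> d (e k y) y \<le> max R 0"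
    proof (cases "k < card (B y)")
      case True
      then have "e k y \<in> B y" using h y unfolding e_def by (auto dest: bij_betwE)
      then show ?thesis using assms y unfolding thin_def by fastforce
    qed (use y in \<open>auto simp: e_def\<close>)
  qed
  ultimately show ?thesis by blast
qed

lemma unit_ultrafilter_source:
  assumes "g \<in> coarse_arrows X d" shows "unit_ultrafilter (filtermap snd g)"
proof -
  obtain R where "ultrafilter g" "eventually (near R) g" using assms by (auto simp: coarse_arrows_iff)
  then show ?thesis unfolding unit_ultrafilter_def
    by (auto simp: ultrafilter_filtermap eventually_filtermap near_def elim!: eventually_mono)
qed

lemma displaced_pair_arrow:
  assumes u: "unit_ultrafilter u" and "displacement \<sigma> S" "displacement \<tau> T"
  shows "filtermap (\<lambda>y. (\<sigma> y, \<tau> y)) u \<in> coarse_arrows X d"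
proof -
  have "near (max (S + T) 0) (\<sigma> y, \<tau> y)" if y: "y \<in> X" for y
  proof -
    have "d (\<sigma> y) (\<tau> y) \<le> d (\<sigma> y) y + d y (\<tau> y)"
      using assms y by (intro triangle) (auto simp: displacement_def)
    also have "\<dots> \<le> S + T" using assms y by (intro add_mono) (auto simp: displacement_def commute[of y])
    finally show ?thesis using assms y by (auto simp: near_def displacement_def)
  qed
  then have "eventually (near (max (S + T) 0)) (filtermap (\<lambda>y. (\<sigma> y, \<tau> y)) u)"
    using u unfolding unit_ultrafilter_def eventually_filtermap by (auto elim!: eventually_mono)
  then show ?thesis using u unfolding coarse_arrows_iff unit_ultrafilter_def
    by (auto simp: ultrafilter_filtermap intro!: exI[of _ "max (S + T) 0"])
qed

lemma germ_arrow: "unit_ultrafilter u \<Longrightarrow> displacement \<sigma> S \<Longrightarrow> germ \<sigma> u \<in> coarse_arrows X d"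
  using displaced_pair_arrow[of u \<sigma> S "\<lambda>y. y" 0] by (simp add: germ_def displacement_def)

text \<open>As \<open>card (B y)\<close> is bounded, it is equal to some \<open>n\<close> for \<open>u\<close>-almost all \<open>y\<close>; enumerating the sets
  \<open>B y\<close> gives the \<open>n\<close> germs.\<close>

lemma fibre:
  assumes u: "unit_ultrafilter u" and B: "thin B R N"
  obtains n e where "n \<le> N" "\<And>k. displacement (e k) (max R 0)" "inj_on (\<lambda>k. germ (e k) u) {..<n}"
    "{g \<in> coarse_arrows X d. filtermap snd g = u \<and> eventually (\<lambda>(w, y). w \<in> B y) g} = (\<lambda>k. germ (e k) u) ` {..<n}"
    "eventually (\<lambda>y. bij_betw (\<lambda>k. e k y) {..<n} (B y)) u"
proof -
  have U: "ultrafilter u" and evX: "eventually (\<lambda>y. y \<in> X) u" using u by (auto simp: unit_ultrafilter_def)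
  obtain e where e: "\<And>k. displacement (e k) (max R 0)"
    "\<And>y. y \<in> X \<Longrightarrow> bij_betw (\<lambda>k. e k y) {..<card (B y)} (B y)" using thin_enumeration[OF B] by blast
  have "eventually (\<lambda>y. \<exists>n\<in>{..N}. card (B y) = n) u"
    using evX by (rule eventually_mono) (use B in \<open>auto simp: thin_def\<close>)
  then obtain n where n: "n \<le> N" "eventually (\<lambda>y. card (B y) = n) u"
    using ultrafilter_eventually_finite_Bex[OF U, of "{..N}" "\<lambda>n y. card (B y) = n"] by auto
  have bij: "eventually (\<lambda>y. bij_betw (\<lambda>k. e k y) {..<n} (B y)) u"
    using evX n(2) by eventually_elim (use e(2) in auto)
  have "inj_on (\<lambda>k. germ (e k) u) {..<n}"
  proof (rule inj_onI)
    fix k l assume kl: "k \<in> {..<n}" "l \<in> {..<n}" "germ (e k) u = germ (e l) u"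
    then have "eventually (\<lambda>y. e k y = e l y) u" by (simp add: germ_eq_iff)
    with bij have "eventually (\<lambda>y. k = l) u"
      by eventually_elim (use kl in \<open>auto simp: bij_betw_def dest: inj_onD\<close>)
    then show "k = l" using U by (auto simp: ultrafilter_def)
  qed
  moreover have "{g \<in> coarse_arrows X d. filtermap snd g = u \<and> eventually (\<lambda>(w, y). w \<in> B y) g} = (\<lambda>k. germ (e k) u) ` {..<n}"
  proof (intro equalityI subsetI)
    fix g assume "g \<in> {g \<in> coarse_arrows X d. filtermap snd g = u \<and> eventually (\<lambda>(w, y). w \<in> B y) g}"
    then have g: "ultrafilter g" "filtermap snd g = u" "eventually (\<lambda>(w, y). w \<in> B y) g" by (auto simp: coarse_arrows_iff)
    have "eventually (\<lambda>p. bij_betw (\<lambda>k. e k (snd p)) {..<n} (B (snd p))) g"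
      using bij unfolding g(2)[symmetric] by (simp add: eventually_filtermap)
    with g(3) have "eventually (\<lambda>p. \<exists>k\<in>{..<n}. fst p = e k (snd p)) g"
      by eventually_elim (auto simp: bij_betw_def)
    then obtain k where k: "k < n" "eventually (\<lambda>p. fst p = e k (snd p)) g"
      using ultrafilter_eventually_finite_Bex[OF g(1), of "{..<n}" "\<lambda>k p. fst p = e k (snd p)"] by auto
    then show "g \<in> (\<lambda>k. germ (e k) u) ` {..<n}" using eq_germI[OF k(2)] g(2) by auto
  next
    fix g assume "g \<in> (\<lambda>k. germ (e k) u) ` {..<n}"
    then obtain k where k: "k < n" "g = germ (e k) u" by auto
    have "eventually (\<lambda>y. e k y \<in> B y) u" using bij by (rule eventually_mono) (use k in \<open>auto simp: bij_betw_def\<close>)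
    then show "g \<in> {g \<in> coarse_arrows X d. filtermap snd g = u \<and> eventually (\<lambda>(w, y). w \<in> B y) g}"
      using k germ_arrow[OF u e(1)] by (auto simp: eventually_germ)
  qed
  ultimately show thesis using that n(1) e(1) bij by blast
qed

lemma fibre_finite:
  assumes u: "unit_ultrafilter u" and B: "thin B R N"
  shows "finite {g \<in> coarse_arrows X d. filtermap snd g = u \<and> eventually (\<lambda>(w, y). w \<in> B y) g}"
    and "card {g \<in> coarse_arrows X d. filtermap snd g = u \<and> eventually (\<lambda>(w, y). w \<in> B y) g} \<le> N"
proof -
  obtain n e where ne: "n \<le> N" "\<And>k. displacement (e k) (max R 0)" "inj_on (\<lambda>k. germ (e k) u) {..<n}"
    "{g \<in> coarse_arrows X d. filtermap snd g = u \<and> eventually (\<lambda>(w, y). w \<in> B y) g} = (\<lambda>k. germ (e k) u) ` {..<n}"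
    by (rule fibre[OF assms]) blast
  show "finite {g \<in> coarse_arrows X d. filtermap snd g = u \<and> eventually (\<lambda>(w, y). w \<in> B y) g}"
    unfolding ne(4) by simp
  show "card {g \<in> coarse_arrows X d. filtermap snd g = u \<and> eventually (\<lambda>(w, y). w \<in> B y) g} \<le> N"
    unfolding ne(4) using ne(1) by (simp add: card_image[OF ne(3)])
qed

text \<open>Limits along an ultrafilter commute with the sum over the constant number of germs in
  the fibre. Both convolution and the push-forward along the source map are transferred to
  \<open>X\<close> by this formula.\<close>

lemma sum_fibre:
  fixes \<psi> :: "'a \<times> 'a \<Rightarrow> 'b::{heine_borel,topological_comm_monoid_add}"
  assumes u: "unit_ultrafilter u" and B: "thin B R N" and \<psi>: "bounded (range \<psi>)"
  shows "(\<Sum>g | g \<in> coarse_arrows X d \<and> filtermap snd g = u \<and> eventually (\<lambda>(w, y). w \<in> B y) g. Lim g \<psi>)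
    = Lim u (\<lambda>y. \<Sum>w\<in>B y. \<psi> (w, y))"
proof -
  have U: "ultrafilter u" using u by (simp add: unit_ultrafilter_def)
  obtain n e where ne: "n \<le> N" "\<And>k. displacement (e k) (max R 0)" "inj_on (\<lambda>k. germ (e k) u) {..<n}"
    "{g \<in> coarse_arrows X d. filtermap snd g = u \<and> eventually (\<lambda>(w, y). w \<in> B y) g} = (\<lambda>k. germ (e k) u) ` {..<n}"
    "eventually (\<lambda>y. bij_betw (\<lambda>k. e k y) {..<n} (B y)) u"
    by (rule fibre[OF u B]) blast
  have "(\<Sum>g | g \<in> coarse_arrows X d \<and> filtermap snd g = u \<and> eventually (\<lambda>(w, y). w \<in> B y) g. Lim g \<psi>)
      = (\<Sum>k<n. Lim u (\<lambda>y. \<psi> (e k y, y)))"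
    unfolding ne(4) by (simp add: sum.reindex[OF ne(3)] Lim_germ)
  also have "\<dots> = Lim u (\<lambda>y. \<Sum>k<n. \<psi> (e k y, y))"
  proof (rule tendsto_Lim[OF ultrafilter_not_bot[OF U], symmetric], rule tendsto_sum)
    show "((\<lambda>y. \<psi> (e k y, y)) \<longlongrightarrow> Lim u (\<lambda>y. \<psi> (e k y, y))) u" for k
      by (rule ultrafilter_tendsto_Lim[OF U]) (use \<psi> in \<open>auto intro: bounded_subset\<close>)
  qed
  also have "\<dots> = Lim u (\<lambda>y. \<Sum>w\<in>B y. \<psi> (w, y))"
    using ne(5) by (intro Lim_cong_eventually) (auto elim!: eventually_mono simp: sum.reindex_bij_betw[where g = "\<lambda>w. \<psi> (w, _)"])
  finally show ?thesis .
qed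

text \<open>An arrow concentrated on \<open>near R\<close> belongs to the fibre of the balls of
  radius \<open>R\<close>, and that fibre consists of germs.\<close>

lemma arrow_germ:
  assumes g: "g \<in> coarse_arrows X d"
  obtains \<sigma> S where "displacement \<sigma> S" "g = germ \<sigma> (filtermap snd g)"
proof -
  obtain R where R: "eventually (near R) g" using g by (auto simp: coarse_arrows_iff)
  obtain N where N: "\<And>x. x \<in> X \<Longrightarrow> finite {w\<in>X. d x w \<le> R}" "\<And>x. x \<in> X \<Longrightarrow> card {w\<in>X. d x w \<le> R} \<le> N"
    using ball_card_bound by metis
  have B: "thin (\<lambda>y. {w\<in>X. d y w \<le> R}) (R + 0) N"
    using thin_displaced_ball[OF N, of "\<lambda>y. y" 0] by (simp add: displacement_def)
  have "eventually (\<lambda>(w, y). w \<in> {w\<in>X. d y w \<le> R}) g"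
    using R by (auto simp: near_def commute elim!: eventually_mono)
  moreover obtain n e where ne: "n \<le> N" "\<And>k. displacement (e k) (max (R + 0) 0)"
    "{h \<in> coarse_arrows X d. filtermap snd h = filtermap snd g \<and> eventually (\<lambda>(w, y). w \<in> {w\<in>X. d y w \<le> R}) h}
      = (\<lambda>k. germ (e k) (filtermap snd g)) ` {..<n}"
    by (rule fibre[OF unit_ultrafilter_source[OF g] B]) blast
  ultimately have "g \<in> (\<lambda>k. germ (e k) (filtermap snd g)) ` {..<n}" using g by blast
  then show thesis using that ne(2) by blast
qed

text \<open>The restriction to composable pairs forces both factors to be evaluated at the same
  middle point \<open>y\<close>. The quotient is therefore the image of \<open>u\<close> alone under
  a map to pairs, with no product filter left.\<close>

lemma gmult_ginv_germ: "gmult G (germ \<sigma> u) (ginv G (germ \<tau> u)) = filtermap (\<lambda>y. (\<sigma> y, \<tau> y)) u"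
proof -
  let ?C = "{((x, y), (y', z)) | x y y' z. y = y'}"
  have inv: "ginv G (germ \<tau> u) = filtermap (\<lambda>y. (y, \<tau> y)) u"
    unfolding coarse_groupoid_def by (simp add: germ_def filtermap_filtermap)
  have "eventually P (filtermap (\<lambda>((x, y), (y', z)). (x, z)) (inf (germ \<sigma> u \<times>\<^sub>F filtermap (\<lambda>y. (y, \<tau> y)) u) (principal ?C)))
      \<longleftrightarrow> eventually P (filtermap (\<lambda>y. (\<sigma> y, \<tau> y)) u)" (is "?L \<longleftrightarrow> ?R") for P
  proof
    assume ?L
    then obtain Pf Pg where P: "eventually Pf (germ \<sigma> u)" "eventually Pg (filtermap (\<lambda>y. (y, \<tau> y)) u)"
      "\<And>x y z. Pf (x, y) \<Longrightarrow> Pg (y, z) \<Longrightarrow> P (x, z)"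
      unfolding eventually_filtermap[where F = "inf _ _"] eventually_inf_principal eventually_prod_filter by fastforce
    have "eventually (\<lambda>y. Pf (\<sigma> y, y)) u" "eventually (\<lambda>y. Pg (y, \<tau> y)) u"
      using P(1,2) by (simp_all add: eventually_germ eventually_filtermap)
    then have "eventually (\<lambda>y. P (\<sigma> y, \<tau> y)) u"
      by eventually_elim (use P(3) in fastforce)
    then show ?R by (simp add: eventually_filtermap)
  next
    assume ?R
    then have R: "eventually (\<lambda>y. P (\<sigma> y, \<tau> y)) u" by (simp add: eventually_filtermap)
    show ?L
      unfolding eventually_filtermap eventually_inf_principal eventually_prod_filter
      \<comment> \<open>The two events are the graphs of the maps, the first intersected with the
        event \<open>P\<close>; a common middle point determines both end points.\<close>
      by (rule exI[of _ "\<lambda>p. fst p = \<sigma> (snd p) \<and> P (\<sigma> (snd p), \<tau> (snd p))"],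
          rule exI[of _ "\<lambda>q. snd q = \<tau> (fst q)"])
        (use R in \<open>auto simp: eventually_germ eventually_filtermap\<close>)
  qed
  then show ?thesis unfolding inv by (simp add: coarse_groupoid_def filter_eq_iff)
qed

subsection \<open>Convolution operators\<close>

text \<open>The matrix of the left regular representation in the basis of arrows. It is block
  diagonal, one block for each source.\<close>

definition kern :: "('a \<times> 'a \<Rightarrow> complex) \<Rightarrow> ('a \<times> 'a) filter \<Rightarrow> ('a \<times> 'a) filter \<Rightarrow> complex" where
  "kern \<phi> g h = (if g \<in> coarse_arrows X d \<and> h \<in> coarse_arrows X d \<and> filtermap snd g = filtermap snd h
     then extend \<phi> (gmult G g (ginv G h)) else 0)"

abbreviation op :: "('a \<times> 'a \<Rightarrow> complex) \<Rightarrow> ('a \<times> 'a) filter operator" where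
  "op \<phi> \<equiv> conv_op G (extend \<phi>)"

text \<open>Every later statement about operators on arrows is reduced by this formula to the values
  of \<open>\<phi>\<close> near the ultrafilter \<open>u\<close>.\<close>

lemma kern_germ:
  assumes "unit_ultrafilter u" "displacement \<sigma> S" "displacement \<tau> T"
  shows "kern \<phi> (germ \<sigma> u) (germ \<tau> u) = Lim u (\<lambda>y. \<phi> (\<sigma> y, \<tau> y))"
  using displaced_pair_arrow[OF assms] germ_arrow[OF assms(1,2)] germ_arrow[OF assms(1,3)]
  by (simp add: kern_def gmult_ginv_germ extend_def Lim_filtermap)

lemma kern_nonzeroD:
  assumes "kern \<phi> g h \<noteq> 0"
  shows "g \<in> coarse_arrows X d" "h \<in> coarse_arrows X d" "filtermap snd g = filtermap snd h"
  using assms by (auto simp: kern_def split: if_splits)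

lemma kern_cases:
  assumes "g \<in> coarse_arrows X d" "h \<in> coarse_arrows X d" "filtermap snd g = filtermap snd h"
  obtains \<sigma> S \<tau> T u where "unit_ultrafilter u" "displacement \<sigma> S" "displacement \<tau> T" "g = germ \<sigma> u" "h = germ \<tau> u"
proof -
  obtain \<sigma> S where "displacement \<sigma> S" "g = germ \<sigma> (filtermap snd g)" by (rule arrow_germ[OF assms(1)])
  moreover obtain \<tau> T where "displacement \<tau> T" "h = germ \<tau> (filtermap snd h)" by (rule arrow_germ[OF assms(2)])
  ultimately show thesis using that[OF unit_ultrafilter_source[OF assms(1)]] assms(3) by metis
qed

lemma kern_row_subset:
  assumes \<phi>: "controlled \<phi> R" and u: "unit_ultrafilter u" and \<sigma>: "displacement \<sigma> S"
  shows "{h. kern \<phi> (germ \<sigma> u) h \<noteq> 0}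
    \<subseteq> {h \<in> coarse_arrows X d. filtermap snd h = u \<and> eventually (\<lambda>(w, y). w \<in> {w\<in>X. d (\<sigma> y) w \<le> R}) h}"
proof
  fix h assume "h \<in> {h. kern \<phi> (germ \<sigma> u) h \<noteq> 0}"
  then have nz: "kern \<phi> (germ \<sigma> u) h \<noteq> 0" by simp
  note h = kern_nonzeroD[OF nz]
  obtain \<tau> T where \<tau>: "displacement \<tau> T" "h = germ \<tau> (filtermap snd h)" by (rule arrow_germ[OF h(2)])
  then have h': "h = germ \<tau> u" using h(3) by simp
  have "Lim u (\<lambda>y. \<phi> (\<sigma> y, \<tau> y)) \<noteq> 0" using nz unfolding h' kern_germ[OF u \<sigma> \<tau>(1)] .
  then have "eventually (\<lambda>y. \<phi> (\<sigma> y, \<tau> y) \<noteq> 0) u" using u by (intro Lim_nonzero_eventually) (simp_all add: unit_ultrafilter_def)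
  then have "eventually (\<lambda>y. \<tau> y \<in> {w\<in>X. d (\<sigma> y) w \<le> R}) u"
    by (rule eventually_mono) (use \<phi> in \<open>auto simp: controlled_def near_def\<close>)
  then show "h \<in> {h \<in> coarse_arrows X d. filtermap snd h = u \<and> eventually (\<lambda>(w, y). w \<in> {w\<in>X. d (\<sigma> y) w \<le> R}) h}"
    using h by (simp add: h' eventually_germ)
qed

text \<open>Lets bounds for columns be read off from bounds for rows.\<close>

lemma kern_flip: "kern (\<lambda>(x, y). \<phi> (y, x)) g h = kern \<phi> h g"
proof (cases "g \<in> coarse_arrows X d \<and> h \<in> coarse_arrows X d \<and> filtermap snd g = filtermap snd h")
  case True
  then obtain \<sigma> S \<tau> T u where *: "unit_ultrafilter u" "displacement \<sigma> S" "displacement \<tau> T" "g = germ \<sigma> u" "h = germ \<tau> u"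
    using kern_cases by metis
  show ?thesis unfolding * using *(1-3) by (simp add: kern_germ)
qed (auto simp: kern_def)

lemma near_flip: "near R (x, y) \<Longrightarrow> near R (y, x)"
  by (simp add: near_def commute)

lemma controlled_flip: "controlled \<phi> R \<Longrightarrow> controlled (\<lambda>(x, y). \<phi> (y, x)) R"
  unfolding controlled_def
proof (elim conjE, intro conjI)
  assume "bounded (range \<phi>)"
  then show "bounded (range (\<lambda>(x, y). \<phi> (y, x)))" by (rule bounded_subset) auto
qed (auto intro: near_flip)

lemma kern_row_card:
  assumes \<phi>: "controlled \<phi> R"
    and N: "\<And>x. x \<in> X \<Longrightarrow> finite {w\<in>X. d x w \<le> R}" "\<And>x. x \<in> X \<Longrightarrow> card {w\<in>X. d x w \<le> R} \<le> N"
  shows "finite {h. kern \<phi> g h \<noteq> 0} \<and> card {h. kern \<phi> g h \<noteq> 0} \<le> N"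
proof (cases "g \<in> coarse_arrows X d")
  case True
  obtain \<sigma> S where \<sigma>: "displacement \<sigma> S" "g = germ \<sigma> (filtermap snd g)" by (rule arrow_germ[OF True])
  note u = unit_ultrafilter_source[OF True]
  have sub: "{h. kern \<phi> g h \<noteq> 0} \<subseteq> {h \<in> coarse_arrows X d. filtermap snd h = filtermap snd g \<and>
      eventually (\<lambda>(w, y). w \<in> {w\<in>X. d (\<sigma> y) w \<le> R}) h}"
    using kern_row_subset[OF \<phi> u \<sigma>(1)] \<sigma>(2) by simp
  note fin = fibre_finite[OF u thin_displaced_ball[OF N \<sigma>(1)]]
  show ?thesis
    using finite_subset[OF sub fin(1)] order_trans[OF card_mono[OF fin(1) sub] fin(2)] by blast
next
  case False
  then show ?thesis by (simp add: kern_def)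
qed

lemma extend_bound:
  assumes "\<And>p. norm (\<phi> p) \<le> M" "0 \<le> M"
  shows "norm (extend \<phi> F :: 'b::{real_normed_vector,heine_borel}) \<le> M"
proof (cases "F \<in> coarse_arrows X d")
  case True
  then have U: "ultrafilter F" by (simp add: coarse_arrows_iff)
  have "bounded (range \<phi>)" unfolding bounded_iff using assms by auto
  then have "Lim F \<phi> \<in> cball 0 M"
    by (intro Lim_in_closed_set[OF closed_cball _ ultrafilter_not_bot[OF U] ultrafilter_tendsto_Lim[OF U]])
      (use assms in auto)
  then show ?thesis using True by (simp add: extend_def)
qed (use assms in \<open>simp add: extend_def\<close>)

lemma controlled_bound:
  fixes \<phi> :: "'a \<times> 'a \<Rightarrow> 'b::real_normed_vector"
  assumes "controlled \<phi> R" obtains M where "M \<ge> 0" "\<And>p. norm (\<phi> p) \<le> M"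
proof -
  obtain M where M: "\<And>p. norm (\<phi> p) \<le> M" using assms unfolding controlled_def bounded_iff by auto
  moreover have "M \<ge> 0" using order_trans[OF norm_ge_zero M] .
  ultimately show thesis using that by blast
qed

lemma banded_kern:
  assumes \<phi>: "controlled \<phi> R"
  shows "banded (kern \<phi>)"
proof -
  obtain N where N: "\<And>x. x \<in> X \<Longrightarrow> finite {w\<in>X. d x w \<le> R}" "\<And>x. x \<in> X \<Longrightarrow> card {w\<in>X. d x w \<le> R} \<le> N"
    using ball_card_bound by metis
  obtain M where M: "M \<ge> 0" "\<And>p. norm (\<phi> p) \<le> M" using controlled_bound[OF \<phi>] by metis
  have "cmod (kern \<phi> g h) \<le> M" for g h
    using M extend_bound[of \<phi> M] by (simp add: kern_def)
  moreover have "finite {g. kern \<phi> g h \<noteq> 0} \<and> card {g. kern \<phi> g h \<noteq> 0} \<le> N" for h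
    using kern_row_card[OF controlled_flip[OF \<phi>] N, of h] unfolding kern_flip .
  ultimately show ?thesis unfolding banded_def using kern_row_card[OF \<phi> N] by blast
qed

text \<open>Gives content to the definite description \<open>conv_op\<close>: the infinite sum over
  a fibre has finitely many nonzero terms, so the banded kernel provides the operator, and the
  prescribed coordinates determine it.\<close>

lemma op_eq_kernel_op:
  assumes \<phi>: "controlled \<phi> R"
  shows "op \<phi> = kernel_op (kern \<phi>)"
  unfolding conv_op_def
proof (rule the_equality)
  note b = banded_kern[OF \<phi>]
  have eq: "coord (kernel_op (kern \<phi>) \<xi>) g = (if g \<in> arrows G
      then \<Sum>\<^sub>\<infinity>h | h \<in> arrows G \<and> gsource G h = gsource G g. extend \<phi> (gmult G g (ginv G h)) * coord \<xi> h
      else 0)" for \<xi> g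
  proof (cases "g \<in> coarse_arrows X d")
    case True
    have "(\<Sum>\<^sub>\<infinity>h | h \<in> arrows G \<and> gsource G h = gsource G g. extend \<phi> (gmult G g (ginv G h)) * coord \<xi> h)
        = infsum (\<lambda>h. kern \<phi> g h * coord \<xi> h) {h. kern \<phi> g h \<noteq> 0}"
    proof (rule infsum_cong_neutral)
      fix h assume "h \<in> {h. kern \<phi> g h \<noteq> 0} - {h \<in> arrows G. gsource G h = gsource G g}"
      then show "kern \<phi> g h * coord \<xi> h = 0" using kern_nonzeroD[of \<phi> g h] by (simp add: gsource_eq_iff)
    qed (use True in \<open>auto simp: kern_def gsource_eq_iff\<close>)
    also have "\<dots> = coord (kernel_op (kern \<phi>) \<xi>) g"
      using banded_finite_row[OF b] by (simp add: coord_kernel_op[OF b])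
    finally show ?thesis using True by simp
  next
    case False
    then show ?thesis by (simp add: coord_kernel_op[OF b]) (simp add: kern_def)
  qed
  then show "\<forall>\<xi> g. coord (kernel_op (kern \<phi>) \<xi>) g = (if g \<in> arrows G
      then \<Sum>\<^sub>\<infinity>h | h \<in> arrows G \<and> gsource G h = gsource G g. extend \<phi> (gmult G g (ginv G h)) * coord \<xi> h
      else 0)" by blast
  fix T :: "('a \<times> 'a) filter operator" assume T: "\<forall>\<xi> g. coord (T \<xi>) g = (if g \<in> arrows G
      then \<Sum>\<^sub>\<infinity>h | h \<in> arrows G \<and> gsource G h = gsource G g. extend \<phi> (gmult G g (ginv G h)) * coord \<xi> h
      else 0)"
  show "T = kernel_op (kern \<phi>)"
    by (intro blinfun_eqI coord_eqI) (simp only: T[rule_format] eq)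
qed

lemma controlled_add:
  fixes \<phi> :: "'a \<times> 'a \<Rightarrow> 'b::real_normed_vector"
  assumes "controlled \<phi> R" "controlled \<psi> S"
  shows "controlled (\<lambda>p. \<phi> p + \<psi> p) (max R S)"
proof -
  obtain M where M: "\<And>p. norm (\<phi> p) \<le> M" using controlled_bound[OF assms(1)] by metis
  obtain M' where M': "\<And>p. norm (\<psi> p) \<le> M'" using controlled_bound[OF assms(2)] by metis
  have "bounded (range (\<lambda>p. \<phi> p + \<psi> p))"
    unfolding bounded_iff by (rule exI[of _ "M + M'"]) (auto intro!: norm_triangle_le add_mono M M')
  moreover have "near (max R S) p" if "\<phi> p + \<psi> p \<noteq> 0" for p
  proof -
    have "\<phi> p \<noteq> 0 \<or> \<psi> p \<noteq> 0" using that by auto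
    then have "near R p \<or> near S p" using assms unfolding controlled_def by blast
    then show ?thesis using near_mono[of R p "max R S"] near_mono[of S p "max R S"] by auto
  qed
  ultimately show ?thesis using assms by (auto simp: controlled_def)
qed

lemma op_add:
  assumes \<phi>: "controlled \<phi> R" and \<psi>: "controlled \<psi> S"
  shows "op (\<lambda>p. \<phi> p + \<psi> p) = op \<phi> + op \<psi>"
proof -
  have "extend (\<lambda>p. \<phi> p + \<psi> p) F = extend \<phi> F + extend \<psi> F" for F
  proof (cases "F \<in> coarse_arrows X d")
    case True
    then have U: "ultrafilter F" by (simp add: coarse_arrows_iff)
    have "Lim F (\<lambda>p. \<phi> p + \<psi> p) = Lim F \<phi> + Lim F \<psi>"
      using \<phi> \<psi> by (intro tendsto_Lim[OF ultrafilter_not_bot[OF U]] tendsto_add ultrafilter_tendsto_Lim[OF U])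
        (simp_all add: controlled_def)
    then show ?thesis using True by (simp add: extend_def)
  qed (simp add: extend_def)
  then have "kern (\<lambda>p. \<phi> p + \<psi> p) = (\<lambda>g h. kern \<phi> g h + kern \<psi> g h)"
    by (intro ext) (simp add: kern_def)
  then show ?thesis
    using kernel_op_add[OF banded_kern[OF \<phi>] banded_kern[OF \<psi>]] banded_kern[OF controlled_add[OF \<phi> \<psi>]]
    by (simp add: op_eq_kernel_op[OF \<phi>] op_eq_kernel_op[OF \<psi>] op_eq_kernel_op[OF controlled_add[OF \<phi> \<psi>]])
qed

definition conv :: "('a \<times> 'a \<Rightarrow> complex) \<Rightarrow> ('a \<times> 'a \<Rightarrow> complex) \<Rightarrow> 'a \<times> 'a \<Rightarrow> complex" where
  "conv \<phi> \<psi> = (\<lambda>(x, z). \<Sum>w | w \<in> X \<and> \<phi> (x, w) \<noteq> 0. \<phi> (x, w) * \<psi> (w, z))"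

lemma controlled_row:
  assumes "controlled \<phi> R" shows "{w. w \<in> X \<and> \<phi> (x, w) \<noteq> 0} \<subseteq> {w\<in>X. d x w \<le> R}"
  using assms by (auto simp: controlled_def near_def)

lemma controlled_row_finite:
  assumes "controlled \<phi> R" shows "finite {w. w \<in> X \<and> \<phi> (x, w) \<noteq> 0}"
proof (cases "x \<in> X")
  case True
  then show ?thesis using finite_subset[OF controlled_row[OF assms]] ball_card_bound by metis
next
  case False
  then have "{w. w \<in> X \<and> \<phi> (x, w) \<noteq> 0} = {}" using assms by (auto simp: controlled_def near_def)
  then show ?thesis by (simp only: finite.emptyI)
qed

lemma controlled_conv:
  assumes \<phi>: "controlled \<phi> R" and \<psi>: "controlled \<psi> S"
  shows "controlled (conv \<phi> \<psi>) (R + S)"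
proof -
  obtain N where N: "\<And>x. x \<in> X \<Longrightarrow> finite {w\<in>X. d x w \<le> R}" "\<And>x. x \<in> X \<Longrightarrow> card {w\<in>X. d x w \<le> R} \<le> N"
    using ball_card_bound by metis
  obtain M where M: "M \<ge> 0" "\<And>p. norm (\<phi> p) \<le> M" using controlled_bound[OF \<phi>] by metis
  obtain M' where M': "M' \<ge> 0" "\<And>p. norm (\<psi> p) \<le> M'" using controlled_bound[OF \<psi>] by metis
  have nz: "\<exists>w\<in>X. \<phi> (x, w) \<noteq> 0 \<and> \<psi> (w, z) \<noteq> 0" if "conv \<phi> \<psi> (x, z) \<noteq> 0" for x z
  proof -
    have "(\<Sum>w | w \<in> X \<and> \<phi> (x, w) \<noteq> 0. \<phi> (x, w) * \<psi> (w, z)) \<noteq> 0" using that by (simp add: conv_def)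
    then obtain w where "w \<in> {w. w \<in> X \<and> \<phi> (x, w) \<noteq> 0}" "\<phi> (x, w) * \<psi> (w, z) \<noteq> 0"
      by (rule sum.not_neutral_contains_not_neutral)
    then show ?thesis by auto
  qed
  have "near (R + S) (x, z)" if xz: "conv \<phi> \<psi> (x, z) \<noteq> 0" for x z
  proof -
    obtain w where w: "w \<in> X" "\<phi> (x, w) \<noteq> 0" "\<psi> (w, z) \<noteq> 0" using nz[OF xz] by blast
    then have "near R (x, w)" "near S (w, z)" using \<phi> \<psi> by (auto simp: controlled_def)
    then show ?thesis using triangle[of x w z] by (auto simp: near_def)
  qed
  moreover have "norm (conv \<phi> \<psi> (x, z)) \<le> real N * (M * M')" for x z
  proof (cases "x \<in> X")
    case True
    have "norm (conv \<phi> \<psi> (x, z)) \<le> (\<Sum>w | w \<in> X \<and> \<phi> (x, w) \<noteq> 0. M * M')"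
      unfolding conv_def prod.case
      by (rule sum_norm_le) (auto simp: norm_mult intro!: mult_mono M M')
    also have "\<dots> = real (card {w. w \<in> X \<and> \<phi> (x, w) \<noteq> 0}) * (M * M')" by simp
    also have "\<dots> \<le> real N * (M * M')"
      using order_trans[OF card_mono[OF N(1)[OF True] controlled_row[OF \<phi>]] N(2)[OF True]] M(1) M'(1)
      by (intro mult_right_mono) auto
    finally show ?thesis .
  next
    case False
    then have "conv \<phi> \<psi> (x, z) = 0" using nz[of x z] \<phi> by (auto simp: controlled_def near_def)
    then show ?thesis using M M' by simp
  qed
  then have "bounded (range (conv \<phi> \<psi>))" unfolding bounded_iff by (intro exI[of _ "real N * (M * M')"]) auto
  ultimately show ?thesis using \<phi> \<psi> by (auto simp: controlled_def)
qed

text \<open>Over germs at \<open>u\<close> a product of kernel entries is a product of limits, hence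
  a limit of products. Summing over the intermediate arrows with \<open>sum_fibre\<close> gives the
  limit of the matrix product on \<open>X\<close>.\<close>

lemma kern_conv:
  assumes \<phi>: "controlled \<phi> R" and \<psi>: "controlled \<psi> S"
  shows "kern (conv \<phi> \<psi>) g k = (\<Sum>h | kern \<phi> g h \<noteq> 0. kern \<phi> g h * kern \<psi> h k)"
proof (cases "g \<in> coarse_arrows X d \<and> k \<in> coarse_arrows X d \<and> filtermap snd g = filtermap snd k")
  case True
  then obtain \<sigma> S' \<kappa> T u where *: "unit_ultrafilter u" "displacement \<sigma> S'" "displacement \<kappa> T" "g = germ \<sigma> u" "k = germ \<kappa> u"
    using kern_cases by metis
  have U: "ultrafilter u" using *(1) by (simp add: unit_ultrafilter_def)
  obtain N where N: "\<And>x. x \<in> X \<Longrightarrow> finite {w\<in>X. d x w \<le> R}" "\<And>x. x \<in> X \<Longrightarrow> card {w\<in>X. d x w \<le> R} \<le> N"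
    using ball_card_bound by metis
  note B = thin_displaced_ball[OF N *(2)]
  \<comment> \<open>A fibre that contains the support of the row but is described by balls of fixed
    radius, so that \<open>sum_fibre\<close> applies to it.\<close>
  let ?F = "{h \<in> coarse_arrows X d. filtermap snd h = u \<and> eventually (\<lambda>(w, y). w \<in> {w\<in>X. d (\<sigma> y) w \<le> R}) h}"
  let ?\<psi> = "\<lambda>(w, y). \<phi> (\<sigma> y, w) * \<psi> (w, \<kappa> y)"
  obtain M where M: "M \<ge> 0" "\<And>p. norm (\<phi> p) \<le> M" using controlled_bound[OF \<phi>] by metis
  obtain M' where M': "M' \<ge> 0" "\<And>p. norm (\<psi> p) \<le> M'" using controlled_bound[OF \<psi>] by metis
  have bdd: "bounded (range ?\<psi>)"
    unfolding bounded_iff by (rule exI[of _ "M * M'"]) (auto simp: norm_mult intro!: mult_mono M M')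
  have term_eq: "kern \<phi> g h * kern \<psi> h k = Lim h ?\<psi>" if "h \<in> ?F" for h
  proof -
    have "h \<in> coarse_arrows X d" using that by simp
    then obtain \<tau> T' where \<tau>: "displacement \<tau> T'" "h = germ \<tau> (filtermap snd h)" by (rule arrow_germ)
    then have h: "h = germ \<tau> u" using that by simp
    have "((\<lambda>y. \<phi> (\<sigma> y, \<tau> y) * \<psi> (\<tau> y, \<kappa> y)) \<longlongrightarrow> Lim u (\<lambda>y. \<phi> (\<sigma> y, \<tau> y)) * Lim u (\<lambda>y. \<psi> (\<tau> y, \<kappa> y))) u"
    proof (intro tendsto_mult ultrafilter_tendsto_Lim[OF U])
      show "bounded (range (\<lambda>y. \<phi> (\<sigma> y, \<tau> y)))"
        unfolding bounded_iff using M(2) by (intro exI[of _ M]) auto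
      show "bounded (range (\<lambda>y. \<psi> (\<tau> y, \<kappa> y)))"
        unfolding bounded_iff using M'(2) by (intro exI[of _ M']) auto
    qed
    then have "Lim u (\<lambda>y. \<phi> (\<sigma> y, \<tau> y) * \<psi> (\<tau> y, \<kappa> y)) = Lim u (\<lambda>y. \<phi> (\<sigma> y, \<tau> y)) * Lim u (\<lambda>y. \<psi> (\<tau> y, \<kappa> y))"
      by (rule tendsto_Lim[OF ultrafilter_not_bot[OF U]])
    then show ?thesis
      unfolding h *(4,5) kern_germ[OF *(1,2) \<tau>(1)] kern_germ[OF *(1) \<tau>(1) *(3)] by (simp add: Lim_germ)
  qed
  have "(\<Sum>h | kern \<phi> g h \<noteq> 0. kern \<phi> g h * kern \<psi> h k) = (\<Sum>h\<in>?F. kern \<phi> g h * kern \<psi> h k)"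
    by (rule sum.mono_neutral_left[OF fibre_finite(1)[OF *(1) B]])
      (use kern_row_subset[OF \<phi> *(1,2)] in \<open>auto simp: *(4)\<close>)
  also have "\<dots> = (\<Sum>h\<in>?F. Lim h ?\<psi>)" by (rule sum.cong[OF refl term_eq])
  also have "\<dots> = Lim u (\<lambda>y. \<Sum>w\<in>{w\<in>X. d (\<sigma> y) w \<le> R}. ?\<psi> (w, y))"
    by (rule sum_fibre[OF *(1) B bdd])
  also have "\<dots> = Lim u (\<lambda>y. conv \<phi> \<psi> (\<sigma> y, \<kappa> y))"
  proof (rule Lim_cong_eventually)
    have "eventually (\<lambda>y. y \<in> X) u" using *(1) by (simp add: unit_ultrafilter_def)
    then show "eventually (\<lambda>y. (\<Sum>w\<in>{w\<in>X. d (\<sigma> y) w \<le> R}. ?\<psi> (w, y)) = conv \<phi> \<psi> (\<sigma> y, \<kappa> y)) u"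
    proof (rule eventually_mono)
      fix y assume "y \<in> X"
      then have "\<sigma> y \<in> X" using *(2) by (simp add: displacement_def)
      then show "(\<Sum>w\<in>{w\<in>X. d (\<sigma> y) w \<le> R}. ?\<psi> (w, y)) = conv \<phi> \<psi> (\<sigma> y, \<kappa> y)"
        unfolding conv_def prod.case
        by (intro sum.mono_neutral_right[OF N(1) controlled_row[OF \<phi>]]) auto
    qed
  qed
  also have "\<dots> = kern (conv \<phi> \<psi>) g k" unfolding *(4,5) by (rule kern_germ[OF *(1-3), symmetric])
  finally show ?thesis ..
next
  case False
  have "kern \<phi> g h * kern \<psi> h k = 0" for h
    using False kern_nonzeroD[of \<phi> g h] kern_nonzeroD[of \<psi> h k]
    by (cases "kern \<phi> g h = 0"; cases "kern \<psi> h k = 0") auto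
  then have "(\<Sum>h | kern \<phi> g h \<noteq> 0. kern \<phi> g h * kern \<psi> h k) = 0" by (intro sum.neutral) blast
  moreover have "kern (conv \<phi> \<psi>) g k = 0" using False by (auto simp: kern_def)
  ultimately show ?thesis by simp
qed

lemma op_compose:
  assumes \<phi>: "controlled \<phi> R" and \<psi>: "controlled \<psi> S"
  shows "op \<phi> o\<^sub>L op \<psi> = op (conv \<phi> \<psi>)"
  unfolding op_eq_kernel_op[OF \<phi>] op_eq_kernel_op[OF \<psi>] op_eq_kernel_op[OF controlled_conv[OF \<phi> \<psi>]]
  by (intro kernel_op_compose banded_kern[OF \<phi>] banded_kern[OF \<psi>] banded_kern[OF controlled_conv[OF \<phi> \<psi>]]
      kern_conv[OF \<phi> \<psi>])

definition adj :: "('a \<times> 'a \<Rightarrow> complex) \<Rightarrow> 'a \<times> 'a \<Rightarrow> complex" where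
  "adj \<phi> = (\<lambda>(x, y). cnj (\<phi> (y, x)))"

lemma controlled_adj:
  assumes "controlled \<phi> R" shows "controlled (adj \<phi>) R"
proof -
  obtain M where M: "M \<ge> 0" "\<And>p. norm (\<phi> p) \<le> M" using controlled_bound[OF assms] by metis
  then have "bounded (range (adj \<phi>))" unfolding bounded_iff adj_def by (intro exI[of _ M]) auto
  then show ?thesis using assms by (auto simp: controlled_def adj_def intro: near_flip)
qed

lemma is_adjoint_op:
  assumes \<phi>: "controlled \<phi> R" shows "is_adjoint (op (adj \<phi>)) (op \<phi>)"
proof -
  have "kern (adj \<phi>) g h = cnj (kern \<phi> h g)" for g h
  proof (cases "g \<in> coarse_arrows X d \<and> h \<in> coarse_arrows X d \<and> filtermap snd g = filtermap snd h")
    case True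
    then obtain \<sigma> S \<tau> T u where *: "unit_ultrafilter u" "displacement \<sigma> S" "displacement \<tau> T" "g = germ \<sigma> u" "h = germ \<tau> u"
      using kern_cases by metis
    have U: "ultrafilter u" using *(1) by (simp add: unit_ultrafilter_def)
    have "bounded (range (\<lambda>y. \<phi> (\<tau> y, \<sigma> y)))"
      using \<phi> unfolding controlled_def by (auto intro: bounded_subset)
    then have "Lim u (\<lambda>y. cnj (\<phi> (\<tau> y, \<sigma> y))) = cnj (Lim u (\<lambda>y. \<phi> (\<tau> y, \<sigma> y)))"
      by (intro tendsto_Lim[OF ultrafilter_not_bot[OF U]] tendsto_cnj ultrafilter_tendsto_Lim[OF U])
    then show ?thesis unfolding *(4,5) kern_germ[OF *(1,2,3)] kern_germ[OF *(1,3,2)] by (simp add: adj_def)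
  qed (auto simp: kern_def)
  then have "kern (adj \<phi>) = (\<lambda>g h. cnj (kern \<phi> h g))" by blast
  then show ?thesis
    using kernel_op_adjoint[OF banded_kern[OF \<phi>]]
    by (simp add: op_eq_kernel_op[OF \<phi>] op_eq_kernel_op[OF controlled_adj[OF \<phi>]])
qed

end

section \<open>Diagonal projections over the reduced algebra and bijections of bounded
  displacement\<close>

subsection \<open>The reduced algebra\<close>

context coarse_space
begin

lemma controlled_zero: "R \<ge> 0 \<Longrightarrow> controlled (\<lambda>_. 0) R"
  by (auto simp: controlled_def)

lemma op_zero: "op (\<lambda>_. 0) = 0"
  using op_add[OF controlled_zero[of 0] controlled_zero[of 0]] by simp

lemma controlled_minus: "controlled \<phi> R \<Longrightarrow> controlled (\<lambda>p. - \<phi> p :: 'b::real_normed_vector) R"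
  unfolding controlled_def bounded_iff by auto

lemma op_diff:
  assumes "controlled \<phi> R" "controlled \<psi> S"
  shows "op (\<lambda>p. \<phi> p - \<psi> p) = op \<phi> - op \<psi>"
proof -
  have c: "controlled (\<lambda>p. \<phi> p - \<psi> p) (max R S)"
    using controlled_add[OF assms(1) controlled_minus[OF assms(2)]] by simp
  show ?thesis using op_add[OF c assms(2)] by (simp add: algebra_simps)
qed

lemma controlled_sum:
  fixes \<psi> :: "'j \<Rightarrow> 'a \<times> 'a \<Rightarrow> 'b::real_normed_vector"
  assumes "\<And>j. j \<in> J \<Longrightarrow> controlled (\<psi> j) R" "R \<ge> 0"
  shows "controlled (\<lambda>p. \<Sum>j\<in>J. \<psi> j p) R"
  using assms
proof (induction J rule: infinite_finite_induct)
  case (insert j J)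
  then show ?case using controlled_add[of "\<psi> j" R "\<lambda>p. \<Sum>j\<in>J. \<psi> j p" R] by simp
qed (simp_all add: controlled_zero)

lemma op_sum:
  assumes "\<And>j. j \<in> J \<Longrightarrow> controlled (\<psi> j) R" "R \<ge> 0"
  shows "op (\<lambda>p. \<Sum>j\<in>J. \<psi> j p) = (\<Sum>j\<in>J. op (\<psi> j))"
  using assms
proof (induction J rule: infinite_finite_induct)
  case (insert j J)
  then show ?case using op_add[of "\<psi> j" R "\<lambda>p. \<Sum>j\<in>J. \<psi> j p" R] controlled_sum[of J \<psi> R] by simp
qed (simp_all add: op_zero)

definition pre_algebra :: "('a \<times> 'a) filter operator set" where
  "pre_algebra = {op \<phi> | \<phi>. \<exists>R. controlled \<phi> R}"

lemma reduced_algebra_eq: "reduced_algebra G = closure pre_algebra"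
proof -
  have "conv_op G ` Cc G = pre_algebra"
  proof (intro equalityI subsetI)
    fix T assume "T \<in> conv_op G ` Cc G"
    then obtain f where f: "f \<in> Cc G" "T = conv_op G f" by blast
    then obtain \<phi> R where "controlled \<phi> R" "f = extend \<phi>" using Cc_imp_extend[OF f(1)] by blast
    then show "T \<in> pre_algebra" unfolding pre_algebra_def f(2) by blast
  next
    fix T assume "T \<in> pre_algebra"
    then show "T \<in> conv_op G ` Cc G" unfolding pre_algebra_def using extend_in_Cc by blast
  qed
  then show ?thesis by (simp add: reduced_algebra_def)
qed

lemma op_in: "controlled \<phi> R \<Longrightarrow> op \<phi> \<in> reduced_algebra G"
  unfolding reduced_algebra_eq pre_algebra_def by (intro subsetD[OF closure_subset]) blast

lemma closure_closed_binary:
  assumes "\<And>S T. S \<in> pre_algebra \<Longrightarrow> T \<in> pre_algebra \<Longrightarrow> f S T \<in> pre_algebra"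
    and "\<And>X Y S T. X \<longlonglongrightarrow> S \<Longrightarrow> Y \<longlonglongrightarrow> T \<Longrightarrow> (\<lambda>n. f (X n) (Y n)) \<longlonglongrightarrow> f S T"
    and S: "S \<in> reduced_algebra G" and T: "T \<in> reduced_algebra G"
  shows "f S T \<in> reduced_algebra G"
proof -
  obtain X where X: "\<And>n. X n \<in> pre_algebra" "X \<longlonglongrightarrow> S"
    using S unfolding reduced_algebra_eq closure_sequential by blast
  obtain Y where Y: "\<And>n. Y n \<in> pre_algebra" "Y \<longlonglongrightarrow> T"
    using T unfolding reduced_algebra_eq closure_sequential by blast
  show ?thesis unfolding reduced_algebra_eq closure_sequential
    by (intro exI[of _ "\<lambda>n. f (X n) (Y n)"] conjI allI assms(1)[OF X(1) Y(1)] assms(2)[OF X(2) Y(2)])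
qed

text \<open>The operations are known for finite propagation operators and continuous in norm, so
  they pass to the closure; adjoints pass by completeness.\<close>

sublocale reduced: star_algebra "reduced_algebra G"
proof
  show "0 \<in> reduced_algebra G" using op_in[OF controlled_zero[of 0]] by (simp add: op_zero)
  fix S T assume S: "S \<in> reduced_algebra G" and T: "T \<in> reduced_algebra G"
  show "S + T \<in> reduced_algebra G"
  proof (rule closure_closed_binary[OF _ _ S T])
    fix S T assume "S \<in> pre_algebra" "T \<in> pre_algebra"
    then obtain \<phi> \<psi> R R' where *: "S = op \<phi>" "T = op \<psi>" "controlled \<phi> R" "controlled \<psi> R'"
      unfolding pre_algebra_def by blast
    show "S + T \<in> pre_algebra"
    proof -
      have "S + T = op (\<lambda>p. \<phi> p + \<psi> p)" using * by (simp add: op_add)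
      then show ?thesis using controlled_add[OF *(3,4)] unfolding pre_algebra_def by blast
    qed
  qed (rule tendsto_add)
  show "S - T \<in> reduced_algebra G"
  proof (rule closure_closed_binary[OF _ _ S T])
    fix S T assume "S \<in> pre_algebra" "T \<in> pre_algebra"
    then obtain \<phi> \<psi> R R' where *: "S = op \<phi>" "T = op \<psi>" "controlled \<phi> R" "controlled \<psi> R'"
      unfolding pre_algebra_def by blast
    show "S - T \<in> pre_algebra"
    proof -
      have "S - T = op (\<lambda>p. \<phi> p - \<psi> p)" using * by (simp add: op_diff)
      moreover have "controlled (\<lambda>p. \<phi> p - \<psi> p) (max R R')"
        using controlled_add[OF *(3) controlled_minus[OF *(4)]] by simp
      ultimately show ?thesis unfolding pre_algebra_def by blast
    qed
  qed (rule tendsto_diff)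
  show "S o\<^sub>L T \<in> reduced_algebra G"
  proof (rule closure_closed_binary[OF _ _ S T])
    fix S T assume "S \<in> pre_algebra" "T \<in> pre_algebra"
    then obtain \<phi> \<psi> R R' where *: "S = op \<phi>" "T = op \<psi>" "controlled \<phi> R" "controlled \<psi> R'"
      unfolding pre_algebra_def by blast
    then show "S o\<^sub>L T \<in> pre_algebra"
      unfolding *(1,2) op_compose[OF *(3,4)] using controlled_conv[OF *(3,4)] unfolding pre_algebra_def by blast
  qed (rule bounded_bilinear.tendsto[OF bounded_bilinear_blinfun_compose])
next
  fix T assume T: "T \<in> reduced_algebra G"
  have "\<exists>S\<in>closure pre_algebra. is_adjoint S T"
    using T unfolding reduced_algebra_eq
    by (rule is_adjoint_closure[rotated]) (use is_adjoint_op controlled_adj in \<open>unfold pre_algebra_def, blast\<close>)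
  then obtain S where S: "S \<in> reduced_algebra G" "is_adjoint S T" unfolding reduced_algebra_eq by blast
  then show "adjoint_op T \<in> reduced_algebra G" "is_adjoint (adjoint_op T) T"
    by (simp_all add: adjoint_op_eq)
qed

subsection \<open>Diagonal projections\<close>

definition chi :: "'a set \<Rightarrow> ('a \<times> 'a) filter operator" where
  "chi S = op (diagonal (indicator S))"

definition diag_proj :: "nat \<Rightarrow> (nat \<Rightarrow> 'a set) \<Rightarrow> nat \<times> ('a \<times> 'a) filter op_matrix" where
  "diag_proj n S = (n, diag_matrix n (\<lambda>i. chi (S i)))"

lemma bounded_indicator: "bounded (range (indicator S :: 'x \<Rightarrow> 'b::real_normed_algebra_1))"
  unfolding bounded_iff by (intro exI[of _ 1]) (auto simp: indicator_def)

lemma controlled_chi: "controlled (diagonal (indicator S) :: _ \<Rightarrow> complex) 0"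
  by (rule controlled_diagonal[OF bounded_indicator])

lemma chi_in: "chi S \<in> reduced_algebra G"
  unfolding chi_def by (rule op_in[OF controlled_chi])

lemma conv_diagonal_left: "controlled \<phi> R \<Longrightarrow> conv (diagonal a) \<phi> = (\<lambda>(x, z). a x * \<phi> (x, z))"
proof (intro ext, clarify)
  fix x z assume \<phi>: "controlled \<phi> R"
  have "conv (diagonal a) \<phi> (x, z) = (\<Sum>w\<in>{w. w = x \<and> x \<in> X \<and> a x \<noteq> 0}. a x * \<phi> (x, z))"
    unfolding conv_def prod.case by (rule sum.cong) (auto simp: diagonal_def)
  also have "\<dots> = a x * \<phi> (x, z)"
  proof (cases "x \<in> X \<and> a x \<noteq> 0")
    case True
    then have "{w. w = x \<and> x \<in> X \<and> a x \<noteq> 0} = {x}" by auto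
    then show ?thesis by simp
  next
    case False
    moreover have "\<phi> (x, z) = 0" if "x \<notin> X" using \<phi> that by (auto simp: controlled_def near_def)
    ultimately show ?thesis by auto
  qed
  finally show "conv (diagonal a) \<phi> (x, z) = a x * \<phi> (x, z)" .
qed

lemma conv_diagonal_right: "controlled \<phi> R \<Longrightarrow> conv \<phi> (diagonal a) = (\<lambda>(x, z). \<phi> (x, z) * a z)"
proof (intro ext, clarify)
  fix x z assume \<phi>: "controlled \<phi> R"
  have "conv \<phi> (diagonal a) (x, z) = (\<Sum>w | w \<in> X \<and> \<phi> (x, w) \<noteq> 0. if w = z then \<phi> (x, z) * a z else 0)"
    unfolding conv_def prod.case by (rule sum.cong) (auto simp: diagonal_def)
  also have "\<dots> = (if z \<in> X \<and> \<phi> (x, z) \<noteq> 0 then \<phi> (x, z) * a z else 0)"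
    using controlled_row_finite[OF \<phi>] by (simp add: sum.delta)
  also have "\<dots> = \<phi> (x, z) * a z" using \<phi> by (auto simp: controlled_def near_def)
  finally show "conv \<phi> (diagonal a) (x, z) = \<phi> (x, z) * a z" .
qed

lemma chi_compose: "chi S o\<^sub>L chi T = chi (S \<inter> T)"
proof -
  have "conv (diagonal (indicator S)) (diagonal (indicator T)) = (diagonal (indicator (S \<inter> T)) :: _ \<Rightarrow> complex)"
    unfolding conv_diagonal_left[OF controlled_chi] by (auto simp: diagonal_def indicator_def)
  then show ?thesis unfolding chi_def op_compose[OF controlled_chi controlled_chi] by simp
qed

lemma adj_chi: "adj (diagonal (indicator S)) = diagonal (indicator S)"
  by (auto simp: adj_def diagonal_def indicator_def)

lemma adjoint_chi: "adjoint_op (chi S) = chi S"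
  using is_adjoint_op[OF controlled_chi[of S]] unfolding chi_def adj_chi by (rule adjoint_op_eq)

lemma chi_empty: "chi {} = 0"
proof -
  have "diagonal (indicator {}) = (\<lambda>_. 0 :: complex)" by (auto simp: diagonal_def)
  then show ?thesis unfolding chi_def by (simp only: op_zero)
qed

text \<open>The Hilbert space is indexed by all filters on pairs, so the unit of the algebra is the
  projection \<open>chi UNIV\<close> and not the identity operator. The equations are checked on
  finite propagation operators and extended by continuity.\<close>

lemma chi_UNIV_left: "T \<in> reduced_algebra G \<Longrightarrow> chi UNIV o\<^sub>L T = T"
  and chi_UNIV_right: "T \<in> reduced_algebra G \<Longrightarrow> T o\<^sub>L chi UNIV = T"
proof -
  assume "T \<in> reduced_algebra G"
  then obtain Y where Y: "\<And>n. Y n \<in> pre_algebra" "Y \<longlonglongrightarrow> T"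
    unfolding reduced_algebra_eq closure_sequential by blast
  have 1: "chi UNIV o\<^sub>L Y n = Y n" "Y n o\<^sub>L chi UNIV = Y n" for n
  proof -
    obtain \<phi> R where \<phi>: "Y n = op \<phi>" "controlled \<phi> R" using Y(1)[of n] unfolding pre_algebra_def by blast
    show "chi UNIV o\<^sub>L Y n = Y n" "Y n o\<^sub>L chi UNIV = Y n"
      unfolding \<phi>(1) chi_def op_compose[OF controlled_chi \<phi>(2)] op_compose[OF \<phi>(2) controlled_chi]
        conv_diagonal_left[OF \<phi>(2)] conv_diagonal_right[OF \<phi>(2)] by simp_all
  qed
  have "(\<lambda>n. chi UNIV o\<^sub>L Y n) \<longlonglongrightarrow> (chi UNIV o\<^sub>L T)" "(\<lambda>n. Y n o\<^sub>L chi UNIV) \<longlonglongrightarrow> (T o\<^sub>L chi UNIV)"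
    by (intro bounded_bilinear.tendsto[OF bounded_bilinear_blinfun_compose] Y tendsto_const)+
  then show "chi UNIV o\<^sub>L T = T" "T o\<^sub>L chi UNIV = T"
    unfolding 1 using Y(2) LIMSEQ_unique by blast+
qed

lemma diag_matrix_chi_times:
  "matrix_times n (diag_matrix n (\<lambda>i. chi (S i))) (diag_matrix n (\<lambda>i. chi (S i))) = diag_matrix n (\<lambda>i. chi (S i))"
proof (intro ext)
  fix i j
  have "(\<Sum>k<n. diag_matrix n (\<lambda>i. chi (S i)) i k o\<^sub>L diag_matrix n (\<lambda>i. chi (S i)) k j)
      = (\<Sum>k<n. if k = i then (if i = j then chi (S i) else 0) else 0)"
    by (rule sum.cong) (auto simp: diag_matrix_def chi_compose)
  then show "matrix_times n (diag_matrix n (\<lambda>i. chi (S i))) (diag_matrix n (\<lambda>i. chi (S i))) i j = diag_matrix n (\<lambda>i. chi (S i)) i j"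
    by (simp add: matrix_times_def sum.delta) (simp add: diag_matrix_def)
qed

lemma matrix_star_diag_matrix_chi: "matrix_star (diag_matrix n (\<lambda>i. chi (S i))) = diag_matrix n (\<lambda>i. chi (S i))"
  unfolding matrix_star_def diag_matrix_def by (intro ext) (auto simp: adjoint_chi)

lemma diag_proj_in:
  assumes "\<And>S. chi S \<in> A" shows "diag_proj n S \<in> projections A"
  using assms chi_empty assms[of "{}"] unfolding diag_proj_def projections_def
  by (auto simp: diag_matrix_chi_times matrix_star_diag_matrix_chi matrices_def) (auto simp: diag_matrix_def)

lemmas diag_proj_in_reduced = diag_proj_in[OF chi_in]

lemma direct_sum_diag_proj:
  "direct_sum (diag_proj n S) (diag_proj m T) = diag_proj (n + m) (\<lambda>i. if i < n then S i else T (i - n))"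
  unfolding direct_sum_def diag_proj_def diag_matrix_def by (auto intro!: ext)

text \<open>The basis vectors of finitely many copies of the square-summable functions on
  \<open>X\<close> that span the range of the diagonal projection.\<close>

definition places :: "nat \<Rightarrow> (nat \<Rightarrow> 'a set) \<Rightarrow> (nat \<times> 'a) set" where
  "places n S = {(i, x). i < n \<and> x \<in> X \<and> x \<in> S i}"

subsection \<open>Bijections of bounded displacement give equivalent projections\<close>

text \<open>One block of the permutation matrix of \<open>\<theta>\<close>: the pair
  \<open>(y, x)\<close> has source \<open>x\<close> and range \<open>y\<close>, matching the
  convention of the pair groupoid.\<close>

definition graph_kernel :: "(nat \<times> 'a \<Rightarrow> nat \<times> 'a) \<Rightarrow> (nat \<times> 'a) set \<Rightarrow> nat \<Rightarrow> nat \<Rightarrow> 'a \<times> 'a \<Rightarrow> complex" where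
  "graph_kernel \<theta> P j i = (\<lambda>(y, x). if (i, x) \<in> P \<and> \<theta> (i, x) = (j, y) then 1 else 0)"

definition graph_matrix :: "nat \<Rightarrow> nat \<Rightarrow> (nat \<times> 'a \<Rightarrow> nat \<times> 'a) \<Rightarrow> (nat \<times> 'a) set \<Rightarrow> ('a \<times> 'a) filter op_matrix" where
  "graph_matrix m n \<theta> P = (\<lambda>j i. if j < m \<and> i < n then op (graph_kernel \<theta> P j i) else 0)"

lemma controlled_graph_kernel:
  assumes "bij_betw \<theta> (places n S) (places m T)" "\<And>i x. (i, x) \<in> places n S \<Longrightarrow> d (snd (\<theta> (i, x))) x \<le> R" "R \<ge> 0"
  shows "controlled (graph_kernel \<theta> (places n S) j i) R"
proof -
  have "near R (y, x)" if "graph_kernel \<theta> (places n S) j i (y, x) \<noteq> 0" for x y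
  proof -
    have *: "(i, x) \<in> places n S" "\<theta> (i, x) = (j, y)" using that by (auto simp: graph_kernel_def split: if_splits)
    then have "(j, y) \<in> places m T" using assms(1) by (metis bij_betwE)
    then show ?thesis using * assms(2)[OF *(1)] by (auto simp: near_def places_def)
  qed
  moreover have "bounded (range (graph_kernel \<theta> (places n S) j i))"
    unfolding bounded_iff by (intro exI[of _ 1]) (auto simp: graph_kernel_def)
  ultimately show ?thesis using assms(3) by (auto simp: controlled_def)
qed

text \<open>Multiplying permutation matrices of mutually inverse bijections: each row of the first
  factor meets a single place. The hypotheses are symmetric in \<open>\<theta>\<close> and
  \<open>\<theta>'\<close>, so both products of a partial isometry with its star are
  instances.\<close>

lemma graph_matrix_times:
  assumes \<theta>: "bij_betw \<theta> (places n S) (places m T)" and R: "\<And>i x. (i, x) \<in> places n S \<Longrightarrow> d (snd (\<theta> (i, x))) x \<le> R" "R \<ge> 0"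
    and \<theta>': "bij_betw \<theta>' (places m T) (places n S)" and R': "\<And>i x. (i, x) \<in> places m T \<Longrightarrow> d (snd (\<theta>' (i, x))) x \<le> R"
    and inv: "\<And>p q. p \<in> places n S \<Longrightarrow> q \<in> places m T \<Longrightarrow> \<theta> p = q \<longleftrightarrow> \<theta>' q = p"
  shows "matrix_times m (graph_matrix n m \<theta>' (places m T)) (graph_matrix m n \<theta> (places n S)) = diag_matrix n (\<lambda>i. chi (S i))"
proof (intro ext)
  fix i i'
  let ?k = "\<lambda>j i. graph_kernel \<theta> (places n S) j i" and ?k' = "\<lambda>i j. graph_kernel \<theta>' (places m T) i j"
  note c = controlled_graph_kernel[OF \<theta> R] and c' = controlled_graph_kernel[OF \<theta>' R' R(2)]
  show "matrix_times m (graph_matrix n m \<theta>' (places m T)) (graph_matrix m n \<theta> (places n S)) i i' = diag_matrix n (\<lambda>i. chi (S i)) i i'"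
  proof (cases "i < n \<and> i' < n")
    case True
    have "matrix_times m (graph_matrix n m \<theta>' (places m T)) (graph_matrix m n \<theta> (places n S)) i i'
        = (\<Sum>j<m. op (conv (?k' i j) (?k j i')))"
      unfolding matrix_times_def graph_matrix_def using True by (intro sum.cong) (auto simp: op_compose[OF c' c])
    also have "\<dots> = op (\<lambda>p. \<Sum>j<m. conv (?k' i j) (?k j i') p)"
      by (rule op_sum[symmetric, where R = "R + R"]) (use controlled_conv[OF c' c] R(2) in auto)
    also have "(\<lambda>p. \<Sum>j<m. conv (?k' i j) (?k j i') p) = diagonal (indicator (if i = i' then S i else {}))"
    proof (intro ext, clarify)
      fix x x'
      show "(\<Sum>j<m. conv (?k' i j) (?k j i') (x, x')) = diagonal (indicator (if i = i' then S i else {})) (x, x')"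
      proof (cases "(i, x) \<in> places n S")
        case ix: True
        obtain j0 y0 where jy: "\<theta> (i, x) = (j0, y0)" by (cases "\<theta> (i, x)")
        then have T: "(j0, y0) \<in> places m T" using \<theta> ix by (metis bij_betwE)
        have set: "{w. w \<in> X \<and> ?k' i j (x, w) \<noteq> 0} = (if j = j0 then {y0} else {})" for j
        proof -
          have "?k' i j (x, w) \<noteq> 0 \<longleftrightarrow> j = j0 \<and> w = y0" for w
            using inv[OF ix, of "(j, w)"] jy T ix by (auto simp: graph_kernel_def)
          then show ?thesis using T by (auto simp: places_def)
        qed
        have one: "?k' i j0 (x, y0) = 1" using inv[OF ix T] jy T by (simp add: graph_kernel_def)
        have "(\<Sum>j<m. conv (?k' i j) (?k j i') (x, x')) = (\<Sum>j<m. if j = j0 then ?k j0 i' (y0, x') else 0)"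
          by (intro sum.cong refl) (auto simp: conv_def set one)
        also have "\<dots> = ?k j0 i' (y0, x')" using T by (simp add: sum.delta places_def)
        also have "\<dots> = (if i = i' \<and> x = x' then 1 else 0)"
          using jy ix inj_onD[OF bij_betw_imp_inj_on[OF \<theta>], of "(i, x)" "(i', x')"] by (auto simp: graph_kernel_def)
        also have "\<dots> = diagonal (indicator (if i = i' then S i else {})) (x, x')"
          using ix by (auto simp: diagonal_def places_def)
        finally show ?thesis .
      next
        case False
        have "?k' i j (x, w) = 0" for j w
          using False bij_betwE[OF \<theta>'] by (force simp: graph_kernel_def)
        then have "(\<Sum>j<m. conv (?k' i j) (?k j i') (x, x')) = 0" by (simp add: conv_def)
        then show ?thesis using False True by (auto simp: diagonal_def places_def)
      qed
    qed
    finally show ?thesis using True chi_empty by (auto simp: diag_matrix_def chi_def)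
  next
    case False
    then show ?thesis by (auto simp: matrix_times_def graph_matrix_def diag_matrix_def intro!: sum.neutral)
  qed
qed

text \<open>The permutation matrix of \<open>\<theta>\<close> has finite propagation, and its star
  is the permutation matrix of the inverse, whose displacement has the same bound.\<close>

theorem mvn_equiv_of_bijection:
  assumes \<theta>: "bij_betw \<theta> (places n S) (places m T)" and R: "\<And>i x. (i, x) \<in> places n S \<Longrightarrow> d (snd (\<theta> (i, x))) x \<le> R"
  shows "mvn_equiv (reduced_algebra G) (diag_proj n S) (diag_proj m T)"
proof -
  let ?R = "max R 0"
  have R1: "\<And>i x. (i, x) \<in> places n S \<Longrightarrow> d (snd (\<theta> (i, x))) x \<le> ?R" and R0: "?R \<ge> 0" using R by (auto simp: le_max_iff_disj)
  define \<theta>' where "\<theta>' = the_inv_into (places n S) \<theta>"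
  have \<theta>': "bij_betw \<theta>' (places m T) (places n S)" unfolding \<theta>'_def by (rule bij_betw_the_inv_into[OF \<theta>])
  have inv: "\<theta> p = q \<longleftrightarrow> \<theta>' q = p" if "p \<in> places n S" "q \<in> places m T" for p q
    using f_the_inv_into_f_bij_betw[OF \<theta>, of q] the_inv_into_f_f[OF bij_betw_imp_inj_on[OF \<theta>] that(1)] that(2)
    unfolding \<theta>'_def by auto
  have inv': "\<theta>' q = p \<longleftrightarrow> \<theta> p = q" if "q \<in> places m T" "p \<in> places n S" for p q
    using inv[OF that(2) that(1)] by auto
  have R': "d (snd (\<theta>' (j, y))) y \<le> ?R" if jy: "(j, y) \<in> places m T" for j y
  proof -
    obtain i x where ix: "\<theta>' (j, y) = (i, x)" by (cases "\<theta>' (j, y)")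
    then have ixS: "(i, x) \<in> places n S" using \<theta>' jy by (metis bij_betwE)
    then have "\<theta> (i, x) = (j, y)" using inv[OF ixS jy] ix by simp
    then show ?thesis using R1[OF ixS] ix by (simp add: commute[of x])
  qed
  let ?v = "graph_matrix m n \<theta> (places n S)"
  have "graph_kernel \<theta>' (places m T) i j = adj (graph_kernel \<theta> (places n S) j i)" for i j
  proof (intro ext, clarify)
    fix x y
    have "(j, y) \<in> places m T \<and> \<theta>' (j, y) = (i, x) \<longleftrightarrow> (i, x) \<in> places n S \<and> \<theta> (i, x) = (j, y)"
      using inv[of "(i, x)" "(j, y)"] bij_betwE[OF \<theta>] bij_betwE[OF \<theta>'] by metis
    then show "graph_kernel \<theta>' (places m T) i j (x, y) = adj (graph_kernel \<theta> (places n S) j i) (x, y)"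
      by (simp add: graph_kernel_def adj_def)
  qed
  then have star: "matrix_star ?v = graph_matrix n m \<theta>' (places m T)"
    unfolding matrix_star_def graph_matrix_def
    by (intro ext) (auto simp: adjoint_op_eq[OF is_adjoint_op[OF controlled_graph_kernel[OF \<theta> R1 R0]]])
  have "?v \<in> matrices (reduced_algebra G) m n"
    unfolding matrices_def graph_matrix_def using op_in[OF controlled_graph_kernel[OF \<theta> R1 R0]] by auto
  moreover have "matrix_times m (matrix_star ?v) ?v = diag_matrix n (\<lambda>i. chi (S i))"
    unfolding star by (rule graph_matrix_times[OF \<theta> R1 R0 \<theta>' R' inv])
  moreover have "matrix_times n ?v (matrix_star ?v) = diag_matrix m (\<lambda>i. chi (T i))"
    unfolding star by (rule graph_matrix_times[OF \<theta>' R' R0 \<theta> R1 inv'])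
  ultimately show ?thesis
    unfolding mvn_equiv_def diag_proj_def fst_conv snd_conv by (intro bexI[of _ ?v] conjI)
qed

end

subsection \<open>Equivalent projections give bijections of bounded displacement\<close>

lift_definition finite_ell2 :: "('i \<Rightarrow> complex) \<Rightarrow> 'i ell2" is
  "\<lambda>f i. if finite {j. f j \<noteq> 0} then f i else 0"
proof -
  fix f :: "'i \<Rightarrow> complex"
  show "(\<lambda>i. (cmod (if finite {j. f j \<noteq> 0} then f i else 0))\<^sup>2) summable_on UNIV"
  proof (cases "finite {j. f j \<noteq> 0}")
    case True
    show ?thesis
    proof (rule square_summableI)
      fix F :: "'i set" assume "finite F"
      have "(\<Sum>i\<in>F. (cmod (if finite {j. f j \<noteq> 0} then f i else 0))\<^sup>2) = (\<Sum>i\<in>F \<inter> {j. f j \<noteq> 0}. (cmod (f i))\<^sup>2)"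
        using \<open>finite F\<close> True by (intro sum.mono_neutral_cong_right) auto
      also have "\<dots> \<le> (\<Sum>i\<in>{j. f j \<noteq> 0}. (cmod (f i))\<^sup>2)"
        using True by (intro sum_mono2) auto
      finally show "(\<Sum>i\<in>F. (cmod (if finite {j. f j \<noteq> 0} then f i else 0))\<^sup>2) \<le> (\<Sum>i\<in>{j. f j \<noteq> 0}. (cmod (f i))\<^sup>2)" .
    qed
  qed simp
qed

lemma coord_finite_ell2: "finite {j. f j \<noteq> 0} \<Longrightarrow> coord (finite_ell2 f) i = f i"
  by (simp add: finite_ell2.rep_eq)

lemma coord_sum: "coord (sum f S) i = (\<Sum>k\<in>S. coord (f k) i)"
  by (induction S rule: infinite_finite_induct) (simp_all add: zero_ell2.rep_eq plus_ell2.rep_eq)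

context coarse_space
begin

text \<open>For a fixed \<open>x0\<close> in \<open>X\<close> these are all the arrows over the
  principal unit at \<open>x0\<close>. On this block the regular representation of
  \<open>\<phi>\<close> is the matrix \<open>\<phi>\<close> itself, independently of
  \<open>x0\<close>.\<close>

definition fibre_point :: "'a \<Rightarrow> 'a \<Rightarrow> ('a \<times> 'a) filter" where
  "fibre_point x0 x = principal {(x, x0)}"

lemma fibre_point_inj [simp]: "fibre_point x0 x = fibre_point x0 y \<longleftrightarrow> x = y"
proof
  assume "fibre_point x0 x = fibre_point x0 y"
  moreover have "eventually (\<lambda>p. p = (x, x0)) (fibre_point x0 x)" by (simp add: fibre_point_def eventually_principal)
  ultimately show "x = y" by (simp add: fibre_point_def eventually_principal)
qed simp

lemma fibre_point_germ: "fibre_point x0 x = germ (\<lambda>y. if y = x0 then x else y) (principal {x0})"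
  by (simp add: fibre_point_def germ_def filtermap_principal)

lemma displacement_point: "x \<in> X \<Longrightarrow> x0 \<in> X \<Longrightarrow> displacement (\<lambda>y. if y = x0 then x else y) (d x x0)"
  by (auto simp: displacement_def)

lemma unit_ultrafilter_principal: "x0 \<in> X \<Longrightarrow> unit_ultrafilter (principal {x0})"
  by (simp add: unit_ultrafilter_def ultrafilter_principal eventually_principal)

lemma kern_fibre_point:
  assumes "x0 \<in> X" "x \<in> X" "y \<in> X"
  shows "kern \<phi> (fibre_point x0 y) (fibre_point x0 x) = \<phi> (y, x)"
  unfolding fibre_point_germ
    kern_germ[OF unit_ultrafilter_principal[OF assms(1)] displacement_point[OF assms(3,1)] displacement_point[OF assms(2,1)]]
  by (simp add: Lim_principal)

lemma arrow_over_point: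
  assumes "x0 \<in> X" "g \<in> coarse_arrows X d" "filtermap snd g = principal {x0}"
  shows "\<exists>x\<in>X. g = fibre_point x0 x"
proof -
  obtain \<sigma> S where \<sigma>: "displacement \<sigma> S" "g = germ \<sigma> (filtermap snd g)" by (rule arrow_germ[OF assms(2)])
  then have "g = fibre_point x0 (\<sigma> x0)" using assms(3) by (simp add: germ_def filtermap_principal fibre_point_def)
  then show ?thesis using \<sigma> assms(1) by (auto simp: displacement_def)
qed

lemma fibre_point_arrow:
  assumes "x0 \<in> X" "x \<in> X"
  shows "fibre_point x0 x \<in> coarse_arrows X d" "filtermap snd (fibre_point x0 x) = principal {x0}"
  using principal_arrow[OF assms(2,1)] by (simp_all add: fibre_point_def filtermap_principal)

lemma coord_op_fibre:
  assumes \<phi>: "controlled \<phi> R" and x0: "x0 \<in> X" and y: "y \<in> X"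
  shows "coord (op \<phi> \<xi>) (fibre_point x0 y) = (\<Sum>x\<in>{x. x \<in> X \<and> \<phi> (y, x) \<noteq> 0}. \<phi> (y, x) * coord \<xi> (fibre_point x0 x))"
proof -
  note b = banded_kern[OF \<phi>]
  have "{h. kern \<phi> (fibre_point x0 y) h \<noteq> 0} = fibre_point x0 ` {x. x \<in> X \<and> \<phi> (y, x) \<noteq> 0}"
  proof (intro equalityI subsetI)
    fix h assume "h \<in> {h. kern \<phi> (fibre_point x0 y) h \<noteq> 0}"
    then have nz: "kern \<phi> (fibre_point x0 y) h \<noteq> 0" by simp
    then have "filtermap snd h = principal {x0}" "h \<in> coarse_arrows X d"
      using kern_nonzeroD[OF nz] fibre_point_arrow[OF x0 y] by auto
    then obtain x where x: "x \<in> X" "h = fibre_point x0 x" using arrow_over_point[OF x0] by blast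
    then show "h \<in> fibre_point x0 ` {x. x \<in> X \<and> \<phi> (y, x) \<noteq> 0}"
      using nz kern_fibre_point[OF x0 x(1) y] by auto
  qed (use kern_fibre_point[OF x0 _ y] in auto)
  then have "coord (op \<phi> \<xi>) (fibre_point x0 y)
      = (\<Sum>h\<in>fibre_point x0 ` {x. x \<in> X \<and> \<phi> (y, x) \<noteq> 0}. kern \<phi> (fibre_point x0 y) h * coord \<xi> h)"
    unfolding op_eq_kernel_op[OF \<phi>] coord_kernel_op[OF b] by simp
  also have "\<dots> = (\<Sum>x\<in>{x. x \<in> X \<and> \<phi> (y, x) \<noteq> 0}. kern \<phi> (fibre_point x0 y) (fibre_point x0 x) * coord \<xi> (fibre_point x0 x))"
    by (subst sum.reindex) (auto simp: inj_on_def)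
  also have "\<dots> = (\<Sum>x\<in>{x. x \<in> X \<and> \<phi> (y, x) \<noteq> 0}. \<phi> (y, x) * coord \<xi> (fibre_point x0 x))"
    by (intro sum.cong) (auto simp: kern_fibre_point[OF x0 _ y])
  finally show ?thesis .
qed

lemma coord_op_off_fibre:
  assumes \<phi>: "controlled \<phi> R" and x0: "x0 \<in> X"
    and \<xi>: "\<And>h. coord \<xi> h \<noteq> 0 \<Longrightarrow> h \<in> fibre_point x0 ` X" and g: "g \<notin> fibre_point x0 ` X"
  shows "coord (op \<phi> \<xi>) g = 0"
  unfolding op_eq_kernel_op[OF \<phi>] coord_kernel_op[OF banded_kern[OF \<phi>]]
proof (rule sum.neutral, rule ballI, rule ccontr)
  fix h assume "h \<in> {h. kern \<phi> g h \<noteq> 0}" "kern \<phi> g h * coord \<xi> h \<noteq> 0"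
  then have nz: "kern \<phi> g h \<noteq> 0" "coord \<xi> h \<noteq> 0" by auto
  then obtain x where "x \<in> X" "h = fibre_point x0 x" using \<xi> by blast
  then have "filtermap snd g = principal {x0}" using kern_nonzeroD(3)[OF nz(1)] fibre_point_arrow[OF x0] by simp
  then show False using arrow_over_point[OF x0 kern_nonzeroD(1)[OF nz(1)]] g by blast
qed

lemma coord_chi_fibre:
  assumes "x0 \<in> X" "y \<in> X"
  shows "coord (chi S \<xi>) (fibre_point x0 y) = (if y \<in> S then coord \<xi> (fibre_point x0 y) else 0)"
proof -
  have "{x. x \<in> X \<and> diagonal (indicator S) (y, x) \<noteq> (0::complex)} = (if y \<in> S then {y} else {})"
    using assms by (auto simp: diagonal_def)
  then show ?thesis
    unfolding chi_def coord_op_fibre[OF controlled_chi assms] using assms by (simp add: diagonal_def)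
qed

text \<open>Hall's condition: if the neighbours of a finite set \<open>F\<close> were too few, a finite propagation
  approximation of \<open>b\<close> would kill a nonzero vector supported on \<open>F\<close>.\<close>

lemma equivalence_hall_condition:
  assumes a: "a \<in> matrices (reduced_algebra G) n m" and b: "b \<in> matrices (reduced_algebra G) m n"
    and ab: "matrix_times m a b = diag_matrix n (\<lambda>i. chi (S i))"
    and ba: "matrix_times n b a = diag_matrix m (\<lambda>i. chi (T i))"
  shows "\<exists>R. \<forall>F. finite F \<longrightarrow> F \<subseteq> places n S \<longrightarrow>
    card F \<le> card (\<Union>p\<in>F. {q \<in> places m T. d (snd q) (snd p) \<le> R})"
proof -
  define C where "C = (\<Sum>i<n. \<Sum>j<m. norm (a i j) * norm (chi (T j)))"
  \<comment> \<open>The approximation error of \<open>b\<close> must be beaten by the norms of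
    \<open>a\<close> and of the projections collected in \<open>C\<close>; adding one avoids
    dividing by zero.\<close>
  define \<epsilon> where "\<epsilon> = 1 / (C + 1)"
  have C: "C \<ge> 0" unfolding C_def by (intro sum_nonneg) auto
  then have \<epsilon>: "\<epsilon> > 0" "C * \<epsilon> < 1" unfolding \<epsilon>_def by (auto simp: field_simps)
  have "\<exists>\<phi> R. controlled \<phi> R \<and> norm (b j k - op \<phi>) < \<epsilon>" for j k
  proof -
    have "b j k \<in> closure pre_algebra" using reduced.matrix_entry[OF b] unfolding reduced_algebra_eq .
    then obtain w where "w \<in> pre_algebra" "dist w (b j k) < \<epsilon>" using closure_approachable \<epsilon>(1) by blast
    then show ?thesis unfolding pre_algebra_def by (auto simp: dist_norm norm_minus_commute)
  qed
  then have "\<forall>p. \<exists>\<phi>R. controlled (fst \<phi>R) (snd \<phi>R) \<and> norm (b (fst p) (snd p) - op (fst \<phi>R)) < \<epsilon>" by simp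
  from choice[OF this] obtain f
    where f: "\<And>p. controlled (fst (f p)) (snd (f p))" "\<And>p. norm (b (fst p) (snd p) - op (fst (f p))) < \<epsilon>" by blast
  define \<phi> where "\<phi> j k = fst (f (j, k))" for j k
  define r where "r j k = snd (f (j, k))" for j k
  have \<phi>: "controlled (\<phi> j k) (r j k)" and approx: "norm (b j k - op (\<phi> j k)) < \<epsilon>" for j k
    using f[of "(j, k)"] by (auto simp: \<phi>_def r_def)
  have r0: "r j k \<ge> 0" for j k using \<phi>[of j k] by (simp add: controlled_def)
  \<comment> \<open>The propagations are nonnegative, so their sum bounds each of them; this is the
    radius in Hall's condition.\<close>
  define R where "R = (\<Sum>j<m. \<Sum>k<n. r j k)"
  have rR: "r j k \<le> R" if "j < m" "k < n" for j k
  proof -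
    have "r j k \<le> (\<Sum>k<n. r j k)" by (rule member_le_sum) (use that r0 in auto)
    also have "\<dots> \<le> R" unfolding R_def
      by (rule member_le_sum[where f = "\<lambda>j. \<Sum>k<n. r j k"]) (use that r0 in \<open>auto intro: sum_nonneg\<close>)
    finally show ?thesis .
  qed
  obtain N where N: "\<And>x. x \<in> X \<Longrightarrow> finite {w\<in>X. d x w \<le> R}" using ball_card_bound by metis
  let ?N = "\<lambda>p. {q \<in> places m T. d (snd q) (snd p) \<le> R}"
  have finN: "finite (?N p)" if "p \<in> places n S" for p
  proof (rule finite_subset)
    show "?N p \<subseteq> {..<m} \<times> {w\<in>X. d (snd p) w \<le> R}" by (auto simp: places_def commute)
    show "finite ({..<m} \<times> {w\<in>X. d (snd p) w \<le> R})" using N that by (auto simp: places_def)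
  qed
  have "card F \<le> card (\<Union>(?N ` F))" if F: "finite F" "F \<subseteq> places n S" for F
  proof (rule ccontr)
    assume "\<not> card F \<le> card (\<Union>(?N ` F))"
    then have less: "card (\<Union>(?N ` F)) < card F" by simp
    have finU: "finite (\<Union>(?N ` F))" using F finN by blast
    \<comment> \<open>One unknown for each place in \<open>F\<close> and one equation for each
      neighbouring place: fewer equations than unknowns.\<close>
    obtain c where c: "\<exists>p\<in>F. c p \<noteq> 0"
      "\<And>q. q \<in> \<Union>(?N ` F) \<Longrightarrow> (\<Sum>p\<in>F. \<phi> (fst q) (fst p) (snd q, snd p) * c p) = 0"
      using underdetermined_homogeneous_system[OF finU F(1) less, of "\<lambda>q p. \<phi> (fst q) (fst p) (snd q, snd p)"] by blast
    obtain p0 where p0: "p0 \<in> F" "c p0 \<noteq> 0" using c(1) by blast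
    \<comment> \<open>Only some base point is required, to choose the fibre serving as a copy of
      \<open>X\<close>; a place of \<open>F\<close> where \<open>c\<close> does not vanish provides
      one.\<close>
    define x0 where "x0 = snd p0"
    have x0: "x0 \<in> X" using p0 F by (auto simp: x0_def places_def)
    \<comment> \<open>The \<open>k\<close>-th component of the vector with coefficients
      \<open>c\<close>, transported to the fibre over \<open>x0\<close>.\<close>
    define \<xi> where "\<xi> k = finite_ell2 (\<lambda>h. \<Sum>p\<in>F. if fst p = k \<and> h = fibre_point x0 (snd p) then c p else 0)" for k
    have \<xi>: "coord (\<xi> k) h = (\<Sum>p\<in>F. if fst p = k \<and> h = fibre_point x0 (snd p) then c p else 0)" for k h
      unfolding \<xi>_def
    proof (rule coord_finite_ell2, rule finite_subset)
      show "{h. (\<Sum>p\<in>F. if fst p = k \<and> h = fibre_point x0 (snd p) then c p else 0) \<noteq> 0} \<subseteq> (\<lambda>p. fibre_point x0 (snd p)) ` F"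
      proof
        fix h assume "h \<in> {h. (\<Sum>p\<in>F. if fst p = k \<and> h = fibre_point x0 (snd p) then c p else 0) \<noteq> 0}"
        then have "(\<Sum>p\<in>F. if fst p = k \<and> h = fibre_point x0 (snd p) then c p else 0) \<noteq> 0" by simp
        then obtain p where "p \<in> F" "(if fst p = k \<and> h = fibre_point x0 (snd p) then c p else 0) \<noteq> 0"
          by (rule sum.not_neutral_contains_not_neutral)
        then show "h \<in> (\<lambda>p. fibre_point x0 (snd p)) ` F" by (auto split: if_splits)
      qed
    qed (use F in auto)
    have \<xi>_at: "coord (\<xi> k) (fibre_point x0 x) = (if (k, x) \<in> F then c (k, x) else 0)" for k x
    proof -
      have "coord (\<xi> k) (fibre_point x0 x) = (\<Sum>p\<in>F. if p = (k, x) then c (k, x) else 0)"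
        unfolding \<xi> by (intro sum.cong) auto
      then show ?thesis using F(1) by (simp add: sum.delta)
    qed
    have \<xi>_supp: "h \<in> fibre_point x0 ` X" if "coord (\<xi> k) h \<noteq> 0" for k h
    proof -
      have "(\<Sum>p\<in>F. if fst p = k \<and> h = fibre_point x0 (snd p) then c p else 0) \<noteq> 0" using that unfolding \<xi> .
      then obtain p where p: "p \<in> F" "(if fst p = k \<and> h = fibre_point x0 (snd p) then c p else 0) \<noteq> 0"
        by (rule sum.not_neutral_contains_not_neutral)
      have "h = fibre_point x0 (snd p)" using p(2) by presburger
      moreover have "snd p \<in> X" using subsetD[OF F(2) p(1)] by (simp add: places_def case_prod_unfold)
      ultimately show ?thesis by (rule image_eqI)
    qed
    define \<eta> where "\<eta> j = (\<Sum>k<n. op (\<phi> j k) (\<xi> k))" for j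
    have \<eta>_off: "coord (\<eta> j) g = 0" if "g \<notin> fibre_point x0 ` X" for j g
      unfolding \<eta>_def coord_sum
      by (intro sum.neutral ballI coord_op_off_fibre[OF \<phi> x0 _ that]) (rule \<xi>_supp)
    have \<eta>_at: "coord (\<eta> j) (fibre_point x0 y) = (\<Sum>p\<in>F. \<phi> j (fst p) (y, snd p) * c p)" if y: "y \<in> X" for j y
    proof -
      have inner: "coord (op (\<phi> j k) (\<xi> k)) (fibre_point x0 y) = (\<Sum>p\<in>{p \<in> F. fst p = k}. \<phi> j k (y, snd p) * c p)" for k
      proof -
        let ?Z = "{x. x \<in> X \<and> \<phi> j k (y, x) \<noteq> 0}" and ?F = "{p \<in> F. fst p = k}"
        have inj: "inj_on snd ?F" by (auto simp: inj_on_def prod_eq_iff)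
        have "coord (op (\<phi> j k) (\<xi> k)) (fibre_point x0 y) = (\<Sum>x\<in>?Z. \<phi> j k (y, x) * (if (k, x) \<in> F then c (k, x) else 0))"
          unfolding coord_op_fibre[OF \<phi> x0 y] \<xi>_at ..
        also have "\<dots> = (\<Sum>x\<in>snd ` ?F. \<phi> j k (y, x) * (if (k, x) \<in> F then c (k, x) else 0))"
        proof (rule sum.mono_neutral_cong)
          show "finite ?Z" by (rule controlled_row_finite[OF \<phi>])
          show "finite (snd ` ?F)" using F by simp
          show "\<phi> j k (y, x) * (if (k, x) \<in> F then c (k, x) else 0) = 0" if x: "x \<in> snd ` ?F - ?Z" for x
            using x F by (auto simp: places_def)
          show "\<phi> j k (y, x) * (if (k, x) \<in> F then c (k, x) else 0) = 0" if x: "x \<in> ?Z - snd ` ?F" for x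
          proof -
            have "(k, x) \<notin> F"
            proof
              assume "(k, x) \<in> F"
              then have "x \<in> snd ` ?F" by (intro image_eqI[of _ _ "(k, x)"]) auto
              then show False using x by blast
            qed
            then show ?thesis by simp
          qed
        qed (rule refl)
        also have "\<dots> = (\<Sum>p\<in>?F. \<phi> j k (y, snd p) * (if (k, snd p) \<in> F then c (k, snd p) else 0))"
          by (simp add: sum.reindex[OF inj])
        also have "\<dots> = (\<Sum>p\<in>?F. \<phi> j k (y, snd p) * c p)"
          by (intro sum.cong refl) auto
        finally show ?thesis .
      qed
      have "coord (\<eta> j) (fibre_point x0 y) = (\<Sum>k<n. \<Sum>p\<in>{p \<in> F. fst p = k}. \<phi> j (fst p) (y, snd p) * c p)"
        unfolding \<eta>_def coord_sum inner by (intro sum.cong) auto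
      also have "\<dots> = (\<Sum>p\<in>F. \<phi> j (fst p) (y, snd p) * c p)"
        by (rule sum.group) (use F in \<open>auto simp: places_def\<close>)
      finally show ?thesis .
    qed
    \<comment> \<open>At a neighbour of \<open>F\<close> the coefficient vanishes by the linear
      equation, at any other place of the projection \<open>T\<close> by finite propagation.\<close>
    have chi_\<eta>: "chi (T j) (\<eta> j) = 0" if j: "j < m" for j
    proof (rule coord_eqI)
      fix g
      show "coord (chi (T j) (\<eta> j)) g = coord 0 g"
      proof (cases "g \<in> fibre_point x0 ` X")
        case True
        then obtain y where y: "y \<in> X" "g = fibre_point x0 y" by blast
        have "(\<Sum>p\<in>F. \<phi> j (fst p) (y, snd p) * c p) = 0" if "y \<in> T j"
        proof (cases "(j, y) \<in> \<Union>(?N ` F)")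
          case True
          then show ?thesis using c(2)[OF True] by simp
        next
          case False
          have "\<phi> j (fst p) (y, snd p) = 0" if p: "p \<in> F" for p
          proof (rule ccontr)
            assume "\<phi> j (fst p) (y, snd p) \<noteq> 0"
            then have "d y (snd p) \<le> r j (fst p)" using \<phi>[of j "fst p"] by (auto simp: controlled_def near_def)
            also have "\<dots> \<le> R" using rR[OF j] p F by (auto simp: places_def)
            finally have "(j, y) \<in> ?N p" using j y \<open>y \<in> T j\<close> by (simp add: places_def)
            then show False using False p by blast
          qed
          then show ?thesis by simp
        qed
        then show ?thesis unfolding y(2) coord_chi_fibre[OF x0 y(1)] \<eta>_at[OF y(1)] by (simp add: zero_ell2.rep_eq)
      next
        case False
        have "coord (chi (T j) (\<eta> j)) g = 0"
          unfolding chi_def by (rule coord_op_off_fibre[OF controlled_chi x0 _ False]) (use \<eta>_off in blast)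
        then show ?thesis by (simp add: zero_ell2.rep_eq)
      qed
    qed
    have chi_\<xi>: "chi (S i) (\<xi> i) = \<xi> i" if "i < n" for i
    proof (rule coord_eqI)
      fix g
      show "coord (chi (S i) (\<xi> i)) g = coord (\<xi> i) g"
      proof (cases "g \<in> fibre_point x0 ` X")
        case True
        then obtain y where y: "y \<in> X" "g = fibre_point x0 y" by blast
        have "y \<in> S i" if "(i, y) \<in> F" using that F by (auto simp: places_def)
        then show ?thesis unfolding y(2) coord_chi_fibre[OF x0 y(1)] \<xi>_at by auto
      next
        case False
        have "coord (chi (S i) (\<xi> i)) g = 0"
          unfolding chi_def by (rule coord_op_off_fibre[OF controlled_chi x0 _ False]) (use \<xi>_supp in blast)
        then show ?thesis using \<xi>_supp False by metis
      qed
    qed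
    \<comment> \<open>Since the product of \<open>a\<close> and \<open>b\<close> is idempotent, the
      product of \<open>b\<close> and \<open>a\<close> may be inserted between them, which places
      the projection \<open>T\<close> in front of \<open>b\<close>.\<close>
    have "diag_matrix n (\<lambda>i. chi (S i)) = matrix_times m a (matrix_times m (diag_matrix m (\<lambda>i. chi (T i))) b)"
      unfolding ba[symmetric] using diag_matrix_chi_times[of n S] unfolding ab[symmetric] by (simp add: matrix_times_assoc)
    then have recon: "(if i = k \<and> i < n then chi (S i) else 0) = (\<Sum>j<m. a i j o\<^sub>L (chi (T j) o\<^sub>L b j k))" for i k
    proof -
      assume eq: "diag_matrix n (\<lambda>i. chi (S i)) = matrix_times m a (matrix_times m (diag_matrix m (\<lambda>i. chi (T i))) b)"
      have "matrix_times m (diag_matrix m (\<lambda>i. chi (T i))) b j k = chi (T j) o\<^sub>L b j k" if "j < m" for j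
      proof -
        have "matrix_times m (diag_matrix m (\<lambda>i. chi (T i))) b j k = (\<Sum>l<m. if l = j then chi (T j) o\<^sub>L b j k else 0)"
          unfolding matrix_times_def diag_matrix_def using that by (intro sum.cong) auto
        then show ?thesis using that by (simp add: sum.delta)
      qed
      then show ?thesis using fun_cong[OF fun_cong[OF eq], of i k]
        unfolding matrix_times_def[of m a] diag_matrix_def by simp
    qed
    \<comment> \<open>The vector is reproduced by \<open>a\<close>, \<open>T\<close> and
      \<open>b\<close>. As \<open>T\<close> annihilates the approximation of \<open>b\<close>
      applied to it, only the error of size \<open>\<epsilon>\<close> remains.\<close>
    have bound: "norm (\<xi> i) \<le> (\<Sum>j<m. norm (a i j) * norm (chi (T j))) * (\<epsilon> * (\<Sum>k<n. norm (\<xi> k)))" if i: "i < n" for i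
    proof -
      have "\<xi> i = (\<Sum>k<n. (if i = k \<and> i < n then chi (S i) else 0) (\<xi> k))"
      proof -
        have "(\<Sum>k<n. (if i = k \<and> i < n then chi (S i) else 0) (\<xi> k)) = (\<Sum>k<n. if k = i then \<xi> i else 0)"
          using i chi_\<xi>[OF i] by (intro sum.cong) (auto simp: zero_blinfun.rep_eq)
        then show ?thesis using i by (simp add: sum.delta)
      qed
      also have "\<dots> = (\<Sum>k<n. \<Sum>j<m. a i j (chi (T j) (b j k (\<xi> k))))"
        unfolding recon by (simp add: blinfun.sum_left)
      also have "\<dots> = (\<Sum>j<m. \<Sum>k<n. a i j (chi (T j) (b j k (\<xi> k))))" by (rule sum.swap)
      also have "\<dots> = (\<Sum>j<m. a i j (chi (T j) (\<Sum>k<n. (b j k - op (\<phi> j k)) (\<xi> k))))"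
      proof (rule sum.cong[OF refl])
        fix j assume "j \<in> {..<m}"
        have "(\<Sum>k<n. a i j (chi (T j) (b j k (\<xi> k)))) = a i j (chi (T j) (\<Sum>k<n. b j k (\<xi> k)))"
          by (simp add: blinfun.sum_right)
        also have "(\<Sum>k<n. b j k (\<xi> k)) = (\<Sum>k<n. (b j k - op (\<phi> j k)) (\<xi> k)) + \<eta> j"
          unfolding \<eta>_def sum.distrib[symmetric] by (simp add: minus_blinfun.rep_eq)
        also have "a i j (chi (T j) \<dots>) = a i j (chi (T j) (\<Sum>k<n. (b j k - op (\<phi> j k)) (\<xi> k)))"
          using chi_\<eta> \<open>j \<in> {..<m}\<close> by (simp add: blinfun.add_right blinfun.zero_right)
        finally show "(\<Sum>k<n. a i j (chi (T j) (b j k (\<xi> k)))) = a i j (chi (T j) (\<Sum>k<n. (b j k - op (\<phi> j k)) (\<xi> k)))" .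
      qed
      also have "norm \<dots> \<le> (\<Sum>j<m. norm (a i j) * norm (chi (T j)) * (\<epsilon> * (\<Sum>k<n. norm (\<xi> k))))"
      proof (rule sum_norm_le)
        fix j
        have "norm (a i j (chi (T j) (\<Sum>k<n. (b j k - op (\<phi> j k)) (\<xi> k))))
            \<le> norm (a i j) * (norm (chi (T j)) * norm (\<Sum>k<n. (b j k - op (\<phi> j k)) (\<xi> k)))"
          by (intro order_trans[OF norm_blinfun] mult_left_mono norm_blinfun norm_ge_zero)
        also have "norm (\<Sum>k<n. (b j k - op (\<phi> j k)) (\<xi> k)) \<le> (\<Sum>k<n. \<epsilon> * norm (\<xi> k))"
          by (intro sum_norm_le order_trans[OF norm_blinfun] mult_right_mono norm_ge_zero less_imp_le[OF approx])
        also have "\<dots> = \<epsilon> * (\<Sum>k<n. norm (\<xi> k))" by (simp add: sum_distrib_left)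
        finally show "norm (a i j (chi (T j) (\<Sum>k<n. (b j k - op (\<phi> j k)) (\<xi> k))))
            \<le> norm (a i j) * norm (chi (T j)) * (\<epsilon> * (\<Sum>k<n. norm (\<xi> k)))"
          by (simp add: mult.assoc mult_left_mono)
      qed
      finally show ?thesis by (simp add: sum_distrib_right)
    qed
    \<comment> \<open>Summing the estimates over the components bounds this positive number by
      \<open>C * \<epsilon>\<close> times itself, although \<open>C * \<epsilon>\<close> is below
      one.\<close>
    define Y where "Y = (\<Sum>k<n. norm (\<xi> k))"
    have "Y \<le> (\<Sum>i<n. (\<Sum>j<m. norm (a i j) * norm (chi (T j))) * (\<epsilon> * Y))"
      unfolding Y_def by (intro sum_mono) (use bound in auto)
    also have "\<dots> = C * \<epsilon> * Y" unfolding C_def by (simp add: sum_distrib_right mult.assoc)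
    finally have "Y \<le> C * \<epsilon> * Y" .
    moreover have "Y > 0"
    proof -
      have "fst p0 < n" using p0 F by (auto simp: places_def)
      have "coord (\<xi> (fst p0)) (fibre_point x0 (snd p0)) \<noteq> 0" unfolding \<xi>_at using p0 by simp
      then have "\<xi> (fst p0) \<noteq> 0" by (auto simp: zero_ell2.rep_eq)
      then have "0 < norm (\<xi> (fst p0))" by simp
      also have "\<dots> \<le> Y" unfolding Y_def using \<open>fst p0 < n\<close> by (intro member_le_sum) auto
      finally show ?thesis .
    qed
    ultimately show False using \<epsilon>(2) by (simp add: mult_le_cancel_right1)
  qed
  then show ?thesis by blast
qed

lemma hall_bounded_injection:
  assumes "\<And>F. finite F \<Longrightarrow> F \<subseteq> places n S \<Longrightarrow> card F \<le> card (\<Union>p\<in>F. {q \<in> places m T. d (snd q) (snd p) \<le> R})"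
  shows "\<exists>f. inj_on f (places n S) \<and> (\<forall>p\<in>places n S. f p \<in> places m T \<and> d (snd (f p)) (snd p) \<le> R)"
proof -
  obtain N where N: "\<And>x. x \<in> X \<Longrightarrow> finite {w\<in>X. d x w \<le> R}" using ball_card_bound by metis
  have "\<exists>f. inj_on f (places n S) \<and> (\<forall>p\<in>places n S. f p \<in> {q \<in> places m T. d (snd q) (snd p) \<le> R})"
  proof (rule hall_locally_finite)
    fix p assume p: "p \<in> places n S"
    have "{q \<in> places m T. d (snd q) (snd p) \<le> R} \<subseteq> {..<m} \<times> {w\<in>X. d (snd p) w \<le> R}"
      by (auto simp: places_def commute)
    moreover have "finite ({..<m} \<times> {w\<in>X. d (snd p) w \<le> R})" using N p by (auto simp: places_def)
    ultimately show "finite {q \<in> places m T. d (snd q) (snd p) \<le> R}" by (rule finite_subset)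
  qed (use assms in auto)
  then show ?thesis by auto
qed

text \<open>Hall's condition is applied to the implementing matrix and to its star. Each matched
  pair comes from one of the two injections, so the larger radius bounds the displacement.\<close>

theorem bijection_of_mvn_equiv:
  assumes "mvn_equiv (reduced_algebra G) (diag_proj n S) (diag_proj m T)"
  shows "\<exists>\<theta> R. bij_betw \<theta> (places n S) (places m T) \<and> (\<forall>p\<in>places n S. d (snd (\<theta> p)) (snd p) \<le> R)"
proof -
  obtain v where v: "v \<in> matrices (reduced_algebra G) m n"
    "matrix_times m (matrix_star v) v = diag_matrix n (\<lambda>i. chi (S i))"
    "matrix_times n v (matrix_star v) = diag_matrix m (\<lambda>i. chi (T i))"
    using assms unfolding mvn_equiv_def diag_proj_def by auto
  note v' = reduced.matrix_star_in[OF v(1)]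
  obtain R1 where "\<And>F. finite F \<Longrightarrow> F \<subseteq> places n S \<Longrightarrow> card F \<le> card (\<Union>p\<in>F. {q \<in> places m T. d (snd q) (snd p) \<le> R1})"
    using equivalence_hall_condition[OF v' v] by blast
  from hall_bounded_injection[OF this] obtain f where f: "inj_on f (places n S)"
    "\<And>p. p \<in> places n S \<Longrightarrow> f p \<in> places m T \<and> d (snd (f p)) (snd p) \<le> R1" by blast
  obtain R2 where "\<And>F. finite F \<Longrightarrow> F \<subseteq> places m T \<Longrightarrow> card F \<le> card (\<Union>p\<in>F. {q \<in> places n S. d (snd q) (snd p) \<le> R2})"
    using equivalence_hall_condition[OF v(1) v' v(3,2)] by blast
  from hall_bounded_injection[OF this] obtain g where g: "inj_on g (places m T)"
    "\<And>p. p \<in> places m T \<Longrightarrow> g p \<in> places n S \<and> d (snd (g p)) (snd p) \<le> R2" by blast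
  have "f ` places n S \<subseteq> places m T" "g ` places m T \<subseteq> places n S" using f(2) g(2) by auto
  then obtain h where h: "bij_betw h (places n S) (places m T)" "\<And>p. p \<in> places n S \<Longrightarrow> h p = f p \<or> g (h p) = p"
    using Schroeder_Bernstein_graph[OF f(1) _ g(1)] by blast
  have "d (snd (h p)) (snd p) \<le> max R1 R2" if p: "p \<in> places n S" for p
  proof (cases "h p = f p")
    case True
    then show ?thesis using f(2)[OF p] by (simp add: le_max_iff_disj)
  next
    case False
    then have "g (h p) = p" using h(2)[OF p] by blast
    moreover have "h p \<in> places m T" using h(1) p by (metis bij_betwE)
    ultimately have "d (snd p) (snd (h p)) \<le> R2" using g(2)[of "h p"] by simp
    then show ?thesis by (simp add: commute[of "snd p"] le_max_iff_disj)
  qed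
  then show ?thesis using h(1) by blast
qed

end

section \<open>Equality of K0 classes of diagonal projections in terms of uniformly finite
  chains\<close>

subsection \<open>Classes of diagonal projections and boundaries\<close>

lemma fibrewise_bijection:
  assumes "f ` P \<subseteq> K" "g ` Q \<subseteq> K"
    and "\<And>x. x \<in> K \<Longrightarrow> finite {p\<in>P. f p = x} \<and> finite {q\<in>Q. g q = x} \<and> card {p\<in>P. f p = x} = card {q\<in>Q. g q = x}"
  shows "\<exists>h. bij_betw h P Q \<and> (\<forall>p\<in>P. g (h p) = f p)"
proof -
  have "\<forall>x\<in>K. \<exists>h. bij_betw h {p\<in>P. f p = x} {q\<in>Q. g q = x}"
    using assms(3) by (blast intro: finite_same_card_bij)
  from bchoice[OF this] obtain h where h: "\<And>x. x \<in> K \<Longrightarrow> bij_betw (h x) {p\<in>P. f p = x} {q\<in>Q. g q = x}" by blast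
  let ?h = "\<lambda>p. h (f p) p"
  have img: "?h p \<in> Q \<and> g (?h p) = f p" if "p \<in> P" for p
    using bij_betwE[OF h[of "f p"]] that assms(1) by auto
  have "inj_on ?h P"
  proof (rule inj_onI)
    fix p p' assume p: "p \<in> P" "p' \<in> P" "?h p = ?h p'"
    then have eq: "f p = f p'" using img[of p] img[of p'] by simp
    have "f p \<in> K" using assms(1) p(1) by blast
    then show "p = p'" using inj_onD[OF bij_betw_imp_inj_on[OF h], of "f p" p p'] p eq by simp
  qed
  moreover have "?h ` P = Q"
  proof
    show "?h ` P \<subseteq> Q" using img by blast
    show "Q \<subseteq> ?h ` P"
    proof
      fix q assume q: "q \<in> Q"
      then have "g q \<in> K" using assms(2) by blast
      then have "q \<in> h (g q) ` {p\<in>P. f p = g q}" using bij_betw_imp_surj_on[OF h] q by blast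
      then obtain p where p: "p \<in> P" "f p = g q" "q = h (g q) p" by blast
      then have "q = ?h p" by simp
      then show "q \<in> ?h ` P" using p(1) by (rule image_eqI)
    qed
  qed
  ultimately show ?thesis using img unfolding bij_betw_def by blast
qed

context coarse_space
begin

definition rank :: "nat \<Rightarrow> (nat \<Rightarrow> 'a set) \<Rightarrow> 'a \<Rightarrow> int" where
  "rank n S x = int (card {i. i < n \<and> x \<in> S i})"

text \<open>Sums over the arrows with source \<open>y\<close>, while \<open>row\<close> sums over
  those with a given range; the difference \<open>col \<phi> x - row \<phi> x\<close> is the
  boundary of the chain \<open>\<phi>\<close> at \<open>x\<close>.\<close>

definition col :: "('a \<times> 'a \<Rightarrow> int) \<Rightarrow> 'a \<Rightarrow> int" where
  "col \<phi> y = (\<Sum>x | x \<in> X \<and> \<phi> (x, y) \<noteq> 0. \<phi> (x, y))"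

definition row :: "('a \<times> 'a \<Rightarrow> int) \<Rightarrow> 'a \<Rightarrow> int" where
  "row \<phi> x = (\<Sum>y | y \<in> X \<and> \<phi> (x, y) \<noteq> 0. \<phi> (x, y))"

lemma finite_ball: "x \<in> X \<Longrightarrow> finite {w\<in>X. d x w \<le> R}"
  using ball_card_bound[of R] by metis

lemma col_eq_sum:
  assumes "controlled \<phi> R" "y \<in> X" "{w\<in>X. d y w \<le> R} \<subseteq> B" "finite B" "B \<subseteq> X"
  shows "col \<phi> y = (\<Sum>x\<in>B. \<phi> (x, y))"
  unfolding col_def
proof (rule sum.mono_neutral_left[OF assms(4)])
  show "{x. x \<in> X \<and> \<phi> (x, y) \<noteq> 0} \<subseteq> B"
    using assms(1,3) by (auto simp: controlled_def near_def commute[of y])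
qed (use assms(5) in auto)

lemma row_eq_sum:
  assumes "controlled \<phi> R" "x \<in> X" "{w\<in>X. d x w \<le> R} \<subseteq> B" "finite B" "B \<subseteq> X"
  shows "row \<phi> x = (\<Sum>y\<in>B. \<phi> (x, y))"
  unfolding row_def
proof (rule sum.mono_neutral_left[OF assms(4)])
  show "{y. y \<in> X \<and> \<phi> (x, y) \<noteq> 0} \<subseteq> B"
    using assms(1,3) by (auto simp: controlled_def near_def)
qed (use assms(5) in auto)

lemma card_places_over: "x \<in> X \<Longrightarrow> int (card {p \<in> places n S. snd p = x}) = rank n S x"
  and finite_places_over: "finite {p \<in> places n S. snd p = x}"
proof -
  have *: "{p \<in> places n S. snd p = x} \<subseteq> (\<lambda>i. (i, x)) ` {i. i < n \<and> x \<in> S i}" for x by (auto simp: places_def)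
  then show "finite {p \<in> places n S. snd p = x}" by (rule finite_subset) auto
  assume "x \<in> X"
  then have "{p \<in> places n S. snd p = x} = (\<lambda>i. (i, x)) ` {i. i < n \<and> x \<in> S i}" using * by (auto simp: places_def)
  then show "int (card {p \<in> places n S. snd p = x}) = rank n S x"
    by (simp add: rank_def card_image inj_on_def)
qed

lemma rank_append: "rank (n + m) (\<lambda>i. if i < n then S i else T (i - n)) x = rank n S x + rank m T x"
proof -
  have "{i. i < n + m \<and> x \<in> (if i < n then S i else T (i - n))}
      = {i. i < n \<and> x \<in> S i} \<union> (\<lambda>i. n + i) ` {i. i < m \<and> x \<in> T i}"
  proof (intro equalityI subsetI)
    fix i assume i: "i \<in> {i. i < n + m \<and> x \<in> (if i < n then S i else T (i - n))}"
    show "i \<in> {i. i < n \<and> x \<in> S i} \<union> (\<lambda>i. n + i) ` {i. i < m \<and> x \<in> T i}"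
    proof (cases "i < n")
      case False
      then show ?thesis using i by (intro UnI2 image_eqI[of _ _ "i - n"]) auto
    qed (use i in auto)
  qed (auto split: if_splits)
  moreover have "card ({i. i < n \<and> x \<in> S i} \<union> (\<lambda>i. n + i) ` {i. i < m \<and> x \<in> T i})
      = card {i. i < n \<and> x \<in> S i} + card {i. i < m \<and> x \<in> T i}"
    by (subst card_Un_disjoint) (auto simp: card_image)
  ultimately show ?thesis by (simp add: rank_def)
qed

text \<open>The chain counts, for each pair of points, the places over the second that are moved to
  places over the first. Its column sums count the places before the move and its row sums those
  after it.\<close>

lemma boundary_of_bijection:
  assumes \<theta>: "bij_betw \<theta> (places n S) (places m T)" and R: "\<And>p. p \<in> places n S \<Longrightarrow> d (snd (\<theta> p)) (snd p) \<le> R"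
  shows "\<exists>\<phi> R. controlled \<phi> R \<and> (\<forall>x\<in>X. rank n S x - rank m T x = col \<phi> x - row \<phi> x)"
proof -
  let ?R = "max R 0"
  define P where "P y x = {p \<in> places n S. snd p = x \<and> snd (\<theta> p) = y}" for y x
  define \<phi> :: "'a \<times> 'a \<Rightarrow> int" where "\<phi> = (\<lambda>(y, x). int (card (P y x)))"
  have finP: "finite (P y x)" for y x
    unfolding P_def by (rule finite_subset[OF _ finite_places_over[of n S x]]) auto
  have \<theta>_in: "\<theta> p \<in> places m T" if "p \<in> places n S" for p using bij_betwE[OF \<theta>] that by blast
  have near: "near ?R (y, x)" if "p \<in> P y x" for p y x
    using that R[of p] \<theta>_in[of p] by (auto simp: P_def places_def near_def le_max_iff_disj)
  have \<phi>_le: "\<phi> p \<le> int n" "0 \<le> \<phi> p" for p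
  proof -
    obtain y x where p: "p = (y, x)" by (cases p)
    have "P y x \<subseteq> (\<lambda>i. (i, x)) ` {..<n}" by (auto simp: P_def places_def)
    then have "card (P y x) \<le> card ((\<lambda>i. (i, x)) ` {..<n})" by (intro card_mono) auto
    also have "\<dots> = n" by (simp add: card_image inj_on_def)
    finally show "\<phi> p \<le> int n" "0 \<le> \<phi> p" by (auto simp: p \<phi>_def)
  qed
  have "controlled \<phi> ?R"
    unfolding controlled_def
  proof (intro conjI allI impI)
    show "bounded (range \<phi>)" unfolding bounded_def
    proof (rule exI[of _ 0], rule exI[of _ "real n"], clarify)
      fix x y
      show "dist 0 (\<phi> (x, y)) \<le> real n" unfolding dist_int_def using \<phi>_le[of "(x, y)"] by linarith
    qed
    fix p assume "\<phi> p \<noteq> 0"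
    then obtain q where "q \<in> P (fst p) (snd p)" by (cases p) (auto simp: \<phi>_def card_eq_0_iff)
    then show "near ?R p" using near by (metis prod.collapse)
  qed simp
  moreover have "col \<phi> x = rank n S x" if x: "x \<in> X" for x
  proof -
    let ?B = "{w\<in>X. d x w \<le> ?R}"
    have "col \<phi> x = (\<Sum>y\<in>?B. int (card (P y x)))"
      using col_eq_sum[OF calculation x subset_refl finite_ball[OF x]] by (simp add: \<phi>_def)
    also have "\<dots> = (\<Sum>y\<in>?B. \<Sum>p\<in>{p \<in> {p \<in> places n S. snd p = x}. snd (\<theta> p) = y}. 1)"
      by (intro sum.cong refl) (simp add: P_def conj_assoc)
    also have "\<dots> = (\<Sum>p\<in>{p \<in> places n S. snd p = x}. 1)"
    proof (rule sum.group[OF finite_places_over finite_ball[OF x]])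
      show "(\<lambda>p. snd (\<theta> p)) ` {p \<in> places n S. snd p = x} \<subseteq> ?B"
        using near unfolding P_def by (fastforce simp: near_def commute)
    qed
    also have "\<dots> = rank n S x" using card_places_over[OF x] by simp
    finally show ?thesis .
  qed
  moreover have "row \<phi> y = rank m T y" if y: "y \<in> X" for y
  proof -
    let ?B = "{w\<in>X. d y w \<le> ?R}" and ?Q = "{p \<in> places n S. snd (\<theta> p) = y}"
    have bij: "bij_betw \<theta> ?Q {q \<in> places m T. snd q = y}"
    proof (rule bij_betw_subset[OF \<theta>])
      show "\<theta> ` ?Q = {q \<in> places m T. snd q = y}"
      proof (intro equalityI subsetI)
        fix q assume q: "q \<in> {q \<in> places m T. snd q = y}"
        then obtain p where "p \<in> places n S" "q = \<theta> p" using bij_betw_imp_surj_on[OF \<theta>] by blast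
        then show "q \<in> \<theta> ` ?Q" using q by blast
      qed (use \<theta>_in in auto)
    qed auto
    have "row \<phi> y = (\<Sum>x\<in>?B. int (card (P y x)))"
      using row_eq_sum[OF calculation(1) y subset_refl finite_ball[OF y]] by (simp add: \<phi>_def)
    also have "\<dots> = (\<Sum>x\<in>?B. \<Sum>p\<in>{p \<in> ?Q. snd p = x}. 1)"
      by (intro sum.cong refl) (simp add: P_def conj_ac)
    also have "\<dots> = (\<Sum>p\<in>?Q. 1)"
    proof (rule sum.group[OF _ finite_ball[OF y]])
      show "finite ?Q" using bij_betw_finite[OF bij] finite_places_over by blast
      show "snd ` ?Q \<subseteq> ?B" using near unfolding P_def by (fastforce simp: near_def)
    qed
    also have "\<dots> = rank m T y" using card_places_over[OF y, of m T] bij_betw_same_card[OF bij] by simp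
    finally show ?thesis .
  qed
  ultimately show ?thesis by auto
qed

text \<open>The set \<open>Z\<close> below consists of \<open>c x\<close> loops at each \<open>x\<close> and \<open>\<psi> (y, x)\<close> edges from each \<open>x\<close> to each \<open>y\<close>;
  its projections to the starting and to the end points have the prescribed fibre sizes.\<close>

lemma bijection_of_boundary:
  assumes \<psi>: "controlled \<psi> R" "\<And>p. \<psi> p \<ge> 0" and c: "\<And>x. x \<in> X \<Longrightarrow> c x \<ge> 0"
    and U: "\<And>x. x \<in> X \<Longrightarrow> rank n S x = c x + col \<psi> x" and V: "\<And>x. x \<in> X \<Longrightarrow> rank m T x = c x + row \<psi> x"
  shows "\<exists>\<theta>. bij_betw \<theta> (places n S) (places m T) \<and> (\<forall>p\<in>places n S. d (snd (\<theta> p)) (snd p) \<le> R)"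
proof -
  \<comment> \<open>The flag \<open>b\<close> separates edges from loops, and \<open>k\<close>
    numbers parallel copies.\<close>
  define Z where "Z = {(b, k :: nat, y, x). y \<in> X \<and> x \<in> X \<and> (if b then int k < \<psi> (y, x) else y = x \<and> int k < c x)}"
  let ?s = "\<lambda>(b :: bool, k :: nat, y :: 'a, x :: 'a). x" and ?t = "\<lambda>(b :: bool, k :: nat, y :: 'a, x :: 'a). y"
  have R0: "R \<ge> 0" using \<psi> by (simp add: controlled_def)
  have d_Z: "d (?t z) (?s z) \<le> R" if "z \<in> Z" for z
  proof -
    obtain b k y x where z: "z = (b, k, y, x)" by (cases z)
    show ?thesis
    proof (cases b)
      case True
      then have "\<psi> (y, x) \<noteq> 0" using that unfolding z Z_def by auto
      then show ?thesis using \<psi>(1) unfolding z controlled_def near_def by auto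
    next
      case False
      then show ?thesis using that R0 unfolding z Z_def by auto
    qed
  qed
  have s: "finite {z\<in>Z. ?s z = x} \<and> int (card {z\<in>Z. ?s z = x}) = c x + col \<psi> x" if x: "x \<in> X" for x
  proof -
    let ?B = "{w\<in>X. d x w \<le> R}"
    let ?E = "SIGMA y:?B. {..<nat (\<psi> (y, x))}" and ?L = "{..<nat (c x)}"
    have eq: "{z\<in>Z. ?s z = x} = (\<lambda>(y, k). (True, k, y, x)) ` ?E \<union> (\<lambda>k. (False, k, x, x)) ` ?L"
    proof (intro equalityI subsetI)
      fix z assume z: "z \<in> {z\<in>Z. ?s z = x}"
      obtain b k y where zz: "z = (b, k, y, x)" using z by (cases z) auto
      show "z \<in> (\<lambda>(y, k). (True, k, y, x)) ` ?E \<union> (\<lambda>k. (False, k, x, x)) ` ?L"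
      proof (cases b)
        case True
        then have "(y, k) \<in> ?E" using z d_Z[of z] unfolding zz Z_def by (auto simp: commute[of x])
        then show ?thesis unfolding zz using True by (intro UnI1 image_eqI[of _ _ "(y, k)"]) auto
      next
        case False
        then show ?thesis using z unfolding zz Z_def by (intro UnI2 image_eqI[of _ _ k]) auto
      qed
    qed (use x in \<open>auto simp: Z_def\<close>)
    have finE: "finite ?E" using finite_ball[OF x] by auto
    have "card {z\<in>Z. ?s z = x} = card ?E + card ?L"
      unfolding eq using finE by (subst card_Un_disjoint) (auto simp: card_image inj_on_def)
    also have "card ?E = (\<Sum>y\<in>?B. nat (\<psi> (y, x)))" using finite_ball[OF x] by simp
    finally have "int (card {z\<in>Z. ?s z = x}) = (\<Sum>y\<in>?B. \<psi> (y, x)) + c x"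
      using \<psi>(2) c[OF x] by simp
    moreover have "col \<psi> x = (\<Sum>y\<in>?B. \<psi> (y, x))"
      using finite_ball[OF x] by (intro col_eq_sum[OF \<psi>(1) x]) auto
    moreover have "finite {z\<in>Z. ?s z = x}" unfolding eq using finE by simp
    ultimately show ?thesis by simp
  qed
  have t: "finite {z\<in>Z. ?t z = y} \<and> int (card {z\<in>Z. ?t z = y}) = c y + row \<psi> y" if y: "y \<in> X" for y
  proof -
    let ?B = "{w\<in>X. d y w \<le> R}"
    let ?E = "SIGMA x:?B. {..<nat (\<psi> (y, x))}" and ?L = "{..<nat (c y)}"
    have eq: "{z\<in>Z. ?t z = y} = (\<lambda>(x, k). (True, k, y, x)) ` ?E \<union> (\<lambda>k. (False, k, y, y)) ` ?L"
    proof (intro equalityI subsetI)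
      fix z assume z: "z \<in> {z\<in>Z. ?t z = y}"
      obtain b k x where zz: "z = (b, k, y, x)" using z by (cases z) auto
      show "z \<in> (\<lambda>(x, k). (True, k, y, x)) ` ?E \<union> (\<lambda>k. (False, k, y, y)) ` ?L"
      proof (cases b)
        case True
        then have "(x, k) \<in> ?E" using z d_Z[of z] unfolding zz Z_def by auto
        then show ?thesis unfolding zz using True by (intro UnI1 image_eqI[of _ _ "(x, k)"]) auto
      next
        case False
        then show ?thesis using z unfolding zz Z_def by (intro UnI2 image_eqI[of _ _ k]) auto
      qed
    qed (use y in \<open>auto simp: Z_def\<close>)
    have finE: "finite ?E" using finite_ball[OF y] by auto
    have "card {z\<in>Z. ?t z = y} = card ?E + card ?L"
      unfolding eq using finE by (subst card_Un_disjoint) (auto simp: card_image inj_on_def)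
    also have "card ?E = (\<Sum>x\<in>?B. nat (\<psi> (y, x)))" using finite_ball[OF y] by simp
    finally have "int (card {z\<in>Z. ?t z = y}) = (\<Sum>x\<in>?B. \<psi> (y, x)) + c y"
      using \<psi>(2) c[OF y] by simp
    moreover have "row \<psi> y = (\<Sum>x\<in>?B. \<psi> (y, x))"
      using finite_ball[OF y] by (intro row_eq_sum[OF \<psi>(1) y]) auto
    moreover have "finite {z\<in>Z. ?t z = y}" unfolding eq using finE by simp
    ultimately show ?thesis by simp
  qed
  have "\<exists>h. bij_betw h (places n S) Z \<and> (\<forall>p\<in>places n S. ?s (h p) = snd p)"
  proof (rule fibrewise_bijection[where K = X])
    show "finite {p \<in> places n S. snd p = x} \<and> finite {z\<in>Z. ?s z = x} \<and>
        card {p \<in> places n S. snd p = x} = card {z\<in>Z. ?s z = x}" if x: "x \<in> X" for x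
      using s[OF x] card_places_over[OF x, of n S] finite_places_over[of n S x] U[OF x] by linarith
  qed (auto simp: places_def Z_def)
  then obtain h1 where h1: "bij_betw h1 (places n S) Z" "\<And>p. p \<in> places n S \<Longrightarrow> ?s (h1 p) = snd p" by blast
  have "\<exists>h. bij_betw h Z (places m T) \<and> (\<forall>z\<in>Z. snd (h z) = ?t z)"
  proof (rule fibrewise_bijection[where K = X])
    show "finite {z\<in>Z. ?t z = x} \<and> finite {p \<in> places m T. snd p = x} \<and>
        card {z\<in>Z. ?t z = x} = card {p \<in> places m T. snd p = x}" if x: "x \<in> X" for x
      using t[OF x] card_places_over[OF x, of m T] finite_places_over[of m T x] V[OF x] by linarith
  qed (auto simp: places_def Z_def)
  then obtain h2 where h2: "bij_betw h2 Z (places m T)" "\<And>z. z \<in> Z \<Longrightarrow> snd (h2 z) = ?t z" by blast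
  have "d (snd ((h2 \<circ> h1) p)) (snd p) \<le> R" if p: "p \<in> places n S" for p
  proof -
    have "h1 p \<in> Z" using bij_betwE[OF h1(1)] p by blast
    then show ?thesis using h2(2)[of "h1 p"] h1(2)[OF p] d_Z[of "h1 p"] by simp
  qed
  then show ?thesis using bij_betw_trans[OF h1(1) h2(1)] by blast
qed

lemma rank_levels:
  assumes "a x \<le> int K"
  shows "rank K (\<lambda>i. {x. int i < a x}) x = max (a x) 0"
proof -
  have "{i. i < K \<and> x \<in> {x. int i < a x}} = {..<nat (a x)}" using assms by auto
  then show ?thesis by (simp add: rank_def)
qed

lemma controlled_int_bound:
  fixes \<phi> :: "'a \<times> 'a \<Rightarrow> int"
  assumes "controlled \<phi> R" obtains M :: nat where "\<And>p. \<bar>\<phi> p\<bar> \<le> int M"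
proof -
  obtain z :: int and e where e: "\<And>p. dist z (\<phi> p) \<le> e" using assms unfolding controlled_def bounded_def by auto
  have "\<bar>\<phi> p\<bar> \<le> int (nat (\<bar>z\<bar> + \<lceil>e\<rceil>))" for p
    using e[of p] unfolding dist_int_def by linarith
  then show thesis by (rule that)
qed

lemma row_bounded:
  assumes "controlled \<phi> R" obtains K :: nat where "\<And>x. x \<in> X \<Longrightarrow> \<bar>row \<phi> x\<bar> \<le> int K"
proof -
  obtain N where N: "\<And>x. x \<in> X \<Longrightarrow> finite {w\<in>X. d x w \<le> R}" "\<And>x. x \<in> X \<Longrightarrow> card {w\<in>X. d x w \<le> R} \<le> N"
    using ball_card_bound by metis
  obtain M where M': "\<And>p. \<bar>\<phi> p\<bar> \<le> int M" using controlled_int_bound[OF assms] by blast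
  have "\<bar>row \<phi> x\<bar> \<le> int (N * M)" if x: "x \<in> X" for x
  proof -
    let ?B = "{w\<in>X. d x w \<le> R}"
    have "row \<phi> x = (\<Sum>y\<in>?B. \<phi> (x, y))" using N(1)[OF x] by (intro row_eq_sum[OF assms x]) auto
    then have "\<bar>row \<phi> x\<bar> \<le> (\<Sum>y\<in>?B. \<bar>\<phi> (x, y)\<bar>)" by simp
    also have "\<dots> \<le> (\<Sum>y\<in>?B. int M)" by (intro sum_mono M')
    also have "\<dots> = int (card ?B * M)" by simp
    also have "\<dots> \<le> int (N * M)" using N(2)[OF x] by (simp add: mult_right_mono)
    finally show ?thesis .
  qed
  then show thesis by (rule that)
qed

text \<open>A negative coefficient on an edge is replaced by its absolute value on the reversed
  edge, which has the same boundary. Nonnegativity allows coefficients to be read as numbers of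
  edges.\<close>

lemma nonnegative_chain:
  assumes \<phi>: "controlled \<phi> R"
  shows "\<exists>\<psi>. controlled \<psi> R \<and> (\<forall>p. \<psi> p \<ge> 0) \<and> (\<forall>x\<in>X. col \<psi> x - row \<psi> x = col \<phi> x - row \<phi> x)"
proof -
  define \<psi> where "\<psi> = (\<lambda>(x, y). max (\<phi> (x, y)) 0 + max (- \<phi> (y, x)) 0)"
  obtain M where M: "\<And>p. \<bar>\<phi> p\<bar> \<le> int M" using controlled_int_bound[OF \<phi>] by blast
  have "dist 0 (\<psi> p) \<le> 2 * real M" for p
  proof -
    obtain x y where p: "p = (x, y)" by (cases p)
    have "\<bar>\<psi> p\<bar> \<le> 2 * int M"
      using M[of "(x, y)"] M[of "(y, x)"] unfolding p \<psi>_def prod.case by linarith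
    then show ?thesis unfolding dist_int_def by linarith
  qed
  then have "bounded (range \<psi>)" unfolding bounded_def by (intro exI[of _ 0] exI[of _ "2 * real M"]) auto
  moreover have "near R (x, y)" if "\<psi> (x, y) \<noteq> 0" for x y
  proof -
    have "\<phi> (x, y) \<noteq> 0 \<or> \<phi> (y, x) \<noteq> 0" using that unfolding \<psi>_def by auto
    then show ?thesis using \<phi> near_flip unfolding controlled_def by blast
  qed
  ultimately have c: "controlled \<psi> R" using \<phi> by (auto simp: controlled_def)
  have "col \<psi> x - row \<psi> x = col \<phi> x - row \<phi> x" if x: "x \<in> X" for x
  proof -
    let ?B = "{w\<in>X. d x w \<le> R}"
    have B: "?B \<subseteq> ?B" "finite ?B" "?B \<subseteq> X" using finite_ball[OF x] by auto
    have "(\<Sum>w\<in>?B. \<psi> (w, x) - \<psi> (x, w)) = (\<Sum>w\<in>?B. \<phi> (w, x) - \<phi> (x, w))"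
      by (intro sum.cong refl) (simp add: \<psi>_def max_def)
    then show ?thesis
      unfolding col_eq_sum[OF c x B] row_eq_sum[OF c x B] col_eq_sum[OF \<phi> x B] row_eq_sum[OF \<phi> x B]
      by (simp add: sum_subtractf)
  qed
  then show ?thesis using c by (intro exI[of _ \<psi>]) (auto simp: \<psi>_def)
qed

definition diag_class :: "nat \<Rightarrow> (nat \<Rightarrow> 'a set) \<Rightarrow> nat \<Rightarrow> (nat \<Rightarrow> 'a set) \<Rightarrow> ('a \<times> 'a) filter formal_difference set" where
  "diag_class n S n' S' = K0_rel (reduced_algebra G) `` {(diag_proj n S, diag_proj n' S')}"

text \<open>The forward direction will give injectivity of the comparison map, the backward one its
  being well defined; both compare only rank functions modulo boundaries.\<close>

theorem diag_class_eq_iff: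
  "diag_class n S n' S' = diag_class m T m' T' \<longleftrightarrow>
    (\<exists>\<phi> R. controlled \<phi> R \<and>
      (\<forall>x\<in>X. (rank n S x - rank n' S' x) - (rank m T x - rank m' T' x) = col \<phi> x - row \<phi> x))"
    (is "?L \<longleftrightarrow> ?R")
proof
  let ?app = "\<lambda>n S T i. if i < n then S i else T (i - n)"
  have eq: "?L \<longleftrightarrow> ((diag_proj n S, diag_proj n' S'), (diag_proj m T, diag_proj m' T')) \<in> K0_rel (reduced_algebra G)"
    unfolding diag_class_def by (rule reduced.K0_class_eq_iff) (rule diag_proj_in_reduced)+
  {
    assume ?L
    then obtain P where P: "P \<in> projections (reduced_algebra G)"
      "mvn_equiv (reduced_algebra G) (direct_sum (direct_sum (diag_proj n S) (diag_proj m' T')) P)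
         (direct_sum (direct_sum (diag_proj m T) (diag_proj n' S')) P)"
      unfolding eq K0_rel_def by blast
    \<comment> \<open>The stabilizer is exchanged for an identity matrix, which is itself diagonal
      with all entries \<open>chi UNIV\<close>, so both sides are diagonal projections.\<close>
    obtain k where k: "mvn_equiv (reduced_algebra G)
        (direct_sum (direct_sum (diag_proj n S) (diag_proj m' T')) (diag_proj k (\<lambda>_. UNIV)))
        (direct_sum (direct_sum (diag_proj m T) (diag_proj n' S')) (diag_proj k (\<lambda>_. UNIV)))"
      using reduced.mvn_equiv_cancel[OF chi_in chi_UNIV_left chi_UNIV_right
          reduced.direct_sum_in[OF diag_proj_in_reduced diag_proj_in_reduced]
          reduced.direct_sum_in[OF diag_proj_in_reduced diag_proj_in_reduced] P]
      unfolding diag_proj_def by blast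
    then obtain \<theta> R where \<theta>: "bij_betw \<theta> (places (n + m' + k) (?app (n + m') (?app n S T') (\<lambda>_. UNIV)))
        (places (m + n' + k) (?app (m + n') (?app m T S') (\<lambda>_. UNIV)))"
      "\<And>p. p \<in> places (n + m' + k) (?app (n + m') (?app n S T') (\<lambda>_. UNIV)) \<Longrightarrow> d (snd (\<theta> p)) (snd p) \<le> R"
      unfolding direct_sum_diag_proj by (blast dest: bijection_of_mvn_equiv)
    obtain \<phi> R' where \<phi>: "controlled \<phi> R'"
      and *: "\<And>x. x \<in> X \<Longrightarrow> rank (n + m' + k) (?app (n + m') (?app n S T') (\<lambda>_. UNIV)) x
         - rank (m + n' + k) (?app (m + n') (?app m T S') (\<lambda>_. UNIV)) x = col \<phi> x - row \<phi> x"
      using boundary_of_bijection[OF \<theta>] by blast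
    have "(rank n S x - rank n' S' x) - (rank m T x - rank m' T' x) = col \<phi> x - row \<phi> x" if x: "x \<in> X" for x
      using *[OF x] unfolding rank_append[where T = "\<lambda>_. UNIV"] rank_append by linarith
    then show ?R using \<phi> by blast
  }
  assume ?R
  then obtain \<phi> R where \<phi>: "controlled \<phi> R"
    "\<And>x. x \<in> X \<Longrightarrow> (rank n S x - rank n' S' x) - (rank m T x - rank m' T' x) = col \<phi> x - row \<phi> x" by blast
  obtain \<psi> where \<psi>: "controlled \<psi> R" "\<And>p. \<psi> p \<ge> 0" "\<And>x. x \<in> X \<Longrightarrow> col \<psi> x - row \<psi> x = col \<phi> x - row \<phi> x"
    using nonnegative_chain[OF \<phi>(1)] by blast
  obtain K where K: "\<And>x. x \<in> X \<Longrightarrow> \<bar>row \<psi> x\<bar> \<le> int K" using row_bounded[OF \<psi>(1)] by blast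
  \<comment> \<open>A diagonal projection whose rank function is \<open>row \<psi>\<close>. Adding
    it to both sides turns the ranks into a common nonnegative function plus
    \<open>col \<psi>\<close> and plus \<open>row \<psi>\<close>, as
    \<open>bijection_of_boundary\<close> demands.\<close>
  let ?lev = "\<lambda>i. {x. int i < row \<psi> x}"
  have row0: "row \<psi> x \<ge> 0" for x unfolding row_def by (intro sum_nonneg) (simp add: \<psi>(2))
  have lev: "rank K ?lev x = row \<psi> x" if x: "x \<in> X" for x
  proof -
    have "row \<psi> x \<le> int K" using K[OF x] by simp
    then show ?thesis using rank_levels[of "row \<psi>" x K] row0[of x] by simp
  qed
  have "\<exists>\<theta>. bij_betw \<theta> (places (n + m' + K) (?app (n + m') (?app n S T') ?lev))
        (places (m + n' + K) (?app (m + n') (?app m T S') ?lev)) \<and>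
      (\<forall>p\<in>places (n + m' + K) (?app (n + m') (?app n S T') ?lev). d (snd (\<theta> p)) (snd p) \<le> R)"
  proof (rule bijection_of_boundary[OF \<psi>(1,2), where c = "\<lambda>x. rank m T x + rank n' S' x"])
    fix x assume x: "x \<in> X"
    show "rank (n + m' + K) (?app (n + m') (?app n S T') ?lev) x = rank m T x + rank n' S' x + col \<psi> x"
      unfolding rank_append[where T = ?lev] rank_append lev[OF x] using \<phi>(2)[OF x] \<psi>(3)[OF x] by linarith
    show "rank (m + n' + K) (?app (m + n') (?app m T S') ?lev) x = rank m T x + rank n' S' x + row \<psi> x"
      unfolding rank_append[where T = ?lev] rank_append lev[OF x] ..
  qed (simp add: rank_def)
  then obtain \<theta> where \<theta>: "bij_betw \<theta> (places (n + m' + K) (?app (n + m') (?app n S T') ?lev))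
        (places (m + n' + K) (?app (m + n') (?app m T S') ?lev))"
      "\<And>p. p \<in> places (n + m' + K) (?app (n + m') (?app n S T') ?lev) \<Longrightarrow> d (snd (\<theta> p)) (snd p) \<le> R" by blast
  have "mvn_equiv (reduced_algebra G)
        (direct_sum (direct_sum (diag_proj n S) (diag_proj m' T')) (diag_proj K ?lev))
        (direct_sum (direct_sum (diag_proj m T) (diag_proj n' S')) (diag_proj K ?lev))"
    unfolding direct_sum_diag_proj
    by (rule mvn_equiv_of_bijection[OF \<theta>(1)]) (use \<theta>(2) in fastforce)
  then show ?L unfolding eq K0_rel_def using diag_proj_in_reduced by blast
qed

end

section \<open>Degree zero homology described by bounded functions on \<open>X\<close>, and the
  comparison map\<close>

subsection \<open>The comparison map\<close>

context coarse_space
begin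

lemma eventually_eq_Lim_int:
  fixes \<phi> :: "'x \<Rightarrow> int"
  assumes U: "ultrafilter U" and "bounded (range \<phi>)"
  shows "eventually (\<lambda>p. \<phi> p = Lim U \<phi>) U"
  using topological_tendstoD[OF ultrafilter_tendsto_Lim[OF assms], of "{Lim U \<phi>}"] by (simp add: open_discrete)

lemma bounded_int_iff: "bounded (range a) \<longleftrightarrow> (\<exists>M::nat. \<forall>x. \<bar>a x :: int\<bar> \<le> int M)"
proof
  assume "bounded (range a)"
  then obtain z :: int and e where e: "\<And>p. dist z (a p) \<le> e" unfolding bounded_def by auto
  have "\<bar>a p\<bar> \<le> int (nat (\<bar>z\<bar> + \<lceil>e\<rceil>))" for p using e[of p] unfolding dist_int_def by linarith
  then show "\<exists>M::nat. \<forall>x. \<bar>a x\<bar> \<le> int M" by blast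
next
  assume "\<exists>M::nat. \<forall>x. \<bar>a x\<bar> \<le> int M"
  then obtain M :: nat where M: "\<And>x. \<bar>a x\<bar> \<le> int M" by blast
  have "dist 0 (a x) \<le> real M" for x using M[of x] unfolding dist_int_def by linarith
  then show "bounded (range a)" unfolding bounded_def by (intro exI[of _ 0] exI[of _ "real M"]) auto
qed

lemma bounded_int_diff:
  assumes "bounded (range a)" "bounded (range b)" shows "bounded (range (\<lambda>x. a x - b x :: int))"
proof -
  obtain M M' :: nat where M: "\<And>x. \<bar>a x\<bar> \<le> int M" "\<And>x. \<bar>b x\<bar> \<le> int M'"
    using assms unfolding bounded_int_iff by blast
  have "\<bar>a x - b x\<bar> \<le> int (M + M')" for x using M(1)[of x] M(2)[of x] by linarith
  then show ?thesis unfolding bounded_int_iff by blast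
qed

lemma bounded_int_const: "bounded (range (\<lambda>_. k :: int))"
  by simp

lemma bounded_int_add:
  assumes "bounded (range a)" "bounded (range b)" shows "bounded (range (\<lambda>x. a x + b x :: int))"
  using bounded_int_diff[OF assms(1) bounded_int_diff[OF bounded_int_const[of 0] assms(2)]] by simp

lemma bounded_diagonal: "bounded (range a) \<Longrightarrow> bounded (range (diagonal a))"
  using controlled_diagonal[of a] by (simp add: controlled_def)

lemma extend_diagonal_eq_iff:
  "extend (diagonal a) = extend (diagonal b) \<longleftrightarrow> (\<forall>x\<in>X. a x = (b x :: 'b::{zero,t2_space}))"
proof
  assume eq: "extend (diagonal a) = extend (diagonal b)"
  show "\<forall>x\<in>X. a x = b x"
  proof
    fix x assume x: "x \<in> X"
    then show "a x = b x"
      using fun_cong[OF eq, of "principal {(x, x)}"] by (simp add: extend_principal) (simp add: diagonal_def)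
  qed
next
  assume "\<forall>x\<in>X. a x = b x"
  then have "diagonal a = diagonal b" by (auto simp: diagonal_def)
  then show "extend (diagonal a) = extend (diagonal b)" by simp
qed

text \<open>Along an ultrafilter a bounded integer-valued function is eventually equal to its limit,
  so any binary operation commutes with the extension. The condition on \<open>h 0 0\<close> takes
  care of pairs off the diagonal and of filters that are not arrows.\<close>

lemma extend_diagonal_map2:
  fixes a b :: "'a \<Rightarrow> int"
  assumes a: "bounded (range a)" and b: "bounded (range b)" and h0: "h 0 0 = 0"
  shows "h (extend (diagonal a) F) (extend (diagonal b) F) = extend (diagonal (\<lambda>x. h (a x) (b x))) F"
proof (cases "F \<in> coarse_arrows X d")
  case True
  then have U: "ultrafilter F" by (simp add: coarse_arrows_iff)
  have "eventually (\<lambda>p. diagonal a p = Lim F (diagonal a)) F" "eventually (\<lambda>p. diagonal b p = Lim F (diagonal b)) F"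
    by (intro eventually_eq_Lim_int[OF U] bounded_diagonal a b)+
  then have "eventually (\<lambda>p. diagonal (\<lambda>x. h (a x) (b x)) p = h (Lim F (diagonal a)) (Lim F (diagonal b))) F"
  proof eventually_elim
    case (elim p)
    obtain x y where p: "p = (x, y)" by fastforce
    have "diagonal (\<lambda>x. h (a x) (b x)) p = h (diagonal a p) (diagonal b p)"
      using h0 by (auto simp: diagonal_def p)
    then show ?case by (simp only: elim)
  qed
  then have "Lim F (diagonal (\<lambda>x. h (a x) (b x))) = h (Lim F (diagonal a)) (Lim F (diagonal b))"
    by (rule Lim_eventually_const[OF U])
  then show ?thesis using True by (simp add: extend_def)
qed (simp add: extend_def h0)

text \<open>Level sets survive the passage to ultrafilters because integer-valued functions are
  eventually constant there; thus \<open>level_projection\<close> consists of the operators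
  \<open>chi\<close>.\<close>

lemma indicator_level:
  fixes a :: "'a \<Rightarrow> int"
  assumes a: "bounded (range a)"
  shows "(indicator {u \<in> unit_arrows G. int i < extend (diagonal a) u} :: _ \<Rightarrow> complex)
    = extend (diagonal (indicator {x. int i < a x}))"
proof
  fix F
  let ?I = "indicator {x. int i < a x} :: 'a \<Rightarrow> complex"
  show "indicator {u \<in> unit_arrows G. int i < extend (diagonal a) u} F = extend (diagonal ?I) F"
  proof (cases "F \<in> unit_arrows G")
    case True
    then have F: "F \<in> coarse_arrows X d" "eventually (\<lambda>(x, y). x = y) F" by (auto simp: unit_arrows_eq arrows_in_def)
    then obtain R where U: "ultrafilter F" and R: "eventually (near R) F" by (auto simp: coarse_arrows_iff)
    have "eventually (\<lambda>p. diagonal a p = Lim F (diagonal a)) F"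
      by (rule eventually_eq_Lim_int[OF U bounded_diagonal[OF a]])
    with F(2) R have "eventually (\<lambda>p. diagonal ?I p = (if int i < Lim F (diagonal a) then 1 else 0)) F"
    proof eventually_elim
      case (elim p)
      obtain x where x: "p = (x, x)" "x \<in> X" using elim by (auto simp: near_def)
      then show ?case using elim(3) by (simp add: diagonal_def)
    qed
    then have "Lim F (diagonal ?I) = (if int i < Lim F (diagonal a) then 1 else 0)"
      by (rule Lim_eventually_const[OF U])
    then show ?thesis using True F(1) by (simp add: extend_def)
  next
    case False
    have "extend (diagonal ?I) \<in> C_units G" by (rule extend_diagonal_in_C_units[OF bounded_indicator])
    then show ?thesis using False by (simp add: C_units_def)
  qed
qed

lemma unit_point: "x \<in> X \<Longrightarrow> principal {(x, x)} \<in> unit_arrows G"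
  by (simp add: unit_arrows_eq arrows_in_def principal_arrow eventually_principal)

lemma level_projection_eq:
  fixes a :: "'a \<Rightarrow> int"
  assumes a: "bounded (range a)"
  shows "\<exists>N. level_projection G (extend (diagonal a)) = diag_proj N (\<lambda>i. {x. int i < a x}) \<and> (\<forall>x\<in>X. a x \<le> int N)"
proof -
  define N where "N = (LEAST N. \<forall>u\<in>unit_arrows G. extend (diagonal a) u \<le> int N)"
  obtain M :: nat where M: "\<And>x. \<bar>a x\<bar> \<le> int M" using a unfolding bounded_int_iff by blast
  have "extend (diagonal a) u \<le> int M" for u
  proof (cases "u \<in> coarse_arrows X d")
    case True
    then have U: "ultrafilter u" by (simp add: coarse_arrows_iff)
    then obtain p where "diagonal a p = Lim u (diagonal a)"
      using eventually_happens'[OF ultrafilter_not_bot[OF U] eventually_eq_Lim_int[OF U bounded_diagonal[OF a]]] by blast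
    moreover have "diagonal a p \<le> int M" using M[of "fst p"] by (auto simp: diagonal_def abs_le_iff split: prod.split)
    ultimately show ?thesis using True by (simp add: extend_def)
  qed (simp add: extend_def)
  then have "\<exists>N. \<forall>u\<in>unit_arrows G. extend (diagonal a) u \<le> int N" by blast
  then have N: "\<forall>u\<in>unit_arrows G. extend (diagonal a) u \<le> int N" unfolding N_def by (rule LeastI_ex)
  have "a x \<le> int N" if x: "x \<in> X" for x
    using N[rule_format, OF unit_point[OF x]] x by (simp add: extend_principal) (simp add: diagonal_def)
  moreover have "level_projection G (extend (diagonal a)) = diag_proj N (\<lambda>i. {x. int i < a x})"
    unfolding level_projection_def N_def[symmetric] Let_def indicator_level[OF a] diag_proj_def diag_matrix_def chi_def ..
  ultimately show ?thesis by blast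
qed

lemma unit_algebra_subset: "unit_algebra G \<subseteq> reduced_algebra G"
proof
  fix T assume "T \<in> unit_algebra G"
  then obtain f where f: "f \<in> C_units G" "T = conv_op G f" unfolding unit_algebra_def by blast
  then obtain a where "bounded (range a)" "f = extend (diagonal a)" using C_units_imp_extend[OF f(1)] by blast
  then show "T \<in> reduced_algebra G" unfolding f(2) by (simp add: op_in[OF controlled_diagonal])
qed

lemma chi_in_unit_algebra: "chi S \<in> unit_algebra G"
  unfolding chi_def unit_algebra_def by (intro imageI extend_diagonal_in_C_units bounded_indicator)

definition unit_class :: "('a \<Rightarrow> int) \<Rightarrow> ('a \<times> 'a) filter formal_difference set" where
  "unit_class a = K0_inclusion (reduced_algebra G) (rank_class G (extend (diagonal a)))"

lemma unit_class_diag: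
  assumes a: "bounded (range a)"
  obtains n S n' S' where "unit_class a = diag_class n S n' S'" "\<And>x. x \<in> X \<Longrightarrow> rank n S x - rank n' S' x = a x"
proof -
  have neg: "bounded (range (\<lambda>x. - a x))" using a unfolding bounded_int_iff by simp
  have "(\<lambda>u. - extend (diagonal a) u) = extend (diagonal (\<lambda>x. - a x))"
    using extend_diagonal_map2[OF a a, of "\<lambda>x y. - x"] by auto
  moreover obtain N where N: "level_projection G (extend (diagonal a)) = diag_proj N (\<lambda>i. {x. int i < a x})"
    "\<And>x. x \<in> X \<Longrightarrow> a x \<le> int N" using level_projection_eq[OF a] by blast
  moreover obtain N' where N': "level_projection G (extend (diagonal (\<lambda>x. - a x))) = diag_proj N' (\<lambda>i. {x. int i < - a x})"
    "\<And>x. x \<in> X \<Longrightarrow> - a x \<le> int N'" using level_projection_eq[OF neg] by blast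
  ultimately have "unit_class a = K0_inclusion (reduced_algebra G)
      (K0_rel (unit_algebra G) `` {(diag_proj N (\<lambda>i. {x. int i < a x}), diag_proj N' (\<lambda>i. {x. int i < - a x}))})"
    unfolding unit_class_def rank_class_def by simp
  also have "\<dots> = diag_class N (\<lambda>i. {x. int i < a x}) N' (\<lambda>i. {x. int i < - a x})"
    unfolding diag_class_def
    by (rule reduced.K0_inclusion_class[OF unit_algebra_subset])
      (use chi_in_unit_algebra[of "{}"] in \<open>auto simp: chi_empty intro: diag_proj_in[OF chi_in_unit_algebra]\<close>)
  finally show thesis
  proof (rule that)
    fix x assume x: "x \<in> X"
    show "rank N (\<lambda>i. {x. int i < a x}) x - rank N' (\<lambda>i. {x. int i < - a x}) x = a x"
      using rank_levels[of a x N] rank_levels[of "\<lambda>x. - a x" x N'] N(2)[OF x] N'(2)[OF x] by simp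
  qed
qed

lemma unit_class_eq_iff:
  assumes a: "bounded (range a)" and b: "bounded (range b)"
  shows "unit_class a = unit_class b \<longleftrightarrow> (\<exists>\<phi> R. controlled \<phi> R \<and> (\<forall>x\<in>X. a x - b x = col \<phi> x - row \<phi> x))"
proof -
  obtain n S n' S' where 1: "unit_class a = diag_class n S n' S'" "\<And>x. x \<in> X \<Longrightarrow> rank n S x - rank n' S' x = a x"
    using unit_class_diag[OF a] by blast
  obtain m T m' T' where 2: "unit_class b = diag_class m T m' T'" "\<And>x. x \<in> X \<Longrightarrow> rank m T x - rank m' T' x = b x"
    using unit_class_diag[OF b] by blast
  show ?thesis unfolding 1(1) 2(1) diag_class_eq_iff using 1(2) 2(2) by simp
qed

lemma unit_class_carrier:
  assumes "bounded (range a)" shows "unit_class a \<in> carrier (K0 (reduced_algebra G))"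
  using unit_class_diag[OF assms] reduced.K0_carrierI[OF diag_proj_in_reduced diag_proj_in_reduced]
  unfolding diag_class_def by metis

text \<open>Both sides are classes of diagonal projections with the same difference of ranks, so the
  zero chain witnesses their equality.\<close>

lemma unit_class_add:
  assumes a: "bounded (range a)" and b: "bounded (range b)"
  shows "unit_class (\<lambda>x. a x + b x) = unit_class a \<otimes>\<^bsub>K0 (reduced_algebra G)\<^esub> unit_class b"
proof -
  have ab: "bounded (range (\<lambda>x. a x + b x))" by (rule bounded_int_add[OF a b])
  obtain n S n' S' where 1: "unit_class a = diag_class n S n' S'" "\<And>x. x \<in> X \<Longrightarrow> rank n S x - rank n' S' x = a x"
    using unit_class_diag[OF a] by blast
  obtain m T m' T' where 2: "unit_class b = diag_class m T m' T'" "\<And>x. x \<in> X \<Longrightarrow> rank m T x - rank m' T' x = b x"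
    using unit_class_diag[OF b] by blast
  obtain k V k' V' where 3: "unit_class (\<lambda>x. a x + b x) = diag_class k V k' V'"
    "\<And>x. x \<in> X \<Longrightarrow> rank k V x - rank k' V' x = a x + b x"
    using unit_class_diag[OF ab] by blast
  have "unit_class a \<otimes>\<^bsub>K0 (reduced_algebra G)\<^esub> unit_class b
      = diag_class (n + m) (\<lambda>i. if i < n then S i else T (i - n)) (n' + m') (\<lambda>i. if i < n' then S' i else T' (i - n'))"
    unfolding 1(1) 2(1) diag_class_def
    by (simp add: reduced.K0_mult_class diag_proj_in_reduced direct_sum_diag_proj)
  also have "\<dots> = unit_class (\<lambda>x. a x + b x)"
    unfolding 3(1) diag_class_eq_iff
  proof (intro exI conjI ballI)
    show "controlled (\<lambda>_. 0 :: int) 0" by (auto simp: controlled_def)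
    fix x assume x: "x \<in> X"
    show "rank (n + m) (\<lambda>i. if i < n then S i else T (i - n)) x - rank (n' + m') (\<lambda>i. if i < n' then S' i else T' (i - n')) x
        - (rank k V x - rank k' V' x) = col (\<lambda>_. 0) x - row (\<lambda>_. 0) x"
      unfolding rank_append 3(2)[OF x] using 1(2)[OF x] 2(2)[OF x] by (simp add: col_def row_def)
  qed
  finally show ?thesis ..
qed

subsection \<open>Homology in degree 0\<close>

lemma bounded_row:
  assumes "controlled \<phi> R" shows "bounded (range (row \<phi>))"
proof -
  obtain K :: nat where K: "\<And>x. x \<in> X \<Longrightarrow> \<bar>row \<phi> x\<bar> \<le> int K" using row_bounded[OF assms] by blast
  have "row \<phi> x = 0" if "x \<notin> X" for x
    unfolding row_def using assms that by (intro sum.neutral) (auto simp: controlled_def near_def)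
  then have "\<bar>row \<phi> x\<bar> \<le> int K" for x using K[of x] by (cases "x \<in> X") auto
  then show ?thesis unfolding bounded_int_iff by blast
qed

lemma row_flip: "row (\<lambda>(x, y). \<phi> (y, x)) = col \<phi>" and col_flip: "col (\<lambda>(x, y). \<phi> (y, x)) = row \<phi>"
  by (auto simp: row_def col_def)

lemma bounded_col: "controlled \<phi> R \<Longrightarrow> bounded (range (col \<phi>))"
  using bounded_row[OF controlled_flip] by (simp add: row_flip)

text \<open>The arrows over \<open>u\<close> on which the extension is nonzero lie in the fibre of
  balls, and \<open>sum_fibre\<close> turns their sum into the limit of column sums.\<close>

lemma source_push_extend:
  assumes \<phi>: "controlled \<phi> R"
  shows "source_push G (extend \<phi>) = extend (diagonal (col \<phi>))"
proof
  fix u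
  show "source_push G (extend \<phi>) u = extend (diagonal (col \<phi>)) u"
  proof (cases "u \<in> unit_arrows G")
    case False
    then have empty: "{g. g \<in> arrows G \<and> gsource G g = u \<and> extend \<phi> g \<noteq> 0} = {}"
      unfolding unit_arrows_def by blast
    have "source_push G (extend \<phi>) u = 0" unfolding source_push_def empty by simp
    moreover have "extend (diagonal (col \<phi>)) \<in> C_units G"
      by (rule extend_diagonal_in_C_units[OF bounded_col[OF \<phi>]])
    ultimately show ?thesis using False by (simp add: C_units_def)
  next
    case True
    define u0 where "u0 = filtermap snd u"
    have u: "u \<in> coarse_arrows X d" "eventually (\<lambda>(x, y). x = y) u" using True by (auto simp: unit_arrows_eq arrows_in_def)
    have u0: "unit_ultrafilter u0" unfolding u0_def by (rule unit_ultrafilter_source[OF u(1)])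
    have u_eq: "u = germ (\<lambda>y. y) u0"
      unfolding u0_def by (rule eq_germI) (use u(2) in \<open>auto elim!: eventually_mono\<close>)
    have src: "gsource G g = u \<longleftrightarrow> filtermap snd g = u0" for g
    proof -
      have "gsource G u = u" unfolding gsource_eq u0_def[symmetric] by (simp add: u_eq germ_def)
      then show ?thesis using gsource_eq_iff[of g u] by (simp add: u0_def)
    qed
    obtain N where N: "\<And>x. x \<in> X \<Longrightarrow> finite {w\<in>X. d x w \<le> R}" "\<And>x. x \<in> X \<Longrightarrow> card {w\<in>X. d x w \<le> R} \<le> N"
      using ball_card_bound by metis
    have B: "thin (\<lambda>y. {w\<in>X. d y w \<le> R}) (R + 0) N"
      using thin_displaced_ball[OF N, of "\<lambda>y. y" 0] by (simp add: displacement_def)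
    let ?F = "{g. g \<in> coarse_arrows X d \<and> filtermap snd g = u0 \<and> eventually (\<lambda>(w, y). w \<in> {w\<in>X. d y w \<le> R}) g}"
    have "source_push G (extend \<phi>) u = (\<Sum>g\<in>?F. extend \<phi> g)"
      unfolding source_push_def
    proof (rule sum.mono_neutral_left[OF fibre_finite(1)[OF u0 B]])
      show "{g. g \<in> arrows G \<and> gsource G g = u \<and> extend \<phi> g \<noteq> 0} \<subseteq> ?F"
      proof
        fix g assume g: "g \<in> {g. g \<in> arrows G \<and> gsource G g = u \<and> extend \<phi> g \<noteq> 0}"
        then have "eventually (near R) g" using extend_nonzero_near[OF \<phi>, of g] by (simp add: arrows_in_def)
        then have "eventually (\<lambda>(w, y). w \<in> {w\<in>X. d y w \<le> R}) g"
          by (rule eventually_mono) (auto simp: near_def commute)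
        then show "g \<in> ?F" using g src by simp
      qed
    qed (use src in auto)
    also have "\<dots> = (\<Sum>g\<in>?F. Lim g \<phi>)" by (intro sum.cong) (auto simp: extend_def)
    also have "\<dots> = Lim u0 (\<lambda>y. \<Sum>w\<in>{w\<in>X. d y w \<le> R}. \<phi> (w, y))"
      by (rule sum_fibre[OF u0 B]) (use \<phi> in \<open>simp add: controlled_def\<close>)
    also have "\<dots> = Lim u0 (\<lambda>y. diagonal (col \<phi>) (y, y))"
    proof (rule Lim_cong_eventually)
      have "eventually (\<lambda>y. y \<in> X) u0" using u0 by (simp add: unit_ultrafilter_def)
      then show "eventually (\<lambda>y. (\<Sum>w\<in>{w\<in>X. d y w \<le> R}. \<phi> (w, y)) = diagonal (col \<phi>) (y, y)) u0"
      proof (rule eventually_mono)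
        fix y assume y: "y \<in> X"
        have "col \<phi> y = (\<Sum>w\<in>{w\<in>X. d y w \<le> R}. \<phi> (w, y))"
          using finite_ball[OF y] by (intro col_eq_sum[OF \<phi> y]) auto
        then show "(\<Sum>w\<in>{w\<in>X. d y w \<le> R}. \<phi> (w, y)) = diagonal (col \<phi>) (y, y)"
          using y by (simp add: diagonal_def)
      qed
    qed
    also have "\<dots> = extend (diagonal (col \<phi>)) u"
      using u(1) by (simp add: extend_def) (simp add: u_eq Lim_germ)
    finally show ?thesis .
  qed
qed

lemma ginv_eq: "ginv G g = filtermap (\<lambda>(x, y). (y, x)) g"
  by (simp add: coarse_groupoid_def)

lemma ginv_ginv: "ginv G (ginv G g) = g"
  by (simp add: ginv_eq filtermap_filtermap case_prod_unfold)

lemma ginv_arrow: "g \<in> coarse_arrows X d \<Longrightarrow> ginv G g \<in> coarse_arrows X d"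
proof -
  assume "g \<in> coarse_arrows X d"
  then obtain R where R: "R \<ge> 0" "ultrafilter g" "eventually (near R) g" by (auto simp: coarse_arrows_iff)
  have "eventually (near R) (ginv G g)"
    unfolding ginv_eq eventually_filtermap using R(3) by (rule eventually_mono) (auto intro: near_flip)
  then show "ginv G g \<in> coarse_arrows X d"
    using R unfolding coarse_arrows_iff ginv_eq by (auto intro: ultrafilter_filtermap)
qed

text \<open>Inversion of arrows exchanges source and range and transposes the kernel, which reduces
  this to the source.\<close>

lemma range_push_extend:
  assumes \<phi>: "controlled \<phi> R"
  shows "range_push G (extend \<phi>) = extend (diagonal (row \<phi>))"
proof
  fix u
  let ?\<psi> = "\<lambda>(x, y). \<phi> (y, x)"
  have ext: "extend ?\<psi> (ginv G g) = extend \<phi> g" if "g \<in> coarse_arrows X d" for g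
    using that ginv_arrow[OF that] by (simp add: extend_def ginv_eq Lim_filtermap case_prod_unfold)
  have ext': "extend \<phi> (ginv G g) = extend ?\<psi> g" if "g \<in> coarse_arrows X d" for g
    using ext[OF ginv_arrow[OF that]] by (simp add: ginv_ginv)
  have range: "grange G g = gsource G (ginv G g)" for g
    by (simp add: coarse_groupoid_def filtermap_filtermap case_prod_unfold)
  have "range_push G (extend \<phi>) u = source_push G (extend ?\<psi>) u"
    unfolding range_push_def source_push_def
    by (rule sum.reindex_bij_witness[where i = "ginv G" and j = "ginv G"])
      (auto simp: ginv_ginv ginv_arrow range ext ext')
  then show "range_push G (extend \<phi>) u = extend (diagonal (row \<phi>)) u"
    unfolding source_push_extend[OF controlled_flip[OF \<phi>]] col_flip .
qed

definition boundaries :: "(('a \<times> 'a) filter \<Rightarrow> int) set" where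
  "boundaries = (\<lambda>f u. source_push G f u - range_push G f u) ` Cc G"

lemma boundaries_eq: "boundaries = {extend (diagonal (\<lambda>x. col \<phi> x - row \<phi> x)) | \<phi>. \<exists>R. controlled \<phi> R}"
proof -
  have eq: "(\<lambda>u. source_push G (extend \<phi>) u - range_push G (extend \<phi>) u) = extend (diagonal (\<lambda>x. col \<phi> x - row \<phi> x))"
    if \<phi>: "controlled \<phi> R" for \<phi> R
    unfolding source_push_extend[OF \<phi>] range_push_extend[OF \<phi>]
    by (rule ext) (rule extend_diagonal_map2[OF bounded_col[OF \<phi>] bounded_row[OF \<phi>], where h = "(-)"], simp)
  show ?thesis
  proof (intro equalityI subsetI)
    fix g assume "g \<in> boundaries"
    then obtain f where f: "f \<in> Cc G" "g = (\<lambda>u. source_push G f u - range_push G f u)" unfolding boundaries_def by blast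
    obtain \<phi> R where \<phi>: "controlled \<phi> R" "f = extend \<phi>" using Cc_imp_extend[OF f(1)] by blast
    then show "g \<in> {extend (diagonal (\<lambda>x. col \<phi> x - row \<phi> x)) | \<phi>. \<exists>R. controlled \<phi> R}"
      using f(2) eq by blast
  next
    fix g assume "g \<in> {extend (diagonal (\<lambda>x. col \<phi> x - row \<phi> x)) | \<phi>. \<exists>R. controlled \<phi> R}"
    then obtain \<phi> R where \<phi>: "controlled \<phi> R" "g = extend (diagonal (\<lambda>x. col \<phi> x - row \<phi> x))" by blast
    then show "g \<in> boundaries" unfolding boundaries_def using eq[OF \<phi>(1)] extend_in_Cc[OF \<phi>(1)] by (intro image_eqI) simp_all
  qed
qed

lemma carrier_C_units_group:
  "carrier (C_units_group G) = {extend (diagonal a) | a. bounded (range a)}"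
  unfolding C_units_group_def using C_units_imp_extend extend_diagonal_in_C_units by auto

lemma C_units_group_simps [simp]:
  "f \<otimes>\<^bsub>C_units_group G\<^esub> f' = (\<lambda>u. f u + f' u)" "\<one>\<^bsub>C_units_group G\<^esub> = (\<lambda>_. 0)"
  by (simp_all add: C_units_group_def)

lemma extend_diagonal_add:
  fixes a b :: "'a \<Rightarrow> int"
  assumes "bounded (range a)" "bounded (range b)"
  shows "(\<lambda>u. extend (diagonal a) u + extend (diagonal b) u) = extend (diagonal (\<lambda>x. a x + b x))"
  by (rule ext) (rule extend_diagonal_map2[OF assms, where h = "(+)"], simp)

lemma extend_diagonal_zero: "extend (diagonal (\<lambda>_. 0 :: int)) = (\<lambda>_. 0)"
proof
  fix F
  have d: "diagonal (\<lambda>_. 0 :: int) = (\<lambda>_. 0)" by (auto simp: diagonal_def)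
  show "extend (diagonal (\<lambda>_. 0 :: int)) F = 0"
  proof (cases "F \<in> coarse_arrows X d")
    case True
    then have U: "ultrafilter F" by (simp add: coarse_arrows_iff)
    have "Lim F (\<lambda>_. 0 :: int) = 0" by (rule Lim_eventually_const[OF U]) simp
    then show ?thesis using True by (simp add: extend_def d)
  qed (simp add: extend_def)
qed

lemma C_units_comm_group: "comm_group (C_units_group G)"
proof (rule comm_groupI)
  show "\<one>\<^bsub>C_units_group G\<^esub> \<in> carrier (C_units_group G)"
    unfolding carrier_C_units_group C_units_group_simps
    by (rule CollectI, rule exI[of _ "\<lambda>_. 0"]) (simp add: extend_diagonal_zero)
  fix f assume "f \<in> carrier (C_units_group G)"
  then obtain a where a: "bounded (range a)" "f = extend (diagonal a)" unfolding carrier_C_units_group by blast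
  have na: "bounded (range (\<lambda>x. - a x))" using bounded_int_diff[OF bounded_int_const[of 0] a(1)] by simp
  show "\<exists>g\<in>carrier (C_units_group G). g \<otimes>\<^bsub>C_units_group G\<^esub> f = \<one>\<^bsub>C_units_group G\<^esub>"
  proof (rule bexI[of _ "extend (diagonal (\<lambda>x. - a x))"])
    show "extend (diagonal (\<lambda>x. - a x)) \<otimes>\<^bsub>C_units_group G\<^esub> f = \<one>\<^bsub>C_units_group G\<^esub>"
      using extend_diagonal_add[OF na a(1)] by (simp add: a(2) extend_diagonal_zero)
  qed (use na in \<open>auto simp: carrier_C_units_group\<close>)
  fix f' assume "f' \<in> carrier (C_units_group G)"
  then obtain b where b: "bounded (range b)" "f' = extend (diagonal b)" unfolding carrier_C_units_group by blast
  show "f \<otimes>\<^bsub>C_units_group G\<^esub> f' \<in> carrier (C_units_group G)"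
    using extend_diagonal_add[OF a(1) b(1)] bounded_int_add[OF a(1) b(1)]
    by (auto simp: a(2) b(2) carrier_C_units_group)
qed (auto simp: add.assoc add.commute)

lemma inv_C_units:
  assumes "f \<in> carrier (C_units_group G)" shows "inv\<^bsub>C_units_group G\<^esub> f = (\<lambda>u. - f u)"
proof -
  interpret C: comm_group "C_units_group G" by (rule C_units_comm_group)
  have "(\<lambda>u. (inv\<^bsub>C_units_group G\<^esub> f) u + f u) = (\<lambda>_. 0)" using C.l_inv[OF assms] by simp
  then show ?thesis by (auto simp: fun_eq_iff eq_neg_iff_add_eq_0)
qed

lemma boundaries_subgroup: "subgroup boundaries (C_units_group G)"
proof -
  interpret C: comm_group "C_units_group G" by (rule C_units_comm_group)
  have bdd: "bounded (range (\<lambda>x. col \<phi> x - row \<phi> x))" if "controlled \<phi> R" for \<phi> R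
    by (intro bounded_int_diff bounded_col[OF that] bounded_row[OF that])
  show ?thesis
  proof (rule C.subgroupI)
    show sub: "boundaries \<subseteq> carrier (C_units_group G)"
      unfolding boundaries_eq carrier_C_units_group using bdd by blast
    have "extend (diagonal (\<lambda>x. col (\<lambda>_. 0) x - row (\<lambda>_. 0) x)) \<in> boundaries"
      unfolding boundaries_eq by (rule CollectI, rule exI[of _ "\<lambda>_. 0"]) (auto simp: controlled_def)
    then show "boundaries \<noteq> {}" by blast
    fix f assume f: "f \<in> boundaries"
    then obtain \<phi> R where \<phi>: "controlled \<phi> R" "f = extend (diagonal (\<lambda>x. col \<phi> x - row \<phi> x))" unfolding boundaries_eq by blast
    have "(\<lambda>u. - f u) = extend (diagonal (\<lambda>x. - (col \<phi> x - row \<phi> x)))"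
      unfolding \<phi>(2) by (rule ext) (rule extend_diagonal_map2[OF bdd[OF \<phi>(1)] bdd[OF \<phi>(1)], where h = "\<lambda>x y. - x"], simp)
    also have "(\<lambda>x. - (col \<phi> x - row \<phi> x)) = (\<lambda>x. col (\<lambda>(x, y). \<phi> (y, x)) x - row (\<lambda>(x, y). \<phi> (y, x)) x)"
      by (simp add: col_flip row_flip)
    finally have "(\<lambda>u. - f u) \<in> boundaries" unfolding boundaries_eq using controlled_flip[OF \<phi>(1)] by blast
    then show "inv\<^bsub>C_units_group G\<^esub> f \<in> boundaries" using inv_C_units f sub by auto
    fix f' assume "f' \<in> boundaries"
    then obtain \<psi> S where \<psi>: "controlled \<psi> S" "f' = extend (diagonal (\<lambda>x. col \<psi> x - row \<psi> x))" unfolding boundaries_eq by blast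
    have c: "controlled (\<lambda>p. \<phi> p + \<psi> p) (max R S)"
    proof -
      have "bounded (range (\<lambda>p. \<phi> p + \<psi> p))"
        using \<phi>(1) \<psi>(1) by (intro bounded_int_add) (simp_all add: controlled_def)
      moreover have "near (max R S) p" if "\<phi> p + \<psi> p \<noteq> 0" for p
      proof -
        have "\<phi> p \<noteq> 0 \<or> \<psi> p \<noteq> 0" using that by auto
        then have "near R p \<or> near S p" using \<phi>(1) \<psi>(1) unfolding controlled_def by blast
        then show ?thesis using near_mono[of R p "max R S"] near_mono[of S p "max R S"] by auto
      qed
      ultimately show ?thesis using \<phi>(1) by (auto simp: controlled_def)
    qed
    have "(\<lambda>u. f u + f' u) = extend (diagonal (\<lambda>x. (col \<phi> x - row \<phi> x) + (col \<psi> x - row \<psi> x)))"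
      unfolding \<phi>(2) \<psi>(2) by (rule extend_diagonal_add[OF bdd[OF \<phi>(1)] bdd[OF \<psi>(1)]])
    also have "\<dots> = extend (diagonal (\<lambda>x. col (\<lambda>p. \<phi> p + \<psi> p) x - row (\<lambda>p. \<phi> p + \<psi> p) x))"
      unfolding extend_diagonal_eq_iff
    proof
      fix x assume x: "x \<in> X"
      let ?B = "{w\<in>X. d x w \<le> max R S}"
      have B: "{w\<in>X. d x w \<le> R} \<subseteq> ?B" "{w\<in>X. d x w \<le> S} \<subseteq> ?B" "?B \<subseteq> ?B" "finite ?B" "?B \<subseteq> X" using finite_ball[OF x] by auto
      show "(col \<phi> x - row \<phi> x) + (col \<psi> x - row \<psi> x) = col (\<lambda>p. \<phi> p + \<psi> p) x - row (\<lambda>p. \<phi> p + \<psi> p) x"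
        unfolding col_eq_sum[OF \<phi>(1) x B(1,4,5)] row_eq_sum[OF \<phi>(1) x B(1,4,5)] col_eq_sum[OF \<psi>(1) x B(2,4,5)]
          row_eq_sum[OF \<psi>(1) x B(2,4,5)] col_eq_sum[OF c x B(3,4,5)] row_eq_sum[OF c x B(3,4,5)]
        by (simp add: sum.distrib)
    qed
    finally have "(\<lambda>u. f u + f' u) \<in> boundaries" unfolding boundaries_eq using c by blast
    then show "f \<otimes>\<^bsub>C_units_group G\<^esub> f' \<in> boundaries" by simp
  qed
qed

lemma groupoid_H0_eq: "groupoid_H0 G = C_units_group G Mod boundaries"
  by (simp add: groupoid_H0_def boundaries_def)

lemma groupoid_H0_comm_group: "comm_group (groupoid_H0 G)"
  unfolding groupoid_H0_eq by (rule comm_group.abelian_FactGroup[OF C_units_comm_group boundaries_subgroup])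

text \<open>The condition on the right is literally the one in \<open>unit_class_eq_iff\<close>;
  this coincidence is what makes the comparison map both well defined and injective.\<close>

lemma H0_coset_eq_iff:
  assumes a: "bounded (range a)" and b: "bounded (range b)"
  shows "boundaries #>\<^bsub>C_units_group G\<^esub> extend (diagonal a) = boundaries #>\<^bsub>C_units_group G\<^esub> extend (diagonal b)
    \<longleftrightarrow> (\<exists>\<phi> R. controlled \<phi> R \<and> (\<forall>x\<in>X. a x - b x = col \<phi> x - row \<phi> x))"
proof -
  have mem: "extend (diagonal a) \<in> carrier (C_units_group G)" "extend (diagonal b) \<in> carrier (C_units_group G)"
    using a b by (auto simp: carrier_C_units_group)
  have "extend (diagonal a) \<otimes>\<^bsub>C_units_group G\<^esub> inv\<^bsub>C_units_group G\<^esub> extend (diagonal b) = extend (diagonal (\<lambda>x. a x - b x))"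
    unfolding inv_C_units[OF mem(2)] C_units_group_simps
    using extend_diagonal_map2[OF a b, where h = "(-)"] by auto
  then have "boundaries #>\<^bsub>C_units_group G\<^esub> extend (diagonal a) = boundaries #>\<^bsub>C_units_group G\<^esub> extend (diagonal b)
    \<longleftrightarrow> extend (diagonal (\<lambda>x. a x - b x)) \<in> boundaries"
    using comm_group.rcos_eq_iff[OF C_units_comm_group boundaries_subgroup mem] by simp
  then show ?thesis unfolding boundaries_eq mem_Collect_eq extend_diagonal_eq_iff by blast
qed

lemma carrier_H0:
  "carrier (groupoid_H0 G) = {boundaries #>\<^bsub>C_units_group G\<^esub> extend (diagonal a) | a. bounded (range a)}"
  unfolding groupoid_H0_eq carrier_FactGroup carrier_C_units_group by blast

text \<open>All representatives of a homology class have the same K0 class, so the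
  \<open>the_elem\<close> in the definition picks the element of a singleton.\<close>

lemma comparison_map_coset:
  assumes a: "bounded (range a)"
  shows "comparison_map G (boundaries #>\<^bsub>C_units_group G\<^esub> extend (diagonal a)) = unit_class a"
proof -
  interpret C: comm_group "C_units_group G" by (rule C_units_comm_group)
  let ?c = "boundaries #>\<^bsub>C_units_group G\<^esub> extend (diagonal a)"
  have mem: "extend (diagonal a) \<in> carrier (C_units_group G)" using a by (auto simp: carrier_C_units_group)
  have "K0_inclusion (reduced_algebra G) (rank_class G f) = unit_class a" if f: "f \<in> ?c" for f
  proof -
    have "f \<in> carrier (C_units_group G)"
      by (rule subgroup.elemrcos_carrier[OF boundaries_subgroup C.is_group mem f])
    then obtain b where b: "bounded (range b)" "f = extend (diagonal b)" unfolding carrier_C_units_group by blast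
    have "?c = boundaries #>\<^bsub>C_units_group G\<^esub> extend (diagonal b)"
      using C.repr_independence[OF f mem boundaries_subgroup] b(2) by simp
    then have "unit_class a = unit_class b" unfolding H0_coset_eq_iff[OF a b(1)] unit_class_eq_iff[OF a b(1)] .
    then show ?thesis by (simp add: unit_class_def b(2))
  qed
  moreover have "extend (diagonal a) \<in> ?c" by (rule C.rcos_self[OF mem boundaries_subgroup])
  ultimately have "(\<lambda>f. K0_inclusion (reduced_algebra G) (rank_class G f)) ` ?c = {unit_class a}" by blast
  then show ?thesis unfolding comparison_map_def by simp
qed

theorem comparison_map_hom: "comparison_map G \<in> hom (groupoid_H0 G) (K0 (reduced_algebra G))"
proof (rule homI)
  interpret C: comm_group "C_units_group G" by (rule C_units_comm_group)
  fix c assume "c \<in> carrier (groupoid_H0 G)"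
  then obtain a where a: "bounded (range a)" "c = boundaries #>\<^bsub>C_units_group G\<^esub> extend (diagonal a)"
    unfolding carrier_H0 by blast
  then show "comparison_map G c \<in> carrier (K0 (reduced_algebra G))"
    by (simp add: comparison_map_coset unit_class_carrier)
  fix c' assume "c' \<in> carrier (groupoid_H0 G)"
  then obtain b where b: "bounded (range b)" "c' = boundaries #>\<^bsub>C_units_group G\<^esub> extend (diagonal b)"
    unfolding carrier_H0 by blast
  have mem: "extend (diagonal a) \<in> carrier (C_units_group G)" "extend (diagonal b) \<in> carrier (C_units_group G)"
    using a b by (auto simp: carrier_C_units_group)
  have "normal boundaries (C_units_group G)" using boundaries_subgroup by (simp add: C.normal_iff_subgroup)
  then have "c \<otimes>\<^bsub>groupoid_H0 G\<^esub> c' = boundaries #>\<^bsub>C_units_group G\<^esub> extend (diagonal (\<lambda>x. a x + b x))"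
    using normal.rcos_sum[OF _ mem] extend_diagonal_add[OF a(1) b(1)] by (simp add: groupoid_H0_eq a(2) b(2))
  then show "comparison_map G (c \<otimes>\<^bsub>groupoid_H0 G\<^esub> c') = comparison_map G c \<otimes>\<^bsub>K0 (reduced_algebra G)\<^esub> comparison_map G c'"
    using a b by (simp add: comparison_map_coset bounded_int_add unit_class_add)
qed

theorem comparison_map_inj: "inj_on (comparison_map G) (carrier (groupoid_H0 G))"
proof (rule inj_onI)
  fix c c' assume c: "c \<in> carrier (groupoid_H0 G)" "c' \<in> carrier (groupoid_H0 G)" "comparison_map G c = comparison_map G c'"
  obtain a where a: "bounded (range a)" "c = boundaries #>\<^bsub>C_units_group G\<^esub> extend (diagonal a)"
    using c(1) unfolding carrier_H0 by blast
  obtain b where b: "bounded (range b)" "c' = boundaries #>\<^bsub>C_units_group G\<^esub> extend (diagonal b)"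
    using c(2) unfolding carrier_H0 by blast
  have "unit_class a = unit_class b" using c(3) a b by (simp add: comparison_map_coset)
  then show "c = c'" unfolding a(2) b(2) H0_coset_eq_iff[OF a(1) b(1)] unit_class_eq_iff[OF a(1) b(1)] .
qed

end

theorem mainTheorem4:
  fixes X :: "'a set" and d :: "'a \<Rightarrow> 'a \<Rightarrow> real"
  assumes "Metric_space X d"
    and "uniformly_locally_finite X d"
  shows "split_injective
    (tensor_product (groupoid_H0 (coarse_groupoid X d)) rational_group)
    (tensor_product (K0 (reduced_algebra (coarse_groupoid X d))) rational_group)
    (tensor_map (K0 (reduced_algebra (coarse_groupoid X d))) rational_group
       (comparison_map (coarse_groupoid X d)) id)"
proof -
  interpret coarse_space X d
    by (intro coarse_space.intro coarse_space_axioms.intro assms)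
  show ?thesis
    by (rule rational_tensor_map_split_injective[OF groupoid_H0_comm_group reduced.K0_comm_group
          comparison_map_hom comparison_map_inj])
qed

end
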